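(* Let $A$ be a finite dimensional symmetric algebra over a field $k$, and $P\in K^{\mathrm b}(\mathrm{proj}\,A)$ a partial tilting complex of length $2$. Then the following are equivalent. 1. $P$ is a tilting complex for $A$. 2. $n(P)=n(A)$.
   Context: $A$ is symmetric if $A\cong\mathrm{Hom}_k(A,k)$ as $A$-bimodules. Modules are right modules; $D(A)$ is the derived category of $\mathrm{Mod}\,A$, and $K^{\mathrm b}(\mathrm{proj}\,A)$ is the bounded homotopy category of finitely generated projectives. A partial tilting complex is a perfect complex $P$ with $\mathrm{Hom}_{D(A)}(P,P[n])=0$ for $n\neq0$; it is a tilting complex if moreover $\mathrm{add}\,P$ generates $K^{\mathrm b}(\mathrm{proj}\,A)$ as a triangulated category. The length of a complex $X$ is $l(X)=\max\{n:H^n(X)\ne0\}-\min\{n:H^n(X)\neq0\}+1$. For an object $M$ of an additive category, $\mathrm{add}\,M$ consists of the objects isomorphic to summands of finite coproducts of copies of $M$, and $n(M)$ is the number of isomorphism types of indecomposable objects in $\mathrm{add}\,M$ (for $P$ computed in $K^{\mathrm b}(\mathrm{proj}\,A)$). *)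

theory Defs
  imports Complex_Main "HOL-Algebra.AbelCoset" "HOL-Algebra.Module" "HOL-Library.FuncSet"
begin

section \<open>Finite dimensional symmetric algebras\<close>

text \<open>The algebra is the whole type \<open>'a\<close>, with structure map \<open>scale\<close>. The class \<open>ring_1\<close> excludes
  the zero algebra; over that algebra every complex is acyclic.\<close>

locale unital_algebra = vector_space scale
  for scale :: "'k::field \<Rightarrow> 'a::ring_1 \<Rightarrow> 'a" +
  assumes scale_mult_left: "scale c x * y = scale c (x * y)"
    and scale_mult_right: "x * scale c y = scale c (x * y)"

definition fin_dim_algebra :: "('k::field \<Rightarrow> 'a::ring_1 \<Rightarrow> 'a) \<Rightarrow> bool" where
  "fin_dim_algebra scale \<longleftrightarrow>
     unital_algebra scale \<and> (\<exists>B. finite_dimensional_vector_space scale B)"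

text \<open>\<open>\<phi>\<close> is an isomorphism of bimodules from \<open>A\<close> to \<open>Hom\<^sub>k(A,k)\<close>, where the bimodule structure
  of the latter is \<open>(a f b)(z) = f (b z a)\<close>.\<close>

definition symmetric_algebra :: "('k::field \<Rightarrow> 'a::ring_1 \<Rightarrow> 'a) \<Rightarrow> bool" where
  "symmetric_algebra scale \<longleftrightarrow>
     (\<exists>\<phi>. bij_betw \<phi> UNIV {f. Vector_Spaces.linear scale ((*) :: 'k \<Rightarrow> 'k \<Rightarrow> 'k) f} \<and>
          (\<forall>x y. \<phi> (x + y) = (\<lambda>z. \<phi> x z + \<phi> y z)) \<and>
          (\<forall>a x b. \<phi> (a * x * b) = (\<lambda>z. \<phi> x (b * z * a))))"

section \<open>Right modules\<close>

text \<open>Modules are \<open>module\<close> records, whose fields \<open>mult\<close> and \<open>one\<close> are irrelevant. Scalars are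
  written on the left as in HOL-Algebra, so \<open>a \<odot> x\<close> stands for \<open>x a\<close>; note the order of the
  factors in \<open>act_mult\<close>.\<close>

locale right_module = abelian_group M
  for M :: "('a::ring_1, 'm) module" (structure) +
  assumes act_closed: "x \<in> carrier M \<Longrightarrow> a \<odot> x \<in> carrier M"
    and act_add_scalar: "x \<in> carrier M \<Longrightarrow> (a + b) \<odot> x = a \<odot> x \<oplus> b \<odot> x"
    and act_add: "x \<in> carrier M \<Longrightarrow> y \<in> carrier M \<Longrightarrow> a \<odot> (x \<oplus> y) = a \<odot> x \<oplus> a \<odot> y"
    and act_mult: "x \<in> carrier M \<Longrightarrow> (a * b) \<odot> x = b \<odot> (a \<odot> x)"
    and act_one: "x \<in> carrier M \<Longrightarrow> 1 \<odot> x = x"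

text \<open>Quantifiers over all modules, or over all complexes, have to range over modules carried by
  subsets of one fixed type. The type \<open>nat \<Rightarrow> 'a\<close> contains the countable free modules and is closed
  under countable products up to bijection. A finitely generated module with elements of any type,
  its submodules and its quotients are isomorphic to modules carried by subsets of \<open>nat \<Rightarrow> 'a\<close>.\<close>

type_synonym 'a univ = "nat \<Rightarrow> 'a"

definition regular_module :: "('a::ring_1, 'a) module" where
  "regular_module = \<lparr>carrier = UNIV, mult = undefined, one = undefined,
     zero = 0, add = (+), smult = (\<lambda>a x. x * a)\<rparr>"

definition module_sum :: "('a, 'm) module \<Rightarrow> ('a, 'n) module \<Rightarrow> ('a, 'm \<times> 'n) module" where
  "module_sum M N = \<lparr>carrier = carrier M \<times> carrier N, mult = undefined, one = undefined,
     zero = (\<zero>\<^bsub>M\<^esub>, \<zero>\<^bsub>N\<^esub>),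
     add = (\<lambda>x y. (fst x \<oplus>\<^bsub>M\<^esub> fst y, snd x \<oplus>\<^bsub>N\<^esub> snd y)),
     smult = (\<lambda>a x. (a \<odot>\<^bsub>M\<^esub> fst x, a \<odot>\<^bsub>N\<^esub> snd x))\<rparr>"

definition module_power :: "nat \<Rightarrow> ('a, 'm) module \<Rightarrow> ('a, nat \<Rightarrow> 'm) module" where
  "module_power r M = \<lparr>carrier = (\<Pi>\<^sub>E i\<in>{..<r}. carrier M), mult = undefined, one = undefined,
     zero = (\<lambda>i\<in>{..<r}. \<zero>\<^bsub>M\<^esub>),
     add = (\<lambda>x y. \<lambda>i\<in>{..<r}. x i \<oplus>\<^bsub>M\<^esub> y i),
     smult = (\<lambda>a x. \<lambda>i\<in>{..<r}. a \<odot>\<^bsub>M\<^esub> x i)\<rparr>"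

definition module_homs :: "('a, 'm) module \<Rightarrow> ('a, 'n) module \<Rightarrow> ('m \<Rightarrow> 'n) set" where
  "module_homs M N = {f \<in> carrier M \<rightarrow> carrier N.
     (\<forall>x\<in>carrier M. \<forall>y\<in>carrier M. f (x \<oplus>\<^bsub>M\<^esub> y) = f x \<oplus>\<^bsub>N\<^esub> f y) \<and>
     (\<forall>a. \<forall>x\<in>carrier M. f (a \<odot>\<^bsub>M\<^esub> x) = a \<odot>\<^bsub>N\<^esub> f x)}"

definition module_iso :: "('a, 'm) module \<Rightarrow> ('a, 'n) module \<Rightarrow> bool" where
  "module_iso M N \<longleftrightarrow> (\<exists>f \<in> module_homs M N. bij_betw f (carrier M) (carrier N))"

definition zero_module :: "('a, 'm) module \<Rightarrow> bool" where
  "zero_module M \<longleftrightarrow> carrier M = {\<zero>\<^bsub>M\<^esub>}"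

definition finitely_generated :: "('a, 'm) module \<Rightarrow> bool" where
  "finitely_generated M \<longleftrightarrow> (\<exists>G. finite G \<and> G \<subseteq> carrier M \<and>
     (\<forall>x\<in>carrier M. \<exists>c. x = (\<Oplus>\<^bsub>M\<^esub>g\<in>G. c g \<odot>\<^bsub>M\<^esub> g)))"

text \<open>For finitely generated \<open>M\<close> it suffices to lift along surjections of modules in \<open>'a univ\<close>,
  because a free module of finite rank with a surjection onto \<open>M\<close> has a copy there.\<close>

definition projective_module :: "('a::ring_1, 'm) module \<Rightarrow> bool" where
  "projective_module M \<longleftrightarrow>
     (\<forall>(N :: ('a, 'a univ) module) (L :: ('a, 'a univ) module). \<forall>p f.
        right_module N \<longrightarrow> right_module L \<longrightarrow>
        p \<in> module_homs N L \<longrightarrow> p ` carrier N = carrier L \<longrightarrow> f \<in> module_homs M L \<longrightarrow>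
        (\<exists>g \<in> module_homs M N. \<forall>x\<in>carrier M. p (g x) = f x))"

definition fg_projective :: "('a::ring_1, 'm) module \<Rightarrow> bool" where
  "fg_projective M \<longleftrightarrow> right_module M \<and> finitely_generated M \<and> projective_module M"

section \<open>Numbers of indecomposable summands\<close>

definition num_iso_types :: "'o set \<Rightarrow> ('o \<Rightarrow> 'o \<Rightarrow> bool) \<Rightarrow> nat" where
  "num_iso_types S R = card (S // {(X, Y). X \<in> S \<and> Y \<in> S \<and> R X Y})"

definition in_add_module :: "('a::ring_1, 'm) module \<Rightarrow> ('a, 'n) module \<Rightarrow> bool" where
  "in_add_module M X \<longleftrightarrow> right_module X \<and>
     (\<exists>r. \<exists>Y :: ('a, 'a univ) module. right_module Y \<and>
        module_iso (module_sum X Y) (module_power r M))"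

definition indecomposable_module :: "('a::ring_1, 'm) module \<Rightarrow> bool" where
  "indecomposable_module X \<longleftrightarrow> right_module X \<and> \<not> zero_module X \<and>
     (\<forall>(Y :: ('a, 'a univ) module) (Z :: ('a, 'a univ) module).
        right_module Y \<longrightarrow> right_module Z \<longrightarrow> module_iso X (module_sum Y Z) \<longrightarrow>
        zero_module Y \<or> zero_module Z)"

definition num_indec_module :: "('a::ring_1, 'm) module \<Rightarrow> nat" where
  "num_indec_module M =
     num_iso_types {X :: ('a, 'a univ) module. in_add_module M X \<and> indecomposable_module X} module_iso"

section \<open>Complexes\<close>

text \<open>Complexes are cochain complexes, \<open>diff X n\<close> maps \<open>obj X n\<close> to \<open>obj X (n + 1)\<close>.\<close>

record ('a, 'm) cpx =
  obj :: "int \<Rightarrow> ('a, 'm) module"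
  diff :: "int \<Rightarrow> 'm \<Rightarrow> 'm"

definition is_complex :: "('a::ring_1, 'm) cpx \<Rightarrow> bool" where
  "is_complex X \<longleftrightarrow> (\<forall>n. right_module (obj X n)) \<and>
     (\<forall>n. diff X n \<in> module_homs (obj X n) (obj X (n + 1))) \<and>
     (\<forall>n. \<forall>x\<in>carrier (obj X n). diff X (n + 1) (diff X n x) = \<zero>\<^bsub>obj X (n + 2)\<^esub>)"

definition chain_maps :: "('a, 'm) cpx \<Rightarrow> ('a, 'n) cpx \<Rightarrow> (int \<Rightarrow> 'm \<Rightarrow> 'n) set" where
  "chain_maps X Y = {f. (\<forall>n. f n \<in> module_homs (obj X n) (obj Y n)) \<and>
     (\<forall>n. \<forall>x\<in>carrier (obj X n). f (n + 1) (diff X n x) = diff Y n (f n x))}"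

definition homotopic_maps ::
  "('a, 'm) cpx \<Rightarrow> ('a, 'n) cpx \<Rightarrow> (int \<Rightarrow> 'm \<Rightarrow> 'n) \<Rightarrow> (int \<Rightarrow> 'm \<Rightarrow> 'n) \<Rightarrow> bool" where
  "homotopic_maps X Y f g \<longleftrightarrow> (\<exists>h. (\<forall>n. h n \<in> module_homs (obj X n) (obj Y (n - 1))) \<and>
     (\<forall>n. \<forall>x\<in>carrier (obj X n).
        f n x = g n x \<oplus>\<^bsub>obj Y n\<^esub> (diff Y (n - 1) (h n x) \<oplus>\<^bsub>obj Y n\<^esub> h (n + 1) (diff X n x))))"

abbreviation comp_maps :: "(int \<Rightarrow> 'n \<Rightarrow> 'p) \<Rightarrow> (int \<Rightarrow> 'm \<Rightarrow> 'n) \<Rightarrow> int \<Rightarrow> 'm \<Rightarrow> 'p" where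
  "comp_maps g f \<equiv> \<lambda>n. g n \<circ> f n"

definition homotopy_iso :: "('a, 'm) cpx \<Rightarrow> ('a, 'n) cpx \<Rightarrow> bool" where
  "homotopy_iso X Y \<longleftrightarrow> (\<exists>f \<in> chain_maps X Y. \<exists>g \<in> chain_maps Y X.
     homotopic_maps X X (comp_maps g f) (\<lambda>n x. x) \<and>
     homotopic_maps Y Y (comp_maps f g) (\<lambda>n y. y))"

text \<open>An object of the homotopy category is zero iff its identity is the zero morphism.\<close>

definition homotopy_zero :: "('a, 'm) cpx \<Rightarrow> bool" where
  "homotopy_zero X \<longleftrightarrow> homotopic_maps X X (\<lambda>n x. x) (\<lambda>n x. \<zero>\<^bsub>obj X n\<^esub>)"

definition cpx_sum :: "('a, 'm) cpx \<Rightarrow> ('a, 'n) cpx \<Rightarrow> ('a, 'm \<times> 'n) cpx" where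
  "cpx_sum X Y = \<lparr>obj = (\<lambda>n. module_sum (obj X n) (obj Y n)),
     diff = (\<lambda>n x. (diff X n (fst x), diff Y n (snd x)))\<rparr>"

definition cpx_power :: "nat \<Rightarrow> ('a, 'm) cpx \<Rightarrow> ('a, nat \<Rightarrow> 'm) cpx" where
  "cpx_power r X = \<lparr>obj = (\<lambda>n. module_power r (obj X n)),
     diff = (\<lambda>n x. \<lambda>i\<in>{..<r}. diff X n (x i))\<rparr>"

text \<open>\<open>X[m]\<close> has \<open>X\<close> in degree \<open>n + m\<close> as its component of degree \<open>n\<close>, and differential
  \<open>(-1)\<^sup>m d\<close>.\<close>

definition shift :: "int \<Rightarrow> ('a, 'm) cpx \<Rightarrow> ('a, 'm) cpx" where
  "shift m X = \<lparr>obj = (\<lambda>n. obj X (n + m)),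
     diff = (\<lambda>n x. if even m then diff X (n + m) x else \<ominus>\<^bsub>obj X (n + m + 1)\<^esub> diff X (n + m) x)\<rparr>"

definition mapping_cone ::
  "('a, 'm) cpx \<Rightarrow> ('a, 'n) cpx \<Rightarrow> (int \<Rightarrow> 'm \<Rightarrow> 'n) \<Rightarrow> ('a, 'm \<times> 'n) cpx" where
  "mapping_cone X Y f = \<lparr>obj = (\<lambda>n. module_sum (obj X (n + 1)) (obj Y n)),
     diff = (\<lambda>n z. (\<ominus>\<^bsub>obj X (n + 2)\<^esub> diff X (n + 1) (fst z),
                    f (n + 1) (fst z) \<oplus>\<^bsub>obj Y (n + 1)\<^esub> diff Y n (snd z)))\<rparr>"

definition Kb_proj :: "('a::ring_1, 'm) cpx \<Rightarrow> bool" where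
  "Kb_proj X \<longleftrightarrow> is_complex X \<and> (\<forall>n. fg_projective (obj X n)) \<and>
     finite {n. \<not> zero_module (obj X n)}"

section \<open>Cohomology\<close>

definition cocycles :: "('a, 'm) cpx \<Rightarrow> int \<Rightarrow> 'm set" where
  "cocycles X n = {x \<in> carrier (obj X n). diff X n x = \<zero>\<^bsub>obj X (n + 1)\<^esub>}"

definition coboundaries :: "('a, 'm) cpx \<Rightarrow> int \<Rightarrow> 'm set" where
  "coboundaries X n = diff X (n - 1) ` carrier (obj X (n - 1))"

definition cohomology :: "int \<Rightarrow> ('a, 'm) cpx \<Rightarrow> 'm set monoid" where
  "cohomology n X = (obj X n)\<lparr>carrier := cocycles X n\<rparr> A_Mod coboundaries X n"

text \<open>A class \<open>c\<close> is sent to the coset of \<open>f x\<close> for any \<open>x\<close> in \<open>c\<close>; the union is over equal cosets.\<close>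

definition cohomology_map ::
  "int \<Rightarrow> ('a, 'n) cpx \<Rightarrow> (int \<Rightarrow> 'm \<Rightarrow> 'n) \<Rightarrow> 'm set \<Rightarrow> 'n set" where
  "cohomology_map n Y f c = (\<Union>x\<in>c. coboundaries Y n +>\<^bsub>obj Y n\<^esub> f n x)"

definition quasi_iso :: "('a, 'm) cpx \<Rightarrow> ('a, 'n) cpx \<Rightarrow> (int \<Rightarrow> 'm \<Rightarrow> 'n) \<Rightarrow> bool" where
  "quasi_iso X Y f \<longleftrightarrow> f \<in> chain_maps X Y \<and>
     (\<forall>n. bij_betw (cohomology_map n Y f) (carrier (cohomology n X)) (carrier (cohomology n Y)))"

definition cohomology_support :: "('a, 'm) cpx \<Rightarrow> int set" where
  "cohomology_support X = {n. carrier (cohomology n X) \<noteq> {\<one>\<^bsub>cohomology n X\<^esub>}}"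

text \<open>Only meaningful for complexes with bounded cohomology. The value for acyclic complexes, for
  which the maximum and minimum do not exist, is set to 0.\<close>

definition cpx_length :: "('a, 'm) cpx \<Rightarrow> int" where
  "cpx_length X = (if cohomology_support X = {} then 0
     else Max (cohomology_support X) - Min (cohomology_support X) + 1)"

section \<open>Morphisms in the derived category\<close>

text \<open>\<open>D(A)\<close> is the localization of the homotopy category at the quasi-isomorphisms: morphisms
  from \<open>X\<close> to \<open>Y\<close> are classes of roofs \<open>X \<leftarrow> W \<rightarrow> Y\<close> whose left leg is a quasi-isomorphism.\<close>

type_synonym ('a, 'm, 'n) roof =
  "('a, 'a univ) cpx \<times> (int \<Rightarrow> 'a univ \<Rightarrow> 'm) \<times> (int \<Rightarrow> 'a univ \<Rightarrow> 'n)"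

definition roofs :: "('a::ring_1, 'm) cpx \<Rightarrow> ('a, 'n) cpx \<Rightarrow> ('a, 'm, 'n) roof set" where
  "roofs X Y = {(W, s, f). is_complex W \<and> quasi_iso W X s \<and> f \<in> chain_maps W Y}"

definition roof_rel ::
  "('a::ring_1, 'm) cpx \<Rightarrow> ('a, 'n) cpx \<Rightarrow> (('a, 'm, 'n) roof \<times> ('a, 'm, 'n) roof) set" where
  "roof_rel X Y = {((W1, s1, f1), (W2, s2, f2)).
     (W1, s1, f1) \<in> roofs X Y \<and> (W2, s2, f2) \<in> roofs X Y \<and>
     (\<exists>V :: ('a, 'a univ) cpx. is_complex V \<and>
        (\<exists>u1 \<in> chain_maps V W1. \<exists>u2 \<in> chain_maps V W2.
           quasi_iso V X (comp_maps s1 u1) \<and>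
           homotopic_maps V X (comp_maps s1 u1) (comp_maps s2 u2) \<and>
           homotopic_maps V Y (comp_maps f1 u1) (comp_maps f2 u2)))}"

definition derived_hom ::
  "('a::ring_1, 'm) cpx \<Rightarrow> ('a, 'n) cpx \<Rightarrow> ('a, 'm, 'n) roof set set" where
  "derived_hom X Y = roofs X Y // roof_rel X Y"

section \<open>Tilting complexes\<close>

text \<open>A \<open>Hom\<close> group is zero iff it has exactly one element. Perfect complexes are taken to be the
  objects of \<open>K\<^sup>b(proj A)\<close>.\<close>

definition partial_tilting :: "('a::ring_1, 'm) cpx \<Rightarrow> bool" where
  "partial_tilting P \<longleftrightarrow> Kb_proj P \<and> (\<forall>n. n \<noteq> 0 \<longrightarrow> is_singleton (derived_hom P (shift n P)))"

definition in_add_Kb :: "('a::ring_1, 'm) cpx \<Rightarrow> ('a, 'n) cpx \<Rightarrow> bool" where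
  "in_add_Kb P X \<longleftrightarrow> Kb_proj X \<and>
     (\<exists>r. \<exists>Y :: ('a, 'a univ) cpx. Kb_proj Y \<and> homotopy_iso (cpx_sum X Y) (cpx_power r P))"

definition indecomposable_Kb :: "('a::ring_1, 'm) cpx \<Rightarrow> bool" where
  "indecomposable_Kb X \<longleftrightarrow> Kb_proj X \<and> \<not> homotopy_zero X \<and>
     (\<forall>(Y :: ('a, 'a univ) cpx) (Z :: ('a, 'a univ) cpx).
        Kb_proj Y \<longrightarrow> Kb_proj Z \<longrightarrow> homotopy_iso X (cpx_sum Y Z) \<longrightarrow>
        homotopy_zero Y \<or> homotopy_zero Z)"

definition num_indec_Kb :: "('a::ring_1, 'm) cpx \<Rightarrow> nat" where
  "num_indec_Kb P =
     num_iso_types {X :: ('a, 'a univ) cpx. in_add_Kb P X \<and> indecomposable_Kb X} homotopy_iso"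

text \<open>Full triangulated subcategories of \<open>K\<^sup>b(proj A)\<close> closed under isomorphism; they need not be
  closed under direct summands.\<close>

definition triangulated_subcategory :: "('a::ring_1, 'a univ) cpx set \<Rightarrow> bool" where
  "triangulated_subcategory T \<longleftrightarrow> T \<noteq> {} \<and> (\<forall>X\<in>T. Kb_proj X) \<and>
     (\<forall>X\<in>T. \<forall>Y. Kb_proj Y \<longrightarrow> homotopy_iso X Y \<longrightarrow> Y \<in> T) \<and>
     (\<forall>X\<in>T. \<forall>m. shift m X \<in> T) \<and>
     (\<forall>X\<in>T. \<forall>Y\<in>T. \<forall>f\<in>chain_maps X Y. \<forall>Z.
        Kb_proj Z \<longrightarrow> homotopy_iso Z (mapping_cone X Y f) \<longrightarrow> Z \<in> T)"

definition generates_Kb :: "('a::ring_1, 'a univ) cpx set \<Rightarrow> bool" where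
  "generates_Kb S \<longleftrightarrow> (\<forall>T. triangulated_subcategory T \<longrightarrow> S \<subseteq> T \<longrightarrow> {X. Kb_proj X} \<subseteq> T)"

definition tilting :: "('a::ring_1, 'm) cpx \<Rightarrow> bool" where
  "tilting P \<longleftrightarrow> partial_tilting P \<and> generates_Kb {X. in_add_Kb P X}"

end

theory Submission
  imports Defs "HOL-Library.Function_Algebras"
begin

text \<open>Finitely generated projective modules are the column modules of idempotents of the ring of finitely
  supported matrices, so \<open>K\<^sup>b(proj A)\<close> is modelled by complexes of idempotents. A symmetric algebra is
  self-injective, hence a complex of projectives splits off a contractible summand at every degree where it is
  exact; so a partial tilting complex of length 2 is isomorphic in \<open>K\<^sup>b(proj A)\<close> to a complex \<open>F\<close> in degrees
  \<open>c - 1\<close> and \<open>c\<close> with \<open>Hom(F, F[1]) = 0\<close>.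

  The class of a complex is the function sending a right ideal \<open>J\<close> to the alternating sum of the dimensions of
  \<open>J e\<close> over its idempotents \<open>e\<close>; it is invariant under isomorphism and additive on triangles. By Nakayama's
  lemma the classes of non-isomorphic indecomposables in \<open>add F\<close> are linearly independent, while the classes
  of the indecomposable projectives form a basis of the span of all classes. If \<open>F\<close> generates, its
  indecomposables span too, so both numbers agree. Conversely, let the numbers agree, and let \<open>Q\<close> be a
  Bongartz complement of \<open>F\<close>. As \<open>F\<close> and \<open>Q\<close> have no extensions among each other, the class of a summand of
  \<open>Q\<close> outside \<open>add F\<close> would be independent of the classes of \<open>add F\<close>, which already span. Hence \<open>Q\<close> lies
  in \<open>add F\<close>, and the defining triangle of \<open>Q\<close> generates the projectives.\<close>

text \<open>Independence of classes is the hard point: a class records only dimensions, and it can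
  be zero for a nonzero complex. A relation with real coefficients \<open>a i\<close> is tested at
  two right ideals attached to one member \<open>X j\<close>: all morphisms into its object in
  degree \<open>c\<close>, and the part generated by the members with \<open>a i > 0\<close>
  together with the differential. Vanishing of extensions turns the difference of the two values
  into a nonnegative defect of each member, which is zero where \<open>a i > 0\<close>. The weighted
  defects sum to zero, so the defect vanishes for \<open>a j < 0\<close> too, and \<open>X j\<close>
  is generated by members with coefficients of the opposite sign. Pairwise non-isomorphic
  indecomposables that generate each other in this way have no cohomology in degree
  \<open>c\<close>, hence are stalks in degree \<open>c - 1\<close>, and the same argument one
  degree lower kills them. The test objects are right ideals because such a trace ideal is in
  general not of the form \<open>w R\<close> with \<open>w\<close> idempotent. Krull-Schmidt for the
  homotopy category rests on Fitting's lemma for strict chain maps, so that summands stay in the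
  degrees of the given complex.\<close>

locale linear_space = vector_space scale for scale :: "'k::field => 'b::ab_group_add => 'b"
begin

text \<open>The ambient spaces, a ring of matrices without size bound and a space of real functions,
  can be infinite dimensional, so finiteness is a property of subsets.\<close>

definition fin_dim :: "'b set => bool" where
  "fin_dim V \<longleftrightarrow> (\<exists>B. finite B \<and> V \<subseteq> span B)"

lemma fin_dim_subset: "fin_dim W ==> V \<subseteq> span W ==> fin_dim V"
  unfolding fin_dim_def by (meson order_trans span_minimal subspace_span)

lemma fin_dim_union: "fin_dim V ==> fin_dim W ==> fin_dim (V \<union> W)"
proof -
  assume "fin_dim V" "fin_dim W"
  then obtain B C where B: "finite B" "V \<subseteq> span B" and C: "finite C" "W \<subseteq> span C"
    unfolding fin_dim_def by blast
  have "V \<union> W \<subseteq> span (B \<union> C)"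
    using B(2) C(2) span_mono[of B "B \<union> C"] span_mono[of C "B \<union> C"] by auto
  thus ?thesis unfolding fin_dim_def using B(1) C(1) by blast
qed

lemma fin_dim_finite: "finite B ==> fin_dim B"
  unfolding fin_dim_def using span_superset by blast

lemma fin_dim_basis:
  assumes "fin_dim V"
  obtains B where "B \<subseteq> V" "independent B" "V \<subseteq> span B" "finite B" "card B = dim V"
proof -
  obtain B where B: "B \<subseteq> V" "independent B" "V \<subseteq> span B"
    using maximal_independent_subset by blast
  obtain C where C: "finite C" "V \<subseteq> span C" using assms unfolding fin_dim_def by blast
  have "finite B" using independent_span_bound[OF C(1) B(2)] B(1) C(2) by blast
  moreover have "card B = dim V" using B by (metis basis_card_eq_dim)
  ultimately show ?thesis using B that by blast
qed

lemma dim_zero: "dim {0} = 0"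
  using dim_unique[of "{}" "{0}" 0] by (simp add: independent_empty)

lemma dim_insert_fin_dim:
  assumes "fin_dim S"
  shows "dim (insert x S) = (if x \<in> span S then dim S else Suc (dim S))"
proof -
  obtain B where B: "B \<subseteq> S" "independent B" "S \<subseteq> span B" "finite B" "card B = dim S"
    using fin_dim_basis[OF assms] .
  have sp: "span B = span S" using B by (metis span_eq span_superset subset_trans)
  show ?thesis
  proof (cases "x \<in> span S")
    case True
    thus ?thesis using dim_span[of "insert x S"] dim_span[of S] span_redundant by simp
  next
    case False
    hence x: "x \<notin> span B" using sp by simp
    have ind: "independent (insert x B)" using B(2) x by (simp add: independent_insert)
    have "dim (insert x S) = card (insert x B)"
    proof (rule dim_unique)
      show "insert x B \<subseteq> insert x S" using B by blast
      show "insert x S \<subseteq> span (insert x B)"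
        using B(3) span_mono[of B "insert x B"] by (auto intro: span_base)
    qed (use ind in auto)
    also have "\<dots> = Suc (card B)" using B(4) x by (simp add: card_insert_if) (metis span_base)
    finally show ?thesis using False B(5) by simp
  qed
qed

lemma dim_mono_fin_dim:
  assumes "V \<subseteq> span W" "fin_dim W"
  shows "dim V \<le> dim W"
proof -
  obtain B where B: "B \<subseteq> W" "independent B" "W \<subseteq> span B" "finite B" "card B = dim W"
    using fin_dim_basis[OF assms(2)] .
  obtain C where C: "C \<subseteq> V" "independent C" "V \<subseteq> span C" "finite C" "card C = dim V"
    using fin_dim_basis[OF fin_dim_subset[OF assms(2,1)]] .
  have "C \<subseteq> span B" using C(1) assms(1) span_minimal[OF B(3) subspace_span] by blast
  thus ?thesis using independent_span_bound[OF B(4) C(2)] B(5) C(5) by simp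
qed

lemma dim_eq_imp_eq:
  assumes "subspace V" "V \<subseteq> W" "fin_dim W" "dim V = dim W"
  shows "V = W"
proof (rule ccontr)
  assume "V ~= W"
  then obtain x where x: "x \<in> W" "x \<notin> V" using assms(2) by blast
  have fV: "fin_dim V" using fin_dim_subset[OF assms(3)] assms(2) span_superset by blast
  have "dim (insert x V) = Suc (dim V)"
    using dim_insert_fin_dim[OF fV] x span_eq_iff[THEN iffD2, OF assms(1)] by simp
  moreover have "dim (insert x V) \<le> dim W"
    using x assms(2) span_superset by (intro dim_mono_fin_dim assms(3)) blast
  ultimately show False using assms(4) by simp
qed

text \<open>Rank-nullity for the map from \<open>K\<close> to the ambient space modulo \<open>R\<close>.\<close>

lemma dim_plus_preimage:
  assumes K: "subspace K" "fin_dim K" and R: "subspace R" "fin_dim R"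
    and f: "Vector_Spaces.linear scale scale f"
  shows "dim K + dim R = dim {f x + y | x y. x \<in> K \<and> y \<in> R} + dim {x \<in> K. f x \<in> R}"
proof -
  interpret f: Vector_Spaces.linear scale scale f by fact
  define N where "N = {x \<in> K. f x \<in> R}"
  have "N \<subseteq> span K" using span_superset[of K] unfolding N_def by blast
  hence fN: "fin_dim N" by (rule fin_dim_subset[OF K(2)])
  \<comment> \<open>The vectors of a basis of \<open>K\<close> are added to \<open>N\<close> one at
    a time. A vector \<open>x\<close> is new modulo \<open>N\<close> and its predecessors exactly if
    \<open>f x\<close> is new modulo \<open>R\<close> and their images, so both sides grow
    together.\<close>
  have key: "dim (N \<union> F) + dim R = dim (f ` F \<union> R) + dim N" if "finite F" "F \<subseteq> K" for F
    using that
  proof (induction F rule: finite_induct)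
    case empty
    show ?case by simp
  next
    case (insert x F)
    have fNF: "fin_dim (N \<union> F)" using fN insert.hyps by (simp add: fin_dim_union fin_dim_finite)
    have fFR: "fin_dim (f ` F \<union> R)" using R insert.hyps by (simp add: fin_dim_union fin_dim_finite)
    have IH: "dim (N \<union> F) + dim R = dim (f ` F \<union> R) + dim N" using insert by simp
    have NFK: "span (N \<union> F) \<subseteq> K" using insert.prems K(1) unfolding N_def by (intro span_minimal) simp_all
    have "f x \<in> span (f ` F \<union> R) \<longleftrightarrow> x \<in> span (N \<union> F)"
    proof
      assume "f x \<in> span (f ` F \<union> R)"
      then obtain u r where ur: "u \<in> span (f ` F)" "r \<in> span R" "f x = u + r"
        unfolding span_Un by blast
      have r: "r \<in> R" using ur(2) span_eq_iff[THEN iffD2, OF R(1)] by simp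
      obtain z where z: "z \<in> span F" "u = f z" using ur(1) unfolding f.span_image by blast
      have zK: "z \<in> K" using z(1) insert.prems span_minimal[of F K] K(1) by blast
      have "f (x - z) = r" using ur z by (simp add: f.diff)
      hence "x - z \<in> N" unfolding N_def using r zK insert.prems subspace_diff[OF K(1), of x z] by simp
      hence "x - z \<in> span (N \<union> F)" using span_base[of "x - z" "N \<union> F"] by blast
      moreover have "z \<in> span (N \<union> F)" using z(1) span_mono[of F "N \<union> F"] by blast
      ultimately have "x - z + z \<in> span (N \<union> F)" by (rule span_add)
      thus "x \<in> span (N \<union> F)" by simp
    next
      assume "x \<in> span (N \<union> F)"
      then obtain u z where uz: "u \<in> span N" "z \<in> span F" "x = u + z"
        unfolding span_Un by blast
      have "f u \<in> span (f ` N)" using uz(1) unfolding f.span_image by blast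
      moreover have "f ` N \<subseteq> R" unfolding N_def by auto
      ultimately have "f u \<in> span (f ` F \<union> R)" using span_mono[of "f ` N" "f ` F \<union> R"] by blast
      moreover have "f z \<in> span (f ` F)" using uz(2) unfolding f.span_image by blast
      hence "f z \<in> span (f ` F \<union> R)" using span_mono[of "f ` F" "f ` F \<union> R"] by blast
      ultimately show "f x \<in> span (f ` F \<union> R)" unfolding uz(3) f.add by (rule span_add)
    qed
    thus ?case using IH by (simp add: dim_insert_fin_dim[OF fNF] dim_insert_fin_dim[OF fFR])
  qed
  obtain B where B: "B \<subseteq> K" "independent B" "K \<subseteq> span B" "finite B" "card B = dim K"
    using fin_dim_basis[OF K(2)] .
  have spB: "span B = K" using B K(1) by (simp add: span_subspace)
  have "K \<subseteq> span (N \<union> B)" using B(3) span_mono[of B "N \<union> B"] by blast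
  moreover have "N \<union> B \<subseteq> K" using B(1) unfolding N_def by blast
  ultimately have "span (N \<union> B) = K" using K(1) by (intro span_subspace)
  hence 1: "dim (N \<union> B) = dim K" by (metis dim_span)
  have "span (f ` B \<union> R) = {f x + y | x y. x \<in> K \<and> y \<in> R}"
    unfolding span_Un f.span_image spB span_eq_iff[THEN iffD2, OF R(1)] by blast
  hence 2: "dim (f ` B \<union> R) = dim {f x + y | x y. x \<in> K \<and> y \<in> R}" by (metis dim_span)
  show ?thesis using key[OF B(4,1)] unfolding 1 2 by (simp only: N_def)
qed

lemma dim_direct_sum:
  assumes "subspace V" "fin_dim V" "subspace W" "fin_dim W" "V \<inter> W \<subseteq> {0}"
  shows "dim {x + y | x y. x \<in> V \<and> y \<in> W} = dim V + dim W"
proof -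
  have "{x \<in> V. id x \<in> W} = {0}" using assms by (auto simp: subspace_0)
  moreover have "dim {0} = 0" by (rule dim_zero)
  moreover have "Vector_Spaces.linear scale scale id" by (rule linear_id)
  ultimately show ?thesis using dim_plus_preimage[OF assms(1,2,3,4), of id] by simp
qed

lemma dim_inj_image:
  assumes "subspace V" "fin_dim V" "Vector_Spaces.linear scale scale f"
    and "!!x. x \<in> V ==> f x = 0 ==> x = 0"
  shows "dim (f ` V) = dim V"
proof -
  interpret f: Vector_Spaces.linear scale scale f by fact
  have "{x \<in> V. f x \<in> {0}} = {0}" using assms(1,4) by (auto simp: subspace_0)
  moreover have "dim {0} = 0" by (rule dim_zero)
  moreover have "{f x + y | x y. x \<in> V \<and> y \<in> {0}} = f ` V" by auto
  moreover have "fin_dim {0}" by (rule fin_dim_finite) simp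
  ultimately show ?thesis using dim_plus_preimage[OF assms(1,2), of "{0}" f] assms(3) by simp
qed

end

section \<open>Morphisms between idempotents of a ring\<close>

lemma mult_eq_assoc: "a * b = d ==> a * (b * c) = d * (c :: 'r :: ring)"
  by (simp add: mult.assoc[symmetric])

text \<open>The morphisms from \<open>e\<close> to \<open>f\<close> in the idempotent completion of
  the ring: an idempotent is an object and its own identity, and the composite of \<open>x\<close>
  followed by \<open>y\<close> is \<open>y * x\<close>.\<close>

definition arr :: "'r::ring => 'r => 'r set" where
  "arr e f = {x. f * x = x \<and> x * e = x}"

lemma arrD: "x \<in> arr e f ==> f * x = x" "x \<in> arr e f ==> x * e = x"
  unfolding arr_def by auto

lemma arrI: "f * x = x ==> x * e = x ==> x \<in> arr e f"
  unfolding arr_def by auto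

lemma hom_mult: "x \<in> arr e f ==> y \<in> arr f g ==> y * x \<in> arr e g"
  unfolding arr_def by (auto simp: mult.assoc) (metis mult.assoc)

lemma hom_zero [simp]: "0 \<in> arr e f"
  unfolding arr_def by simp

lemma hom_add: "x \<in> arr e f ==> y \<in> arr e f ==> x + y \<in> arr e f"
  unfolding arr_def by (auto simp: algebra_simps)

lemma hom_diff: "x \<in> arr e f ==> y \<in> arr e f ==> x - y \<in> arr e f"
  unfolding arr_def by (auto simp: algebra_simps)

lemma hom_uminus: "x \<in> arr e f ==> - x \<in> arr e f"
  unfolding arr_def by (auto simp: algebra_simps)

lemma hom_sum: "(!!i. i \<in> I ==> x i \<in> arr e f) ==> sum x I \<in> arr e f"
  by (induction I rule: infinite_finite_induct) (auto intro: hom_add)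

lemma hom_id: "e * e = e ==> e \<in> arr e e"
  unfolding arr_def by simp

lemma hom_to_zero: "x \<in> arr e 0 ==> x = 0" and hom_from_zero: "x \<in> arr 0 e ==> x = 0"
  unfolding arr_def by auto

lemma hom_corner:
  assumes "e * e = e" "f * f = f"
  shows "f * x * e \<in> arr e f"
  using assms by (simp add: arr_def mult.assoc mult_eq_assoc[OF assms(2)])

section \<open>Complexes over the category of idempotents\<close>

record 'r mcx =
  ob :: "int => 'r"
  df :: "int => 'r"

definition cx :: "'r::ring mcx => bool" where
  "cx E \<longleftrightarrow> (\<forall>n. ob E n * ob E n = ob E n) \<and> (\<forall>n. df E n \<in> arr (ob E n) (ob E (n + 1))) \<and>
     (\<forall>n. df E (n + 1) * df E n = 0) \<and> finite {n. ob E n ~= 0}"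

text \<open>Chain maps are elements of the ring of functions on the integers with pointwise
  operations. Composition is therefore multiplication, and the identity of \<open>E\<close> is
  \<open>ob E\<close>.\<close>

definition mhoms :: "'r::ring mcx => 'r mcx => (int => 'r) set" where
  "mhoms E F = {f. (\<forall>n. f n \<in> arr (ob E n) (ob F n)) \<and> (\<forall>n. df F n * f n = f (n + 1) * df E n)}"

definition nulls :: "'r::ring mcx => 'r mcx => (int => 'r) set" where
  "nulls E F = {f. \<exists>h. (\<forall>n. h n \<in> arr (ob E n) (ob F (n - 1))) \<and>
     (\<forall>n. f n = df F (n - 1) * h n + h (n + 1) * df E n)}"

lemma cxD:
  assumes "cx E"
  shows "ob E n * ob E n = ob E n" "df E n \<in> arr (ob E n) (ob E (n + 1))"
    "df E (n + 1) * df E n = 0" "finite {n. ob E n ~= 0}"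
    "df E n * df E (n - 1) = 0" "df E (n - 1) \<in> arr (ob E (n - 1)) (ob E n)"
    "ob E (n + 1) * df E n = df E n" "df E n * ob E n = df E n"
    "ob E n * df E (n - 1) = df E (n - 1)"
proof -
  show a: "ob E n * ob E n = ob E n" "df E n \<in> arr (ob E n) (ob E (n + 1))" for n
    using assms unfolding cx_def by auto
  show "df E (n + 1) * df E n = 0" and fin: "finite {n. ob E n ~= 0}"
    using assms unfolding cx_def by auto
  have "df E (n - 1 + 1) * df E (n - 1) = 0" using assms unfolding cx_def by blast
  thus "df E n * df E (n - 1) = 0" by simp
  show b: "df E (n - 1) \<in> arr (ob E (n - 1)) (ob E n)" using a(2)[of "n - 1"] by simp
  show "ob E (n + 1) * df E n = df E n" "df E n * ob E n = df E n" using a(2)[of n] by (auto dest: arrD)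
  show "ob E n * df E (n - 1) = df E (n - 1)" using b by (auto dest: arrD)
qed

lemma mhomsD:
  assumes "f \<in> mhoms E F"
  shows "f n \<in> arr (ob E n) (ob F n)" "df F n * f n = f (n + 1) * df E n"
    "ob F n * f n = f n" "f n * ob E n = f n" "df F (n - 1) * f (n - 1) = f n * df E (n - 1)"
proof -
  have a: "f n \<in> arr (ob E n) (ob F n)" "df F n * f n = f (n + 1) * df E n" for n
    using assms unfolding mhoms_def by auto
  show "f n \<in> arr (ob E n) (ob F n)" "df F n * f n = f (n + 1) * df E n" by (fact a)+
  show "ob F n * f n = f n" "f n * ob E n = f n" using a(1)[of n] by (auto dest: arrD)
  show "df F (n - 1) * f (n - 1) = f n * df E (n - 1)" using a(2)[of "n - 1"] by simp
qed

lemma mhomsI: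
  "(!!n. f n \<in> arr (ob E n) (ob F n)) ==> (!!n. df F n * f n = f (n + 1) * df E n) ==> f \<in> mhoms E F"
  unfolding mhoms_def by blast

lemma mhoms_id: "cx E ==> ob E \<in> mhoms E E"
  by (rule mhomsI) (simp_all add: cxD hom_id)

lemma mhoms_mult: "f \<in> mhoms E F ==> g \<in> mhoms F G ==> g * f \<in> mhoms E G"
proof (rule mhomsI)
  fix n assume f: "f \<in> mhoms E F" and g: "g \<in> mhoms F G"
  show "(g * f) n \<in> arr (ob E n) (ob G n)" using mhomsD(1)[OF f] mhomsD(1)[OF g] by (auto intro: hom_mult)
  have "df G n * (g n * f n) = g (n + 1) * (df F n * f n)"
    using mhomsD(2)[OF g, of n] by (metis mult.assoc)
  thus "df G n * (g * f) n = (g * f) (n + 1) * df E n"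
    using mhomsD(2)[OF f, of n] by (simp add: mult.assoc)
qed

lemma mhoms_add: "f \<in> mhoms E F ==> g \<in> mhoms E F ==> f + g \<in> mhoms E F"
  unfolding mhoms_def by (auto simp: algebra_simps intro: hom_add)

lemma mhoms_uminus: "f \<in> mhoms E F ==> - f \<in> mhoms E F"
  unfolding mhoms_def by (auto simp: algebra_simps intro: hom_uminus)

lemma mhoms_diff: "f \<in> mhoms E F ==> g \<in> mhoms E F ==> f - g \<in> mhoms E F"
  using mhoms_add[of f E F "- g"] mhoms_uminus[of g E F] by simp

lemma mhoms_zero: "0 \<in> mhoms E F"
  unfolding mhoms_def by auto

lemma mhoms_sum: "(!!i. i \<in> I ==> f i \<in> mhoms E F) ==> sum f I \<in> mhoms E F"
  by (induction I rule: infinite_finite_induct) (auto intro: mhoms_add mhoms_zero)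

lemma mhoms_id_left: "f \<in> mhoms E F ==> ob F * f = f"
  by (rule ext) (simp add: mhomsD)

lemma mhoms_id_right: "f \<in> mhoms E F ==> f * ob E = f"
  by (rule ext) (simp add: mhomsD)

lemma nullsI:
  "(!!n. h n \<in> arr (ob E n) (ob F (n - 1))) ==> (!!n. f n = df F (n - 1) * h n + h (n + 1) * df E n)
    ==> f \<in> nulls E F"
  unfolding nulls_def by blast

lemma nulls_mhoms: "cx E ==> cx F ==> f \<in> nulls E F ==> f \<in> mhoms E F"
proof (rule mhomsI)
  fix n assume E: "cx E" and F: "cx F" and "f \<in> nulls E F"
  then obtain h where h: "!!n. h n \<in> arr (ob E n) (ob F (n - 1))"
    and f: "!!n. f n = df F (n - 1) * h n + h (n + 1) * df E n" unfolding nulls_def by blast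
  have h': "h (n + 1) \<in> arr (ob E (n + 1)) (ob F n)" using h[of "n + 1"] by simp
  show "f n \<in> arr (ob E n) (ob F n)"
    unfolding f using cxD(6)[OF F, of n] cxD(2)[OF E, of n] h[of n] h' by (auto intro: hom_add hom_mult)
  have 1: "df F n * (df F (n - 1) * h n) = 0" using cxD(5)[OF F, of n] by (metis mult.assoc mult_zero_left)
  have 2: "h (n + 2) * df E (n + 1) * df E n = 0"
    using cxD(3)[OF E, of n] by (simp add: mult.assoc)
  show "df F n * f n = f (n + 1) * df E n"
    unfolding f using 1 2 by (simp add: algebra_simps)
qed

lemma nulls_zero: "0 \<in> nulls E F"
  by (rule nullsI[of "%_. 0"]) auto

lemma nulls_add: "f \<in> nulls E F ==> g \<in> nulls E F ==> f + g \<in> nulls E F"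
proof -
  assume "f \<in> nulls E F" "g \<in> nulls E F"
  then obtain h k where "!!n. h n \<in> arr (ob E n) (ob F (n - 1))"
    "!!n. f n = df F (n - 1) * h n + h (n + 1) * df E n"
    "!!n. k n \<in> arr (ob E n) (ob F (n - 1))"
    "!!n. g n = df F (n - 1) * k n + k (n + 1) * df E n" unfolding nulls_def by blast
  thus ?thesis by (intro nullsI[of "%n. h n + k n"]) (auto simp: algebra_simps intro: hom_add)
qed

lemma nulls_uminus: "f \<in> nulls E F ==> - f \<in> nulls E F"
proof -
  assume "f \<in> nulls E F"
  then obtain h where "!!n. h n \<in> arr (ob E n) (ob F (n - 1))"
    "!!n. f n = df F (n - 1) * h n + h (n + 1) * df E n" unfolding nulls_def by blast
  thus ?thesis by (intro nullsI[of "%n. - h n"]) (auto simp: algebra_simps intro: hom_uminus)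
qed

lemma nulls_diff: "f \<in> nulls E F ==> g \<in> nulls E F ==> f - g \<in> nulls E F"
  using nulls_add[of f E F "- g"] nulls_uminus[of g E F] by simp

lemma nulls_mult_left: "f \<in> nulls E F ==> g \<in> mhoms F G ==> g * f \<in> nulls E G"
proof -
  assume "f \<in> nulls E F" and g: "g \<in> mhoms F G"
  then obtain h where h: "!!n. h n \<in> arr (ob E n) (ob F (n - 1))"
    "!!n. f n = df F (n - 1) * h n + h (n + 1) * df E n" unfolding nulls_def by blast
  show ?thesis
  proof (rule nullsI[of "%n. g (n - 1) * h n"])
    fix n
    show "g (n - 1) * h n \<in> arr (ob E n) (ob G (n - 1))" using h(1) mhomsD(1)[OF g] by (auto intro: hom_mult)
    have "g n * (df F (n - 1) * h n) = df G (n - 1) * (g (n - 1) * h n)"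
      using mhomsD(5)[OF g, of n] by (metis mult.assoc)
    thus "(g * f) n = df G (n - 1) * (g (n - 1) * h n) + g (n + 1 - 1) * h (n + 1) * df E n"
      by (simp add: h(2) algebra_simps)
  qed
qed

lemma nulls_mult_right: "f \<in> nulls F G ==> g \<in> mhoms E F ==> f * g \<in> nulls E G"
proof -
  assume "f \<in> nulls F G" and g: "g \<in> mhoms E F"
  then obtain h where h: "!!n. h n \<in> arr (ob F n) (ob G (n - 1))"
    "!!n. f n = df G (n - 1) * h n + h (n + 1) * df F n" unfolding nulls_def by blast
  show ?thesis
  proof (rule nullsI[of "%n. h n * g n"])
    fix n
    show "h n * g n \<in> arr (ob E n) (ob G (n - 1))" using h(1) mhomsD(1)[OF g] by (auto intro: hom_mult)
    have "h (n + 1) * (df F n * g n) = h (n + 1) * g (n + 1) * df E n"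
      using mhomsD(2)[OF g, of n] by (simp add: mult.assoc)
    thus "(f * g) n = df G (n - 1) * (h n * g n) + h (n + 1) * g (n + 1) * df E n"
      by (simp add: h(2) algebra_simps)
  qed
qed

definition heq :: "'r::ring mcx => 'r mcx => (int => 'r) => (int => 'r) => bool" where
  "heq E F f g \<longleftrightarrow> f - g \<in> nulls E F"

lemma heq_refl: "heq E F f f"
  unfolding heq_def using nulls_zero by simp

lemma heq_sym: "heq E F f g ==> heq E F g f"
  unfolding heq_def using nulls_uminus by fastforce

lemma heq_trans [trans]: "heq E F f g ==> heq E F g h ==> heq E F f h"
  unfolding heq_def using nulls_add by fastforce

lemma heq_eq_trans [trans]: "heq E F f g ==> g = h ==> heq E F f h" "f = g ==> heq E F g h ==> heq E F f h"
  by auto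

lemma heq_left: "heq E F f f' ==> g \<in> mhoms F G ==> heq E G (g * f) (g * f')"
  unfolding heq_def using nulls_mult_left by (fastforce simp: algebra_simps)

lemma heq_right: "heq F G f f' ==> g \<in> mhoms E F ==> heq E G (f * g) (f' * g)"
  unfolding heq_def using nulls_mult_right by (fastforce simp: algebra_simps)

lemma heq_add: "heq E F f f' ==> heq E F g g' ==> heq E F (f + g) (f' + g')"
  unfolding heq_def using nulls_add[of "f - f'" E F "g - g'"] by (simp add: algebra_simps)

lemma heq_diff: "heq E F f f' ==> heq E F g g' ==> heq E F (f - g) (f' - g')"
  unfolding heq_def using nulls_diff[of "f - f'" E F "g - g'"] by (simp add: algebra_simps)

lemma heq_zero: "heq E F f 0 \<longleftrightarrow> f \<in> nulls E F"
  unfolding heq_def by simp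

definition mzero :: "'r::ring mcx => bool" where
  "mzero E \<longleftrightarrow> ob E \<in> nulls E E"

definition mequiv :: "'r::ring mcx => 'r mcx => (int => 'r) => (int => 'r) => bool" where
  "mequiv E F f g \<longleftrightarrow> f \<in> mhoms E F \<and> g \<in> mhoms F E \<and> heq E E (g * f) (ob E) \<and> heq F F (f * g) (ob F)"

definition meq :: "'r::ring mcx => 'r mcx => bool" where
  "meq E F \<longleftrightarrow> (\<exists>f g. mequiv E F f g)"

definition mretract :: "'r::ring mcx => 'r mcx => bool" where
  "mretract E F \<longleftrightarrow> (\<exists>f g. f \<in> mhoms E F \<and> g \<in> mhoms F E \<and> heq E E (g * f) (ob E))"

definition munit :: "'r::ring mcx => (int => 'r) => bool" where
  "munit E f \<longleftrightarrow> f \<in> mhoms E E \<and> (\<exists>g \<in> mhoms E E. heq E E (g * f) (ob E) \<and> heq E E (f * g) (ob E))"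

lemma heq_mult_id:
  assumes "f \<in> mhoms E F" "g \<in> mhoms F E" "heq E E (g * f) (ob E)"
    and "f' \<in> mhoms F G" "g' \<in> mhoms G F" "heq F F (g' * f') (ob F)"
  shows "heq E E (g * g' * (f' * f)) (ob E)"
proof -
  have "heq E E (g * ((g' * f') * f)) (g * (ob F * f))"
    by (intro heq_left[where F = F] heq_right[where F = F] assms)
  also have "g * (ob F * f) = g * f" using assms(1) by (simp add: mhoms_id_left)
  also have "heq E E (g * f) (ob E)" by fact
  finally show ?thesis by (simp add: mult.assoc)
qed

lemma meq_refl: "cx E ==> meq E E"
  unfolding meq_def mequiv_def
  by (rule exI[of _ "ob E"], rule exI[of _ "ob E"]) (auto simp: mhoms_id cxD fun_eq_iff intro!: heq_refl[THEN heq_eq_trans(1)])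

lemma meq_sym: "meq E F ==> meq F E"
  unfolding meq_def mequiv_def by blast

lemma meq_trans: "meq E F ==> meq F G ==> meq E G"
proof -
  assume "meq E F" "meq F G"
  then obtain f g f' g' where *: "mequiv E F f g" "mequiv F G f' g'" unfolding meq_def by blast
  have "mequiv E G (f' * f) (g * g')"
    unfolding mequiv_def using * heq_mult_id[of f E F g f' G g'] heq_mult_id[of g' G F f' g E f]
    by (auto simp: mequiv_def intro: mhoms_mult)
  thus ?thesis unfolding meq_def by blast
qed

lemma meq_mretract: "meq E F ==> mretract E F"
  unfolding meq_def mequiv_def mretract_def by blast

lemma mretract_trans: "mretract E F ==> mretract F G ==> mretract E G"
proof -
  assume "mretract E F" "mretract F G"
  then obtain f g f' g' where "f \<in> mhoms E F" "g \<in> mhoms F E" "heq E E (g * f) (ob E)"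
    "f' \<in> mhoms F G" "g' \<in> mhoms G F" "heq F F (g' * f') (ob F)" unfolding mretract_def by blast
  thus ?thesis unfolding mretract_def using heq_mult_id[of f E F g f' G g'] mhoms_mult by blast
qed

lemma mretract_mzero: "mretract E F ==> mzero F ==> mzero E"
proof -
  assume "mretract E F" and F: "mzero F"
  then obtain f g where fg: "f \<in> mhoms E F" "g \<in> mhoms F E" "heq E E (g * f) (ob E)"
    unfolding mretract_def by blast
  have "ob F * f \<in> nulls E F" using F fg(1) unfolding mzero_def by (rule nulls_mult_right)
  hence "f \<in> nulls E F" using fg(1) by (simp add: mhoms_id_left)
  hence "g * f \<in> nulls E E" using fg(2) by (rule nulls_mult_left)
  thus ?thesis unfolding mzero_def using fg(3) by (metis heq_zero heq_sym heq_trans)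
qed

lemma meq_mzero: "meq E F ==> mzero E \<longleftrightarrow> mzero F"
  using mretract_mzero meq_mretract meq_sym by blast

text \<open>A left inverse and a right inverse up to homotopy agree up to homotopy.\<close>

lemma munitI:
  assumes "f \<in> mhoms E E" "g \<in> mhoms E E" "g' \<in> mhoms E E"
    and "heq E E (g * f) (ob E)" "heq E E (f * g') (ob E)"
  shows "munit E f"
proof -
  have "heq E E g (g * (f * g'))"
    using heq_left[OF heq_sym[OF assms(5)] assms(2)] assms(2) by (simp add: mhoms_id_right)
  also have "g * (f * g') = g * f * g'" by (simp add: mult.assoc)
  also have "heq E E \<dots> (ob E * g')" using assms by (intro heq_right[where F = E])
  also have "ob E * g' = g'" using assms by (simp add: mhoms_id_left)
  finally have "heq E E (f * g) (f * g')" using assms(1) by (rule heq_left)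
  hence "heq E E (f * g) (ob E)" using assms(5) by (rule heq_trans)
  thus ?thesis unfolding munit_def using assms by blast
qed

lemma munit_heq:
  assumes "munit E f" "heq E E f f'" "f' \<in> mhoms E E"
  shows "munit E f'"
proof -
  obtain g where g: "g \<in> mhoms E E" "heq E E (g * f) (ob E)" "heq E E (f * g) (ob E)" "f \<in> mhoms E E"
    using assms(1) unfolding munit_def by blast
  have "heq E E (g * f') (ob E)" using heq_left[OF heq_sym[OF assms(2)] g(1)] g(2) by (rule heq_trans)
  moreover have "heq E E (f' * g) (ob E)" using heq_right[OF heq_sym[OF assms(2)] g(1)] g(3) by (rule heq_trans)
  ultimately show ?thesis unfolding munit_def using g assms by blast
qed

lemma munit_mzero_iff:
  assumes "cx E" "f \<in> nulls E E" "munit E f" shows "mzero E"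
proof -
  obtain g where g: "g \<in> mhoms E E" "heq E E (g * f) (ob E)" using assms unfolding munit_def by blast
  have "g * f \<in> nulls E E" using assms g by (intro nulls_mult_left)
  thus ?thesis using g unfolding mzero_def by (metis heq_zero heq_sym heq_trans)
qed

section \<open>Fitting's lemma\<close>

text \<open>The idempotent \<open>e\<close> takes the place of the power with exponent 0, since the
  ring of matrices has no unit.\<close>

definition pw :: "'r::ring => 'r => nat => 'r" where
  "pw e f n = (((*) f) ^^ n) e"

lemma pw_0 [simp]: "pw e f 0 = e" and pw_Suc: "pw e f (Suc n) = f * pw e f n"
  unfolding pw_def by auto

lemma pw_hom: "e * e = e ==> f \<in> arr e e ==> pw e f n \<in> arr e e"
  by (induction n) (auto simp: pw_Suc intro: hom_mult hom_id)

lemma pw_add: "e * e = e ==> f \<in> arr e e ==> pw e f (m + n) = pw e f m * pw e f n"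
  by (induction m) (auto simp: pw_Suc mult.assoc arrD(1)[OF pw_hom])

lemma pw_Suc2: "e * e = e ==> f \<in> arr e e ==> pw e f (Suc n) = pw e f n * f"
  using pw_add[of e f n 1] arrD[of f e e] by (simp add: pw_Suc)

lemma pw_fun: "pw e f m n = pw (e n) (f n) m" for e f :: "'i => 'r::ring"
  by (induction m) (auto simp: pw_Suc)

lemma pw_mhoms: "cx E ==> f \<in> mhoms E E ==> pw (ob E) f m \<in> mhoms E E"
  by (induction m) (auto simp: pw_Suc intro: mhoms_mult mhoms_id)

text \<open>An element with \<open>a = a a x = y a a\<close> is invertible in the corner of the idempotent \<open>a x = y a\<close>,
  with inverse \<open>y a x\<close>. Both are natural with respect to intertwiners.\<close>

lemma strongly_regular:
  fixes a x y :: "'r::ring"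
  assumes "a = a * a * x" "a = y * a * a"
  shows "a * x = y * a" "a * x * (a * x) = a * x" "a * x * a = a" "a * (a * x) = a"
    "y * a * x * a = a * x" "a * (y * a * x) = a * x"
proof -
  have *: "a * a * x = a" "y * a * a = a" using assms by simp_all
  show 1: "a * x = y * a" by (metis * mult.assoc)
  show "a * (a * x) = a" using * by (simp add: mult.assoc)
  show 2: "a * x * a = a" using 1 * by (simp add: mult.assoc)
  show "a * x * (a * x) = a * x" using 2 by (metis mult.assoc)
  show "y * a * x * a = a * x" using 1 2 by (metis mult.assoc)
  show "a * (y * a * x) = a * x" using 1 2 * by (metis mult.assoc)
qed

lemma strongly_regular_natural:
  fixes a x y a' x' y' d :: "'r::ring"
  assumes "a = a * a * x" "a = y * a * a" "a' = a' * a' * x'" "a' = y' * a' * a'" "d * a = a' * d"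
  shows "a' * x' * d = d * (a * x)" "y' * a' * x' * d = d * (y * a * x)"
proof -
  note r = strongly_regular[OF assms(1,2)] and r' = strongly_regular[OF assms(3,4)]
  have "a' * x' * d = y' * (a' * d)" using r'(1) by (simp add: mult.assoc)
  also have "\<dots> = y' * d * (a * a * x)" using assms(1,5) by (metis mult.assoc)
  also have "\<dots> = y' * (d * a) * a * x" by (simp add: mult.assoc)
  also have "\<dots> = y' * a' * (d * a) * x" by (subst assms(5)) (simp add: mult.assoc)
  also have "\<dots> = (y' * a' * a') * (d * x)" unfolding assms(5) by (simp add: mult.assoc)
  also have "\<dots> = a' * d * x" using assms(4) by (metis mult.assoc)
  also have "\<dots> = d * (a * x)" unfolding assms(5)[symmetric] by (simp add: mult.assoc)
  finally show e: "a' * x' * d = d * (a * x)" .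
  have "y' * a' * x' * d = y' * (d * (a * x))" unfolding e[symmetric] by (simp add: mult.assoc)
  also have "\<dots> = y' * (d * (a * (a * x) * x))" using r(4) by simp
  also have "\<dots> = y' * (d * a) * (a * x * x)" by (simp add: mult.assoc)
  also have "\<dots> = a' * x' * (d * (a * x * x))" unfolding assms(5) r'(1) by (simp add: mult.assoc)
  also have "\<dots> = d * (a * x) * (a * x * x)" using e by (metis mult.assoc)
  also have "\<dots> = d * (a * x * (a * x) * x)" by (simp add: mult.assoc)
  also have "\<dots> = d * (y * a * x)" by (simp only: r(2)) (simp only: r(1))
  finally show "y' * a' * x' * d = d * (y * a * x)" .
qed

text \<open>What the matrix ring contributes to the theory: finite dimensional morphism spaces, a
  chosen biproduct \<open>bs e f\<close> with its injections and projections, and an idempotent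
  \<open>gen\<close> through finite sums of which every identity factors. The last property bounds
  the number of indecomposable projectives.\<close>

locale hom_finite_ring = linear_space scale
  for scale :: "'k::field => 'r::ring => 'r" +
  fixes bs i1 i2 p1 p2 :: "'r => 'r => 'r" and gen :: 'r
  assumes scale_mult_left: "scale c x * y = scale c (x * y)"
    and scale_mult_right: "x * scale c y = scale c (x * y)"
    and fin_dim_hom: "e * e = e ==> f * f = f ==> fin_dim (arr e f)"
    and biprod: "e * e = e ==> f * f = f ==> bs e f * bs e f = bs e f \<and>
        i1 e f \<in> arr e (bs e f) \<and> i2 e f \<in> arr f (bs e f) \<and>
        p1 e f \<in> arr (bs e f) e \<and> p2 e f \<in> arr (bs e f) f \<and>
        p1 e f * i1 e f = e \<and> p2 e f * i2 e f = f \<and> p1 e f * i2 e f = 0 \<and> p2 e f * i1 e f = 0 \<and>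
        i1 e f * p1 e f + i2 e f * p2 e f = bs e f"
    and gen_idem: "gen * gen = gen"
    and generated: "e * e = e ==> \<exists>n::nat. \<exists>u v. e = (\<Sum>i<n. u i * gen * v i)"
begin

lemma linear_mult_right: "Vector_Spaces.linear scale scale (%x. x * y)"
  by unfold_locales (auto simp: algebra_simps scale_mult_left)

lemma linear_mult_left: "Vector_Spaces.linear scale scale (%x. y * x)"
  by unfold_locales (auto simp: algebra_simps scale_mult_right)

lemma hom_scale: "x \<in> arr e f ==> scale c x \<in> arr e f"
  unfolding arr_def by (auto simp: scale_mult_left scale_mult_right)

lemma subspace_hom: "subspace (arr e f)"
  unfolding subspace_def by (auto intro: hom_add hom_scale)

lemma subspace_linear_image:
  assumes "Vector_Spaces.linear scale scale f" "subspace V"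
  shows "subspace (f ` V)"
proof -
  interpret f: Vector_Spaces.linear scale scale f by fact
  show ?thesis using assms(2) by (rule f.subspace_image)
qed

lemma dim_chain_stable:
  fixes V :: "nat => 'r set"
  assumes "!!i. subspace (V i)" "!!i j. i \<le> j ==> V j \<subseteq> V i" "fin_dim (V 0)"
  shows "\<exists>M. \<forall>i\<ge>M. V i = V M"
proof -
  obtain M where M: "!!i. dim (V M) \<le> dim (V i)"
    using ex_has_least_nat[of "%_. True" _ "%i. dim (V i)"] by blast
  have fd: "fin_dim (V i)" for i
    using fin_dim_subset[OF assms(3), of "V i"] assms(2)[of 0 i] span_superset[of "V 0"] by simp
  have "V i = V M" if "i \<ge> M" for i
  proof (rule dim_eq_imp_eq)
    show "V i \<subseteq> V M" using assms(2) that by simp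
    hence "dim (V i) \<le> dim (V M)" using span_superset[of "V M"] by (intro dim_mono_fin_dim fd) blast
    thus "dim (V i) = dim (V M)" using M[of i] by simp
  qed (use assms fd in auto)
  thus ?thesis by blast
qed

text \<open>The one-sided ideals generated by the powers of \<open>f\<close> form descending chains
  of finite dimensional spaces, so both chains become stationary; comparing the exponents
  \<open>m\<close> and \<open>m + m\<close> gives the two equations. They are claimed for all large
  \<open>m\<close> because one exponent has to serve all degrees of a complex.\<close>

lemma power_strongly_regular:
  fixes e f :: 'r
  assumes "e * e = e" "f \<in> arr e e"
  shows "\<exists>M. \<forall>m\<ge>M. \<exists>x\<in>arr e e. \<exists>y\<in>arr e e.
    pw e f m = pw e f m * pw e f m * x \<and> pw e f m = y * pw e f m * pw e f m"
proof -
  let ?V = "%i. (%x. pw e f i * x) ` arr e e" and ?W = "%i. (%x. x * pw e f i) ` arr e e"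
  have pw: "pw e f i \<in> arr e e" for i using assms by (rule pw_hom)
  have V0: "?V 0 = arr e e" and W0: "?W 0 = arr e e" by (auto simp: arrD intro: image_eqI[rotated])
  have "\<exists>M. \<forall>i\<ge>M. ?V i = ?V M"
  proof (rule dim_chain_stable[where V = ?V])
    show "subspace (?V i)" for i
      by (intro subspace_linear_image linear_mult_left subspace_hom)
    show "?V j \<subseteq> ?V i" if "i \<le> j" for i j
    proof -
      have "pw e f j * x = pw e f i * (pw e f (j - i) * x)" for x
        using pw_add[OF assms, of i "j - i"] that by (simp add: mult.assoc)
      thus ?thesis using pw[of "j - i"] by (auto intro: hom_mult)
    qed
    show "fin_dim (?V 0)" unfolding V0 using assms by (intro fin_dim_hom)
  qed
  then obtain M where M: "!!i. i \<ge> M ==> ?V i = ?V M" by blast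
  have "\<exists>M. \<forall>i\<ge>M. ?W i = ?W M"
  proof (rule dim_chain_stable[where V = ?W])
    show "subspace (?W i)" for i
      by (intro subspace_linear_image linear_mult_right subspace_hom)
    show "?W j \<subseteq> ?W i" if "i \<le> j" for i j
    proof -
      have "x * pw e f j = x * pw e f (j - i) * pw e f i" for x
        using pw_add[OF assms, of "j - i" i] that by (simp add: mult.assoc)
      thus ?thesis using pw[of "j - i"] by (auto intro: hom_mult)
    qed
    show "fin_dim (?W 0)" unfolding W0 using assms by (intro fin_dim_hom)
  qed
  then obtain N where N: "!!i. i \<ge> N ==> ?W i = ?W N" by blast
  show ?thesis
  proof (intro exI[of _ "max M N"] allI impI)
    fix m assume m: "max M N \<le> m"
    have "?V m = ?V (m + m)" "?W m = ?W (m + m)" using M[of m] M[of "m + m"] N[of m] N[of "m + m"] m by auto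
    moreover have "pw e f m \<in> ?V m" "pw e f m \<in> ?W m"
      using pw[of m] hom_id[OF assms(1)] by (auto simp: arrD intro!: image_eqI[of _ _ e])
    ultimately obtain x y where "x \<in> arr e e" "y \<in> arr e e"
      "pw e f m = pw e f (m + m) * x" "pw e f m = y * pw e f (m + m)" by blast
    thus "\<exists>x\<in>arr e e. \<exists>y\<in>arr e e.
        pw e f m = pw e f m * pw e f m * x \<and> pw e f m = y * pw e f m * pw e f m"
      using pw_add[OF assms, of m m] by (metis mult.assoc)
  qed
qed

text \<open>A power \<open>a\<close> of \<open>f\<close> is strongly regular in every degree, and
  its idempotent \<open>p\<close> is a chain map because it is natural. On the image of
  \<open>p\<close> the map \<open>f\<close> is invertible; on the complement \<open>f\<close> is
  nilpotent, so \<open>ob E - f\<close> is invertible there. All equations are strict, not up to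
  homotopy.\<close>

lemma fitting:
  fixes E :: "'r mcx"
  assumes E: "cx E" and f: "f \<in> mhoms E E"
  obtains p g c where "p \<in> mhoms E E" "g \<in> mhoms E E" "c \<in> mhoms E E" "p * p = p" "f * p = p * f"
    "g * f = p" "f * g = p" "c * (ob E - f) = ob E - p" "(ob E - f) * c = ob E - p"
proof -
  let ?S = "{n. ob E n ~= 0}"
  note e = cxD(1)[OF E] and fh = mhomsD(1)[OF f]
  have "\<forall>n. \<exists>M. \<forall>m\<ge>M. \<exists>x\<in>arr (ob E n) (ob E n). \<exists>y\<in>arr (ob E n) (ob E n).
     pw (ob E n) (f n) m = pw (ob E n) (f n) m * pw (ob E n) (f n) m * x \<and>
     pw (ob E n) (f n) m = y * pw (ob E n) (f n) m * pw (ob E n) (f n) m"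
    using power_strongly_regular[OF e fh] by blast
  then obtain M where M: "!!n m. m \<ge> M n ==> \<exists>x\<in>arr (ob E n) (ob E n). \<exists>y\<in>arr (ob E n) (ob E n).
     pw (ob E n) (f n) m = pw (ob E n) (f n) m * pw (ob E n) (f n) m * x \<and>
     pw (ob E n) (f n) m = y * pw (ob E n) (f n) m * pw (ob E n) (f n) m" by metis
  define m where "m = Suc (Max (insert 0 (M ` ?S)))"
  define a where "a = pw (ob E) f m"
  have a_n: "a n = pw (ob E n) (f n) m" for n unfolding a_def by (rule pw_fun)
  have ah: "a \<in> mhoms E E" unfolding a_def using E f by (rule pw_mhoms)
  have "\<exists>x\<in>arr (ob E n) (ob E n). \<exists>y\<in>arr (ob E n) (ob E n). a n = a n * a n * x \<and> a n = y * a n * a n" for n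
  proof (cases "n \<in> ?S")
    case True
    have "M n \<le> Max (insert 0 (M ` ?S))" using True cxD(4)[OF E] by (intro Max_ge) auto
    hence "M n \<le> m" unfolding m_def by simp
    thus ?thesis unfolding a_n using M by blast
  next
    case False
    hence "a n = 0" using mhomsD(1)[OF ah, of n] by (auto dest: hom_to_zero)
    thus ?thesis by (intro bexI[of _ 0]) auto
  qed
  then obtain x y where x: "!!n. x n \<in> arr (ob E n) (ob E n)" and y: "!!n. y n \<in> arr (ob E n) (ob E n)"
    and ax: "!!n. a n = a n * a n * x n" and ya: "!!n. a n = y n * a n * a n" by metis
  define p b where "p = a * x" and "b = y * a * x"
  have nat: "p (n + 1) * df E n = df E n * p n" "b (n + 1) * df E n = df E n * b n" for n
    using strongly_regular_natural[OF ax ya ax ya mhomsD(2)[OF ah]] unfolding p_def b_def by simp_all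
  have p: "p \<in> mhoms E E" and b: "b \<in> mhoms E E"
    using nat x y mhomsD(1)[OF ah] by (auto simp: p_def b_def intro!: mhomsI hom_mult)
  have efn: "pw (ob E) f (Suc n) = pw (ob E) f n * f" for n
    using e fh by (simp add: fun_eq_iff pw_fun pw_Suc2)
  hence fa: "f * a = a * f" unfolding a_def by (metis pw_Suc)
  have ax': "a = a * a * x" and ya': "a = y * a * a" using ax ya by (auto simp: fun_eq_iff)
  note r = strongly_regular[OF ax' ya', folded p_def b_def]
  have fp: "f * p = p * f" and fb: "f * b = b * f"
    using strongly_regular_natural[OF ax' ya' ax' ya' fa] unfolding p_def b_def by (simp_all add: mult.assoc)
  define k where "k = m - 1"
  have mk: "m = Suc k" unfolding k_def m_def by simp
  define g where "g = b * pw (ob E) f k"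
  have gh: "g \<in> mhoms E E" unfolding g_def by (rule mhoms_mult[OF pw_mhoms[OF E f] b])
  have ba: "b * a = p" using r(5) unfolding b_def by (simp add: mult.assoc)
  have "g * f = b * a" unfolding g_def a_def mk efn by (simp add: mult.assoc)
  hence gf: "g * f = p" using ba by simp
  have "f * g = b * (f * pw (ob E) f k)" unfolding g_def using fb by (metis mult.assoc)
  hence fg: "f * g = p" unfolding pw_Suc[symmetric] mk[symmetric] a_def[symmetric] ba .
  \<comment> \<open>The geometric series: its product with \<open>ob E - f\<close> is
    \<open>ob E - a\<close>, and \<open>a\<close> vanishes on the complement of
    \<open>p\<close>.\<close>
  define q where "q = (\<Sum>i<m. pw (ob E) f i)"
  have qh: "q \<in> mhoms E E" unfolding q_def by (intro mhoms_sum pw_mhoms E f)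
  have "q * f = (\<Sum>i<m. pw (ob E) f (Suc i))" unfolding q_def sum_distrib_right efn ..
  hence qf: "q * (ob E - f) = ob E - a"
    using sum.lessThan_Suc_shift[of "pw (ob E) f" m] unfolding a_def
    by (simp add: algebra_simps mhoms_id_right[OF qh]) (simp add: q_def algebra_simps)
  have "f * q = (\<Sum>i<m. pw (ob E) f (Suc i))" unfolding q_def sum_distrib_left pw_Suc ..
  hence fq: "(ob E - f) * q = ob E - a"
    using sum.lessThan_Suc_shift[of "pw (ob E) f" m] unfolding a_def
    by (simp add: algebra_simps mhoms_id_left[OF qh]) (simp add: q_def algebra_simps)
  have ep: "ob E * ob E = ob E" "ob E * p = p" "p * ob E = p" "ob E * f = f" "f * ob E = f" "a * ob E = a" "ob E * a = a"
    using mhoms_id_left[OF p] mhoms_id_right[OF p] mhoms_id_left[OF f] mhoms_id_right[OF f] e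
      mhoms_id_left[OF ah] mhoms_id_right[OF ah] by (auto simp: fun_eq_iff)
  have comm: "(ob E - f) * (ob E - p) = (ob E - p) * (ob E - f)" using fp ep by (simp add: algebra_simps)
  have an: "(ob E - a) * (ob E - p) = ob E - p" "(ob E - p) * (ob E - a) = ob E - p"
    using r(3,4) ep unfolding p_def by (simp_all add: algebra_simps)
  show ?thesis
  proof
    show "p \<in> mhoms E E" "g \<in> mhoms E E" "f * p = p * f" "g * f = p" "f * g = p" by fact+
    show pp: "p * p = p" unfolding p_def by (rule strongly_regular(2)[OF ax' ya'])
    let ?c = "(ob E - p) * q * (ob E - p)"
    show "?c \<in> mhoms E E" by (intro mhoms_mult[of _ E E] mhoms_diff p mhoms_id[OF E] qh)
    have pq: "(ob E - p) * (ob E - p) = ob E - p" using pp ep by (simp add: algebra_simps)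
    have "?c * (ob E - f) = (ob E - p) * (q * (ob E - f)) * (ob E - p)" using comm by (metis mult.assoc)
    also have "\<dots> = ob E - p" unfolding qf using an pq by (simp add: mult.assoc)
    finally show "?c * (ob E - f) = ob E - p" .
    have "(ob E - f) * ?c = (ob E - p) * ((ob E - f) * q) * (ob E - p)" using comm by (metis mult.assoc)
    also have "\<dots> = ob E - p" unfolding fq using an pq by (simp add: mult.assoc)
    finally show "(ob E - f) * ?c = ob E - p" .
  qed
qed

end

section \<open>Splitting of idempotents and direct sums of complexes\<close>

definition sub_cx :: "'r::ring mcx => (int => 'r) => 'r mcx" where
  "sub_cx E p = \<lparr>ob = p, df = (%n. df E n * p n)\<rparr>"

lemma sub_cx_sel [simp]: "ob (sub_cx E p) = p" "df (sub_cx E p) n = df E n * p n"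
  unfolding sub_cx_def by auto

text \<open>In the idempotent completion the idempotent \<open>p\<close> is itself the object that
  it splits off, and it serves both as inclusion and as projection.\<close>

lemma sub_cx:
  assumes E: "cx E" and p: "p \<in> mhoms E E" and pp: "p * p = p"
  shows "cx (sub_cx E p)" "p \<in> mhoms (sub_cx E p) E" "p \<in> mhoms E (sub_cx E p)"
proof -
  have ppn: "p n * p n = p n" for n using pp by (metis times_fun_apply)
  have c: "df E n * p n = p (n + 1) * df E n" for n using mhomsD(2)[OF p] .
  have c2: "p (n + 1) * (df E n * p n) = df E n * p n" for n using c ppn by (metis mult.assoc)
  show "cx (sub_cx E p)"
    unfolding cx_def
  proof (intro conjI allI)
    fix n
    show "ob (sub_cx E p) n * ob (sub_cx E p) n = ob (sub_cx E p) n" by (simp add: ppn)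
    show "df (sub_cx E p) n \<in> arr (ob (sub_cx E p) n) (ob (sub_cx E p) (n + 1))"
      using c2 ppn by (auto intro!: arrI simp: mult.assoc)
    have "df E (n + 1) * p (n + 1) * (df E n * p n) = df E (n + 1) * df E n * p n"
      using c2 by (simp add: mult.assoc)
    thus "df (sub_cx E p) (n + 1) * df (sub_cx E p) n = 0" using cxD(3)[OF E] by simp
  next
    have "{n. p n ~= 0} \<subseteq> {n. ob E n ~= 0}" using mhomsD(3)[OF p] by (metis (mono_tags, lifting) Collect_mono mult_zero_left)
    thus "finite {n. ob (sub_cx E p) n ~= 0}" using cxD(4)[OF E] by (simp add: finite_subset)
  qed
  show "p \<in> mhoms (sub_cx E p) E" "p \<in> mhoms E (sub_cx E p)"
    using mhomsD(3,4)[OF p] c c2 ppn by (auto intro!: mhomsI arrI simp: mult.assoc)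
qed

lemma mretract_sub_cx:
  assumes "cx E" "p \<in> mhoms E E" "p * p = p" shows "mretract (sub_cx E p) E"
  unfolding mretract_def using sub_cx[OF assms] assms(3) by (intro exI[of _ p] exI[of _ p]) (simp add: heq_refl)

lemma mzero_sub_cx:
  assumes "cx E" "p \<in> mhoms E E" "p * p = p" shows "mzero (sub_cx E p) \<longleftrightarrow> p \<in> nulls E E"
proof
  note s = sub_cx[OF assms]
  assume "mzero (sub_cx E p)"
  hence "p \<in> nulls (sub_cx E p) (sub_cx E p)" unfolding mzero_def by simp
  hence "p * p * p \<in> nulls E E" using nulls_mult_left nulls_mult_right s(2,3) by blast
  thus "p \<in> nulls E E" using assms(3) by simp
next
  note s = sub_cx[OF assms]
  assume "p \<in> nulls E E"
  hence "p * p * p \<in> nulls (sub_cx E p) (sub_cx E p)" using nulls_mult_left nulls_mult_right s(2,3) by blast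
  thus "mzero (sub_cx E p)" unfolding mzero_def using assms(3) by simp
qed

definition mbiprod :: "'r::ring mcx => 'r mcx => 'r mcx => bool" where
  "mbiprod E X Y \<longleftrightarrow> (\<exists>u v u' v'. u \<in> mhoms X E \<and> v \<in> mhoms E X \<and> u' \<in> mhoms Y E \<and> v' \<in> mhoms E Y \<and>
     heq X X (v * u) (ob X) \<and> heq Y Y (v' * u') (ob Y) \<and> heq Y X (v * u') 0 \<and> heq X Y (v' * u) 0 \<and>
     heq E E (u * v + u' * v') (ob E))"

lemma mbiprod_sub_cx:
  assumes E: "cx E" and p: "p \<in> mhoms E E" and pp: "p * p = p"
  shows "ob E - p \<in> mhoms E E" "(ob E - p) * (ob E - p) = ob E - p"
    "mbiprod E (sub_cx E p) (sub_cx E (ob E - p))"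
proof -
  show q: "ob E - p \<in> mhoms E E" by (intro mhoms_diff mhoms_id E p)
  have 1: "ob E * ob E = ob E" "ob E * p = p" "p * ob E = p"
    using mhoms_id_left[OF p] mhoms_id_right[OF p] cxD(1)[OF E] by (auto simp: fun_eq_iff)
  show qq: "(ob E - p) * (ob E - p) = ob E - p" using 1 pp by (simp add: algebra_simps)
  have "p * (ob E - p) = 0" "(ob E - p) * p = 0" using 1 pp by (auto simp: algebra_simps)
  thus "mbiprod E (sub_cx E p) (sub_cx E (ob E - p))"
    unfolding mbiprod_def using sub_cx[OF E p pp] sub_cx[OF E q qq] pp qq
    by (intro exI[of _ p] exI[of _ "ob E - p"]) (auto simp: heq_refl)
qed

lemma mbiprod_retracts: "mbiprod E X Y ==> mretract X E \<and> mretract Y E"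
  unfolding mbiprod_def mretract_def by blast

context hom_finite_ring
begin

definition bsum :: "'r mcx => 'r mcx => 'r mcx" where
  "bsum E F = \<lparr>ob = (%n. bs (ob E n) (ob F n)),
     df = (%n. i1 (ob E (n + 1)) (ob F (n + 1)) * df E n * p1 (ob E n) (ob F n) +
               i2 (ob E (n + 1)) (ob F (n + 1)) * df F n * p2 (ob E n) (ob F n))\<rparr>"

definition bi1 :: "'r mcx => 'r mcx => int => 'r" where "bi1 E F = (%n. i1 (ob E n) (ob F n))"
definition bi2 :: "'r mcx => 'r mcx => int => 'r" where "bi2 E F = (%n. i2 (ob E n) (ob F n))"
definition bp1 :: "'r mcx => 'r mcx => int => 'r" where "bp1 E F = (%n. p1 (ob E n) (ob F n))"
definition bp2 :: "'r mcx => 'r mcx => int => 'r" where "bp2 E F = (%n. p2 (ob E n) (ob F n))"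

lemma biprodD:
  assumes "e * e = e" "f * f = f"
  shows "bs e f * bs e f = bs e f"
    "i1 e f \<in> arr e (bs e f)" "i2 e f \<in> arr f (bs e f)" "p1 e f \<in> arr (bs e f) e" "p2 e f \<in> arr (bs e f) f"
    "p1 e f * i1 e f = e" "p2 e f * i2 e f = f" "p1 e f * i2 e f = 0" "p2 e f * i1 e f = 0"
    "i1 e f * p1 e f + i2 e f * p2 e f = bs e f"
  using biprod[OF assms] by auto

lemma bs_zero: "bs 0 0 = 0"
  using biprodD(2,3,10)[of 0 0] by (auto dest!: hom_from_zero)

lemma zero_assocI: "a * b = 0 ==> a * (b * c) = (0 :: 'r)"
  by (simp add: mult.assoc[symmetric])

lemma assocI: "a * b = d ==> a * (b * c) = d * (c :: 'r)"
  by (simp add: mult.assoc[symmetric])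

lemma bsum_cx:
  assumes E: "cx E" and F: "cx F"
  shows "cx (bsum E F)" "bi1 E F \<in> mhoms E (bsum E F)" "bi2 E F \<in> mhoms F (bsum E F)"
    "bp1 E F \<in> mhoms (bsum E F) E" "bp2 E F \<in> mhoms (bsum E F) F"
    "bp1 E F * bi1 E F = ob E" "bp2 E F * bi2 E F = ob F" "bp1 E F * bi2 E F = 0" "bp2 E F * bi1 E F = 0"
    "bi1 E F * bp1 E F + bi2 E F * bp2 E F = ob (bsum E F)"
proof -
  note e = cxD(1)[OF E] and f = cxD(1)[OF F]
  note b = biprodD[OF e f]
  note b' = assocI[OF b(6)] assocI[OF b(7)] zero_assocI[OF b(8)] zero_assocI[OF b(9)]
  note h = arrD[OF b(2)] arrD[OF b(3)] arrD[OF b(4)] arrD[OF b(5)]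
  note h' = h h[THEN assocI]
  note d = cxD(7,8)[OF E] cxD(7,8)[OF F]
  note d' = d d[THEN assocI]
  note dd = cxD(3)[OF E] cxD(3)[OF F] cxD(3)[OF E, THEN zero_assocI] cxD(3)[OF F, THEN zero_assocI]
  show "cx (bsum E F)"
    unfolding cx_def
  proof (intro conjI allI)
    fix n
    show "ob (bsum E F) n * ob (bsum E F) n = ob (bsum E F) n" by (simp add: bsum_def b)
    show "df (bsum E F) n \<in> arr (ob (bsum E F) n) (ob (bsum E F) (n + 1))"
      by (rule arrI) (simp_all add: bsum_def distrib_left distrib_right mult.assoc h' d')
    show "df (bsum E F) (n + 1) * df (bsum E F) n = 0"
      by (simp add: bsum_def distrib_left distrib_right mult.assoc b b' d' dd)
  next
    have "{n. bs (ob E n) (ob F n) ~= 0} \<subseteq> {n. ob E n ~= 0} \<union> {n. ob F n ~= 0}"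
      using bs_zero by auto
    thus "finite {n. ob (bsum E F) n ~= 0}"
      using cxD(4)[OF E] cxD(4)[OF F] by (simp add: bsum_def finite_subset)
  qed
  show "bi1 E F \<in> mhoms E (bsum E F)" "bi2 E F \<in> mhoms F (bsum E F)"
    "bp1 E F \<in> mhoms (bsum E F) E" "bp2 E F \<in> mhoms (bsum E F) F"
    by (rule mhomsI; simp add: bsum_def bi1_def bi2_def bp1_def bp2_def distrib_left distrib_right mult.assoc b b' d')+
  show "bp1 E F * bi1 E F = ob E" "bp2 E F * bi2 E F = ob F" "bp1 E F * bi2 E F = 0" "bp2 E F * bi1 E F = 0"
    "bi1 E F * bp1 E F + bi2 E F * bp2 E F = ob (bsum E F)"
    by (auto simp: fun_eq_iff bsum_def bi1_def bi2_def bp1_def bp2_def b)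
qed

lemma mbiprod_bsum: "cx E ==> cx F ==> mbiprod (bsum E F) E F"
  unfolding mbiprod_def using bsum_cx[of E F]
  by (intro exI[of _ "bi1 E F"] exI[of _ "bi2 E F"] exI[of _ "bp1 E F"] exI[of _ "bp2 E F"]) (simp add: heq_refl)

lemma bsum_universal:
  assumes "cx X" "cx Y" "u \<in> mhoms X E" "u' \<in> mhoms Y E" "v \<in> mhoms E X" "v' \<in> mhoms E Y"
  defines "f \<equiv> u * bp1 X Y + u' * bp2 X Y" and "g \<equiv> bi1 X Y * v + bi2 X Y * v'"
  shows "f \<in> mhoms (bsum X Y) E" "g \<in> mhoms E (bsum X Y)" "f * g = u * v + u' * v'"
    "g * f = bi1 X Y * (v * u) * bp1 X Y + bi1 X Y * (v * u') * bp2 X Y +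
       bi2 X Y * (v' * u) * bp1 X Y + bi2 X Y * (v' * u') * bp2 X Y"
proof -
  note b = bsum_cx[OF assms(1,2)]
  show "f \<in> mhoms (bsum X Y) E" "g \<in> mhoms E (bsum X Y)" unfolding f_def g_def
    using b assms by (auto intro!: mhoms_add mhoms_mult)
  have "f * g = u * (bp1 X Y * bi1 X Y) * v + u * (bp1 X Y * bi2 X Y) * v' +
      u' * (bp2 X Y * bi1 X Y) * v + u' * (bp2 X Y * bi2 X Y) * v'"
    unfolding f_def g_def by (simp add: algebra_simps)
  thus "f * g = u * v + u' * v'" unfolding b using assms by (simp add: mhoms_id_right)
  show "g * f = bi1 X Y * (v * u) * bp1 X Y + bi1 X Y * (v * u') * bp2 X Y +
       bi2 X Y * (v' * u) * bp1 X Y + bi2 X Y * (v' * u') * bp2 X Y"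
    unfolding f_def g_def by (simp add: algebra_simps)
qed

lemma mbiprod_meq:
  assumes X: "cx X" and Y: "cx Y" and "mbiprod E X Y"
  shows "meq E (bsum X Y)"
proof -
  obtain u v u' v' where h: "u \<in> mhoms X E" "v \<in> mhoms E X" "u' \<in> mhoms Y E" "v' \<in> mhoms E Y"
     "heq X X (v * u) (ob X)" "heq Y Y (v' * u') (ob Y)" "heq Y X (v * u') 0" "heq X Y (v' * u) 0"
     "heq E E (u * v + u' * v') (ob E)" using assms(3) unfolding mbiprod_def by blast
  note b = bsum_cx[OF X Y] and un = bsum_universal[OF X Y h(1,3,2,4)]
  let ?S = "bsum X Y"
  have "heq ?S ?S (bi1 X Y * (v * u) * bp1 X Y + bi1 X Y * (v * u') * bp2 X Y +
       bi2 X Y * (v' * u) * bp1 X Y + bi2 X Y * (v' * u') * bp2 X Y)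
     (bi1 X Y * ob X * bp1 X Y + bi1 X Y * 0 * bp2 X Y + bi2 X Y * 0 * bp1 X Y + bi2 X Y * ob Y * bp2 X Y)"
    by (intro heq_add; rule heq_right, rule heq_left, rule h, rule b, rule b)
  also have "\<dots> = ob ?S" using b(10) mhoms_id_right[OF b(2)] mhoms_id_right[OF b(3)] by simp
  finally show ?thesis unfolding meq_def mequiv_def using un h(9)
    by (intro exI[of _ "bi1 X Y * v + bi2 X Y * v'"] exI[of _ "u * bp1 X Y + u' * bp2 X Y"]) simp
qed

lemma meq_bsum_mbiprod:
  assumes X: "cx X" and Y: "cx Y" and "meq E (bsum X Y)"
  shows "mbiprod E X Y"
proof -
  let ?S = "bsum X Y"
  obtain f g where fg: "f \<in> mhoms E ?S" "g \<in> mhoms ?S E" "heq E E (g * f) (ob E)" "heq ?S ?S (f * g) (ob ?S)"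
    using assms(3) unfolding meq_def mequiv_def by blast
  note b = bsum_cx[OF X Y]
  have c: "heq A B (p * f * (g * i)) (p * i)" if "p \<in> mhoms ?S B" "i \<in> mhoms A ?S" for p i A B
  proof -
    have "heq A B (p * (f * g) * i) (p * ob ?S * i)"
      by (intro heq_right[where F = ?S] heq_left[where F = ?S] fg that)
    thus ?thesis using that by (simp add: mhoms_id_right mult.assoc)
  qed
  have "heq E E (g * i * (p * f) + g * i' * (p' * f)) (ob E)" if "i * p + i' * p' = ob ?S" for i p i' p'
  proof -
    have "g * i * (p * f) + g * i' * (p' * f) = g * (i * p + i' * p') * f" by (simp add: algebra_simps)
    also have "\<dots> = g * f" unfolding that mhoms_id_right[OF fg(2)] ..
    finally show ?thesis using fg(3) by simp
  qed
  note s = this[OF b(10)]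
  show ?thesis unfolding mbiprod_def
    by (rule exI[of _ "g * bi1 X Y"], rule exI[of _ "bp1 X Y * f"], rule exI[of _ "g * bi2 X Y"], rule exI[of _ "bp2 X Y * f"])
      (use b(2-5) fg c[OF b(4,2)] c[OF b(5,3)] c[OF b(4,3)] c[OF b(5,2)] s in \<open>auto simp: b(6-9) intro: mhoms_mult\<close>)
qed

text \<open>The Fitting idempotent \<open>p\<close> of \<open>f\<close> is the lift. Multiplying the
  null homotopic map \<open>f * f - f\<close> by the partial inverses \<open>g\<close> and
  \<open>c\<close> yields \<open>p * f - p\<close> and \<open>p * f - f\<close>, whose difference is
  \<open>f - p\<close>.\<close>

lemma lift_idempotent:
  fixes E :: "'r mcx"
  assumes E: "cx E" and f: "f \<in> mhoms E E" "heq E E (f * f) f"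
  obtains p where "p \<in> mhoms E E" "p * p = p" "heq E E f p"
proof -
  obtain p g c where p: "p \<in> mhoms E E" "g \<in> mhoms E E" "c \<in> mhoms E E" "p * p = p" "f * p = p * f"
    "g * f = p" "f * g = p" "c * (ob E - f) = ob E - p" "(ob E - f) * c = ob E - p"
    using fitting[OF E f(1)] .
  have of: "ob E * f = f" using f by (simp add: mhoms_id_left)
  have n: "f * f - f \<in> nulls E E" using f(2) unfolding heq_def .
  have "g * (f * f - f) \<in> nulls E E" using n p(2) by (rule nulls_mult_left)
  moreover have "g * (f * f - f) = p * f - p" using p(6) by (simp add: algebra_simps) (metis mult.assoc)
  moreover have "c * (f * f - f) \<in> nulls E E" using n p(3) by (rule nulls_mult_left)
  moreover have "c * (f * f - f) = - ((c * (ob E - f)) * f)" using of by (simp add: algebra_simps)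
  moreover have "\<dots> = p * f - f" unfolding p(8) using of by (simp add: algebra_simps)
  ultimately have "(p * f - p) - (p * f - f) \<in> nulls E E" using nulls_diff by metis
  hence "heq E E f p" unfolding heq_def by simp
  thus ?thesis using that p by blast
qed

section \<open>Indecomposable complexes and the Krull-Schmidt property\<close>

definition mindec :: "'r mcx => bool" where
  "mindec E \<longleftrightarrow> cx E \<and> \<not> mzero E \<and> (\<forall>F G. cx F --> cx G --> meq E (bsum F G) --> mzero F \<or> mzero G)"

lemma mindecD: "mindec E ==> cx E" "mindec E ==> \<not> mzero E"
  unfolding mindec_def by auto

lemma mindec_meq: "mindec E ==> cx F ==> meq E F ==> mindec F"
  unfolding mindec_def using meq_mzero meq_trans by blast

text \<open>Fitting's lemma splits \<open>E\<close> along the idempotent \<open>p\<close> belonging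
  to \<open>f\<close>, and one of the two summands is contractible. If it is the image of
  \<open>p\<close>, then \<open>ob E - f\<close> is invertible; otherwise \<open>f\<close> is. So
  the endomorphism ring is local.\<close>

lemma mindec_local:
  assumes E: "mindec E" and f: "f \<in> mhoms E E"
  shows "munit E f \<or> munit E (ob E - f)"
proof -
  have cE: "cx E" using E by (rule mindecD)
  obtain p g c where p: "p \<in> mhoms E E" "g \<in> mhoms E E" "c \<in> mhoms E E" "p * p = p" "f * p = p * f"
    "g * f = p" "f * g = p" "c * (ob E - f) = ob E - p" "(ob E - f) * c = ob E - p"
    using fitting[OF cE f] .
  note s = mbiprod_sub_cx[OF cE p(1,4)]
  have "meq E (bsum (sub_cx E p) (sub_cx E (ob E - p)))"
    by (intro mbiprod_meq s sub_cx cE p)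
  hence "mzero (sub_cx E p) \<or> mzero (sub_cx E (ob E - p))"
    using E sub_cx(1)[OF cE p(1,4)] sub_cx(1)[OF cE s(1,2)] unfolding mindec_def by blast
  hence "p \<in> nulls E E \<or> ob E - p \<in> nulls E E" using mzero_sub_cx[OF cE p(1,4)] mzero_sub_cx[OF cE s(1,2)] by blast
  thus ?thesis
  proof
    assume "p \<in> nulls E E"
    hence "heq E E (ob E - p) (ob E)" unfolding heq_def using nulls_uminus by fastforce
    hence "munit E (ob E - f)" unfolding munit_def using p(3) mhoms_diff[OF mhoms_id[OF cE] f]
      by (intro conjI bexI[of _ c]) (simp_all only: p(8,9))
    thus ?thesis ..
  next
    assume "ob E - p \<in> nulls E E"
    hence "heq E E (ob E) p" unfolding heq_def .
    hence "munit E f" unfolding munit_def using p(2) f heq_sym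
      by (intro conjI bexI[of _ g]) (simp_all only: p(6,7))
    thus ?thesis ..
  qed
qed

text \<open>By locality \<open>f * w\<close> or \<open>ob X - f * w\<close> is a unit. The second
  one is annihilated by \<open>f\<close> on the right, so if it were a unit, \<open>f\<close> would
  be null homotopic and \<open>X\<close> would be zero.\<close>

lemma mindec_left_inverse:
  assumes X: "mindec X" and f: "f \<in> mhoms X X" "w \<in> mhoms X X" "heq X X (w * f) (ob X)"
  shows "munit X f"
  using mindec_local[OF X mhoms_mult[OF f(2,1)]]
proof
  assume "munit X (f * w)"
  then obtain k where k: "k \<in> mhoms X X" "heq X X (f * w * k) (ob X)" unfolding munit_def by blast
  show ?thesis using f(1,2) mhoms_mult[OF k(1) f(2)] f(3) by (rule munitI) (use k in \<open>simp add: mult.assoc\<close>)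
next
  assume u: "munit X (ob X - f * w)"
  then obtain k where k: "k \<in> mhoms X X" "heq X X (k * (ob X - f * w)) (ob X)" unfolding munit_def by blast
  have "heq X X (f * (w * f)) (f * ob X)" using f by (intro heq_left[where F = X])
  hence "f * (w * f) - f \<in> nulls X X" using f unfolding heq_def by (simp add: mhoms_id_right)
  hence "k * (f * (w * f) - f) \<in> nulls X X" using k(1) by (rule nulls_mult_left)
  moreover have "k * (f * (w * f) - f) = - (k * (ob X - f * w) * f)"
    using f by (simp add: algebra_simps mhoms_id_left)
  ultimately have "heq X X (k * (ob X - f * w) * f) 0" unfolding heq_zero using nulls_uminus by fastforce
  moreover have "heq X X (k * (ob X - f * w) * f) (ob X * f)" using k f by (intro heq_right[where F = X])
  ultimately have "f \<in> nulls X X" using f by (metis heq_sym heq_trans heq_zero mhoms_id_left)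
  hence "w * f \<in> nulls X X" using f by (intro nulls_mult_left)
  hence "mzero X" unfolding mzero_def using f(3) by (metis heq_sym heq_trans heq_zero)
  thus ?thesis using mindecD(2)[OF X] by simp
qed

lemma munit_factor:
  assumes X: "mindec X" and f: "f \<in> mhoms X X" "u \<in> mhoms X X" "munit X (u * f)"
  shows "munit X f"
proof -
  obtain k where "k \<in> mhoms X X" "heq X X (k * (u * f)) (ob X)" using f unfolding munit_def by blast
  thus ?thesis using f by (intro mindec_left_inverse[OF X, of f "k * u"]) (auto simp: mult.assoc intro: mhoms_mult)
qed

text \<open>After multiplication with an inverse \<open>u\<close> of the sum, \<open>u * g\<close>
  is homotopic to \<open>ob X - u * f\<close>, and locality applies to \<open>u * f\<close>.\<close>

lemma munit_add:
  assumes X: "mindec X" and f: "f \<in> mhoms X X" "g \<in> mhoms X X" "munit X (f + g)"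
  shows "munit X f \<or> munit X g"
proof -
  obtain u where u: "u \<in> mhoms X X" "heq X X (u * (f + g)) (ob X)" using f unfolding munit_def by blast
  have uf: "u * f \<in> mhoms X X" and ug: "u * g \<in> mhoms X X" using u f by (auto intro: mhoms_mult)
  have "heq X X (ob X - u * f) (u * (f + g) - u * f)" using heq_sym[OF u(2)] heq_refl by (rule heq_diff)
  hence e: "heq X X (ob X - u * f) (u * g)" by (simp add: algebra_simps)
  show ?thesis using mindec_local[OF X uf] munit_factor[OF X f(1) u(1)] munit_factor[OF X f(2) u(1)]
    munit_heq[OF _ e ug] by blast
qed

lemma munit_sum:
  assumes X: "mindec X" and "!!i. i \<in> I ==> f i \<in> mhoms X X" "munit X (sum f I)"
  shows "\<exists>i\<in>I. munit X (f i)"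
proof -
  have z: "\<not> munit X 0" using munit_mzero_iff[OF mindecD(1)[OF X] nulls_zero] mindecD(2)[OF X] by blast
  show ?thesis using assms(2,3)
  proof (induction I rule: infinite_finite_induct)
    case (insert i I)
    have "munit X (f i + sum f I)" using insert.prems(2) unfolding sum.insert[OF insert.hyps(1,2)] .
    moreover have "f i \<in> mhoms X X" "sum f I \<in> mhoms X X" using insert.prems(1) by (auto intro: mhoms_sum)
    ultimately show ?case using munit_add[OF X, of "f i" "sum f I"] insert by blast
  qed (use z in auto)
qed

text \<open>With a left inverse \<open>v\<close> of \<open>a\<close>, the product
  \<open>a * v\<close> is idempotent up to homotopy in a local ring, hence homotopic to the identity
  or to zero; in the second case \<open>X\<close> would be zero.\<close>

lemma mindec_retract_meq:
  assumes X: "mindec X" and Y: "mindec Y" and a: "a \<in> mhoms X Y" "b \<in> mhoms Y X" "munit X (b * a)"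
  shows "meq X Y"
proof -
  obtain w where w: "w \<in> mhoms X X" "heq X X (w * (b * a)) (ob X)" using a unfolding munit_def by blast
  define v where "v = w * b"
  have v: "v \<in> mhoms Y X" "heq X X (v * a) (ob X)" unfolding v_def using w a by (auto simp: mult.assoc intro: mhoms_mult)
  have av: "a * v \<in> mhoms Y Y" using a v by (auto intro: mhoms_mult)
  have "heq Y Y (a * (v * a) * v) (a * ob X * v)"
    by (intro heq_right[where F = X] heq_left[where F = X] a v)
  hence idem: "heq Y Y (a * v * (a * v)) (a * v)" using a by (simp add: mult.assoc mhoms_id_right[symmetric])
      (metis mhoms_id_right mult.assoc)
  have cY: "cx Y" using Y by (rule mindecD)
  from mindec_local[OF Y av] show ?thesis
  proof
    assume "munit Y (a * v)"
    then obtain k where k: "k \<in> mhoms Y Y" "heq Y Y (k * (a * v)) (ob Y)" unfolding munit_def by blast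
    have "heq Y Y (k * (a * v * (a * v))) (k * (a * v))" using idem k by (intro heq_left[where F = Y])
    hence "heq Y Y (k * (a * v) * (a * v)) (ob Y)" using k heq_trans by (auto simp: mult.assoc)
    moreover have "heq Y Y (k * (a * v) * (a * v)) (ob Y * (a * v))" using k av by (intro heq_right[where F = Y])
    ultimately have "heq Y Y (a * v) (ob Y)" using av by (metis heq_sym heq_trans mhoms_id_left)
    thus ?thesis unfolding meq_def mequiv_def using a v by blast
  next
    assume "munit Y (ob Y - a * v)"
    then obtain k where k: "k \<in> mhoms Y Y" "heq Y Y (k * (ob Y - a * v)) (ob Y)" unfolding munit_def by blast
    have "a * v - a * v * (a * v) \<in> nulls Y Y" using heq_sym[OF idem] unfolding heq_def .
    hence "k * (a * v - a * v * (a * v)) \<in> nulls Y Y" using k by (intro nulls_mult_left)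
    moreover have "k * (a * v - a * v * (a * v)) = k * (ob Y - a * v) * (a * v)"
    proof -
      have "(ob Y - a * v) * (a * v) = ob Y * (a * v) - a * v * (a * v)" by (simp add: algebra_simps)
      thus ?thesis unfolding mhoms_id_left[OF av] by (simp add: mult.assoc)
    qed
    moreover have "heq Y Y (k * (ob Y - a * v) * (a * v)) (ob Y * (a * v))" using k av by (intro heq_right[where F = Y])
    ultimately have "a * v \<in> nulls Y Y" using av by (metis heq_sym heq_trans heq_zero mhoms_id_left)
    hence "v * (a * v) * a \<in> nulls X X" using a v nulls_mult_left nulls_mult_right by blast
    moreover have "heq X X (v * a * (v * a)) (ob X * (v * a))" using a v by (intro heq_right[where F = X] mhoms_mult)
    moreover have "ob X * (v * a) = v * a" using a v by (intro mhoms_id_left mhoms_mult)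
    ultimately have "mzero X" unfolding mzero_def using v(2) by (metis heq_sym heq_trans heq_zero mult.assoc)
    thus ?thesis using mindecD(2)[OF X] by simp
  qed
qed

text \<open>The measure for decomposing into indecomposables. It is not invariant under homotopy
  equivalence, so a decomposition must be realized by strict idempotents before it counts as
  smaller.\<close>

definition msize :: "'r mcx => nat" where
  "msize E = (\<Sum>n | ob E n ~= 0. dim (arr (ob E n) (ob E n)))"

lemma msize_sub_cx:
  assumes E: "cx E" and p: "p \<in> mhoms E E" "p * p = p" "p ~= ob E"
  shows "msize (sub_cx E p) < msize E"
proof -
  let ?S = "{n. ob E n ~= 0}"
  note e = cxD(1)[OF E]
  have pp: "p n * p n = p n" for n using p(2) by (metis times_fun_apply)
  have sub: "arr (p n) (p n) \<subseteq> arr (ob E n) (ob E n)" for n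
    using mhomsD(3,4)[OF p(1)] by (auto simp: arr_def) (metis mult.assoc)+
  have fd: "fin_dim (arr (ob E n) (ob E n))" for n using e by (intro fin_dim_hom)
  have S: "{n. p n ~= 0} \<subseteq> ?S" using mhomsD(3)[OF p(1)] by (metis (mono_tags, lifting) Collect_mono mult_zero_left)
  have "msize (sub_cx E p) \<le> (\<Sum>n\<in>?S. dim (arr (p n) (p n)))"
    unfolding msize_def using S cxD(4)[OF E] by (simp add: sum_mono2)
  also have "\<dots> < (\<Sum>n\<in>?S. dim (arr (ob E n) (ob E n)))"
  proof (rule sum_strict_mono_ex1)
    show "finite ?S" by (rule cxD[OF E])
    have le: "dim (arr (p n) (p n)) \<le> dim (arr (ob E n) (ob E n))" for n
      using sub[of n] span_superset[of "arr (ob E n) (ob E n)"] by (intro dim_mono_fin_dim fd) blast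
    show "\<forall>n\<in>?S. dim (arr (p n) (p n)) \<le> dim (arr (ob E n) (ob E n))" using le by blast
    obtain m where m: "p m ~= ob E m" using p(3) by blast
    have "arr (p m) (p m) ~= arr (ob E m) (ob E m)"
    proof
      assume "arr (p m) (p m) = arr (ob E m) (ob E m)"
      hence "ob E m \<in> arr (p m) (p m)" using hom_id[OF e] by blast
      hence "p m * ob E m = ob E m" by (rule arrD)
      thus False using mhomsD(4)[OF p(1)] m by metis
    qed
    hence "dim (arr (p m) (p m)) ~= dim (arr (ob E m) (ob E m))"
      using dim_eq_imp_eq[OF subspace_hom sub fd] by blast
    hence "dim (arr (p m) (p m)) < dim (arr (ob E m) (ob E m))" using le[of m] by simp
    moreover have "m \<in> ?S" using m mhomsD(3)[OF p(1), of m] by auto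
    ultimately show "\<exists>n\<in>?S. dim (arr (p n) (p n)) < dim (arr (ob E n) (ob E n))" by blast
  qed
  finally show ?thesis unfolding msize_def by simp
qed

text \<open>A decomposition up to homotopy is replaced by the images of a strict idempotent
  \<open>p\<close> and of \<open>ob F - p\<close>, which have smaller \<open>msize\<close>. This
  also keeps every piece inside the degrees of \<open>E\<close>; the indecomposable case records
  that fact, so that summands of a two-term complex are two-term.\<close>

lemma decompose_induct [consumes 1, case_names zero mindec bsum]:
  fixes E :: "'r mcx"
  assumes "cx E"
    and zero: "!!F. cx F ==> mzero F ==> Q F"
    and indec: "!!F. mindec F ==> mretract F E ==> (!!n. ob E n = 0 ==> ob F n = 0) ==> Q F"
    and bsum: "!!F G H. cx F ==> cx G ==> cx H ==> meq F (bsum G H) ==> Q G ==> Q H ==> Q F"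
  shows "Q E"
proof -
  have "Q F" if "cx F" "mretract F E" "!!n. ob E n = 0 ==> ob F n = 0" for F
    using that
  proof (induction "msize F" arbitrary: F rule: less_induct)
    case less
    show ?case
    proof (cases "mzero F \<or> mindec F")
      case True
      thus ?thesis using zero indec less.prems by blast
    next
      case False
      then obtain G H where GH: "cx G" "cx H" "meq F (bsum G H)" "\<not> mzero G" "\<not> mzero H"
        using less.prems unfolding mindec_def by blast
      then obtain u v u' v' where h: "u \<in> mhoms G F" "v \<in> mhoms F G" "u' \<in> mhoms H F" "v' \<in> mhoms F H"
         "heq G G (v * u) (ob G)" "heq H H (v' * u') (ob H)" "heq H G (v * u') 0" "heq G H (v' * u) 0"
         "heq F F (u * v + u' * v') (ob F)" using meq_bsum_mbiprod[OF GH(1-3)] unfolding mbiprod_def by blast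
      have uv: "u * v \<in> mhoms F F" using h by (auto intro: mhoms_mult)
      have "heq F F (u * (v * u) * v) (u * ob G * v)" by (intro heq_right[where F = G] heq_left[where F = G] h)
      hence "heq F F (u * v * (u * v)) (u * v)" unfolding mhoms_id_right[OF h(1)] by (simp add: mult.assoc)
      then obtain p where p: "p \<in> mhoms F F" "p * p = p" "heq F F (u * v) p"
        using lift_idempotent[OF less.prems(1) uv] by blast
      note s = mbiprod_sub_cx[OF less.prems(1) p(1,2)]
      \<comment> \<open>Neither idempotent may be the whole identity, as otherwise \<open>H\<close>
        or \<open>G\<close> would be zero; hence both summands are strictly smaller.\<close>
      have 1: "p ~= ob F"
      proof
        assume "p = ob F"
        hence "heq F F (u * v) (u * v + u' * v')" using p(3) heq_sym[OF h(9)] heq_trans by blast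
        hence "u' * v' \<in> nulls F F" unfolding heq_def using nulls_uminus by fastforce
        hence "v' * (u' * v') * u' \<in> nulls H H" using h nulls_mult_left nulls_mult_right by blast
        moreover have "heq H H (v' * u' * (v' * u')) (ob H)"
          using heq_trans[OF heq_right[OF h(6), of "v' * u'" H]] h(6) mhoms_id_left[of "v' * u'" H H] mhoms_mult[OF h(3,4)] by simp
        ultimately show False using GH(5) unfolding mzero_def by (metis heq_sym heq_trans heq_zero mult.assoc)
      qed
      have "p ~= 0"
      proof
        assume "p = 0"
        hence "u * v \<in> nulls F F" using p(3) unfolding heq_zero[symmetric] by simp
        hence "v * (u * v) * u \<in> nulls G G" using h nulls_mult_left nulls_mult_right by blast
        moreover have "heq G G (v * u * (v * u)) (ob G)"
          using heq_trans[OF heq_right[OF h(5), of "v * u" G]] h(5) mhoms_id_left[of "v * u" G G] mhoms_mult[OF h(1,2)] by simp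
        ultimately show False using GH(4) unfolding mzero_def by (metis heq_sym heq_trans heq_zero mult.assoc)
      qed
      hence 2: "ob F - p ~= ob F" by (simp add: fun_eq_iff)
      have supp: "q n = 0" if "q \<in> mhoms F F" "ob E n = 0" for q n
        using less.prems(3)[OF that(2)] mhomsD(3)[OF that(1), of n] by simp
      have "Q (sub_cx F p)"
        using less.prems supp p 1 by (intro less.hyps msize_sub_cx sub_cx mretract_trans[OF mretract_sub_cx]) auto
      moreover have "Q (sub_cx F (ob F - p))"
        using less.prems supp[OF p(1)] supp[OF s(1)] s 2 by (intro less.hyps msize_sub_cx sub_cx mretract_trans[OF mretract_sub_cx]) auto
      moreover have "meq F (bsum (sub_cx F p) (sub_cx F (ob F - p)))"
        by (intro mbiprod_meq s sub_cx less.prems p)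
      ultimately show ?thesis
        using less.prems p s by (intro bsum[of F "sub_cx F p" "sub_cx F (ob F - p)"] sub_cx) auto
    qed
  qed
  thus ?thesis using assms(1) meq_mretract[OF meq_refl] by blast
qed

text \<open>If a unit of a local ring factors through a direct sum, it already factors through one
  of the summands. Hence an indecomposable retract of \<open>E\<close> is isomorphic to one of the
  finitely many indecomposable pieces of \<open>E\<close>.\<close>

lemma finite_mindec_factors:
  fixes E :: "'r mcx"
  assumes "cx E"
  shows "\<exists>D. finite D \<and> (\<forall>F a b. mindec F --> a \<in> mhoms F E --> b \<in> mhoms E F --> munit F (b * a) --> (\<exists>G\<in>D. mindec G \<and> meq F G))"
  using assms
proof (induction rule: decompose_induct)
  case (zero F)
  have "\<not> munit G (b * a)" if "mindec G" "a \<in> mhoms G F" "b \<in> mhoms F G" for G a b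
  proof
    assume u: "munit G (b * a)"
    have "ob F * a \<in> nulls G F" using zero(2) that unfolding mzero_def by (intro nulls_mult_right)
    hence "b * a \<in> nulls G G" using that by (intro nulls_mult_left) (auto simp: mhoms_id_left)
    thus False using munit_mzero_iff[OF _ _ u] mindecD[OF that(1)] by blast
  qed
  thus ?case by blast
next
  case (mindec F)
  thus ?case using mindec_retract_meq by (intro exI[of _ "{F}"]) blast
next
  case (bsum F G H)
  obtain u v u' v' where h: "u \<in> mhoms G F" "v \<in> mhoms F G" "u' \<in> mhoms H F" "v' \<in> mhoms F H"
      "heq F F (u * v + u' * v') (ob F)" using meq_bsum_mbiprod[OF bsum(2-4)] unfolding mbiprod_def by blast
  obtain D where D: "finite D" "!!K a b. mindec K ==> a \<in> mhoms K G ==> b \<in> mhoms G K ==> munit K (b * a) ==> (\<exists>L\<in>D. mindec L \<and> meq K L)"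
    using bsum(5) by blast
  obtain D' where D': "finite D'" "!!K a b. mindec K ==> a \<in> mhoms K H ==> b \<in> mhoms H K ==> munit K (b * a) ==> (\<exists>L\<in>D'. mindec L \<and> meq K L)"
    using bsum(6) by blast
  have "\<exists>L\<in>D \<union> D'. mindec L \<and> meq K L" if K: "mindec K" "a \<in> mhoms K F" "b \<in> mhoms F K" "munit K (b * a)" for K a b
  proof -
    have "heq K K (b * (u * v + u' * v') * a) (b * ob F * a)"
      by (intro heq_right[where F = F] heq_left[where F = F] K h)
    moreover have "b * (u * v + u' * v') * a = (b * u) * (v * a) + (b * u') * (v' * a)"
      by (simp only: distrib_left distrib_right mult.assoc)
    ultimately have "heq K K (b * a) ((b * u) * (v * a) + (b * u') * (v' * a))"
      unfolding mhoms_id_right[OF K(3)] using heq_sym by metis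
    hence "munit K ((b * u) * (v * a) + (b * u') * (v' * a))"
      by (rule munit_heq[OF K(4)]) (use h K in \<open>auto intro!: mhoms_add mhoms_mult\<close>)
    hence "munit K ((b * u) * (v * a)) \<or> munit K ((b * u') * (v' * a))"
      by (rule munit_add[OF K(1), rotated 2]) (use h K in \<open>auto intro!: mhoms_mult\<close>)
    thus ?thesis using D(2)[OF K(1), of "v * a" "b * u"] D'(2)[OF K(1), of "v' * a" "b * u'"] h K by (auto intro: mhoms_mult)
  qed
  thus ?case using D(1) D'(1) by (intro exI[of _ "D \<union> D'"]) blast
qed

end

section \<open>Stalk complexes and complexes in two adjacent degrees\<close>

definition stalk :: "int => 'r::ring => 'r mcx" where
  "stalk c e = \<lparr>ob = (%n. if n = c then e else 0), df = (%_. 0)\<rparr>"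

lemma stalk_sel [simp]: "ob (stalk c e) n = (if n = c then e else 0)" "df (stalk c e) n = 0"
  unfolding stalk_def by auto

lemma cx_stalk: "e * e = e ==> cx (stalk c e)"
  unfolding cx_def by auto

definition two_term :: "int => 'r::ring mcx => bool" where
  "two_term c E \<longleftrightarrow> cx E \<and> (\<forall>n. n ~= c --> n ~= c - 1 --> ob E n = 0)"

lemma two_term_cx: "two_term c E ==> cx E"
  unfolding two_term_def by blast

lemma two_term_stalk: "e * e = e ==> two_term c (stalk c e)" "e * e = e ==> two_term c (stalk (c - 1) e)"
  unfolding two_term_def by (auto simp: cx_stalk)

lemma two_term_df: "two_term c E ==> n ~= c - 1 ==> df E n = 0"
proof -
  assume E: "two_term c E" "n ~= c - 1"
  show "df E n = 0"
  proof (cases "n = c")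
    case True
    hence "ob E (n + 1) = 0" using E unfolding two_term_def by auto
    thus ?thesis using cxD(2)[OF two_term_cx[OF E(1)], of n] by (auto dest: hom_to_zero)
  next
    case False
    hence "ob E n = 0" using E unfolding two_term_def by auto
    thus ?thesis using cxD(2)[OF two_term_cx[OF E(1)], of n] by (auto dest: hom_from_zero)
  qed
qed

lemma two_term_d:
  assumes "two_term c E"
  shows "ob E c * ob E c = ob E c" "ob E (c - 1) * ob E (c - 1) = ob E (c - 1)"
    "ob E c * df E (c - 1) = df E (c - 1)" "df E (c - 1) * ob E (c - 1) = df E (c - 1)"
  using cxD[OF two_term_cx[OF assms]] by auto

definition two_map :: "int => 'r::ring => 'r => int => 'r" where
  "two_map c x y = (%n. if n = c then x else if n = c - 1 then y else 0)"

lemma two_map_mhoms: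
  assumes E: "two_term c E" and F: "two_term c F" and x: "x \<in> arr (ob E c) (ob F c)"
    and y: "y \<in> arr (ob E (c - 1)) (ob F (c - 1))" and d: "df F (c - 1) * y = x * df E (c - 1)"
  shows "two_map c x y \<in> mhoms E F"
proof (rule mhomsI)
  fix n
  show "two_map c x y n \<in> arr (ob E n) (ob F n)" using x y unfolding two_map_def by auto
  show "df F n * two_map c x y n = two_map c x y (n + 1) * df E n"
    using d two_term_df[OF E, of n] two_term_df[OF F, of n] unfolding two_map_def by auto
qed

text \<open>Only the component of a homotopy from degree \<open>c\<close> to degree
  \<open>c - 1\<close> contributes, because all differentials other than the one leaving degree
  \<open>c - 1\<close> are zero.\<close>

lemma two_term_nulls:
  assumes E: "two_term c E" and F: "two_term c F" and f: "f \<in> nulls E F"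
  obtains k where "k \<in> arr (ob E c) (ob F (c - 1))" "f c = df F (c - 1) * k" "f (c - 1) = k * df E (c - 1)"
proof -
  obtain h where h: "!!n. h n \<in> arr (ob E n) (ob F (n - 1))"
    "!!n. f n = df F (n - 1) * h n + h (n + 1) * df E n" using f unfolding nulls_def by blast
  have "f c = df F (c - 1) * h c" using h(2)[of c] two_term_df[OF E, of c] by simp
  moreover have "f (c - 1) = h c * df E (c - 1)"
    using h(2)[of "c - 1"] two_term_df[OF F, of "c - 1 - 1"] by simp
  ultimately show ?thesis using that h(1)[of c] by blast
qed

text \<open>\<open>ext_zero c E F\<close> says \<open>Hom(E, F[1]) = 0\<close> for complexes concentrated in degrees \<open>c - 1\<close> and \<open>c\<close>.\<close>

definition ext_zero :: "int => 'r::ring mcx => 'r mcx => bool" where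
  "ext_zero c E F \<longleftrightarrow> (\<forall>x\<in>arr (ob E (c - 1)) (ob F c). \<exists>s\<in>arr (ob E c) (ob F c).
     \<exists>h\<in>arr (ob E (c - 1)) (ob F (c - 1)). x = s * df E (c - 1) + df F (c - 1) * h)"

lemma ext_zeroD:
  assumes "ext_zero c E F" "x \<in> arr (ob E (c - 1)) (ob F c)"
  obtains s h where "s \<in> arr (ob E c) (ob F c)" "h \<in> arr (ob E (c - 1)) (ob F (c - 1))"
    "x = s * df E (c - 1) + df F (c - 1) * h"
  using assms unfolding ext_zero_def by blast

lemma ext_zero_stalk: "ext_zero c (stalk c e) F"
  unfolding ext_zero_def
proof
  fix x assume "x \<in> arr (ob (stalk c e) (c - 1)) (ob F c)"
  hence "x = 0 * df (stalk c e) (c - 1) + df F (c - 1) * 0" by (auto dest: hom_from_zero)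
  thus "\<exists>s\<in>arr (ob (stalk c e) c) (ob F c). \<exists>h\<in>arr (ob (stalk c e) (c - 1)) (ob F (c - 1)).
      x = s * df (stalk c e) (c - 1) + df F (c - 1) * h" using hom_zero by blast
qed

context hom_finite_ring
begin

section \<open>Ranks of idempotents at right ideals\<close>

text \<open>The idempotent \<open>w\<close> puts the right ideal inside \<open>w R\<close>, and this
  is what makes its intersection with \<open>R e\<close> finite dimensional.\<close>

definition rideal :: "'r set => bool" where
  "rideal J \<longleftrightarrow> subspace J \<and> (\<forall>x\<in>J. \<forall>y. x * y \<in> J) \<and> (\<exists>w. w * w = w \<and> (\<forall>x\<in>J. w * x = x))"

definition rcorner :: "'r set => 'r => 'r set" where
  "rcorner J e = {x \<in> J. x * e = x}"

text \<open>For \<open>J = w R\<close> this is the dimension of the space of morphisms from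
  \<open>e\<close> to \<open>w\<close>. The value 0 at sets that are no such ideals makes classes
  total functions, so that relations between them can be stated at every \<open>J\<close>.\<close>

definition rk :: "'r => 'r set => real" where
  "rk e J = (if rideal J then real (dim (rcorner J e)) else 0)"

lemma rcorner:
  assumes "rideal J" "e * e = e"
  shows "subspace (rcorner J e)" "fin_dim (rcorner J e)"
proof -
  show "subspace (rcorner J e)"
    using assms unfolding rideal_def rcorner_def subspace_def by (auto simp: algebra_simps scale_mult_left)
  obtain w where w: "w * w = w" "\<forall>x\<in>J. w * x = x" using assms unfolding rideal_def by blast
  have "rcorner J e \<subseteq> arr e w" using w unfolding rcorner_def arr_def by auto
  thus "fin_dim (rcorner J e)" using fin_dim_subset[OF fin_dim_hom[OF assms(2) w(1)]] span_superset[of "arr e w"] by blast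
qed

lemma rideal_hom: "w * w = w ==> rideal {x. w * x = x}" and rcorner_hom: "rcorner {x. w * x = x} e = arr e w"
  unfolding rideal_def rcorner_def subspace_def arr_def
  by (auto simp: algebra_simps scale_mult_right) (auto simp: mult.assoc[symmetric])

lemma rk_iso:
  assumes "u \<in> arr e f" "v \<in> arr f e" "v * u = e" "u * v = f" "e * e = e" "f * f = f"
  shows "rk e = rk f"
proof
  fix J show "rk e J = rk f J"
  proof (cases "rideal J")
    case True
    note hd = arrD[OF assms(1)] arrD[OF assms(2)]
    have "(%x. x * v) ` rcorner J e = rcorner J f"
    proof (intro equalityI subsetI)
      fix y assume "y \<in> rcorner J f"
      hence "y = y * u * v" "y * u \<in> rcorner J e"
        using True assms hd unfolding rcorner_def rideal_def by (auto simp: mult.assoc)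
      thus "y \<in> (%x. x * v) ` rcorner J e" by blast
    qed (use True hd in \<open>auto simp: rcorner_def rideal_def mult.assoc\<close>)
    moreover have "x = 0" if "x \<in> rcorner J e" "x * v = 0" for x
    proof -
      have "x = x * (v * u)" using that assms(3) unfolding rcorner_def by simp
      hence "x = x * v * u" by (simp add: mult.assoc)
      thus ?thesis using that by simp
    qed
    ultimately have "dim (rcorner J f) = dim (rcorner J e)"
      using dim_inj_image[OF rcorner[OF True assms(5)] linear_mult_right] by metis
    thus ?thesis unfolding rk_def by simp
  qed (simp add: rk_def)
qed

lemma rk_zero: "rk 0 = 0"
proof
  fix J
  have "rcorner J 0 = {0}" if "rideal J"
    using that unfolding rcorner_def rideal_def by (auto intro: subspace_0)
  thus "rk 0 J = 0 J" unfolding rk_def by (simp add: dim_zero)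
qed

lemma rk_add:
  assumes "e * e = e" "f * f = f" "e * f = 0" "f * e = 0"
  shows "rk (e + f) = rk e + rk f"
proof
  fix J show "rk (e + f) J = (rk e + rk f) J"
  proof (cases "rideal J")
    case True
    have "{x + y | x y. x \<in> rcorner J e \<and> y \<in> rcorner J f} = rcorner J (e + f)"
    proof (intro equalityI subsetI)
      fix z assume z: "z \<in> rcorner J (e + f)"
      hence "z = z * e + z * f" "z * e \<in> rcorner J e" "z * f \<in> rcorner J f"
        using True assms unfolding rcorner_def rideal_def by (auto simp: algebra_simps)
      thus "z \<in> {x + y | x y. x \<in> rcorner J e \<and> y \<in> rcorner J f}" by blast
    next
      fix z assume "z \<in> {x + y | x y. x \<in> rcorner J e \<and> y \<in> rcorner J f}"
      then obtain x y where z: "z = x + y" "x \<in> J" "x * e = x" "y \<in> J" "y * f = y" unfolding rcorner_def by blast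
      have "x * f = 0" "y * e = 0" using z assms by (metis mult.assoc mult_zero_right)+
      thus "z \<in> rcorner J (e + f)" using z True unfolding rcorner_def rideal_def
        by (auto simp: algebra_simps intro: subspace_add)
    qed
    moreover have "rcorner J e \<inter> rcorner J f \<subseteq> {0}"
    proof
      fix x assume "x \<in> rcorner J e \<inter> rcorner J f"
      hence "x * e = x" "x * f = x" unfolding rcorner_def by auto
      hence "x = x * (e * f)" by (simp add: mult.assoc[symmetric])
      thus "x \<in> {0}" using assms by simp
    qed
    ultimately have "dim (rcorner J (e + f)) = dim (rcorner J e) + dim (rcorner J f)"
      using dim_direct_sum[OF rcorner[OF True assms(1)] rcorner[OF True assms(2)]] by simp
    thus ?thesis using True unfolding rk_def by simp
  qed (simp add: rk_def)
qed

text \<open>The identity of the biproduct is a sum of two orthogonal idempotents, isomorphic to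
  \<open>e\<close> and to \<open>f\<close>.\<close>

lemma rk_bs:
  assumes "e * e = e" "f * f = f"
  shows "rk (bs e f) = rk e + rk f"
proof -
  note b = biprodD[OF assms]
  note h = arrD[OF b(2)] arrD[OF b(3)] arrD[OF b(4)] arrD[OF b(5)]
  note h' = h h[THEN assocI] b(6-9) b(6,7)[THEN assocI] b(8,9)[THEN zero_assocI] assms assms[THEN assocI]
  have 1: "rk e = rk (i1 e f * p1 e f)"
    by (rule rk_iso[of "i1 e f" _ _ "p1 e f"]; (rule arrI)?; simp add: mult.assoc h')
  have 2: "rk f = rk (i2 e f * p2 e f)"
    by (rule rk_iso[of "i2 e f" _ _ "p2 e f"]; (rule arrI)?; simp add: mult.assoc h')
  have "rk (i1 e f * p1 e f + i2 e f * p2 e f) = rk (i1 e f * p1 e f) + rk (i2 e f * p2 e f)"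
    by (rule rk_add; simp add: mult.assoc h')
  thus ?thesis unfolding b(10) 1 2 .
qed

section \<open>Linear independence of the classes of a presilting complex\<close>

text \<open>Modulo the image of the differential this is the trace of the complexes
  \<open>X i\<close>, \<open>i \<in> K\<close>, in the cohomology of \<open>E\<close> in degree
  \<open>c\<close>, the top degree of the two-term complexes to which it is applied.\<close>

definition trace_ideal :: "int => ('i => 'r mcx) => 'i set => 'r mcx => 'r set" where
  "trace_ideal c X K E = span {g * y | g y. g = df E (c - 1) \<or> (\<exists>i\<in>K. \<exists>f\<in>mhoms (X i) E. g = f c)}"

lemma trace_ideal_subset:
  assumes "subspace T" "!!y. df E (c - 1) * y \<in> T"
    and "!!i f y. i \<in> K ==> f \<in> mhoms (X i) E ==> f c * y \<in> T"
  shows "trace_ideal c X K E \<subseteq> T"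
  unfolding trace_ideal_def using assms by (intro span_minimal) auto

lemma trace_ideal_base:
  "df E (c - 1) * y \<in> trace_ideal c X K E"
  "i \<in> K ==> f \<in> mhoms (X i) E ==> f c * y \<in> trace_ideal c X K E"
  unfolding trace_ideal_def by (rule span_base; blast)+

lemma subspace_trace_ideal: "subspace (trace_ideal c X K E)"
  unfolding trace_ideal_def by (rule subspace_span)

lemma trace_ideal_mono: "K \<subseteq> K' ==> trace_ideal c X K E \<subseteq> trace_ideal c X K' E"
  unfolding trace_ideal_def by (rule span_mono) blast

lemma trace_ideal_right: "x \<in> trace_ideal c X K E ==> x * y \<in> trace_ideal c X K E"
proof -
  have "trace_ideal c X K E \<subseteq> {x. x * y \<in> trace_ideal c X K E}"
    using subspace_trace_ideal[of c X K E]
    by (intro trace_ideal_subset) (auto simp: subspace_def algebra_simps scale_mult_left intro: trace_ideal_base)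
  thus "x \<in> trace_ideal c X K E ==> x * y \<in> trace_ideal c X K E" by blast
qed

lemma trace_ideal_left:
  assumes "cx E" "x \<in> trace_ideal c X K E"
  shows "ob E c * x = x"
proof -
  have "trace_ideal c X K E \<subseteq> {x. ob E c * x = x}"
    by (intro trace_ideal_subset)
      (auto simp: subspace_def algebra_simps scale_mult_right cxD(9)[OF assms(1), THEN assocI] mhomsD(3)[THEN assocI])
  thus ?thesis using assms by blast
qed

lemma rideal_trace_ideal: "cx E ==> rideal (trace_ideal c X K E)"
  unfolding rideal_def using subspace_trace_ideal trace_ideal_right trace_ideal_left cxD(1) by blast

text \<open>Vanishing of extensions writes every element of the trace ideal, restricted to the lower
  object of \<open>X i\<close>, as \<open>s d + d h\<close> with \<open>s\<close> again in the trace
  ideal. For \<open>x\<close> times the differential this says that \<open>x - s\<close> and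
  \<open>h\<close> form a chain map from \<open>X i\<close> to \<open>X j\<close>; since
  \<open>i \<in> K\<close>, its upper component lies in the ideal, and so does
  \<open>x\<close>.\<close>

lemma trace_ideal_lift:
  assumes X: "!!i. i \<in> I ==> two_term c (X i)" and ext: "!!i j. i \<in> I ==> j \<in> I ==> ext_zero c (X i) (X j)"
    and i: "i \<in> K" "K \<subseteq> I" and j: "j \<in> I"
    and x: "x \<in> arr (ob (X i) c) (ob (X j) c)" "x * df (X i) (c - 1) \<in> trace_ideal c X K (X j)"
  shows "x \<in> trace_ideal c X K (X j)"
proof -
  let ?J = "trace_ideal c X K (X j)"
  let ?X0 = "%i. ob (X i) c" and ?X1 = "%i. ob (X i) (c - 1)" and ?d = "%i. df (X i) (c - 1)"
  have iI: "i \<in> I" using i by blast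
  \<comment> \<open>The elements that admit such a decomposition. They form a subspace, so it
    suffices to treat the generators of the trace ideal.\<close>
  define T where "T = {b. \<exists>s\<in>?J. \<exists>h\<in>arr (?X1 i) (?X1 j). s \<in> arr (?X0 i) (?X0 j) \<and> b * ?X1 i = s * ?d i + ?d j * h}"
  note dd = two_term_d[OF X]
  have "?J \<subseteq> T"
  proof (rule trace_ideal_subset)
    show "subspace T"
      unfolding subspace_def
    proof (intro conjI ballI allI)
      show "0 \<in> T" unfolding T_def using subspace_0[OF subspace_trace_ideal] by (auto intro!: bexI[of _ 0])
    next
      fix b b' assume "b \<in> T" "b' \<in> T"
      then obtain s h s' h' where "s \<in> ?J" "h \<in> arr (?X1 i) (?X1 j)" "s \<in> arr (?X0 i) (?X0 j)" "b * ?X1 i = s * ?d i + ?d j * h"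
         "s' \<in> ?J" "h' \<in> arr (?X1 i) (?X1 j)" "s' \<in> arr (?X0 i) (?X0 j)" "b' * ?X1 i = s' * ?d i + ?d j * h'" unfolding T_def by blast
      moreover from this have "(b + b') * ?X1 i = (s + s') * ?d i + ?d j * (h + h')" by (simp add: algebra_simps)
      ultimately show "b + b' \<in> T" unfolding T_def using subspace_add[OF subspace_trace_ideal] hom_add by blast
    next
      fix t b assume "b \<in> T"
      then obtain s h where "s \<in> ?J" "h \<in> arr (?X1 i) (?X1 j)" "s \<in> arr (?X0 i) (?X0 j)" "b * ?X1 i = s * ?d i + ?d j * h" unfolding T_def by blast
      moreover from this have "scale t b * ?X1 i = scale t s * ?d i + ?d j * scale t h"
        by (simp add: algebra_simps scale_mult_left scale_mult_right)
      ultimately show "scale t b \<in> T" unfolding T_def using subspace_scale[OF subspace_trace_ideal] hom_scale by blast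
    qed
  next
    fix y
    have "?X1 j * y * ?X1 i \<in> arr (?X1 i) (?X1 j)" using dd iI j by (intro hom_corner) auto
    moreover have "?d j * y * ?X1 i = 0 * ?d i + ?d j * (?X1 j * y * ?X1 i)" using dd(4)[OF j] by (simp add: mult.assoc[symmetric])
    ultimately show "?d j * y \<in> T" unfolding T_def using subspace_0[OF subspace_trace_ideal] by (blast intro: hom_zero)
  next
    fix l f y assume l: "l \<in> K" and f: "f \<in> mhoms (X l) (X j)"
    hence lI: "l \<in> I" using i by blast
    \<comment> \<open>For a generator coming from \<open>f\<close>, the decomposition is found in
      \<open>X l\<close>, where extensions from \<open>X i\<close> vanish, and is then pushed
      forward along \<open>f\<close>.\<close>
    have "?X0 l * y * ?X1 i \<in> arr (?X1 i) (?X0 l)" using dd iI lI by (intro hom_corner) auto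
    then obtain s h where sh: "s \<in> arr (?X0 i) (?X0 l)" "h \<in> arr (?X1 i) (?X1 l)"
      "?X0 l * y * ?X1 i = s * ?d i + ?d l * h" using ext_zeroD[OF ext[OF iI lI]] by blast
    have "f c * y * ?X1 i = f c * (?X0 l * y * ?X1 i)" using mhomsD(4)[OF f, of c] by (simp add: mult.assoc[symmetric])
    also have "\<dots> = f c * s * ?d i + ?d j * (f (c - 1) * h)" unfolding sh(3) using mhomsD(5)[OF f, of c]
      by (simp add: distrib_left mult.assoc[symmetric])
    finally have "f c * y * ?X1 i = f c * s * ?d i + ?d j * (f (c - 1) * h)" .
    moreover have "f c * s \<in> ?J" using l f by (rule trace_ideal_base)
    moreover have "f c * s \<in> arr (?X0 i) (?X0 j)" "f (c - 1) * h \<in> arr (?X1 i) (?X1 j)"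
      using sh mhomsD(1)[OF f] by (auto intro: hom_mult)
    ultimately show "f c * y \<in> T" unfolding T_def by blast
  qed
  hence "x * ?d i \<in> T" using x by blast
  then obtain s h where sh: "s \<in> ?J" "h \<in> arr (?X1 i) (?X1 j)" "s \<in> arr (?X0 i) (?X0 j)"
    "x * ?d i * ?X1 i = s * ?d i + ?d j * h" unfolding T_def by blast
  have "?d j * h = (x - s) * ?d i" using sh(4) dd(4)[OF iI] by (simp add: algebra_simps)
  hence "two_map c (x - s) h \<in> mhoms (X i) (X j)" using X iI j sh x by (intro two_map_mhoms hom_diff) auto
  hence "two_map c (x - s) h c * ?X0 i \<in> ?J" by (rule trace_ideal_base(2)[OF i(1)])
  moreover have "(x - s) * ?X0 i = x - s" using arrD(2)[OF x(1)] arrD(2)[OF sh(3)] by (simp add: algebra_simps)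
  ultimately have "x - s \<in> ?J" unfolding two_map_def by simp
  hence "x - s + s \<in> ?J" using sh(1) by (intro subspace_add[OF subspace_trace_ideal])
  thus ?thesis by simp
qed

lemma sum_nonpos_eq_zero:
  fixes f :: "'i => real"
  assumes "finite I" "!!i. i \<in> I ==> f i \<le> 0" "sum f I = 0" "i \<in> I"
  shows "f i = 0"
  using sum_nonneg_eq_0_iff[of I "%i. - f i"] assms by (simp add: sum_negf)

text \<open>The defect \<open>\<delta> i\<close> measures how many morphisms between the upper
  objects of \<open>X i\<close> and \<open>X j\<close> land in the trace ideal only after
  composition with the differential. Rank-nullity expresses it through the class of
  \<open>X i\<close> at \<open>?L\<close> and \<open>?J\<close>, so the relation gives
  \<open>a i * \<delta> i\<close> the sum zero. All defects are nonnegative and they vanish where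
  \<open>a i > 0\<close>, so no summand is positive and each is zero. For \<open>a j < 0\<close>
  this gives \<open>\<delta> j = 0\<close>.\<close>

lemma generated_by_positive_part:
  fixes X :: "'i => 'r mcx" and a :: "'i => real"
  assumes fin: "finite I" and X: "!!i. i \<in> I ==> two_term c (X i)"
    and ext: "!!i j. i \<in> I ==> j \<in> I ==> ext_zero c (X i) (X j)"
    and sum: "!!J. (\<Sum>i\<in>I. a i * (rk (ob (X i) c) J - rk (ob (X i) (c - 1)) J)) = 0"
    and j: "j \<in> I" "a j < 0"
  shows "ob (X j) c \<in> trace_ideal c X {i \<in> I. a i > 0} (X j)"
proof -
  define K where "K = {i \<in> I. a i > 0}"
  let ?J = "trace_ideal c X K (X j)" and ?L = "{x. ob (X j) c * x = x}"
  let ?X0 = "%i. ob (X i) c" and ?X1 = "%i. ob (X i) (c - 1)" and ?d = "%i. df (X i) (c - 1)"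
  note dd = two_term_d[OF X]
  have rJ: "rideal ?J" using two_term_cx[OF X[OF j(1)]] by (rule rideal_trace_ideal)
  have rL: "rideal ?L" using dd(1)[OF j(1)] by (rule rideal_hom)
  define N where "N i = {x \<in> arr (?X0 i) (?X0 j). x * ?d i \<in> rcorner ?J (?X1 i)}" for i
  define \<delta> where "\<delta> i = real (dim (N i)) - real (dim (rcorner ?J (?X0 i)))" for i
  have \<delta>: "\<delta> i = (rk (?X0 i) ?L - rk (?X1 i) ?L) - (rk (?X0 i) ?J - rk (?X1 i) ?J)" if i: "i \<in> I" for i
  proof -
    \<comment> \<open>This is the vanishing of extensions from \<open>X i\<close> to
      \<open>X j\<close>: morphisms that factor through the differential of \<open>X i\<close>,
      together with the trace ideal, exhaust all morphisms between these objects.\<close>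
    have "{x * ?d i + y | x y. x \<in> arr (?X0 i) (?X0 j) \<and> y \<in> rcorner ?J (?X1 i)} = arr (?X1 i) (?X0 j)"
    proof (intro equalityI subsetI)
      fix z assume "z \<in> {x * ?d i + y | x y. x \<in> arr (?X0 i) (?X0 j) \<and> y \<in> rcorner ?J (?X1 i)}"
      then obtain x y where "z = x * ?d i + y" "x \<in> arr (?X0 i) (?X0 j)" "y \<in> rcorner ?J (?X1 i)" by blast
      moreover have "?d i \<in> arr (?X1 i) (?X0 i)" using dd(3,4)[OF i] by (rule arrI)
      moreover from this calculation have "x * ?d i \<in> arr (?X1 i) (?X0 j)" by (blast intro: hom_mult)
      moreover from calculation have "y \<in> arr (?X1 i) (?X0 j)"
        using trace_ideal_left[OF two_term_cx[OF X[OF j(1)]], of y c X K] unfolding rcorner_def by (auto intro: arrI)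
      ultimately show "z \<in> arr (?X1 i) (?X0 j)" by (auto intro: hom_add)
    next
      fix z assume "z \<in> arr (?X1 i) (?X0 j)"
      then obtain s h where "s \<in> arr (?X0 i) (?X0 j)" "h \<in> arr (?X1 i) (?X1 j)" "z = s * ?d i + ?d j * h"
        using ext_zeroD[OF ext[OF i j(1)]] by blast
      moreover from this have "?d j * h \<in> rcorner ?J (?X1 i)" unfolding rcorner_def
        using trace_ideal_base(1) arrD(2)[of h] by (auto simp: mult.assoc)
      ultimately show "z \<in> {x * ?d i + y | x y. x \<in> arr (?X0 i) (?X0 j) \<and> y \<in> rcorner ?J (?X1 i)}" by blast
    qed
    hence "dim (arr (?X0 i) (?X0 j)) + dim (rcorner ?J (?X1 i)) = dim (arr (?X1 i) (?X0 j)) + dim (N i)"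
      using dim_plus_preimage[OF subspace_hom fin_dim_hom rcorner[OF rJ dd(2)] linear_mult_right[of "?d i"], of "?X0 i" "?X0 j" i]
        dd i j unfolding N_def by simp
    thus ?thesis unfolding \<delta>_def rk_def using rJ rL by (simp add: rcorner_hom)
  qed
  have sub: "rcorner ?J (?X0 i) \<subseteq> N i" if i: "i \<in> I" for i
  proof
    fix x assume x: "x \<in> rcorner ?J (?X0 i)"
    hence "x \<in> arr (?X0 i) (?X0 j)" using trace_ideal_left[OF two_term_cx[OF X[OF j(1)]], of x c X K]
      unfolding rcorner_def by (auto intro: arrI)
    thus "x \<in> N i" using x dd(4)[OF i] unfolding N_def rcorner_def by (auto intro: trace_ideal_right simp: mult.assoc)
  qed
  have fdN: "fin_dim (N i)" if "i \<in> I" for i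
  proof -
    have "N i \<subseteq> arr (?X0 i) (?X0 j)" unfolding N_def by blast
    thus ?thesis using fin_dim_subset[OF fin_dim_hom[OF dd(1)[OF that] dd(1)[OF j(1)]]] span_superset by (metis subset_trans)
  qed
  have \<delta>0: "\<delta> i \<ge> 0" if "i \<in> I" for i
  proof -
    have "dim (rcorner ?J (?X0 i)) \<le> dim (N i)"
      using sub[OF that] span_superset[of "N i"] by (intro dim_mono_fin_dim fdN that) blast
    thus ?thesis unfolding \<delta>_def by simp
  qed
  have \<delta>K: "\<delta> i = 0" if "i \<in> K" for i
  proof -
    have i: "i \<in> I" using that unfolding K_def by blast
    have "N i \<subseteq> rcorner ?J (?X0 i)"
    proof
      fix x assume x: "x \<in> N i"
      have "x \<in> ?J" by (rule trace_ideal_lift[OF X ext that _ j(1)]) (use x in \<open>auto simp: N_def K_def rcorner_def\<close>)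
      thus "x \<in> rcorner ?J (?X0 i)" using x unfolding N_def rcorner_def arr_def by auto
    qed
    hence "N i = rcorner ?J (?X0 i)" using sub[OF i] by blast
    thus ?thesis unfolding \<delta>_def by simp
  qed
  have "(\<Sum>i\<in>I. a i * \<delta> i) = (\<Sum>i\<in>I. a i * (rk (?X0 i) ?L - rk (?X1 i) ?L)) - (\<Sum>i\<in>I. a i * (rk (?X0 i) ?J - rk (?X1 i) ?J))"
    unfolding sum_subtractf[symmetric] by (intro sum.cong) (simp_all add: \<delta> algebra_simps)
  hence s0: "(\<Sum>i\<in>I. a i * \<delta> i) = 0" unfolding sum by simp
  have "a i * \<delta> i \<le> 0" if "i \<in> I" for i
  proof (cases "i \<in> K")
    case False
    hence "a i \<le> 0" using that unfolding K_def by simp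
    thus ?thesis using \<delta>0[OF that] by (simp add: mult_nonpos_nonneg)
  qed (simp add: \<delta>K)
  hence "a j * \<delta> j = 0" using sum_nonpos_eq_zero[OF fin _ s0 j(1)] by blast
  hence "\<delta> j = 0" using j by simp
  hence "rcorner ?J (?X0 j) = N j"
    using dim_eq_imp_eq[OF rcorner(1)[OF rJ dd(1)[OF j(1)]] sub[OF j(1)] fdN[OF j(1)]] unfolding \<delta>_def by simp
  \<comment> \<open>The identity belongs to \<open>N j\<close> because its product with the
    differential of \<open>X j\<close> is that differential, a generator of the ideal. As the defect
    is zero, the identity itself lies in the ideal.\<close>
  moreover have "?X0 j \<in> N j" unfolding N_def rcorner_def
    using dd[OF j(1)] trace_ideal_base(1)[of "X j" c "?X1 j" X K] by (auto intro: hom_id)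
  ultimately show ?thesis unfolding rcorner_def K_def by blast
qed

lemma mhoms_scale: "f \<in> mhoms E F ==> (%n. scale t (f n)) \<in> mhoms E F"
  unfolding mhoms_def by (auto simp: scale_mult_left scale_mult_right intro: hom_scale)

lemma not_munit_scale:
  assumes E: "mindec E" and f: "f \<in> mhoms E E" "\<not> munit E f"
  shows "\<not> munit E (%n. scale t (f n))"
proof
  assume "munit E (%n. scale t (f n))"
  moreover have "(%n. scale t (f n)) = (%n. scale t (ob E n)) * f"
    using mhomsD(3)[OF f(1)] by (simp add: fun_eq_iff scale_mult_left)
  ultimately have "munit E f"
    using munit_factor[OF E f(1) mhoms_scale[OF mhoms_id[OF mindecD(1)[OF E]]]] by metis
  thus False using f by blast
qed

text \<open>Nakayama's lemma: a radical generating relation between the degree \<open>c\<close> cohomologies of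
  pairwise non-isomorphic indecomposables forces all of them to vanish. The elements \<open>(j, x)\<close> of a
  finite generating system are removed one after the other.\<close>

lemma nakayama:
  fixes X :: "'i => 'r mcx"
  assumes fin: "finite I" and X: "!!i. i \<in> I ==> two_term c (X i)" and ind: "!!i. i \<in> I ==> mindec (X i)"
    and ne: "!!i j. i \<in> I ==> j \<in> I ==> i ~= j ==> \<not> meq (X i) (X j)"
    and gen: "!!j. j \<in> I ==> ob (X j) c \<in> trace_ideal c X (I - {j}) (X j)"
    and i: "i \<in> I"
  shows "\<exists>z. ob (X i) c = df (X i) (c - 1) * z"
proof -
  let ?X0 = "%i. ob (X i) c" and ?d = "%i. df (X i) (c - 1)"
  define q where "q = ?X0 i"
  note dd = two_term_d[OF X]
  have qq: "q * q = q" unfolding q_def using dd i by blast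
  \<comment> \<open>A pair \<open>(j, x)\<close> stands for the element \<open>x\<close> of
    \<open>X j\<close>. \<open>S G l\<close> consists of what the elements of \<open>G\<close>
    generate in \<open>X l\<close> under chain maps, up to coboundaries.\<close>
  define S :: "('i \<times> 'r) set => 'i => 'r set" where
    "S G l = {y. \<exists>F z. (\<forall>g\<in>G. F g \<in> mhoms (X (fst g)) (X l)) \<and> y = (\<Sum>g\<in>G. F g c * snd g) + ?d l * z}" for G l
  have S_I: "(\<Sum>g\<in>G. F g c * snd g) + ?d l * z \<in> S G l" if "!!g. g \<in> G ==> F g \<in> mhoms (X (fst g)) (X l)" for F G l z
    using that unfolding S_def by blast
  have S_D: "\<exists>F z. (\<forall>g\<in>G. F g \<in> mhoms (X (fst g)) (X l)) \<and> x = (\<Sum>g\<in>G. F g c * snd g) + ?d l * z"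
    if "x \<in> S G l" for x G l using that unfolding S_def by simp
  have S_d: "?d l * z \<in> S G l" for G l z using S_I[of G "%_. 0" l z] by (simp add: mhoms_zero)
  have S_add: "x + y \<in> S G l" if xy: "x \<in> S G l" "y \<in> S G l" for x y G l
  proof -
    obtain F z where F: "!!g. g \<in> G ==> F g \<in> mhoms (X (fst g)) (X l)" "x = (\<Sum>g\<in>G. F g c * snd g) + ?d l * z"
      using S_D[OF xy(1)] by (elim exE conjE) (rule that, blast+)
    obtain F' z' where F': "!!g. g \<in> G ==> F' g \<in> mhoms (X (fst g)) (X l)" "y = (\<Sum>g\<in>G. F' g c * snd g) + ?d l * z'"
      using S_D[OF xy(2)] by (elim exE conjE) (rule that, blast+)
    have "(\<Sum>g\<in>G. (F g + F' g) c * snd g) + ?d l * (z + z') \<in> S G l" by (rule S_I) (blast intro: mhoms_add F F')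
    moreover have "(\<Sum>g\<in>G. (F g + F' g) c * snd g) + ?d l * (z + z') = x + y"
      unfolding F F' by (simp add: algebra_simps sum.distrib)
    ultimately show ?thesis by simp
  qed
  have S_map: "\<phi> c * x \<in> S G m" if xy: "x \<in> S G l" "\<phi> \<in> mhoms (X l) (X m)" for \<phi> x G l m
  proof -
    obtain F z where F: "!!g. g \<in> G ==> F g \<in> mhoms (X (fst g)) (X l)" "x = (\<Sum>g\<in>G. F g c * snd g) + ?d l * z"
      using S_D[OF xy(1)] by (elim exE conjE) (rule that, blast+)
    have "(\<Sum>g\<in>G. (\<phi> * F g) c * snd g) + ?d m * (\<phi> (c - 1) * z) \<in> S G m" by (rule S_I) (rule mhoms_mult[OF F(1) xy(2)])
    moreover have "\<phi> c * (?d l * z) = ?d m * (\<phi> (c - 1) * z)" using mhomsD(5)[OF xy(2), of c] by (metis mult.assoc)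
    hence "(\<Sum>g\<in>G. (\<phi> * F g) c * snd g) + ?d m * (\<phi> (c - 1) * z) = \<phi> c * x"
      unfolding F by (simp add: distrib_left sum_distrib_left mult.assoc)
    ultimately show ?thesis by simp
  qed
  have S_sub: "subspace (S G l)" for G l
    unfolding subspace_def
  proof (intro conjI ballI allI)
    show "0 \<in> S G l" using S_d[of l 0 G] by simp
    show "x + y \<in> S G l" if "x \<in> S G l" "y \<in> S G l" for x y using that by (rule S_add)
    show "scale t x \<in> S G l" if x: "x \<in> S G l" for t x
    proof -
      obtain F z where F: "!!g. g \<in> G ==> F g \<in> mhoms (X (fst g)) (X l)" "x = (\<Sum>g\<in>G. F g c * snd g) + ?d l * z"
        using S_D[OF x] by (elim exE conjE) (rule that, blast+)
      have "(\<Sum>g\<in>G. (%n. scale t (F g n)) c * snd g) + ?d l * scale t z \<in> S G l"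
        by (rule S_I[of G "%g n. scale t (F g n)" l]) (auto intro: mhoms_scale F)
      thus ?thesis unfolding F by (simp add: scale_mult_left scale_mult_right scale_right_distrib scale_sum_right)
    qed
  qed
  define P where "P G \<longleftrightarrow> (\<forall>l\<in>I. arr q (?X0 l) \<subseteq> S G l)" for G
  have red: "P G" if G: "finite G" "(j, x0) \<notin> G" "j \<in> I" "x0 \<in> arr q (?X0 j)" "P (insert (j, x0) G)" for G j x0
  proof -
    have ins: "\<exists>F s. F \<in> mhoms (X j) (X l) \<and> s \<in> S G l \<and> y = F c * x0 + s" if y: "y \<in> arr q (?X0 l)" "l \<in> I" for y l
    proof -
      have "y \<in> S (insert (j, x0) G) l" using G(5) y unfolding P_def by blast
      from S_D[OF this] obtain F z where F0: "\<forall>g\<in>insert (j, x0) G. F g \<in> mhoms (X (fst g)) (X l)"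
        "y = (\<Sum>g\<in>insert (j, x0) G. F g c * snd g) + ?d l * z" by (elim exE conjE) (rule that)
      note F = bspec[OF F0(1)] F0(2)
      have "y = F (j, x0) c * x0 + ((\<Sum>g\<in>G. F g c * snd g) + ?d l * z)" unfolding F using G(1,2) by simp
      moreover have "F (j, x0) \<in> mhoms (X j) (X l)" using F(1)[of "(j, x0)"] by simp
      ultimately show ?thesis using S_I[of G F l z] F(1) by blast
    qed
    define R where "R = {y. \<exists>f s. f \<in> mhoms (X j) (X j) \<and> \<not> munit (X j) f \<and> s \<in> S G j \<and> y = f c * x0 + s}"
    note mj = ind[OF G(3)]
    have nz: "\<not> munit (X j) 0"
      using munit_mzero_iff[OF mindecD(1)[OF mj] nulls_zero] mindecD(2)[OF mj] by blast
    have R_S: "s \<in> R" if "s \<in> S G j" for s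
    proof -
      have "s = (0 :: int => 'r) c * x0 + s" by simp
      thus ?thesis unfolding R_def using that nz mhoms_zero[of "X j" "X j"] by blast
    qed
    have R_sub: "subspace R"
      unfolding subspace_def
    proof (intro conjI ballI allI)
      show "0 \<in> R" using R_S subspace_0[OF S_sub] by blast
      show "x + y \<in> R" if xy: "x \<in> R" "y \<in> R" for x y
      proof -
        obtain f s f' s' where h: "f \<in> mhoms (X j) (X j)" "\<not> munit (X j) f" "s \<in> S G j" "x = f c * x0 + s"
          "f' \<in> mhoms (X j) (X j)" "\<not> munit (X j) f'" "s' \<in> S G j" "y = f' c * x0 + s'" using xy unfolding R_def by blast
        have "x + y = (f + f') c * x0 + (s + s')" using h by (simp add: algebra_simps)
        thus ?thesis unfolding R_def using munit_add[OF mj h(1,5)] mhoms_add[OF h(1,5)] S_add[OF h(3,7)] h(2,6) by blast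
      qed
      show "scale t x \<in> R" if xR: "x \<in> R" for t x
      proof -
        obtain f s where h: "f \<in> mhoms (X j) (X j)" "\<not> munit (X j) f" "s \<in> S G j" "x = f c * x0 + s" using xR unfolding R_def by blast
        have "scale t x = (%n. scale t (f n)) c * x0 + scale t s" using h by (simp add: algebra_simps scale_mult_left)
        thus ?thesis unfolding R_def using not_munit_scale[OF mj h(1,2), of t] mhoms_scale[OF h(1), of t] subspace_scale[OF S_sub h(3), of t] by blast
      qed
    qed
    \<comment> \<open>A map from \<open>X j\<close> to \<open>X l\<close> followed by a map back is
      never a unit, since the two complexes are not isomorphic. So generation of \<open>X j\<close>
      by the other members expresses \<open>x0\<close> with radical coefficients only.\<close>
    have "trace_ideal c X (I - {j}) (X j) \<subseteq> {b. \<forall>x\<in>arr q (?X0 j). b * x \<in> R}"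
    proof (rule trace_ideal_subset)
      show "subspace {b. \<forall>x\<in>arr q (?X0 j). b * x \<in> R}"
        using R_sub unfolding subspace_def by (auto simp: algebra_simps scale_mult_left)
      show "?d j * y \<in> {b. \<forall>x\<in>arr q (?X0 j). b * x \<in> R}" for y using R_S S_d by (auto simp: mult.assoc)
      fix l \<phi> y assume l: "l \<in> I - {j}" and \<phi>: "\<phi> \<in> mhoms (X l) (X j)"
      show "\<phi> c * y \<in> {b. \<forall>x\<in>arr q (?X0 j). b * x \<in> R}"
      proof (rule CollectI, rule ballI)
        fix x assume x: "x \<in> arr q (?X0 j)"
        have "?X0 l * (y * x) * q \<in> arr q (?X0 l)" using dd(1)[of l] l qq by (intro hom_corner) auto
        moreover have "x * q = x" using x by (rule arrD)
        ultimately have "?X0 l * (y * x) \<in> arr q (?X0 l)" by (simp add: mult.assoc)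
        then obtain F s where Fs: "F \<in> mhoms (X j) (X l)" "s \<in> S G l" "?X0 l * (y * x) = F c * x0 + s" using ins l by blast
        have "\<phi> c * y * x = \<phi> c * (?X0 l * (y * x))" using mhomsD(4)[OF \<phi>, of c] by (metis mult.assoc)
        also have "\<dots> = (\<phi> * F) c * x0 + \<phi> c * s" unfolding Fs by (simp add: algebra_simps)
        finally have e: "\<phi> c * y * x = (\<phi> * F) c * x0 + \<phi> c * s" .
        have "\<not> munit (X j) (\<phi> * F)"
          using mindec_retract_meq[OF mj ind Fs(1) \<phi>] ne[OF G(3), of l] l by blast
        moreover have "\<phi> * F \<in> mhoms (X j) (X j)" using \<phi> Fs by (auto intro: mhoms_mult)
        moreover have "\<phi> c * s \<in> S G j" using Fs(2) \<phi> by (rule S_map)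
        ultimately show "\<phi> c * y * x \<in> R" unfolding R_def using e by blast
      qed
    qed
    hence "?X0 j * x0 \<in> R" using gen[OF G(3)] G(4) by blast
    moreover have X0x0: "?X0 j * x0 = x0" using G(4) by (rule arrD)
    ultimately obtain f s where f: "f \<in> mhoms (X j) (X j)" "\<not> munit (X j) f" "s \<in> S G j" "x0 = f c * x0 + s"
      unfolding R_def by auto
    \<comment> \<open>The coefficient \<open>f\<close> of \<open>x0\<close> is in the radical, so
      \<open>ob (X j) - f\<close> is invertible and the equation \<open>x0 = f x0 + s\<close> can be
      solved for \<open>x0\<close> without using \<open>x0\<close>.\<close>
    obtain g where g: "g \<in> mhoms (X j) (X j)" "heq (X j) (X j) (g * (ob (X j) - f)) (ob (X j))"
      using mindec_local[OF mj f(1)] f(2) unfolding munit_def by blast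
    then obtain k where "(g * (ob (X j) - f) - ob (X j)) c = ?d j * k"
      using two_term_nulls[OF X X, OF G(3,3)] unfolding heq_def by blast
    hence k: "g c * (?X0 j - f c) = ?d j * k + ?X0 j" by (simp add: algebra_simps)
    have "g c * s = g c * (?X0 j * x0 - f c * x0)" using f(4) unfolding X0x0 by (metis add_diff_cancel_left')
    also have "\<dots> = g c * (?X0 j - f c) * x0" by (simp add: algebra_simps)
    also have "\<dots> = ?d j * (k * x0) + x0" unfolding k using X0x0 by (simp add: algebra_simps)
    finally have "x0 = g c * s + ?d j * (- (k * x0))" by simp
    hence x0: "x0 \<in> S G j" using S_add[OF S_map[OF f(3) g(1)] S_d[of j "- (k * x0)" G]] by simp
    show "P G"
      unfolding P_def
    proof (intro ballI subsetI)
      fix l y assume l: "l \<in> I" and y: "y \<in> arr q (?X0 l)"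
      obtain F s where Fs: "F \<in> mhoms (X j) (X l)" "s \<in> S G l" "y = F c * x0 + s" using ins[OF y l] by blast
      show "y \<in> S G l" unfolding Fs using S_map[OF x0 Fs(1)] Fs(2) by (rule S_add)
    qed
  qed
  have "\<forall>l\<in>I. \<exists>B. finite B \<and> B \<subseteq> arr q (?X0 l) \<and> arr q (?X0 l) \<subseteq> span B"
    using fin_dim_basis[OF fin_dim_hom[OF qq dd(1)]] by metis
  then obtain B where B: "!!l. l \<in> I ==> finite (B l)" "!!l. l \<in> I ==> B l \<subseteq> arr q (?X0 l)"
    "!!l. l \<in> I ==> arr q (?X0 l) \<subseteq> span (B l)" by metis
  define G0 where "G0 = (SIGMA l:I. B l)"
  have fG0: "finite G0" unfolding G0_def using fin B(1) by auto
  have "P G0"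
    unfolding P_def
  proof
    fix l assume l: "l \<in> I"
    have "B l \<subseteq> S G0 l"
    proof
      fix b assume b: "b \<in> B l"
      \<comment> \<open>The basis vector \<open>b\<close> is generated by the pair
        \<open>(l, b)\<close> with the identity as coefficient.\<close>
      define F where "F g = (if g = (l, b) then ob (X l) else 0)" for g :: "'i \<times> 'r"
      have "(\<Sum>g\<in>G0. F g c * snd g) + ?d l * 0 \<in> S G0 l"
        by (rule S_I) (use mhoms_id[OF two_term_cx[OF X[OF l]]] in \<open>auto simp: F_def mhoms_zero\<close>)
      moreover have "(\<Sum>g\<in>G0. F g c * snd g) = (\<Sum>g\<in>G0. if g = (l, b) then ?X0 l * b else 0)"
        by (rule sum.cong) (auto simp: F_def)
      moreover have "\<dots> = ?X0 l * b" using fG0 b l by (simp add: G0_def)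
      moreover have "?X0 l * b = b" using B(2)[OF l] b by (auto dest: arrD)
      ultimately show "b \<in> S G0 l" by simp
    qed
    thus "arr q (?X0 l) \<subseteq> S G0 l" using B(3)[OF l] span_minimal[OF _ S_sub] by blast
  qed
  moreover have "P G ==> P {}" if "finite G" "G \<subseteq> G0" for G
    using that
  proof (induction G rule: finite_induct)
    case (insert g G)
    obtain j x where g: "g = (j, x)" by fastforce
    have "j \<in> I" "x \<in> arr q (?X0 j)" using insert.prems g B(2) unfolding G0_def by auto
    thus ?case using red[of G j x] insert g by blast
  qed
  ultimately have "P {}" using fG0 by blast
  hence "arr q (?X0 i) \<subseteq> S {} i" using i unfolding P_def by blast
  hence "q \<in> S {} i" using hom_id[OF qq] unfolding q_def by blast
  thus ?thesis unfolding S_def q_def by auto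
qed

end

context hom_finite_ring
begin

text \<open>Changing all signs exchanges the positive and the negative members, so each
  \<open>X j\<close> is generated by the members whose coefficients have the opposite sign, in
  particular by members other than itself.\<close>

lemma vanishing_of_nonzero_relation:
  fixes X :: "'i => 'r mcx" and a :: "'i => real"
  assumes fin: "finite I" and X: "!!i. i \<in> I ==> two_term c (X i)" and ind: "!!i. i \<in> I ==> mindec (X i)"
    and ext: "!!i j. i \<in> I ==> j \<in> I ==> ext_zero c (X i) (X j)"
    and ne: "!!i j. i \<in> I ==> j \<in> I ==> i ~= j ==> \<not> meq (X i) (X j)"
    and sum: "!!J. (\<Sum>i\<in>I. a i * (rk (ob (X i) c) J - rk (ob (X i) (c - 1)) J)) = 0"
    and a: "!!i. i \<in> I ==> a i ~= 0" and i: "i \<in> I"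
  shows "\<exists>z. ob (X i) c = df (X i) (c - 1) * z"
proof (rule nakayama[OF fin X ind ne _ i])
  fix j assume j: "j \<in> I"
  consider "a j < 0" | "a j > 0" using a[OF j] by linarith
  thus "ob (X j) c \<in> trace_ideal c X (I - {j}) (X j)"
  proof cases
    case 1
    have "{i \<in> I. a i > 0} \<subseteq> I - {j}" using 1 by auto
    thus ?thesis using generated_by_positive_part[OF fin X ext sum j 1] trace_ideal_mono by blast
  next
    case 2
    have s: "(\<Sum>i\<in>I. (- a i) * (rk (ob (X i) c) J - rk (ob (X i) (c - 1)) J)) = 0" for J
      using sum[of J] by (simp add: sum_negf)
    have "{i \<in> I. - a i > 0} \<subseteq> I - {j}" using 2 by auto
    thus ?thesis using generated_by_positive_part[OF fin X ext s j] 2 trace_ideal_mono by fastforce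
  qed
qed

text \<open>The differential is a split epimorphism with section \<open>a\<close>, and
  \<open>X\<close> contracts onto its kernel, the image of the projection \<open>q\<close> in degree
  \<open>c - 1\<close>.\<close>

lemma two_term_vanishing_cohomology:
  assumes X: "two_term c X" and z: "ob X c = df X (c - 1) * z"
  obtains q where "q * q = q" "meq X (stalk (c - 1) q)" "rk q = rk (ob X (c - 1)) - rk (ob X c)"
proof -
  let ?X0 = "ob X c" and ?X1 = "ob X (c - 1)" and ?d = "df X (c - 1)"
  note dd = two_term_d[OF X] and c = two_term_cx[OF X]
  define a where "a = ?X1 * z * ?X0"
  have a: "a \<in> arr ?X0 ?X1" unfolding a_def using dd by (intro hom_corner)
  have da: "?d * a = ?X0"
  proof -
    have "?d * a = ?d * ?X1 * z * ?X0" unfolding a_def by (simp add: mult.assoc)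
    also have "\<dots> = ?X0" unfolding dd(4) z[symmetric] dd(1) ..
    finally show ?thesis .
  qed
  have d: "?d \<in> arr ?X1 ?X0" using dd by (intro arrI)
  define q where "q = ?X1 - a * ?d"
  note ha = arrD[OF a] and h' = da assocI[OF da] arrD[OF a] arrD[OF a, THEN assocI] dd dd[THEN assocI]
  have e: "a * ?d * (a * ?d) = a * ?d" by (simp add: mult.assoc h')
  have qq: "q * q = q" unfolding q_def by (simp add: algebra_simps h')
  have dq: "?d * q = 0" unfolding q_def by (simp add: algebra_simps h')
  have Xq: "?X1 * q = q" "q * ?X1 = q" unfolding q_def by (simp_all add: algebra_simps h')
  define f where "f = (%n. if n = c - 1 then q else 0)"
  have f1: "f \<in> mhoms X (stalk (c - 1) q)"
  proof (rule mhomsI)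
    fix n show "f n \<in> arr (ob X n) (ob (stalk (c - 1) q) n)" unfolding f_def by (auto intro: arrI simp: qq Xq)
    show "df (stalk (c - 1) q) n * f n = f (n + 1) * df X n"
      using two_term_df[OF X, of n] unfolding f_def by auto
  qed
  have f2: "f \<in> mhoms (stalk (c - 1) q) X"
  proof (rule mhomsI)
    fix n show "f n \<in> arr (ob (stalk (c - 1) q) n) (ob X n)" unfolding f_def by (auto intro: arrI simp: qq Xq)
    show "df X n * f n = f (n + 1) * df (stalk (c - 1) q) n" unfolding f_def by (auto simp: dq)
  qed
  have "f * f - ob X \<in> nulls X X"
  proof (rule nullsI[of "%n. if n = c then - a else 0"])
    fix n show "(if n = c then - a else 0) \<in> arr (ob X n) (ob X (n - 1))" using a by (auto intro: hom_uminus)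
    show "(f * f - ob X) n = df X (n - 1) * (if n = c then - a else 0) + (if n + 1 = c then - a else 0) * df X n"
    proof -
      consider "n = c" | "n = c - 1" | "n ~= c" "n ~= c - 1" by blast
      thus ?thesis
      proof cases
        case 1
        thus ?thesis by (simp add: f_def da)
      next
        case 2
        thus ?thesis by (simp add: f_def qq) (simp add: q_def)
      next
        case 3
        hence "ob X n = 0" "n + 1 ~= c" using X unfolding two_term_def by auto
        thus ?thesis using 3 by (simp add: f_def)
      qed
    qed
  qed
  moreover have "f * f = ob (stalk (c - 1) q)" unfolding f_def by (auto simp: qq)
  ultimately have m: "meq X (stalk (c - 1) q)" unfolding meq_def mequiv_def heq_def using f1 f2 nulls_zero by force
  have r1: "rk (a * ?d) = rk ?X0"
    by (rule rk_iso[of ?d _ _ a]; (rule arrI)?; simp add: mult.assoc h')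
  have "rk (q + a * ?d) = rk q + rk (a * ?d)"
    using qq e by (intro rk_add) (simp_all add: q_def algebra_simps h')
  hence "rk q = rk ?X1 - rk ?X0" unfolding r1 by (simp add: q_def)
  thus ?thesis using that qq m by blast
qed

text \<open>The members with nonzero coefficient turn out to be stalks in degree
  \<open>c - 1\<close>. Viewed as two-term complexes with upper degree \<open>c - 1\<close>, these
  satisfy the same relation up to sign and have no extensions, so the vanishing result applies once
  more; as their differentials are zero, it makes them zero.\<close>

theorem two_term_independent:
  fixes X :: "'i => 'r mcx" and a :: "'i => real"
  assumes fin: "finite I" and X: "!!i. i \<in> I ==> two_term c (X i)" and ind: "!!i. i \<in> I ==> mindec (X i)"
    and ext: "!!i j. i \<in> I ==> j \<in> I ==> ext_zero c (X i) (X j)"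
    and ne: "!!i j. i \<in> I ==> j \<in> I ==> i ~= j ==> \<not> meq (X i) (X j)"
    and sum: "!!J. (\<Sum>i\<in>I. a i * (rk (ob (X i) c) J - rk (ob (X i) (c - 1)) J)) = 0"
    and i: "i \<in> I"
  shows "a i = 0"
proof (rule ccontr)
  assume ai: "a i ~= 0"
  define K where "K = {i \<in> I. a i ~= 0}"
  have K: "finite K" "K \<subseteq> I" "!!i. i \<in> K ==> a i ~= 0" "i \<in> K" unfolding K_def using fin i ai by auto
  have sumK: "(\<Sum>i\<in>K. a i * (rk (ob (X i) c) J - rk (ob (X i) (c - 1)) J)) = 0" for J
    unfolding sum[of J, symmetric] by (rule sum.mono_neutral_left) (auto simp: K_def fin)
  have "\<forall>i\<in>K. \<exists>z. ob (X i) c = df (X i) (c - 1) * z"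
    using vanishing_of_nonzero_relation[OF K(1) X ind ext ne sumK K(3)] K(2) by blast
  hence "\<forall>i\<in>K. \<exists>q. q * q = q \<and> meq (X i) (stalk (c - 1) q) \<and> rk q = rk (ob (X i) (c - 1)) - rk (ob (X i) c)"
    using two_term_vanishing_cohomology X K(2) by (metis subsetD)
  then obtain q where q: "!!i. i \<in> K ==> q i * q i = q i" "!!i. i \<in> K ==> meq (X i) (stalk (c - 1) (q i))"
    "!!i. i \<in> K ==> rk (q i) = rk (ob (X i) (c - 1)) - rk (ob (X i) c)" by metis
  let ?Y = "%i. stalk (c - 1) (q i)"
  have Y: "mindec (?Y i)" if "i \<in> K" for i
    using mindec_meq[OF ind cx_stalk q(2)] that q K(2) by blast
  have "\<exists>z. ob (?Y i) (c - 1) = df (?Y i) (c - 1 - 1) * z"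
  proof (rule vanishing_of_nonzero_relation[OF K(1) _ Y _ _ _ K(3) K(4)])
    show "two_term (c - 1) (?Y i)" if "i \<in> K" for i using q(1)[OF that] by (rule two_term_stalk)
    show "ext_zero (c - 1) (?Y i) (?Y j)" for i j by (rule ext_zero_stalk)
    show "\<not> meq (?Y i) (?Y j)" if "i \<in> K" "j \<in> K" "i ~= j" for i j
      using ne[of i j] meq_trans[OF meq_trans[OF q(2)[OF that(1)]] meq_sym[OF q(2)[OF that(2)]]] that K(2) by blast
    show "(\<Sum>i\<in>K. a i * (rk (ob (?Y i) (c - 1)) J - rk (ob (?Y i) (c - 1 - 1)) J)) = 0" for J
    proof -
      have "(\<Sum>i\<in>K. a i * (rk (ob (?Y i) (c - 1)) J - rk (ob (?Y i) (c - 1 - 1)) J)) =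
          (\<Sum>i\<in>K. - (a i * (rk (ob (X i) c) J - rk (ob (X i) (c - 1)) J)))"
        by (rule sum.cong) (simp_all add: q(3) rk_zero algebra_simps)
      thus ?thesis using sumK[of J] by (simp add: sum_negf)
    qed
  qed
  hence "q i = 0" by simp
  hence "ob (?Y i) = 0" by (simp add: fun_eq_iff)
  hence "mzero (?Y i)" unfolding mzero_def using nulls_zero by metis
  thus False using mindecD(2)[OF Y[OF K(4)]] by blast
qed

section \<open>Euler characteristics\<close>

definition sg :: "int => real" where "sg n = (if even n then 1 else - 1)"

lemma sg_simps: "sg (n + 1) = - sg n" "sg (n - 1) = - sg n" "sg n * sg n = 1" "sg n ~= 0"
  unfolding sg_def by auto

definition chi :: "'r mcx => 'r set => real" where
  "chi E J = (\<Sum>n | ob E n ~= 0. sg n * rk (ob E n) J)"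

lemma chi_superset:
  assumes "finite S" "!!n. n \<notin> S ==> ob E n = 0"
  shows "chi E J = (\<Sum>n\<in>S. sg n * rk (ob E n) J)"
  unfolding chi_def by (rule sum.mono_neutral_left) (use assms in \<open>auto simp: rk_zero\<close>)

lemma chi_stalk: "chi (stalk c e) J = sg c * rk e J"
  using chi_superset[of "{c}" "stalk c e"] by simp

lemma chi_two_term: "two_term c E ==> chi E J = sg c * (rk (ob E c) J - rk (ob E (c - 1)) J)"
  using chi_superset[of "{c, c - 1}" E J] unfolding two_term_def by (auto simp: sg_simps algebra_simps)

lemma chi_bsum:
  assumes "cx E" "cx F" shows "chi (bsum E F) J = chi E J + chi F J"
proof -
  let ?S = "{n. ob E n ~= 0} \<union> {n. ob F n ~= 0}"
  have S: "finite ?S" using cxD(4)[OF assms(1)] cxD(4)[OF assms(2)] by simp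
  have "chi (bsum E F) J = (\<Sum>n\<in>?S. sg n * rk (bs (ob E n) (ob F n)) J)"
    by (subst chi_superset[OF S]) (auto simp: bsum_def bs_zero)
  also have "\<dots> = (\<Sum>n\<in>?S. sg n * rk (ob E n) J) + (\<Sum>n\<in>?S. sg n * rk (ob F n) J)"
    using rk_bs cxD(1)[OF assms(1)] cxD(1)[OF assms(2)] by (simp add: distrib_left sum.distrib)
  also have "\<dots> = chi E J + chi F J"
    using chi_superset[OF S, of E J] chi_superset[OF S, of F J] by simp
  finally show ?thesis .
qed

text \<open>The complex of vector spaces \<open>Hom(E, J)\<close>: its cocycles and coboundaries in degree \<open>n\<close>.\<close>

definition rcyc :: "'r mcx => 'r set => int => 'r set" where
  "rcyc E J n = {x \<in> rcorner J (ob E n). x * df E (n - 1) = 0}"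

definition rbnd :: "'r mcx => 'r set => int => 'r set" where
  "rbnd E J n = (%x. x * df E n) ` rcorner J (ob E (n + 1))"

lemma rcyc_rbnd:
  assumes J: "rideal J" and E: "cx E"
  shows "subspace (rcyc E J n)" "fin_dim (rcyc E J n)" "subspace (rbnd E J n)" "fin_dim (rbnd E J n)"
    "rbnd E J n \<subseteq> rcyc E J n" "dim (rcorner J (ob E n)) = dim (rcyc E J n) + dim (rbnd E J (n - 1))"
proof -
  note c = rcorner[OF J cxD(1)[OF E]]
  have sub: "rcyc E J n \<subseteq> rcorner J (ob E n)" unfolding rcyc_def by blast
  show "subspace (rcyc E J n)" using c(1)[of n] unfolding rcyc_def subspace_def
    by (auto simp: algebra_simps scale_mult_left)
  show "fin_dim (rcyc E J n)" using fin_dim_subset[OF c(2), of _ n] sub span_superset by (metis subset_trans)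
  show "subspace (rbnd E J n)" for n unfolding rbnd_def by (intro subspace_linear_image linear_mult_right c)
  have b: "rbnd E J n \<subseteq> rcorner J (ob E n)" for n
    using cxD(8)[OF E, of n] J unfolding rbnd_def rcorner_def rideal_def by (auto simp: mult.assoc)
  show "fin_dim (rbnd E J n)" for n using fin_dim_subset[OF c(2), of _ n] b[of n] span_superset by (metis subset_trans)
  show "rbnd E J n \<subseteq> rcyc E J n" using b[of n] cxD(5)[OF E, of n] unfolding rcyc_def rbnd_def by (auto simp: mult.assoc)
  have z: "subspace {0}" "fin_dim {0}" by (auto simp: subspace_def fin_dim_finite)
  have "{x * df E (n - 1) + y | x y. x \<in> rcorner J (ob E n) \<and> y \<in> {0}} = rbnd E J (n - 1)" unfolding rbnd_def by auto
  thus "dim (rcorner J (ob E n)) = dim (rcyc E J n) + dim (rbnd E J (n - 1))"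
    using dim_plus_preimage[OF c z linear_mult_right[of "df E (n - 1)"], of n]
    by (simp add: dim_zero rcyc_def)
qed

text \<open>Each dimension is that of the cocycles plus that of the coboundaries one degree lower;
  reindexing the second summand flips its sign. The rank at the upper end is zero because the next
  object vanishes.\<close>

lemma chi_homology:
  assumes J: "rideal J" and E: "cx E" and S: "!!n. ob E n ~= 0 ==> n \<in> {a..b}"
  shows "chi E J = (\<Sum>n\<in>{a..b}. sg n * (real (dim (rcyc E J n)) - real (dim (rbnd E J n))))"
proof -
  let ?r = "%n. real (dim (rbnd E J n))"
  have r0: "?r n = 0" if "n \<notin> {a..b}" for n
  proof -
    have "ob E n = 0" using S that by blast
    hence "rbnd E J n \<subseteq> {0}" using rcyc_rbnd(5)[OF J E, of n] unfolding rcyc_def rcorner_def by auto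
    hence "dim (rbnd E J n) \<le> dim {0}" by (intro dim_mono_fin_dim) (auto simp: fin_dim_finite intro: span_base)
    thus ?thesis by (simp add: dim_zero)
  qed
  have "ob E (b + 1) = 0" using S[of "b + 1"] by auto
  hence "rbnd E J b \<subseteq> {0}" unfolding rbnd_def rcorner_def by auto
  hence "dim (rbnd E J b) \<le> dim {0}" by (intro dim_mono_fin_dim) (auto simp: fin_dim_finite intro: span_base)
  hence rb: "?r b = 0" by (simp add: dim_zero)
  have "chi E J = (\<Sum>n\<in>{a..b}. sg n * rk (ob E n) J)" using S by (intro chi_superset) auto
  also have "\<dots> = (\<Sum>n\<in>{a..b}. sg n * real (dim (rcyc E J n))) + (\<Sum>n\<in>{a..b}. sg n * ?r (n - 1))"
    unfolding rk_def using J rcyc_rbnd(6)[OF J E] by (simp add: distrib_left sum.distrib)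
  \<comment> \<open>The range moves down by one; its two ends are then adjusted by ranks that are
    zero.\<close>
  also have "(\<Sum>n\<in>{a..b}. sg n * ?r (n - 1)) = (\<Sum>n\<in>{a-1..b-1}. - (sg n * ?r n))"
    by (rule sum.reindex_bij_witness[of _ "%n. n + 1" "%n. n - 1"]) (auto simp: sg_simps)
  also have "\<dots> = (\<Sum>n\<in>{a-1..b}. - (sg n * ?r n))"
  proof (rule sum.mono_neutral_left)
    show "\<forall>n\<in>{a - 1..b} - {a - 1..b - 1}. - (sg n * ?r n) = 0"
    proof
      fix n assume "n \<in> {a - 1..b} - {a - 1..b - 1}"
      hence "n = b" by auto
      thus "- (sg n * ?r n) = 0" using rb by simp
    qed
  qed auto
  also have "\<dots> = (\<Sum>n\<in>{a..b}. - (sg n * ?r n))" by (rule sum.mono_neutral_right) (use r0 in auto)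
  finally show ?thesis by (simp add: sum.distrib[symmetric] algebra_simps)
qed

text \<open>Right multiplication by \<open>g\<close> is injective on homology as soon as
  \<open>g * f\<close> is homotopic to the identity. A one-sided inverse gives the inequality, and
  using it in both directions gives invariance of the Euler characteristic.\<close>

lemma homology_dim_le:
  assumes J: "rideal J" and E: "cx E" and F: "cx F" and f: "f \<in> mhoms E F" "g \<in> mhoms F E" "heq E E (g * f) (ob E)"
  shows "dim (rcyc E J n) + dim (rbnd F J n) \<le> dim (rcyc F J n) + dim (rbnd E J n)"
proof -
  note e = rcyc_rbnd[OF J E] and f' = rcyc_rbnd[OF J F]
  obtain h where h: "!!n. h n \<in> arr (ob E n) (ob E (n - 1))"
    "!!n. (g * f - ob E) n = df E (n - 1) * h n + h (n + 1) * df E n" using f(3) unfolding heq_def nulls_def by blast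
  have gf: "g n * f n = ob E n + df E (n - 1) * h n + h (n + 1) * df E n"
    using h(2)[of n] by (simp add: algebra_simps)
  have Jr: "x * y \<in> J" if "x \<in> J" for x y using J that unfolding rideal_def by blast
  have img: "x * g n \<in> rcyc F J n" if "x \<in> rcyc E J n" for x
    using that mhomsD(4)[OF f(2), of n] mhomsD(5)[OF f(2), of n] Jr unfolding rcyc_def rcorner_def
    by (auto simp: mult.assoc) (metis mult.assoc mult_zero_left)
  have "{x * g n + y | x y. x \<in> rcyc E J n \<and> y \<in> rbnd F J n} \<subseteq> rcyc F J n"
    using img subspace_add[OF f'(1)] f'(5)[of n] by blast
  hence 1: "dim {x * g n + y | x y. x \<in> rcyc E J n \<and> y \<in> rbnd F J n} \<le> dim (rcyc F J n)"
    using span_superset[of "rcyc F J n"] by (intro dim_mono_fin_dim f') blast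
  have "{x \<in> rcyc E J n. x * g n \<in> rbnd F J n} \<subseteq> rbnd E J n"
  proof
    fix x assume "x \<in> {x \<in> rcyc E J n. x * g n \<in> rbnd F J n}"
    then obtain y where x: "x \<in> J" "x * ob E n = x" "x * df E (n - 1) = 0" and y: "y \<in> J" "y * ob F (n + 1) = y" "x * g n = y * df F n"
      unfolding rcyc_def rbnd_def rcorner_def by blast
    have "x * g n * f n = y * f (n + 1) * df E n" unfolding y(3) using mhomsD(2)[OF f(1), of n] by (simp add: mult.assoc)
    moreover have "x * g n * f n = x * ob E n + x * df E (n - 1) * h n + x * h (n + 1) * df E n"
      using gf by (simp add: mult.assoc distrib_left)
    ultimately have "x = (y * f (n + 1) - x * h (n + 1)) * df E n" using x by (simp add: algebra_simps)
    moreover have "y * f (n + 1) - x * h (n + 1) \<in> rcorner J (ob E (n + 1))"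
      unfolding rcorner_def using Jr[OF x(1)] Jr[OF y(1)] J mhomsD(4)[OF f(1), of "n + 1"] arrD(2)[OF h(1)[of "n + 1"]]
      by (auto simp: left_diff_distrib mult.assoc rideal_def intro: subspace_diff)
    ultimately show "x \<in> rbnd E J n" unfolding rbnd_def by blast
  qed
  hence 2: "dim {x \<in> rcyc E J n. x * g n \<in> rbnd F J n} \<le> dim (rbnd E J n)"
    using span_superset[of "rbnd E J n"] by (intro dim_mono_fin_dim e) blast
  show ?thesis using dim_plus_preimage[OF e(1,2)[of n] f'(3,4)[of n] linear_mult_right[of "g n"]] 1 2 by linarith
qed

theorem chi_meq:
  assumes E: "cx E" and F: "cx F" and "meq E F"
  shows "chi E = chi F"
proof
  fix J
  obtain f g where fg: "f \<in> mhoms E F" "g \<in> mhoms F E" "heq E E (g * f) (ob E)" "heq F F (f * g) (ob F)"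
    using assms(3) unfolding meq_def mequiv_def by blast
  show "chi E J = chi F J"
  proof (cases "rideal J")
    case True
    define S where "S = insert 0 ({n. ob E n ~= 0} \<union> {n. ob F n ~= 0})"
    have S: "finite S" unfolding S_def using cxD(4)[OF E] cxD(4)[OF F] by simp
    have SE: "n \<in> {Min S..Max S}" if "ob E n ~= 0 \<or> ob F n ~= 0" for n using S that unfolding S_def by auto
    have "real (dim (rcyc E J n)) - real (dim (rbnd E J n)) = real (dim (rcyc F J n)) - real (dim (rbnd F J n))" for n
      using homology_dim_le[OF True E F fg(1-3), of n] homology_dim_le[OF True F E fg(2,1,4), of n] by linarith
    thus ?thesis using chi_homology[OF True E, of "Min S" "Max S"] chi_homology[OF True F, of "Min S" "Max S"] SE by simp
  qed (simp add: chi_def rk_def)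
qed

end

definition fscale :: "real => ('x => real) => 'x => real" where
  "fscale t f = (%x. t * f x)"

interpretation fun_vs: linear_space fscale
  by unfold_locales (auto simp: fscale_def algebra_simps)

section \<open>Retracts, sums and powers of two-term complexes\<close>

definition zero_cx :: "'r::ring mcx" where "zero_cx = \<lparr>ob = 0, df = 0\<rparr>"

lemma zero_cx_sel [simp]: "ob zero_cx = 0" "df zero_cx = 0"
  unfolding zero_cx_def by auto

lemma cx_zero: "cx zero_cx" and two_term_zero: "two_term c zero_cx" and mzero_zero: "mzero zero_cx"
  unfolding two_term_def cx_def mzero_def by (auto intro: nulls_zero)

lemma mzero_meq_zero: "cx F ==> mzero F ==> meq F zero_cx"
proof -
  assume F: "cx F" "mzero F"
  have "0 - ob F \<in> nulls F F" using F(2) nulls_uminus unfolding mzero_def by fastforce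
  hence "heq F F (0 * 0) (ob F)" unfolding heq_def by simp
  thus ?thesis unfolding meq_def mequiv_def
    using mhoms_zero[of F zero_cx] mhoms_zero[of zero_cx F] by (intro exI[of _ 0] conjI) (simp_all add: heq_refl)
qed

lemma mbiprod_meq_left:
  assumes "mbiprod E X Y" "meq X X'"
  shows "mbiprod E X' Y"
proof -
  obtain u v u' v' where h: "u \<in> mhoms X E" "v \<in> mhoms E X" "u' \<in> mhoms Y E" "v' \<in> mhoms E Y"
     "heq X X (v * u) (ob X)" "heq Y Y (v' * u') (ob Y)" "heq Y X (v * u') 0" "heq X Y (v' * u) 0"
     "heq E E (u * v + u' * v') (ob E)" using assms(1) unfolding mbiprod_def by blast
  obtain f g where fg: "f \<in> mhoms X X'" "g \<in> mhoms X' X" "heq X X (g * f) (ob X)" "heq X' X' (f * g) (ob X')"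
    using assms(2) unfolding meq_def mequiv_def by blast
  show ?thesis unfolding mbiprod_def
  proof (intro exI conjI)
    show "u * g \<in> mhoms X' E" "f * v \<in> mhoms E X'" using h fg by (auto intro: mhoms_mult)
    show "u' \<in> mhoms Y E" "v' \<in> mhoms E Y" "heq Y Y (v' * u') (ob Y)" by fact+
    show "heq X' X' (f * v * (u * g)) (ob X')" by (rule heq_mult_id[OF fg(2,1,4) h(1,2,5)])
    show "heq Y X' (f * v * u') 0" using heq_left[OF h(7) fg(1)] by (simp add: mult.assoc)
    show "heq X' Y (v' * (u * g)) 0" using heq_right[OF h(8) fg(2)] by (simp add: mult.assoc)
    have "heq E E (u * (g * f) * v) (u * ob X * v)" by (intro heq_right[where F = X] heq_left[where F = X] h fg)
    hence "heq E E (u * g * (f * v)) (u * v)" unfolding mhoms_id_right[OF h(1)] by (simp add: mult.assoc)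
    hence "heq E E (u * g * (f * v) + u' * v') (u * v + u' * v')" by (intro heq_add heq_refl)
    thus "heq E E (u * g * (f * v) + u' * v') (ob E)" using h(9) by (rule heq_trans)
  qed
qed

text \<open>An extension class is transported to \<open>F\<close> and \<open>G\<close>, split there
  and transported back. The homotopies between the round trips and the identities add terms which
  again have the form \<open>s d + d h\<close>.\<close>

lemma ext_zero_retract:
  assumes t: "two_term c X" "two_term c Y" "two_term c F" "two_term c G"
    and r: "mretract X F" "mretract Y G" and ext: "ext_zero c F G"
  shows "ext_zero c X Y"
  unfolding ext_zero_def
proof
  fix x assume x: "x \<in> arr (ob X (c - 1)) (ob Y c)"
  obtain a b where a: "a \<in> mhoms X F" "b \<in> mhoms F X" "heq X X (b * a) (ob X)" using r(1) unfolding mretract_def by blast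
  obtain a' b' where a': "a' \<in> mhoms Y G" "b' \<in> mhoms G Y" "heq Y Y (b' * a') (ob Y)" using r(2) unfolding mretract_def by blast
  obtain k where k: "k \<in> arr (ob X c) (ob X (c - 1))" "(b * a - ob X) (c - 1) = k * df X (c - 1)"
    using two_term_nulls[OF t(1,1)] a(3) unfolding heq_def by metis
  obtain k' where k': "k' \<in> arr (ob Y c) (ob Y (c - 1))" "(b' * a' - ob Y) c = df Y (c - 1) * k'"
    using two_term_nulls[OF t(2,2)] a'(3) unfolding heq_def by metis
  have "a' c * x * b (c - 1) \<in> arr (ob F (c - 1)) (ob G c)" using x mhomsD(1)[OF a'(1)] mhomsD(1)[OF a(2)]
    by (auto intro: hom_mult)
  then obtain s h where sh: "s \<in> arr (ob F c) (ob G c)" "h \<in> arr (ob F (c - 1)) (ob G (c - 1))"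
    "a' c * x * b (c - 1) = s * df F (c - 1) + df G (c - 1) * h" using ext_zeroD[OF ext] by blast
  have xx: "ob Y c * x = x" "x * ob X (c - 1) = x" using x by (auto dest: arrD)
  have ba: "b (c - 1) * a (c - 1) = ob X (c - 1) + k * df X (c - 1)" using k(2) by (simp add: algebra_simps)
  have ba': "b' c * a' c = ob Y c + df Y (c - 1) * k'" using k'(2) by (simp add: algebra_simps)
  have "b' c * (a' c * x * b (c - 1)) * a (c - 1) = (b' c * a' c) * x * (b (c - 1) * a (c - 1))" by (simp add: mult.assoc)
  also have "\<dots> = x + x * k * df X (c - 1) + df Y (c - 1) * (k' * x * (ob X (c - 1) + k * df X (c - 1)))"
    unfolding ba ba' by (simp add: algebra_simps xx xx[THEN mult_eq_assoc])
  finally have 1: "b' c * (a' c * x * b (c - 1)) * a (c - 1) =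
     x + x * k * df X (c - 1) + df Y (c - 1) * (k' * x * (ob X (c - 1) + k * df X (c - 1)))" .
  have "b' c * (a' c * x * b (c - 1)) * a (c - 1) =
     b' c * s * (df F (c - 1) * a (c - 1)) + (b' c * df G (c - 1)) * h * a (c - 1)"
    unfolding sh(3) by (simp add: algebra_simps)
  also have "\<dots> = b' c * s * a c * df X (c - 1) + df Y (c - 1) * (b' (c - 1) * h * a (c - 1))"
    unfolding mhomsD(5)[OF a(1)] mhomsD(5)[OF a'(2), symmetric] by (simp add: mult.assoc)
  finally have "x = (b' c * s * a c - x * k) * df X (c - 1) +
     df Y (c - 1) * (b' (c - 1) * h * a (c - 1) - k' * x * (ob X (c - 1) + k * df X (c - 1)))"
    using 1 by (simp add: algebra_simps)
  moreover have "b' c * s * a c - x * k \<in> arr (ob X c) (ob Y c)"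
    using sh(1) x k(1) mhomsD(1)[OF a(1)] mhomsD(1)[OF a'(2)] by (auto intro!: hom_diff intro: hom_mult)
  moreover have "ob X (c - 1) + k * df X (c - 1) \<in> arr (ob X (c - 1)) (ob X (c - 1))"
    using k(1) cxD(6)[OF two_term_cx[OF t(1)], of c] hom_id[OF cxD(1)[OF two_term_cx[OF t(1)], of "c - 1"]]
    by (auto intro!: hom_add intro: hom_mult)
  hence "b' (c - 1) * h * a (c - 1) - k' * x * (ob X (c - 1) + k * df X (c - 1)) \<in> arr (ob X (c - 1)) (ob Y (c - 1))"
    using sh(2) x k'(1) mhomsD(1)[OF a(1)] mhomsD(1)[OF a'(2)] by (intro hom_diff) (auto intro: hom_mult)
  ultimately show "\<exists>s\<in>arr (ob X c) (ob Y c). \<exists>h\<in>arr (ob X (c - 1)) (ob Y (c - 1)). x = s * df X (c - 1) + df Y (c - 1) * h"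
    by blast
qed

context hom_finite_ring
begin

text \<open>A retract up to homotopy yields the homotopy idempotent \<open>a * b\<close>. Its strict
  lift represents \<open>X\<close> by a complex in the degrees of \<open>F\<close>.\<close>

lemma retract_split:
  fixes X F :: "'r mcx"
  assumes X: "cx X" and F: "cx F" and r: "mretract X F"
  obtains p where "p \<in> mhoms F F" "p * p = p" "meq X (sub_cx F p)"
proof -
  obtain a b where a: "a \<in> mhoms X F" "b \<in> mhoms F X" "heq X X (b * a) (ob X)" using r unfolding mretract_def by blast
  have ab: "a * b \<in> mhoms F F" using a by (auto intro: mhoms_mult)
  have "heq F F (a * (b * a) * b) (a * ob X * b)" by (intro heq_right[where F = X] heq_left[where F = X] a)
  hence "heq F F (a * b * (a * b)) (a * b)" unfolding mhoms_id_right[OF a(1)] by (simp add: mult.assoc)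
  then obtain p where p: "p \<in> mhoms F F" "p * p = p" "heq F F (a * b) p" using lift_idempotent[OF F ab] by blast
  note s = sub_cx[OF F p(1,2)]
  have "heq X X (b * p * (p * a)) (b * (a * b) * a)"
  proof -
    have "b * p * (p * a) = b * p * a" using p(2) by (metis mult.assoc)
    thus ?thesis using heq_right[OF heq_left[OF heq_sym[OF p(3)] a(2)] a(1)] by simp
  qed
  also have "b * (a * b) * a = b * a * (b * a)" by (simp add: mult.assoc)
  also have "heq X X \<dots> (ob X)"
    using heq_trans[OF heq_right[OF a(3) mhoms_mult[OF a(1,2)]]] a(3) mhoms_id_left[OF mhoms_mult[OF a(1,2)]] by simp
  finally have 1: "heq X X (b * p * (p * a)) (ob X)" .
  have "heq (sub_cx F p) (sub_cx F p) (p * (a * b) * p) (p * p * p)"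
    by (intro heq_right[where F = F] heq_left[where F = F] p s)
  hence 2: "heq (sub_cx F p) (sub_cx F p) (p * a * (b * p)) (ob (sub_cx F p))" using p(2) by (simp add: mult.assoc)
  have "meq X (sub_cx F p)" unfolding meq_def mequiv_def
    using 1 2 mhoms_mult[OF a(1) s(3)] mhoms_mult[OF s(2) a(2)] by blast
  thus ?thesis using that p by blast
qed

lemma retract_complement:
  fixes X F :: "'r mcx"
  assumes X: "cx X" and F: "cx F" and r: "mretract X F"
  obtains Y where "cx Y" "meq F (bsum X Y)" "!!n. ob F n = 0 ==> ob Y n = 0"
proof -
  obtain p where p: "p \<in> mhoms F F" "p * p = p" "meq X (sub_cx F p)" using retract_split[OF X F r] .
  note s = mbiprod_sub_cx[OF F p(1,2)]
  let ?Y = "sub_cx F (ob F - p)"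
  have Y: "cx ?Y" by (rule sub_cx[OF F s(1,2)])
  moreover have "mbiprod F X ?Y" using s(3) meq_sym[OF p(3)] by (rule mbiprod_meq_left)
  hence "meq F (bsum X ?Y)" by (rule mbiprod_meq[OF X Y])
  moreover have "ob ?Y n = 0" if "ob F n = 0" for n using mhomsD(3)[OF s(1), of n] that by simp
  ultimately show ?thesis using that by blast
qed

lemma two_term_bsum: "two_term c X ==> two_term c Y ==> two_term c (bsum X Y)"
  using bsum_cx(1)[of X Y] bs_zero unfolding two_term_def by (auto simp: bsum_def)

lemma bsum_df:
  assumes "cx X" "cx Y"
  shows "df (bsum X Y) n * bi1 X Y n = bi1 X Y (n + 1) * df X n" "df (bsum X Y) n * bi2 X Y n = bi2 X Y (n + 1) * df Y n"
    "bp1 X Y (n + 1) * df (bsum X Y) n = df X n * bp1 X Y n" "bp2 X Y (n + 1) * df (bsum X Y) n = df Y n * bp2 X Y n"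
  using bsum_cx(2-5)[OF assms] mhomsD(2) by metis+

lemma bsum_pointwise:
  assumes "cx X" "cx Y"
  shows "bp1 X Y n * bi1 X Y n = ob X n" "bp2 X Y n * bi2 X Y n = ob Y n"
    "bp1 X Y n * bi2 X Y n = 0" "bp2 X Y n * bi1 X Y n = 0"
    "bi1 X Y n * bp1 X Y n + bi2 X Y n * bp2 X Y n = ob (bsum X Y) n"
  using bsum_cx(6-10)[OF assms] by (simp_all add: fun_eq_iff)

lemma ext_zero_bsum_left:
  assumes t: "two_term c X" "two_term c Y" "two_term c Z" and e: "ext_zero c X Z" "ext_zero c Y Z"
  shows "ext_zero c (bsum X Y) Z"
  unfolding ext_zero_def
proof
  let ?S = "bsum X Y"
  note b = bsum_cx[OF two_term_cx[OF t(1)] two_term_cx[OF t(2)]]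
  note d = bsum_df[OF two_term_cx[OF t(1)] two_term_cx[OF t(2)], of "c - 1", simplified]
  fix x assume x: "x \<in> arr (ob ?S (c - 1)) (ob Z c)"
  have "x * bi1 X Y (c - 1) \<in> arr (ob X (c - 1)) (ob Z c)" "x * bi2 X Y (c - 1) \<in> arr (ob Y (c - 1)) (ob Z c)"
    using x mhomsD(1)[OF b(2)] mhomsD(1)[OF b(3)] by (auto intro: hom_mult)
  then obtain s h s' h' where sh: "s \<in> arr (ob X c) (ob Z c)" "h \<in> arr (ob X (c - 1)) (ob Z (c - 1))"
    "x * bi1 X Y (c - 1) = s * df X (c - 1) + df Z (c - 1) * h"
    "s' \<in> arr (ob Y c) (ob Z c)" "h' \<in> arr (ob Y (c - 1)) (ob Z (c - 1))"
    "x * bi2 X Y (c - 1) = s' * df Y (c - 1) + df Z (c - 1) * h'" using e by (metis ext_zeroD)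
  have "x = x * ob ?S (c - 1)" using arrD(2)[OF x] by simp
  also have "\<dots> = x * bi1 X Y (c - 1) * bp1 X Y (c - 1) + x * bi2 X Y (c - 1) * bp2 X Y (c - 1)"
    unfolding bsum_pointwise(5)[OF two_term_cx[OF t(1)] two_term_cx[OF t(2)], symmetric] by (simp add: distrib_left mult.assoc)
  also have "\<dots> = s * (df X (c - 1) * bp1 X Y (c - 1)) + s' * (df Y (c - 1) * bp2 X Y (c - 1)) +
     df Z (c - 1) * (h * bp1 X Y (c - 1) + h' * bp2 X Y (c - 1))" unfolding sh by (simp add: algebra_simps)
  also have "\<dots> = (s * bp1 X Y c + s' * bp2 X Y c) * df ?S (c - 1) + df Z (c - 1) * (h * bp1 X Y (c - 1) + h' * bp2 X Y (c - 1))"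
    unfolding d(3,4)[symmetric] by (simp add: algebra_simps)
  finally have "x = (s * bp1 X Y c + s' * bp2 X Y c) * df ?S (c - 1) + df Z (c - 1) * (h * bp1 X Y (c - 1) + h' * bp2 X Y (c - 1))" .
  moreover have "s * bp1 X Y c + s' * bp2 X Y c \<in> arr (ob ?S c) (ob Z c)"
    "h * bp1 X Y (c - 1) + h' * bp2 X Y (c - 1) \<in> arr (ob ?S (c - 1)) (ob Z (c - 1))"
    using sh mhomsD(1)[OF b(4)] mhomsD(1)[OF b(5)] by (auto intro!: hom_add intro: hom_mult)
  ultimately show "\<exists>s\<in>arr (ob ?S c) (ob Z c). \<exists>h\<in>arr (ob ?S (c - 1)) (ob Z (c - 1)). x = s * df ?S (c - 1) + df Z (c - 1) * h"
    by blast
qed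

lemma ext_zero_bsum_right:
  assumes t: "two_term c X" "two_term c Y" "two_term c Z" and e: "ext_zero c Z X" "ext_zero c Z Y"
  shows "ext_zero c Z (bsum X Y)"
  unfolding ext_zero_def
proof
  let ?S = "bsum X Y"
  note b = bsum_cx[OF two_term_cx[OF t(1)] two_term_cx[OF t(2)]]
  note d = bsum_df[OF two_term_cx[OF t(1)] two_term_cx[OF t(2)], of "c - 1", simplified]
  fix x assume x: "x \<in> arr (ob Z (c - 1)) (ob ?S c)"
  have "bp1 X Y c * x \<in> arr (ob Z (c - 1)) (ob X c)" "bp2 X Y c * x \<in> arr (ob Z (c - 1)) (ob Y c)"
    using x mhomsD(1)[OF b(4)] mhomsD(1)[OF b(5)] by (auto intro: hom_mult)
  then obtain s h s' h' where sh: "s \<in> arr (ob Z c) (ob X c)" "h \<in> arr (ob Z (c - 1)) (ob X (c - 1))"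
    "bp1 X Y c * x = s * df Z (c - 1) + df X (c - 1) * h"
    "s' \<in> arr (ob Z c) (ob Y c)" "h' \<in> arr (ob Z (c - 1)) (ob Y (c - 1))"
    "bp2 X Y c * x = s' * df Z (c - 1) + df Y (c - 1) * h'" using e by (metis ext_zeroD)
  have "x = ob ?S c * x" using arrD(1)[OF x] by simp
  also have "\<dots> = bi1 X Y c * (bp1 X Y c * x) + bi2 X Y c * (bp2 X Y c * x)"
    unfolding bsum_pointwise(5)[OF two_term_cx[OF t(1)] two_term_cx[OF t(2)], symmetric] by (simp add: distrib_right mult.assoc)
  also have "\<dots> = (bi1 X Y c * s + bi2 X Y c * s') * df Z (c - 1) +
     (bi1 X Y c * df X (c - 1) * h + bi2 X Y c * df Y (c - 1) * h')" unfolding sh by (simp add: algebra_simps)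
  also have "\<dots> = (bi1 X Y c * s + bi2 X Y c * s') * df Z (c - 1) + df ?S (c - 1) * (bi1 X Y (c - 1) * h + bi2 X Y (c - 1) * h')"
    unfolding d(1,2)[symmetric] by (simp add: algebra_simps)
  finally have "x = (bi1 X Y c * s + bi2 X Y c * s') * df Z (c - 1) + df ?S (c - 1) * (bi1 X Y (c - 1) * h + bi2 X Y (c - 1) * h')" .
  moreover have "bi1 X Y c * s + bi2 X Y c * s' \<in> arr (ob Z c) (ob ?S c)"
    "bi1 X Y (c - 1) * h + bi2 X Y (c - 1) * h' \<in> arr (ob Z (c - 1)) (ob ?S (c - 1))"
    using sh mhomsD(1)[OF b(2)] mhomsD(1)[OF b(3)] by (auto intro!: hom_add intro: hom_mult)
  ultimately show "\<exists>s\<in>arr (ob Z c) (ob ?S c). \<exists>h\<in>arr (ob Z (c - 1)) (ob ?S (c - 1)). x = s * df Z (c - 1) + df ?S (c - 1) * h"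
    by blast
qed

fun pow_cx :: "nat => 'r mcx => 'r mcx" where
  "pow_cx 0 E = zero_cx"
| "pow_cx (Suc r) E = bsum (pow_cx r E) E"

lemma cx_pow: "cx E ==> cx (pow_cx r E)"
  by (induction r) (auto simp: cx_zero bsum_cx)

lemma two_term_pow: "two_term c E ==> two_term c (pow_cx r E)"
  by (induction r) (auto simp: two_term_zero two_term_bsum)

lemma ext_zero_zero:
  fixes F :: "'r mcx"
  shows "ext_zero c zero_cx F" "ext_zero c F zero_cx"
proof -
  have z: "\<exists>s\<in>arr e f. \<exists>h\<in>arr e' f'. 0 = s * d + d' * h" for e f e' f' d d' :: 'r
    by (intro bexI[of _ 0]) auto
  show "ext_zero c zero_cx F"
    unfolding ext_zero_def
  proof
    fix x assume "x \<in> arr (ob zero_cx (c - 1)) (ob F c)"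
    hence x: "x = 0" by (auto dest: hom_from_zero)
    show "\<exists>s\<in>arr (ob zero_cx c) (ob F c). \<exists>h\<in>arr (ob zero_cx (c - 1)) (ob F (c - 1)).
        x = s * df zero_cx (c - 1) + df F (c - 1) * h" unfolding x by (rule z)
  qed
  show "ext_zero c F zero_cx"
    unfolding ext_zero_def
  proof
    fix x assume "x \<in> arr (ob F (c - 1)) (ob zero_cx c)"
    hence x: "x = 0" by (auto dest: hom_to_zero)
    show "\<exists>s\<in>arr (ob F c) (ob zero_cx c). \<exists>h\<in>arr (ob F (c - 1)) (ob zero_cx (c - 1)).
        x = s * df F (c - 1) + df zero_cx (c - 1) * h" unfolding x by (rule z)
  qed
qed

lemma ext_zero_pow_left: "two_term c E ==> two_term c F ==> ext_zero c E F ==> ext_zero c (pow_cx r E) F"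
  by (induction r) (auto simp: ext_zero_zero intro: ext_zero_bsum_left two_term_pow)

lemma ext_zero_pow_right: "two_term c E ==> two_term c F ==> ext_zero c F E ==> ext_zero c F (pow_cx r E)"
  by (induction r) (auto simp: ext_zero_zero intro: ext_zero_bsum_right two_term_pow)

text \<open>The additive closure of \<open>E\<close> in the homotopy category, with retracts of
  powers in place of direct summands. Since idempotents split, the two notions agree.\<close>

definition madd :: "'r mcx => 'r mcx => bool" where
  "madd E X \<longleftrightarrow> cx X \<and> (\<exists>r. mretract X (pow_cx r E))"

lemma madd_retract: "madd E X ==> cx Y ==> mretract Y X ==> madd E Y"
  unfolding madd_def using mretract_trans by blast

lemma madd_pow: "cx E ==> madd E (pow_cx r E)"
  unfolding madd_def using cx_pow meq_mretract[OF meq_refl] by blast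

lemma madd_two_term:
  assumes E: "two_term c E" and X: "madd E X"
  obtains Y r where "two_term c Y" "meq X Y" "mretract Y (pow_cx r E)"
proof -
  obtain r where r: "cx X" "mretract X (pow_cx r E)" using X unfolding madd_def by blast
  have F: "two_term c (pow_cx r E)" using E by (rule two_term_pow)
  obtain p where p: "p \<in> mhoms (pow_cx r E) (pow_cx r E)" "p * p = p" "meq X (sub_cx (pow_cx r E) p)"
    using retract_split[OF r(1) two_term_cx[OF F] r(2)] .
  have "two_term c (sub_cx (pow_cx r E) p)"
    unfolding two_term_def
  proof (intro conjI allI impI)
    show "cx (sub_cx (pow_cx r E) p)" by (rule sub_cx[OF two_term_cx[OF F] p(1,2)])
    fix n assume "n ~= c" "n ~= c - 1"
    thus "ob (sub_cx (pow_cx r E) p) n = 0" using F mhomsD(3)[OF p(1), of n] unfolding two_term_def by auto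
  qed
  thus ?thesis using that p(3) mretract_sub_cx[OF two_term_cx[OF F] p(1,2)] by blast
qed

section \<open>The span of all classes\<close>

text \<open>This models the Grothendieck group of the projectives with real coefficients. The signs
  of the coefficients enter the independence proof, and dimensions over the reals do the final
  count.\<close>

definition idem_classes :: "('r set => real) set" where
  "idem_classes = fun_vs.span {rk e | e. e * e = e}"

lemma chi_fun_eq: "chi E = (\<Sum>n | ob E n ~= 0. fscale (sg n) (rk (ob E n)))"
proof
  fix J
  have "(\<Sum>n\<in>S. fscale (sg n) (rk (ob E n))) J = (\<Sum>n\<in>S. sg n * rk (ob E n) J)" for S
    by (induction S rule: infinite_finite_induct) (auto simp: fscale_def)
  thus "chi E J = (\<Sum>n | ob E n ~= 0. fscale (sg n) (rk (ob E n))) J" unfolding chi_def by simp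
qed

lemma chi_in_idem_classes: "cx E ==> chi E \<in> idem_classes"
  unfolding chi_fun_eq idem_classes_def
  by (intro fun_vs.span_sum fun_vs.span_scale fun_vs.span_base) (auto simp: cxD)

lemma chi_mzero: "cx F ==> mzero F ==> chi F = 0"
  using chi_meq[OF _ cx_zero mzero_meq_zero] by (auto simp: chi_def)

lemma chi_span_decompose:
  fixes E :: "'r mcx"
  assumes "cx E" "!!F. mindec F ==> mretract F E ==> (!!n. ob E n = 0 ==> ob F n = 0) ==> chi F \<in> fun_vs.span B"
  shows "chi E \<in> fun_vs.span B"
  using assms(1)
proof (induction rule: decompose_induct)
  case (zero F)
  thus ?case using chi_mzero fun_vs.span_zero by metis
next
  case (mindec F)
  thus ?case using assms(2) by blast
next
  case (bsum F G H)
  have "chi F = chi G + chi H"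
    using chi_meq[OF bsum(1) bsum_cx(1)[OF bsum(2,3)] bsum(4)] chi_bsum[OF bsum(2,3)] by (simp add: fun_eq_iff)
  thus ?case using bsum(5,6) fun_vs.span_add by metis
qed

text \<open>The complexes \<open>T X\<close> are two-term models. Classes are invariant under
  homotopy equivalence, so a relation between the members of \<open>S\<close> becomes one between
  their models, to which the independence theorem applies.\<close>

lemma chi_independent_family:
  fixes S :: "'r mcx set"
  assumes T: "!!X. X \<in> S ==> mindec X" "!!X. X \<in> S ==> two_term c (T X)" "!!X. X \<in> S ==> meq X (T X)"
    and ext: "!!X Y. X \<in> S ==> Y \<in> S ==> ext_zero c (T X) (T Y)"
  shows "fun_vs.independent (chi ` S)" "!!X Y. X \<in> S ==> Y \<in> S ==> chi X = chi Y ==> meq X Y"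
proof -
  have main: "a i = 0" if I: "finite I" "i \<in> I" "!!i. i \<in> I ==> X i \<in> S" "!!i j. i \<in> I ==> j \<in> I ==> i ~= j ==> \<not> meq (X i) (X j)"
    "!!J. (\<Sum>i\<in>I. a i * chi (X i) J) = 0" for I and X :: "'i => 'r mcx" and a i
  proof (rule two_term_independent[OF I(1) _ _ _ _ _ I(2)])
    show "two_term c (T (X i))" "mindec (T (X i))" if "i \<in> I" for i
      using T that I(3) mindec_meq two_term_cx by blast+
    show "ext_zero c (T (X i)) (T (X j))" if "i \<in> I" "j \<in> I" for i j using ext that I(3) by blast
    show "\<not> meq (T (X i)) (T (X j))" if ij: "i \<in> I" "j \<in> I" "i ~= j" for i j
      using I(4)[OF ij] T(3)[OF I(3)[OF ij(1)]] T(3)[OF I(3)[OF ij(2)]] meq_trans meq_sym by blast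
    fix J
    have "chi (X i) J = sg c * (rk (ob (T (X i)) c) J - rk (ob (T (X i)) (c - 1)) J)" if "i \<in> I" for i
      using chi_two_term[OF T(2)] chi_meq[OF mindecD(1)[OF T(1)] two_term_cx[OF T(2)] T(3)] I(3)[OF that] by metis
    hence "0 = (\<Sum>i\<in>I. sg c * (a i * (rk (ob (T (X i)) c) J - rk (ob (T (X i)) (c - 1)) J)))"
      unfolding I(5)[of J, symmetric] by (intro sum.cong) auto
    thus "(\<Sum>i\<in>I. a i * (rk (ob (T (X i)) c) J - rk (ob (T (X i)) (c - 1)) J)) = 0"
      unfolding sum_distrib_left[symmetric] using sg_simps(4) by simp
  qed
  show "meq X Y" if XY: "X \<in> S" "Y \<in> S" "chi X = chi Y" for X Y
  proof (rule ccontr)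
    assume n: "\<not> meq X Y"
    \<comment> \<open>Two non-isomorphic members with the same class would satisfy the relation with
      coefficients 1 and -1, indexed here by the booleans.\<close>
    have "(if True then 1 else - 1) = (0::real)"
      by (rule main[of UNIV True "%b. if b then X else Y" "%b. if b then 1 else - 1"])
        (use XY n meq_sym in \<open>auto simp: UNIV_bool\<close>)
    thus False by simp
  qed
  show "fun_vs.independent (chi ` S)"
  proof
    assume "fun_vs.dependent (chi ` S)"
    then obtain t u v where t: "finite t" "t \<subseteq> chi ` S" "(\<Sum>v\<in>t. fscale (u v) v) = 0" "v \<in> t" "u v ~= 0"
      unfolding fun_vs.dependent_explicit by blast
    define X where "X w = (SOME X. X \<in> S \<and> chi X = w)" for w
    have X: "X w \<in> S" "chi (X w) = w" if "w \<in> t" for w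
    proof -
      have "\<exists>X. X \<in> S \<and> chi X = w" using t(2) that by blast
      from someI_ex[OF this] show "X w \<in> S" "chi (X w) = w" unfolding X_def by auto
    qed
    have "u v = 0"
    proof (rule main[OF t(1,4)])
      show "X w \<in> S" if "w \<in> t" for w using X that by blast
      show "\<not> meq (X w) (X w')" if w: "w \<in> t" "w' \<in> t" "w ~= w'" for w w'
        using chi_meq[OF mindecD(1)[OF T(1)] mindecD(1)[OF T(1)]] X[OF w(1)] X[OF w(2)] w(3) by metis
      fix J
      have "(\<Sum>w\<in>t. u w * chi (X w) J) = (\<Sum>w\<in>t. u w * w J)" using X(2) by (intro sum.cong) auto
      also have "\<dots> = (\<Sum>v\<in>t. fscale (u v) v) J" using t(1) by (induction t) (auto simp: fscale_def)
      finally show "(\<Sum>w\<in>t. u w * chi (X w) J) = 0" using t(3) by simp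
    qed
    thus False using t by simp
  qed
qed

end

lemma hom_imp_iso_stalk:
  assumes "meq (stalk c e) (stalk c f)"
  obtains u v where "u \<in> arr e f" "v \<in> arr f e" "v * u = e" "u * v = f"
proof -
  have n: "x c = 0" if "x \<in> nulls (stalk c a) (stalk c b)" for x a b
    using that unfolding nulls_def by (auto dest!: hom_to_zero spec[of _ c])
  obtain u v where u: "u \<in> mhoms (stalk c e) (stalk c f)" "v \<in> mhoms (stalk c f) (stalk c e)"
    "v * u - ob (stalk c e) \<in> nulls (stalk c e) (stalk c e)" "u * v - ob (stalk c f) \<in> nulls (stalk c f) (stalk c f)"
    using assms unfolding meq_def mequiv_def heq_def by blast
  show ?thesis using that[of "u c" "v c"] mhomsD(1)[OF u(1), of c] mhomsD(1)[OF u(2), of c] n[OF u(3)] n[OF u(4)] by simp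
qed

section \<open>Shifts, cones and triangulated subcategories\<close>

definition mshift :: "int => 'r::ring mcx => 'r mcx" where
  "mshift m E = \<lparr>ob = (%n. ob E (n + m)), df = (%n. if even m then df E (n + m) else - df E (n + m))\<rparr>"

lemma mshift_sel [simp]: "ob (mshift m E) n = ob E (n + m)"
  "df (mshift m E) n = (if even m then df E (n + m) else - df E (n + m))"
  unfolding mshift_def by auto

lemma cx_mshift: "cx E ==> cx (mshift m E)"
proof -
  assume E: "cx E"
  have "finite ((%n. n - m) ` {n. ob E n ~= 0})" using cxD(4)[OF E] by simp
  moreover have "{n. ob E (n + m) ~= 0} \<subseteq> (%n. n - m) ` {n. ob E n ~= 0}"
    by (auto intro!: image_eqI[of _ _ "_ + m"])
  ultimately have "finite {n. ob E (n + m) ~= 0}" by (rule finite_subset[rotated])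
  moreover have "df E (n + 1 + m) * df E (n + m) = 0" "df E (n + m) \<in> arr (ob E (n + m)) (ob E (n + 1 + m))" for n
    using cxD(2,3)[OF E, of "n + m"] by (simp_all add: algebra_simps)
  ultimately show ?thesis unfolding cx_def using cxD(1)[OF E] by (auto intro: hom_uminus)
qed

lemma mshift_stalk: "mshift (c - n) (stalk c q) = stalk n q"
  unfolding mshift_def stalk_def by (auto simp: fun_eq_iff)

context hom_finite_ring
begin

lemma chi_mshift: "cx E ==> chi (mshift m E) = fscale (sg m) (chi E)"
proof
  fix J assume E: "cx E"
  have "chi (mshift m E) J = (\<Sum>n | ob E n ~= 0. sg (n - m) * rk (ob E n) J)"
    unfolding chi_def by (rule sum.reindex_bij_witness[of _ "%n. n - m" "%n. n + m"]) auto
  also have "\<dots> = (\<Sum>n | ob E n ~= 0. sg m * (sg n * rk (ob E n) J))"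
    by (rule sum.cong) (auto simp: sg_def)
  finally show "chi (mshift m E) J = fscale (sg m) (chi E) J"
    unfolding fscale_def chi_def sum_distrib_left .
qed

text \<open>The signs are those of \<open>mapping_cone\<close>, so that a cone of modules is
  represented by the cone of the matrices.\<close>

definition mcone :: "'r mcx => 'r mcx => (int => 'r) => 'r mcx" where
  "mcone E F f = \<lparr>ob = (%n. bs (ob E (n + 1)) (ob F n)),
     df = (%n. i2 (ob E (n + 2)) (ob F (n + 1)) * (f (n + 1) * p1 (ob E (n + 1)) (ob F n) + df F n * p2 (ob E (n + 1)) (ob F n))
        - i1 (ob E (n + 2)) (ob F (n + 1)) * (df E (n + 1) * p1 (ob E (n + 1)) (ob F n)))\<rparr>"

lemma mcone_sel [simp]: "ob (mcone E F f) n = bs (ob E (n + 1)) (ob F n)"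
  "df (mcone E F f) n = i2 (ob E (n + 2)) (ob F (n + 1)) * (f (n + 1) * p1 (ob E (n + 1)) (ob F n) + df F n * p2 (ob E (n + 1)) (ob F n))
        - i1 (ob E (n + 2)) (ob F (n + 1)) * (df E (n + 1) * p1 (ob E (n + 1)) (ob F n))"
  unfolding mcone_def by auto

lemma biprod_simps:
  assumes "e * e = e" "f * f = f"
  shows "p1 e f * i1 e f = e" "p2 e f * i2 e f = f" "p1 e f * i2 e f = 0" "p2 e f * i1 e f = 0"
    "p1 e f * (i1 e f * x) = e * x" "p2 e f * (i2 e f * x) = f * x" "p1 e f * (i2 e f * x) = 0" "p2 e f * (i1 e f * x) = 0"
    "bs e f * bs e f = bs e f" "bs e f * i1 e f = i1 e f" "bs e f * i2 e f = i2 e f"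
    "p1 e f * bs e f = p1 e f" "p2 e f * bs e f = p2 e f" "e * p1 e f = p1 e f" "f * p2 e f = p2 e f"
    "i1 e f * e = i1 e f" "i2 e f * f = i2 e f"
    "bs e f * (i1 e f * x) = i1 e f * x" "bs e f * (i2 e f * x) = i2 e f * x"
    "p1 e f * (bs e f * x) = p1 e f * x" "p2 e f * (bs e f * x) = p2 e f * x" "e * (p1 e f * x) = p1 e f * x" "f * (p2 e f * x) = p2 e f * x"
    "i1 e f * (e * x) = i1 e f * x" "i2 e f * (f * x) = i2 e f * x"
proof -
  note b = biprodD[OF assms]
  note h = arrD[OF b(2)] arrD[OF b(3)] arrD[OF b(4)] arrD[OF b(5)]
  show "p1 e f * i1 e f = e" "p2 e f * i2 e f = f" "p1 e f * i2 e f = 0" "p2 e f * i1 e f = 0"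
    "p1 e f * (i1 e f * x) = e * x" "p2 e f * (i2 e f * x) = f * x" "p1 e f * (i2 e f * x) = 0" "p2 e f * (i1 e f * x) = 0"
    "bs e f * bs e f = bs e f" "bs e f * i1 e f = i1 e f" "bs e f * i2 e f = i2 e f"
    "p1 e f * bs e f = p1 e f" "p2 e f * bs e f = p2 e f" "e * p1 e f = p1 e f" "f * p2 e f = p2 e f"
    "i1 e f * e = i1 e f" "i2 e f * f = i2 e f"
    "bs e f * (i1 e f * x) = i1 e f * x" "bs e f * (i2 e f * x) = i2 e f * x"
    "p1 e f * (bs e f * x) = p1 e f * x" "p2 e f * (bs e f * x) = p2 e f * x" "e * (p1 e f * x) = p1 e f * x" "f * (p2 e f * x) = p2 e f * x"
    "i1 e f * (e * x) = i1 e f * x" "i2 e f * (f * x) = i2 e f * x"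
    using b(1,6-9) h b(6,7)[THEN assocI] b(8,9)[THEN zero_assocI] h[THEN assocI] by simp_all
qed

lemma cx_mcone:
  assumes E: "cx E" and F: "cx F" and f: "f \<in> mhoms E F"
  shows "cx (mcone E F f)"
proof -
  note b = biprod_simps[OF cxD(1)[OF E] cxD(1)[OF F]]
  have e2: "ob E (n + 2) * df E (n + 1) = df E (n + 1)" "df E (n + 2) * df E (n + 1) = 0" for n
    using cxD(7)[OF E, of "n + 1"] cxD(3)[OF E, of "n + 1"] by (simp_all add: algebra_simps)
  note d = cxD(7,8)[OF E] cxD(7,8)[OF F] mhomsD(3,4)[OF f] e2
  note dd = cxD(3)[OF E] cxD(3)[OF F]
  have fd: "f (n + 2) * df E (n + 1) = df F (n + 1) * f (n + 1)" for n
    using mhomsD(2)[OF f, of "n + 1"] by (simp add: algebra_simps)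
  note s = b d d[THEN assocI] dd dd[THEN zero_assocI] fd fd[THEN assocI] distrib_left distrib_right left_diff_distrib right_diff_distrib mult.assoc
  show ?thesis
    unfolding cx_def
  proof (intro conjI allI)
    fix n
    show "ob (mcone E F f) n * ob (mcone E F f) n = ob (mcone E F f) n" by (simp add: b)
    have 2: "n + 1 + 1 = n + 2" "n + 1 + 2 = n + 3" by simp_all
    show "df (mcone E F f) n \<in> arr (ob (mcone E F f) n) (ob (mcone E F f) (n + 1))"
      by (rule arrI) (simp_all add: s 2)
    show "df (mcone E F f) (n + 1) * df (mcone E F f) n = 0" by (simp add: s 2)
  next
    have "{n. ob (mcone E F f) n ~= 0} \<subseteq> {n. ob (mshift 1 E) n ~= 0} \<union> {n. ob F n ~= 0}"
      using bs_zero by auto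
    thus "finite {n. ob (mcone E F f) n ~= 0}"
      using cxD(4)[OF cx_mshift[OF E, of 1]] cxD(4)[OF F] finite_subset by blast
  qed
qed

lemma chi_mcone:
  assumes "cx E" "cx F" shows "chi (mcone E F f) = chi F - chi E"
proof
  fix J
  let ?G = "bsum (mshift 1 E) F"
  have "chi (mcone E F f) J = chi ?G J" unfolding chi_def by (rule sum.cong) (auto simp: bsum_def)
  also have "\<dots> = chi (mshift 1 E) J + chi F J" by (rule chi_bsum[OF cx_mshift[OF assms(1)] assms(2)])
  finally show "chi (mcone E F f) J = (chi F - chi E) J" by (simp add: chi_mshift[OF assms(1)] fscale_def sg_def)
qed

definition mtri :: "'r mcx set => bool" where
  "mtri T \<longleftrightarrow> (\<forall>X\<in>T. cx X) \<and> (\<forall>X\<in>T. \<forall>Y. cx Y --> meq X Y --> Y \<in> T) \<and>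
     (\<forall>X\<in>T. \<forall>m. mshift m X \<in> T) \<and> (\<forall>X\<in>T. \<forall>Y\<in>T. \<forall>f\<in>mhoms X Y. mcone X Y f \<in> T)"

lemma strict_iso_meq:
  assumes "f \<in> mhoms X Y" "g \<in> mhoms Y X" "g * f = ob X" "f * g = ob Y"
  shows "meq X Y"
  unfolding meq_def mequiv_def using assms heq_refl by metis

text \<open>A short exact sequence of complexes that splits in each degree. The retraction
  \<open>r\<close> and the section \<open>s\<close> need not be chain maps.\<close>

definition split_exact :: "'r mcx => 'r mcx => 'r mcx => (int => 'r) => (int => 'r) => (int => 'r) => (int => 'r) => bool" where
  "split_exact X Y Z i p r s \<longleftrightarrow> i \<in> mhoms X Y \<and> p \<in> mhoms Y Z \<and>
     (\<forall>n. r n \<in> arr (ob Y n) (ob X n) \<and> s n \<in> arr (ob Z n) (ob Y n) \<and> r n * i n = ob X n \<and> p n * s n = ob Z n \<and>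
          p n * i n = 0 \<and> r n * s n = 0 \<and> i n * r n + s n * p n = ob Y n)"

text \<open>The family \<open>\<theta>\<close> is the connecting map of the sequence. It measures
  the failure of \<open>s\<close> and of \<open>r\<close> to commute with the differentials, and it
  anticommutes with them itself.\<close>

lemma split_exactD:
  assumes X: "cx X" and Y: "cx Y" and Z: "cx Z" and e: "split_exact X Y Z i p r s"
    and \<theta>_def: "!!n. \<theta> n = r n * df Y (n - 1) * s (n - 1)"
  shows "df Y n * s n - s (n + 1) * df Z n = i (n + 1) * \<theta> (n + 1)"
    "r (n + 1) * df Y n - df X n * r n = \<theta> (n + 1) * p n"
    "df X n * \<theta> n = - (\<theta> (n + 1) * df Z (n - 1))"
    "\<theta> n \<in> arr (ob Z (n - 1)) (ob X n)"
proof -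
  have h: "i \<in> mhoms X Y" "p \<in> mhoms Y Z" "!!n. r n \<in> arr (ob Y n) (ob X n)" "!!n. s n \<in> arr (ob Z n) (ob Y n)"
    "!!n. r n * i n = ob X n" "!!n. p n * s n = ob Z n" "!!n. p n * i n = 0" "!!n. r n * s n = 0" "!!n. i n * r n + s n * p n = ob Y n"
    using e unfolding split_exact_def by blast+
  have \<theta>1: "\<theta> (n + 1) = r (n + 1) * df Y n * s n" for n unfolding \<theta>_def by simp
  show \<theta>h: "\<theta> n \<in> arr (ob Z (n - 1)) (ob X n)" for n
    unfolding \<theta>_def using h(3)[of n] h(4)[of "n - 1"] cxD(6)[OF Y, of n] by (auto intro: hom_mult)
  have ps: "p (n + 1) * (df Y n * s n) = df Z n" for n
  proof -
    have "p (n + 1) * (df Y n * s n) = (p (n + 1) * df Y n) * s n" by (simp add: mult.assoc)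
    also have "\<dots> = df Z n" unfolding mhomsD(2)[OF h(2), symmetric] using h(6) cxD(8)[OF Z] by (simp add: mult.assoc)
    finally show ?thesis .
  qed
  show A: "df Y n * s n - s (n + 1) * df Z n = i (n + 1) * \<theta> (n + 1)" for n
  proof -
    have "df Y n * s n = (i (n + 1) * r (n + 1) + s (n + 1) * p (n + 1)) * (df Y n * s n)"
      unfolding h(9) using cxD(7)[OF Y] by (simp add: mult.assoc[symmetric])
    also have "\<dots> = i (n + 1) * \<theta> (n + 1) + s (n + 1) * df Z n"
      unfolding \<theta>1 distrib_right using ps[of n] by (simp add: mult.assoc)
    finally show ?thesis by simp
  qed
  have ri: "r (n + 1) * (df Y n * i n) = df X n" for n
    using h(5)[of "n + 1"] cxD(7)[OF X, of n] mhomsD(2)[OF h(1), of n] by (metis mult.assoc)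
  show "r (n + 1) * df Y n - df X n * r n = \<theta> (n + 1) * p n"
  proof -
    have "r (n + 1) * df Y n = r (n + 1) * df Y n * (i n * r n + s n * p n)"
      unfolding h(9) using cxD(8)[OF Y] by (simp add: mult.assoc)
    also have "\<dots> = r (n + 1) * (df Y n * i n) * r n + \<theta> (n + 1) * p n"
      unfolding \<theta>1 by (simp add: distrib_left mult.assoc)
    finally show ?thesis unfolding ri by simp
  qed
  show "df X n * \<theta> n = - (\<theta> (n + 1) * df Z (n - 1))"
  proof -
    have dY: "df Y (n - 1) * s (n - 1) = i n * \<theta> n + s n * df Z (n - 1)" using A[of "n - 1"] by (simp add: algebra_simps)
    have "0 = r (n + 1) * (df Y n * (df Y (n - 1) * s (n - 1)))"
      using cxD(5)[OF Y, of n] by (simp add: mult.assoc[symmetric])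
    also have "\<dots> = r (n + 1) * (df Y n * i n) * \<theta> n + \<theta> (n + 1) * df Z (n - 1)"
      unfolding dY \<theta>1 by (simp add: distrib_left mult.assoc)
    finally show ?thesis unfolding ri by (simp add: eq_neg_iff_add_eq_0)
  qed
qed

text \<open>The middle term is isomorphic, as a complex, to the cone of the connecting map from the
  shift of \<open>Z\<close> by -1 to \<open>X\<close>; the degreewise splitting provides the
  isomorphism.\<close>

lemma mtri_extension:
  assumes T: "mtri T" and X: "X \<in> T" and Z: "Z \<in> T" and Y: "cx Y" and e: "split_exact X Y Z i p r s"
  shows "Y \<in> T"
proof -
  have cX: "cx X" and cZ: "cx Z" using T X Z unfolding mtri_def by blast+
  have h: "i \<in> mhoms X Y" "p \<in> mhoms Y Z" "!!n. r n \<in> arr (ob Y n) (ob X n)" "!!n. s n \<in> arr (ob Z n) (ob Y n)"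
    "!!n. r n * i n = ob X n" "!!n. p n * s n = ob Z n" "!!n. p n * i n = 0" "!!n. r n * s n = 0" "!!n. i n * r n + s n * p n = ob Y n"
    using e unfolding split_exact_def by blast+
  define \<theta> where "\<theta> n = r n * df Y (n - 1) * s (n - 1)" for n
  note S = split_exactD[OF cX Y cZ e \<theta>_def]
  let ?Z = "mshift (- 1) Z"
  \<comment> \<open>The sign in the anticommutation rule is the sign of the differential of a
    complex shifted by an odd number.\<close>
  have \<theta>: "\<theta> \<in> mhoms ?Z X" by (rule mhomsI) (use S(3,4) in simp_all)
  define C where "C = mcone ?Z X \<theta>"
  have CT: "C \<in> T" unfolding C_def using T X Z \<theta> unfolding mtri_def by blast
  hence cC: "cx C" using T unfolding mtri_def by blast
  have idx: "n + 1 + - 1 = n" "n + 2 + - 1 = n + 1" for n :: int by simp_all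
  have C: "ob C n = bs (ob Z n) (ob X n)"
    "df C n = i2 (ob Z (n + 1)) (ob X (n + 1)) * (\<theta> (n + 1) * p1 (ob Z n) (ob X n) + df X n * p2 (ob Z n) (ob X n))
       + i1 (ob Z (n + 1)) (ob X (n + 1)) * (df Z n * p1 (ob Z n) (ob X n))" for n
    unfolding C_def by (simp_all add: idx add.commute[of 1])
  note b = biprod_simps[OF cxD(1)[OF cZ] cxD(1)[OF cX]]
  note hh = arrD[OF h(3)] arrD[OF h(4)] mhomsD(3,4)[OF h(1)] mhomsD(3,4)[OF h(2)]
  define \<phi> \<psi> where "\<phi> n = s n * p1 (ob Z n) (ob X n) + i n * p2 (ob Z n) (ob X n)"
    and "\<psi> n = i1 (ob Z n) (ob X n) * p n + i2 (ob Z n) (ob X n) * r n" for n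
  have e1: "\<psi> * \<phi> = ob C"
  proof
    fix n
    have "\<psi> n * \<phi> n = i1 (ob Z n) (ob X n) * p1 (ob Z n) (ob X n) + i2 (ob Z n) (ob X n) * p2 (ob Z n) (ob X n)"
      unfolding \<phi>_def \<psi>_def using h(5-8)[of n]
      by (simp add: distrib_left distrib_right mult.assoc h(5-8)[THEN assocI] b)
    thus "(\<psi> * \<phi>) n = ob C n" using biprodD(10)[OF cxD(1)[OF cZ] cxD(1)[OF cX], of n n] C by simp
  qed
  have e2: "\<phi> * \<psi> = ob Y"
  proof
    fix n
    have "\<phi> n * \<psi> n = s n * p n + i n * r n" unfolding \<phi>_def \<psi>_def
      by (simp add: distrib_left distrib_right mult.assoc b hh hh[THEN assocI])
    thus "(\<phi> * \<psi>) n = ob Y n" using h(9)[of n] by (simp add: add.commute)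
  qed
  have fh: "\<phi> n \<in> arr (ob C n) (ob Y n)" and gh: "\<psi> n \<in> arr (ob Y n) (ob C n)" for n
    unfolding \<phi>_def \<psi>_def by (rule arrI; simp add: C distrib_left distrib_right mult.assoc b hh hh[THEN assocI])+
  have "\<phi> \<in> mhoms C Y"
  proof (rule mhomsI[OF fh])
    fix n
    have "df Y n * \<phi> n = (i (n + 1) * \<theta> (n + 1) + s (n + 1) * df Z n) * p1 (ob Z n) (ob X n) + i (n + 1) * df X n * p2 (ob Z n) (ob X n)"
      unfolding \<phi>_def S(1)[symmetric] using mhomsD(2)[OF h(1), of n] by (simp add: distrib_left mult.assoc[symmetric])
    also have "\<dots> = \<phi> (n + 1) * df C n" unfolding \<phi>_def C using hh hh[THEN assocI]
      by (simp add: distrib_left distrib_right mult.assoc b)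
    finally show "df Y n * \<phi> n = \<phi> (n + 1) * df C n" .
  qed
  moreover have "\<psi> \<in> mhoms Y C"
  proof (rule mhomsI[OF gh])
    fix n
    have "df C n * \<psi> n = i2 (ob Z (n + 1)) (ob X (n + 1)) * (\<theta> (n + 1) * p n + df X n * r n) + i1 (ob Z (n + 1)) (ob X (n + 1)) * (df Z n * p n)"
      unfolding \<psi>_def C by (simp add: distrib_left distrib_right mult.assoc b hh hh[THEN assocI])
    also have "\<dots> = \<psi> (n + 1) * df Y n" unfolding \<psi>_def S(2)[symmetric] mhomsD(2)[OF h(2)] by (simp add: algebra_simps)
    finally show "df C n * \<psi> n = \<psi> (n + 1) * df Y n" .
  qed
  ultimately have "meq C Y" using e1 e2 by (intro strict_iso_meq)
  thus ?thesis using T CT Y unfolding mtri_def by blast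
qed

text \<open>The kernel of a degreewise split epimorphism \<open>p\<close> is homotopy equivalent to
  the cone of \<open>p\<close> shifted back by one.\<close>

lemma mtri_kernel:
  assumes T: "mtri T" and YT: "Y \<in> T" and ZT: "Z \<in> T" and X: "cx X" and e: "split_exact X Y Z i p r s"
  shows "X \<in> T"
proof -
  have Y: "cx Y" and Z: "cx Z" using T YT ZT unfolding mtri_def by blast+
  have h: "i \<in> mhoms X Y" "p \<in> mhoms Y Z" "!!n. r n \<in> arr (ob Y n) (ob X n)" "!!n. s n \<in> arr (ob Z n) (ob Y n)"
    "!!n. r n * i n = ob X n" "!!n. p n * s n = ob Z n" "!!n. p n * i n = 0" "!!n. r n * s n = 0" "!!n. i n * r n + s n * p n = ob Y n"
    using e unfolding split_exact_def by blast+
  define \<theta> where "\<theta> n = r n * df Y (n - 1) * s (n - 1)" for n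
  note S = split_exactD[OF X Y Z e \<theta>_def]
  define C where "C = mshift (- 1) (mcone Y Z p)"
  have CT: "C \<in> T" unfolding C_def using T YT ZT h unfolding mtri_def by blast
  hence cC: "cx C" using T unfolding mtri_def by blast
  let ?i1 = "%n. i1 (ob Y n) (ob Z (n - 1))" and ?i2 = "%n. i2 (ob Y n) (ob Z (n - 1))"
    and ?p1 = "%n. p1 (ob Y n) (ob Z (n - 1))" and ?p2 = "%n. p2 (ob Y n) (ob Z (n - 1))"
  have idx: "n + - 1 + 1 = n" "n + - 1 + 2 = n + 1" "n + - 1 = n - 1" "n + 1 - 1 = n" "n - 1 + 1 = n" for n :: int by simp_all
  have C: "ob C n = bs (ob Y n) (ob Z (n - 1))"
    "df C n = ?i1 (n + 1) * (df Y n * ?p1 n) - ?i2 (n + 1) * (p n * ?p1 n + df Z (n - 1) * ?p2 n)" for n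
    unfolding C_def by (simp_all add: idx add.commute[of 1])
  note b = biprod_simps[OF cxD(1)[OF Y] cxD(1)[OF Z]]
  note hh = arrD[OF h(3)] arrD[OF h(4)] mhomsD(3,4)[OF h(1)] mhomsD(3,4)[OF h(2)]
  have tt: "ob X n * \<theta> n = \<theta> n" "\<theta> n * ob Z (n - 1) = \<theta> n" for n using arrD[OF S(4)] by blast+
  note dd = cxD(7,8)[OF Y] cxD(7,8)[OF Z] cxD(7,8)[OF X] cxD(9)[OF Z]
  note ss = distrib_left distrib_right left_diff_distrib right_diff_distrib mult.assoc b hh hh[THEN assocI] tt tt[THEN assocI] dd dd[THEN assocI]
  define f g where "f n = ?i1 n * i n" and "g n = r n * ?p1 n + \<theta> n * ?p2 n" for n
  have f: "f \<in> mhoms X C"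
  proof (rule mhomsI)
    fix n show "f n \<in> arr (ob X n) (ob C n)" unfolding f_def by (rule arrI) (simp_all add: C ss)
    have "df C n * f n = ?i1 (n + 1) * (df Y n * i n)" unfolding f_def C
      using h(7)[of n] by (simp add: ss)
    thus "df C n * f n = f (n + 1) * df X n" unfolding f_def using mhomsD(2)[OF h(1), of n] by (simp add: mult.assoc)
  qed
  have g: "g \<in> mhoms C X"
  proof (rule mhomsI)
    fix n show "g n \<in> arr (ob C n) (ob X n)" unfolding g_def by (rule arrI) (simp_all add: C ss)
    have "g (n + 1) * df C n = (r (n + 1) * df Y n - \<theta> (n + 1) * p n) * ?p1 n - \<theta> (n + 1) * df Z (n - 1) * ?p2 n"
      unfolding g_def C using tt[of "n + 1"] by (simp add: ss)
    also have "\<dots> = df X n * r n * ?p1 n + df X n * \<theta> n * ?p2 n" unfolding S(2)[symmetric] S(3) by simp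
    finally show "df X n * g n = g (n + 1) * df C n" unfolding g_def by (simp add: distrib_left mult.assoc)
  qed
  have "g * f = ob X"
  proof
    fix n show "(g * f) n = ob X n" unfolding f_def g_def times_fun_apply using h(5)[of n] by (simp add: ss)
  qed
  \<comment> \<open>The homotopy sends the \<open>Z\<close> component back into \<open>Y\<close>
    along the section \<open>s\<close>. Its failure to be a chain map is compensated by the
    \<open>\<theta>\<close> term in \<open>g\<close>.\<close>
  moreover have "f * g - ob C \<in> nulls C C"
  proof (rule nullsI[of "%n. ?i1 (n - 1) * (s (n - 1) * ?p2 n)"])
    fix n
    show "?i1 (n - 1) * (s (n - 1) * ?p2 n) \<in> arr (ob C n) (ob C (n - 1))" by (rule arrI) (simp_all add: C ss)
    have CC: "ob C n = ?i1 n * ?p1 n + ?i2 n * ?p2 n" using biprodD(10)[OF cxD(1)[OF Y] cxD(1)[OF Z]] C by simp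
    have Y1: "?p1 n = i n * (r n * ?p1 n) + s n * (p n * ?p1 n)"
    proof -
      have "?p1 n = (i n * r n + s n * p n) * ?p1 n" unfolding h(9) by (simp add: b)
      thus ?thesis by (simp only: distrib_right mult.assoc)
    qed
    have L: "(f * g - ob C) n = ?i1 n * (i n * (\<theta> n * ?p2 n)) - ?i1 n * (s n * (p n * ?p1 n)) - ?i2 n * ?p2 n"
      unfolding CC minus_apply times_fun_apply f_def g_def using arg_cong[OF Y1, of "(*) (?i1 n)"]
      by (simp only: distrib_left mult.assoc) (simp add: algebra_simps)
    have 1: "df C (n - 1) * (?i1 (n - 1) * (s (n - 1) * ?p2 n)) = ?i1 n * (df Y (n - 1) * (s (n - 1) * ?p2 n)) - ?i2 n * ?p2 n"
      using h(6)[of "n - 1"] h(6)[of "n - 1", THEN assocI] unfolding C idx by (simp add: ss)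
    have 2: "?i1 (n + 1 - 1) * (s (n + 1 - 1) * ?p2 (n + 1)) * df C n = - (?i1 n * (s n * (p n * ?p1 n))) - ?i1 n * (s n * (df Z (n - 1) * ?p2 n))"
      unfolding C idx by (simp add: ss)
    have "df Y (n - 1) * (s (n - 1) * ?p2 n) = i n * (\<theta> n * ?p2 n) + s n * (df Z (n - 1) * ?p2 n)"
      using S(1)[of "n - 1"] by (simp add: algebra_simps) (metis (no_types, lifting) diff_eq_eq distrib_right mult.assoc add.commute)
    thus "(f * g - ob C) n = df C (n - 1) * (?i1 (n - 1) * (s (n - 1) * ?p2 n)) + ?i1 (n + 1 - 1) * (s (n + 1 - 1) * ?p2 (n + 1)) * df C n"
      unfolding L 1 2 by (simp add: distrib_left)
  qed
  ultimately have "meq C X" unfolding meq_def mequiv_def heq_def using f g nulls_zero by force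
  thus ?thesis using T CT X unfolding mtri_def by blast
qed

end

context hom_finite_ring
begin

lemma split_exact_bsum:
  assumes "cx X" "cx Y"
  shows "split_exact X (bsum X Y) Y (bi1 X Y) (bp2 X Y) (bp1 X Y) (bi2 X Y)"
  unfolding split_exact_def
  by (intro conjI allI; rule bsum_cx(2,5)[OF assms] bsum_pointwise[OF assms]
      mhomsD(1)[OF bsum_cx(3)[OF assms]] mhomsD(1)[OF bsum_cx(4)[OF assms]])

lemma mtri_cx: "mtri T ==> X \<in> T ==> cx X"
  unfolding mtri_def by blast

lemma mtri_bsum:
  assumes "mtri T" "X \<in> T" "Y \<in> T"
  shows "bsum X Y \<in> T"
proof -
  have c: "cx X" "cx Y" using assms by (blast intro: mtri_cx)+
  show ?thesis using mtri_extension[OF assms bsum_cx(1)[OF c] split_exact_bsum[OF c]] .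
qed

text \<open>The object in the highest nonzero degree is a subcomplex, because no differential leaves
  it; the quotient has one nonzero object less, and the sequence splits in each degree.\<close>

lemma mtri_stalks:
  assumes T: "mtri T" and st: "!!n q. q * q = q ==> stalk n q \<in> T" and E: "cx E"
  shows "E \<in> T"
  using E
proof (induction "card {n. ob E n ~= 0}" arbitrary: E rule: less_induct)
  case less
  note E = less.prems
  show ?case
  proof (cases "{n. ob E n ~= 0} = {}")
    case True
    hence ob: "ob E n = 0" for n by blast
    have "df E n = 0" for n using cxD(2)[OF E, of n] ob by (auto dest: hom_to_zero)
    hence "E = stalk 0 0" using ob unfolding stalk_def by (intro mcx.equality) (auto simp: fun_eq_iff)
    thus ?thesis using st[of 0 0] by simp
  next
    case False
    note fin = cxD(4)[OF E]
    define b where "b = Max {n. ob E n ~= 0}"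
    have b: "ob E b ~= 0" using Max_in[OF fin False] unfolding b_def by blast
    have "ob E (b + 1) = 0"
    proof (rule ccontr)
      assume "ob E (b + 1) ~= 0"
      hence "b + 1 \<le> b" unfolding b_def using fin by (intro Max_ge) auto
      thus False by simp
    qed
    hence db: "df E b = 0" using cxD(2)[OF E, of b] by (auto dest: hom_to_zero)
    \<comment> \<open>The quotient: the object in degree \<open>b\<close> is removed together with
      the differential that arrives there.\<close>
    define Z where "Z = \<lparr>ob = (%n. if n = b then 0 else ob E n), df = (%n. if n = b \<or> n + 1 = b then 0 else df E n)\<rparr>"
    have Z: "ob Z n = (if n = b then 0 else ob E n)" "df Z n = (if n = b \<or> n + 1 = b then 0 else df E n)" for n
      unfolding Z_def by auto
    have "{n. ob Z n ~= 0} = {n. ob E n ~= 0} - {b}" unfolding Z by auto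
    hence c: "finite {n. ob Z n ~= 0}" "card {n. ob Z n ~= 0} < card {n. ob E n ~= 0}"
      using fin card_Diff1_less[OF fin, of b] b by simp_all
    have cZ: "cx Z" unfolding cx_def using c(1) cxD(1-3)[OF E] by (auto simp: Z)
    have "split_exact (stalk b (ob E b)) E Z (%n. if n = b then ob E b else 0) (%n. if n = b then 0 else ob E n)
      (%n. if n = b then ob E b else 0) (%n. if n = b then 0 else ob E n)"
      unfolding split_exact_def
    proof (intro conjI allI)
      show "(%n. if n = b then ob E b else 0) \<in> mhoms (stalk b (ob E b)) E"
        by (rule mhomsI) (auto simp: db intro: hom_id cxD[OF E])
      show "(%n. if n = b then 0 else ob E n) \<in> mhoms E Z"
        by (rule mhomsI) (auto simp: Z db cxD(7,8)[OF E] intro: hom_id cxD[OF E])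
    qed (auto simp: Z cxD[OF E] intro: hom_id)
    thus ?thesis using mtri_extension[OF T st less.hyps[OF c(2) cZ] E] cxD(1)[OF E] by blast
  qed
qed

text \<open>Coordinates of a power indexed by a finite set. In the approximation below, the set is a
  basis of a morphism space, so that each basis vector owns a copy of \<open>E\<close>.\<close>

lemma pow_maps:
  assumes E: "cx E" and B: "finite B"
  shows "\<exists>r \<iota> \<pi>. (\<forall>b\<in>B. \<iota> b \<in> mhoms E (pow_cx r E) \<and> \<pi> b \<in> mhoms (pow_cx r E) E) \<and>
    (\<forall>a\<in>B. \<forall>b\<in>B. \<pi> a * \<iota> b = (if a = b then ob E else 0)) \<and> (\<Sum>b\<in>B. \<iota> b * \<pi> b) = ob (pow_cx r E)"
  using B
proof (induction B rule: finite_induct)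
  case empty
  thus ?case by (intro exI[of _ 0]) (auto simp: mhoms_zero)
next
  case (insert x B)
  obtain r \<iota> \<pi> where h: "!!b. b \<in> B ==> \<iota> b \<in> mhoms E (pow_cx r E)" "!!b. b \<in> B ==> \<pi> b \<in> mhoms (pow_cx r E) E"
    "!!a b. a \<in> B ==> b \<in> B ==> \<pi> a * \<iota> b = (if a = b then ob E else 0)" "(\<Sum>b\<in>B. \<iota> b * \<pi> b) = ob (pow_cx r E)"
    using insert.IH by blast
  let ?F = "pow_cx r E"
  note s = bsum_cx[OF cx_pow[OF E, of r] E]
  define \<iota>' \<pi>' where "\<iota>' b = (if b = x then bi2 ?F E else bi1 ?F E * \<iota> b)"
    and "\<pi>' b = (if b = x then bp2 ?F E else \<pi> b * bp1 ?F E)" for b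
  have m: "\<iota>' b \<in> mhoms E (bsum ?F E)" "\<pi>' b \<in> mhoms (bsum ?F E) E" if "b \<in> insert x B" for b
    using that s h(1,2) unfolding \<iota>'_def \<pi>'_def by (auto intro: mhoms_mult)
  have d: "\<pi>' a * \<iota>' b = (if a = b then ob E else 0)" if "a \<in> insert x B" "b \<in> insert x B" for a b
  proof -
    have 1: "\<pi> a * bp1 ?F E * (bi1 ?F E * \<iota> b) = (if a = b then ob E else 0)" if "a \<in> B" "b \<in> B" for a b
    proof -
      have "\<pi> a * bp1 ?F E * (bi1 ?F E * \<iota> b) = \<pi> a * (bp1 ?F E * bi1 ?F E) * \<iota> b" by (simp only: mult.assoc)
      also have "\<dots> = \<pi> a * \<iota> b" unfolding s(6) mhoms_id_right[OF h(2)[OF that(1)]] ..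
      finally show ?thesis using h(3)[OF that] by simp
    qed
    have 2: "bp2 ?F E * (bi1 ?F E * f) = 0" "f * bp1 ?F E * bi2 ?F E = 0" for f
      using s(8,9) by (simp_all only: mult.assoc) (simp_all only: mult.assoc[symmetric] s(9) mult_zero_left mult_zero_right)
    show ?thesis using that 1 2 s(7) insert.hyps(2) unfolding \<iota>'_def \<pi>'_def by auto
  qed
  have "(\<Sum>b\<in>B. \<iota>' b * \<pi>' b) = (\<Sum>b\<in>B. bi1 ?F E * (\<iota> b * \<pi> b) * bp1 ?F E)"
    by (rule sum.cong) (use insert.hyps(2) in \<open>auto simp: \<iota>'_def \<pi>'_def mult.assoc\<close>)
  also have "\<dots> = bi1 ?F E * ob ?F * bp1 ?F E" unfolding sum_distrib_right[symmetric] sum_distrib_left[symmetric] h(4) ..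
  finally have sm: "(\<Sum>b\<in>insert x B. \<iota>' b * \<pi>' b) = ob (bsum ?F E)"
    unfolding sum.insert[OF insert.hyps] s(10)[symmetric] mhoms_id_right[OF s(2)] by (simp add: \<iota>'_def \<pi>'_def add.commute)
  show ?case
    by (rule exI[of _ "Suc r"], rule exI[of _ \<iota>'], rule exI[of _ \<pi>'])
      (intro conjI ballI; simp only: pow_cx.simps m d sm)
qed

text \<open>Bongartz completion: the cocone \<open>Q\<close> of a right \<open>add E\<close>-approximation \<open>E\<^sup>r \<rightarrow> q[1]\<close>, where \<open>q\<close> is a
  projective in degree \<open>c\<close>. The approximation is assembled from a basis of \<open>Hom(E\<^bsup>c-1\<^esup>, q)\<close>.\<close>

lemma bongartz_completion:
  assumes E: "two_term c E" and q: "q * q = q"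
  obtains Q r i p \<rho> s where "two_term c Q" "split_exact (stalk c q) Q (pow_cx r E) i p \<rho> s"
    "!!Y. two_term c Y ==> ext_zero c E Y ==> ext_zero c Q Y" "ext_zero c E E ==> ext_zero c E Q"
proof -
  let ?E1 = "ob E (c - 1)" and ?E0 = "ob E c"
  note dE = two_term_d[OF E]
  obtain B where B: "B \<subseteq> arr ?E1 q" "independent B" "arr ?E1 q \<subseteq> span B" "finite B" "card B = dim (arr ?E1 q)"
    using fin_dim_basis[OF fin_dim_hom[OF dE(2) q]] .
  obtain r \<iota> \<pi> where h: "!!b. b \<in> B ==> \<iota> b \<in> mhoms E (pow_cx r E)" "!!b. b \<in> B ==> \<pi> b \<in> mhoms (pow_cx r E) E"
    "!!a b. a \<in> B ==> b \<in> B ==> \<pi> a * \<iota> b = (if a = b then ob E else 0)" "(\<Sum>b\<in>B. \<iota> b * \<pi> b) = ob (pow_cx r E)"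
    using pow_maps[OF two_term_cx[OF E] B(4)] by blast
  define F where "F = pow_cx r E"
  have F: "two_term c F" unfolding F_def using E by (rule two_term_pow)
  let ?F1 = "ob F (c - 1)" and ?F0 = "ob F c" and ?dF = "df F (c - 1)"
  note dF = two_term_d[OF F]
  define \<alpha> where "\<alpha> = (\<Sum>b\<in>B. b * \<pi> b (c - 1))"
  have \<alpha>: "\<alpha> \<in> arr ?F1 q" unfolding \<alpha>_def
    using B(1) h(2)[THEN mhomsD(1)] unfolding F_def by (intro hom_sum) (auto intro: hom_mult)
  note b = biprod_simps[OF dF(1) q]
  let ?i1 = "i1 ?F0 q" and ?i2 = "i2 ?F0 q" and ?p1 = "p1 ?F0 q" and ?p2 = "p2 ?F0 q"
  \<comment> \<open>The differential has the components \<open>df F (c - 1)\<close> and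
    \<open>\<alpha>\<close>. This extends \<open>F\<close> by \<open>q\<close> placed in degree
    \<open>c\<close>, with connecting map \<open>\<alpha>\<close>.\<close>
  define dQ where "dQ = ?i1 * ?dF + ?i2 * \<alpha>"
  define Q where "Q = \<lparr>ob = (%n. if n = c then bs ?F0 q else if n = c - 1 then ?F1 else 0),
    df = (%n. if n = c - 1 then dQ else 0)\<rparr>"
  have Qob: "ob Q n = (if n = c then bs ?F0 q else if n = c - 1 then ?F1 else 0)" and Qdf: "df Q n = (if n = c - 1 then dQ else 0)" for n
    unfolding Q_def by auto
  note s\<alpha> = arrD[OF \<alpha>]
  note ss = b s\<alpha> s\<alpha>[THEN assocI] dF dF[THEN assocI] distrib_left distrib_right mult.assoc q
  have dQh: "dQ \<in> arr ?F1 (bs ?F0 q)" unfolding dQ_def by (rule arrI) (simp_all add: ss)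
  have pQ: "?p1 * dQ = ?dF" "?p2 * dQ = \<alpha>" unfolding dQ_def by (simp_all add: ss)
  have "finite {n. ob Q n ~= 0}"
    by (rule finite_subset[of _ "{c, c - 1}"]) (auto simp: Qob)
  hence Q: "two_term c Q" unfolding two_term_def cx_def using dQh by (auto simp: Qob Qdf b dF)
  have F0: "ob F n = 0" if "n ~= c" "n ~= c - 1" for n using F that unfolding two_term_def by blast
  have Fd: "df F n = 0" if "n ~= c - 1" for n using two_term_df[OF F that] .
  have se: "split_exact (stalk c q) Q F (two_map c ?i2 0) (two_map c ?p1 ?F1) (two_map c ?p2 0) (two_map c ?i1 ?F1)"
    unfolding split_exact_def
  proof (intro conjI allI)
    have "two_map c ?i2 0 \<in> mhoms (stalk c q) Q"
      by (rule two_map_mhoms[OF _ Q]) (auto simp: two_term_stalk q Qob b intro!: arrI)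
    thus "two_map c ?i2 0 \<in> mhoms (stalk c q) Q" .
    show "two_map c ?p1 ?F1 \<in> mhoms Q F"
      by (rule two_map_mhoms[OF Q F]) (auto simp: Qob Qdf pQ b dF intro!: arrI)
    fix n
    show "two_map c ?p2 0 n \<in> arr (ob Q n) (ob (stalk c q) n)" "two_map c ?i1 ?F1 n \<in> arr (ob F n) (ob Q n)"
      "two_map c ?p2 0 n * two_map c ?i2 0 n = ob (stalk c q) n" "two_map c ?p1 ?F1 n * two_map c ?i1 ?F1 n = ob F n"
      "two_map c ?p1 ?F1 n * two_map c ?i2 0 n = 0" "two_map c ?p2 0 n * two_map c ?i1 ?F1 n = 0"
      "two_map c ?i2 0 n * two_map c ?p2 0 n + two_map c ?i1 ?F1 n * two_map c ?p1 ?F1 n = ob Q n"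
      using biprodD(10)[OF dF(1) q] by (auto simp: two_map_def Qob b dF F0 add.commute intro!: arrI)
  qed
  \<comment> \<open>The lower object of \<open>Q\<close> is that of \<open>F\<close>, so a morphism
    on it is split by means of \<open>F\<close>, and the upper part is composed with the projection
    of \<open>Q\<close> onto \<open>F\<close>.\<close>
  have extL: "ext_zero c Q Y" if Y: "two_term c Y" "ext_zero c E Y" for Y
    unfolding ext_zero_def
  proof
    fix x assume "x \<in> arr (ob Q (c - 1)) (ob Y c)"
    hence "x \<in> arr ?F1 (ob Y c)" by (simp add: Qob)
    then obtain s h where sh: "s \<in> arr ?F0 (ob Y c)" "h \<in> arr ?F1 (ob Y (c - 1))" "x = s * ?dF + df Y (c - 1) * h"
      using ext_zeroD[OF ext_zero_pow_left[OF E Y, of r, folded F_def]] by blast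
    have "x = (s * ?p1) * df Q (c - 1) + df Y (c - 1) * h" unfolding sh(3) by (simp add: Qdf pQ mult.assoc)
    moreover have "s * ?p1 \<in> arr (ob Q c) (ob Y c)" "h \<in> arr (ob Q (c - 1)) (ob Y (c - 1))"
      using sh by (auto simp: Qob b mult.assoc intro!: arrI dest: arrD) (metis arrD(1) mult.assoc)
    ultimately show "\<exists>s\<in>arr (ob Q c) (ob Y c). \<exists>h\<in>arr (ob Q (c - 1)) (ob Y (c - 1)). x = s * df Q (c - 1) + df Y (c - 1) * h"
      by blast
  qed
  have extR: "ext_zero c E Q" if EE: "ext_zero c E E"
    unfolding ext_zero_def
  proof
    fix x assume "x \<in> arr ?E1 (ob Q c)"
    hence x: "x \<in> arr ?E1 (bs ?F0 q)" by (simp add: Qob)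
    have "?p1 * x \<in> arr ?E1 ?F0" using x by (auto simp: b mult.assoc intro!: arrI dest: arrD)
    then obtain s k where sk: "s \<in> arr ?E0 ?F0" "k \<in> arr ?E1 ?F1" "?p1 * x = s * df E (c - 1) + ?dF * k"
      using ext_zeroD[OF ext_zero_pow_right[OF E E EE, of r, folded F_def]] by blast
    \<comment> \<open>The component in \<open>F\<close> has been split; \<open>y\<close> is what
      remains in the component \<open>q\<close>.\<close>
    define y where "y = ?p2 * x - \<alpha> * k"
    have "y \<in> arr ?E1 q" unfolding y_def
      using x sk(2) by (intro hom_diff hom_mult[OF sk(2) \<alpha>]) (auto simp: b mult.assoc intro!: arrI dest: arrD)
    hence "y \<in> span B" using B(3) by blast
    then obtain u where u: "y = (\<Sum>b\<in>B. scale (u b) b)" using span_finite[OF B(4)] by auto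
    \<comment> \<open>The coefficients of \<open>y\<close> in the basis combine the coordinate maps
      into a chain map with components \<open>s0\<close> and \<open>k0\<close>. It satisfies
      \<open>\<alpha> * k0 = y\<close>, which is the approximation property, and its effect on the
      component in \<open>F\<close> factors through the differential of \<open>E\<close>.\<close>
    define k0 where "k0 = (\<Sum>b\<in>B. scale (u b) (\<iota> b (c - 1)))"
    define s0 where "s0 = (\<Sum>b\<in>B. scale (u b) (\<iota> b c))"
    have k0: "k0 \<in> arr ?E1 ?F1" "s0 \<in> arr ?E0 ?F0" unfolding k0_def s0_def F_def
      using h(1)[THEN mhomsD(1)] by (auto intro!: hom_sum hom_scale)
    have \<pi>\<iota>: "\<pi> a (c - 1) * \<iota> b (c - 1) = (if a = b then ?E1 else 0)" if "a \<in> B" "b \<in> B" for a b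
      using h(3)[OF that] by (metis times_fun_apply zero_fun_apply)
    have "\<alpha> * \<iota> b (c - 1) = b" if "b \<in> B" for b
    proof -
      have "\<alpha> * \<iota> b (c - 1) = (\<Sum>a\<in>B. if a = b then a * ?E1 else 0)"
        unfolding \<alpha>_def sum_distrib_right by (rule sum.cong) (auto simp: mult.assoc \<pi>\<iota> that)
      also have "\<dots> = b * ?E1" using B(4) that by simp
      also have "\<dots> = b" using B(1) that by (auto dest: arrD)
      finally show ?thesis .
    qed
    hence \<alpha>k0: "\<alpha> * k0 = y" unfolding k0_def u sum_distrib_left by (intro sum.cong) (auto simp: scale_mult_right)
    have "?dF * k0 = s0 * df E (c - 1)" unfolding k0_def s0_def sum_distrib_left sum_distrib_right
      using mhomsD(5)[OF h(1), of _ c] by (intro sum.cong) (auto simp: scale_mult_right scale_mult_left F_def)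
    hence dk0: "dQ * k0 = ?i1 * (s0 * df E (c - 1)) + ?i2 * y" unfolding dQ_def using \<alpha>k0 by (simp add: distrib_right mult.assoc)
    have "x = bs ?F0 q * x" using arrD(1)[OF x] by simp
    also have "\<dots> = ?i1 * (?p1 * x) + ?i2 * (?p2 * x)"
      unfolding biprodD(10)[OF dF(1) q, symmetric] by (simp add: distrib_right mult.assoc)
    also have "?p2 * x = \<alpha> * k + y" unfolding y_def by simp
    also have "?i1 * (?p1 * x) + ?i2 * (\<alpha> * k + y) = ?i1 * (s * df E (c - 1)) + dQ * k + ?i2 * y"
      unfolding sk(3) dQ_def by (simp add: distrib_left distrib_right mult.assoc)
    also have "\<dots> = (?i1 * (s - s0)) * df E (c - 1) + dQ * (k + k0)"
      using dk0 by (simp add: algebra_simps)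
    finally have "x = (?i1 * (s - s0)) * df E (c - 1) + df Q (c - 1) * (k + k0)" by (simp add: Qdf)
    moreover have "?i1 * (s - s0) \<in> arr ?E0 (ob Q c)"
      using hom_mult[OF hom_diff[OF sk(1) k0(2)] biprodD(2)[OF dF(1) q]] by (simp add: Qob)
    moreover have "k + k0 \<in> arr ?E1 (ob Q (c - 1))" using hom_add[OF sk(2) k0(1)] by (simp add: Qob)
    ultimately show "\<exists>s\<in>arr ?E0 (ob Q c). \<exists>h\<in>arr ?E1 (ob Q (c - 1)). x = s * df E (c - 1) + df Q (c - 1) * h" by blast
  qed
  show ?thesis using that Q se extL extR unfolding F_def by blast
qed

section \<open>Classes of indecomposable projectives and of indecomposable summands\<close>

definition prim :: "'r => bool" where
  "prim e \<longleftrightarrow> e * e = e \<and> mindec (stalk 0 e)"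

definition prim_classes :: "('r set => real) set" where
  "prim_classes = rk ` {e. prim e}"

definition add_classes :: "'r mcx => ('r set => real) set" where
  "add_classes E = chi ` {X. mindec X \<and> madd E X}"

lemma chi_stalk_0: "chi (stalk 0 e) = rk e"
  by (auto simp: chi_stalk sg_def)

lemma prim_classes_alt: "prim_classes = chi ` {stalk 0 e | e. prim e}"
  unfolding prim_classes_def by (simp add: setcompr_eq_image image_image chi_stalk_0)

text \<open>Stalk complexes have no extensions among each other, so the theorem on families applies
  with \<open>c = 0\<close> and with every stalk as its own model.\<close>

lemma prim_classes_independent: "fun_vs.independent prim_classes"
  and prim_classes_inj: "prim e ==> prim f ==> rk e = rk f ==> meq (stalk 0 e) (stalk 0 f)"
proof -
  let ?S = "{stalk 0 e | e. prim e}"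
  have *: "mindec X" "two_term 0 (id X)" "meq X (id X)" if "X \<in> ?S" for X
    using that mindecD(1) meq_refl by (auto simp: prim_def two_term_stalk)
  have **: "ext_zero 0 (id X) (id Y)" if "X \<in> ?S" for X Y using that ext_zero_stalk by auto
  show "fun_vs.independent prim_classes" unfolding prim_classes_alt using chi_independent_family(1)[of ?S 0 id] * ** by blast
  show "prim e ==> prim f ==> rk e = rk f ==> meq (stalk 0 e) (stalk 0 f)"
    using chi_independent_family(2)[of ?S 0 id "stalk 0 e" "stalk 0 f"] * ** chi_stalk_0 by auto
qed

text \<open>The identity of \<open>e\<close> is a sum of maps that factor through
  \<open>gen\<close>. If \<open>e\<close> is primitive, one of the summands is already a unit, so
  \<open>e\<close> is among the finitely many indecomposable factors of \<open>gen\<close>.\<close>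

lemma prim_classes_finite: "finite prim_classes"
proof -
  obtain D where D0: "finite D" "\<forall>F a b. mindec F --> a \<in> mhoms F (stalk 0 gen) --> b \<in> mhoms (stalk 0 gen) F -->
      munit F (b * a) --> (\<exists>G\<in>D. mindec G \<and> meq F G)"
    using finite_mindec_factors[OF cx_stalk[OF gen_idem, of 0]] by (elim exE conjE) (rule that)
  note D = D0(1) D0(2)[rule_format]
  have "rk e \<in> chi ` D" if e: "prim e" for e
  proof -
    have ee: "e * e = e" and m: "mindec (stalk 0 e)" using e unfolding prim_def by auto
    obtain n :: nat and u v where uv: "e = (\<Sum>i<n. u i * gen * v i)" using generated[OF ee] by blast
    \<comment> \<open>The terms of the sum are cut down to morphisms between \<open>e\<close> and
      \<open>gen\<close>, placed in degree 0.\<close>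
    let ?a = "%i k. if k = (0::int) then gen * v i * e else 0" and ?b = "%i k. if k = (0::int) then e * u i * gen else 0"
    have a: "?a i \<in> mhoms (stalk 0 e) (stalk 0 gen)" and b: "?b i \<in> mhoms (stalk 0 gen) (stalk 0 e)" for i
      using hom_corner[OF ee gen_idem] hom_corner[OF gen_idem ee] by (auto intro!: mhomsI)
    have "(\<Sum>i<n. ?b i * ?a i) = ob (stalk 0 e)"
    proof
      fix k
      have eqI: "(\<Sum>i\<in>I. ?b i * ?a i) k = (if k = 0 then e * (\<Sum>i\<in>I. u i * gen * v i) * e else 0)" for I :: "nat set"
        by (induction I rule: infinite_finite_induct) (auto simp: algebra_simps gen_idem[THEN assocI])
      thus "(\<Sum>i<n. ?b i * ?a i) k = ob (stalk 0 e) k" unfolding eqI uv[symmetric] by (simp add: ee)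
    qed
    moreover have "munit (stalk 0 e) (ob (stalk 0 e))" unfolding munit_def
      using mhoms_id[OF mindecD(1)[OF m]] mhoms_id_left[OF mhoms_id[OF mindecD(1)[OF m]]] heq_refl by metis
    ultimately have "munit (stalk 0 e) (\<Sum>i<n. ?b i * ?a i)" by simp
    then obtain i where "munit (stalk 0 e) (?b i * ?a i)"
      using munit_sum[OF m, of "{..<n}" "%i. ?b i * ?a i"] a b mhoms_mult by blast
    then obtain G where "G \<in> D" "mindec G" "meq (stalk 0 e) G" using D(2)[OF m a b] by blast
    thus ?thesis using chi_meq[OF mindecD(1)[OF m] mindecD(1)] chi_stalk_0 by (metis imageI)
  qed
  hence "prim_classes \<subseteq> chi ` D" unfolding prim_classes_def by blast
  thus ?thesis using D(1) finite_surj by blast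
qed

text \<open>The pieces of a stalk complex stay in its degree and are therefore stalks of primitive
  idempotents.\<close>

lemma prim_classes_span: "fun_vs.span prim_classes = idem_classes"
proof
  show "fun_vs.span prim_classes \<subseteq> idem_classes"
    unfolding idem_classes_def by (rule fun_vs.span_mono) (auto simp: prim_classes_def prim_def)
  have "rk e \<in> fun_vs.span prim_classes" if e: "e * e = e" for e
  proof -
    have "chi (stalk 0 e) \<in> fun_vs.span prim_classes"
    proof (rule chi_span_decompose[OF cx_stalk[OF e]])
      fix F assume F: "mindec F" "!!n. ob (stalk 0 e) n = 0 ==> ob F n = 0"
      have ob: "ob F n = 0" if "n ~= 0" for n using F(2)[of n] that by simp
      have "df F n = 0" for n
        using cxD(2)[OF mindecD(1)[OF F(1)], of n] ob[of n] ob[of "n + 1"] by (cases "n = 0") (auto dest: hom_to_zero hom_from_zero)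
      hence st: "F = stalk 0 (ob F 0)" using ob unfolding stalk_def by (intro mcx.equality) (auto simp: fun_eq_iff)
      hence "prim (ob F 0)" unfolding prim_def using F(1) cxD(1)[OF mindecD(1)[OF F(1)]] by metis
      thus "chi F \<in> fun_vs.span prim_classes" using st chi_stalk_0 fun_vs.span_base unfolding prim_classes_def
        by (metis imageI mem_Collect_eq)
    qed
    thus ?thesis by (simp add: chi_stalk_0)
  qed
  thus "idem_classes \<subseteq> fun_vs.span prim_classes"
    unfolding idem_classes_def by (intro fun_vs.span_minimal) auto
qed

lemma add_classes_span: "madd E X ==> chi X \<in> fun_vs.span (add_classes E)"
proof (rule chi_span_decompose)
  assume X: "madd E X"
  show "cx X" using X unfolding madd_def by blast
  fix F assume "mindec F" "mretract F X"
  hence "F \<in> {X. mindec X \<and> madd E X}" using madd_retract[OF X] mindecD(1) by blast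
  thus "chi F \<in> fun_vs.span (add_classes E)" unfolding add_classes_def by (intro fun_vs.span_base imageI)
qed

lemma add_classes_subset: "add_classes E \<subseteq> idem_classes"
  unfolding add_classes_def using chi_in_idem_classes mindecD(1) by blast

definition two_term_model :: "int => 'r mcx => 'r mcx => 'r mcx" where
  "two_term_model c E X = (SOME Y. two_term c Y \<and> meq X Y \<and> (\<exists>r. mretract Y (pow_cx r E)))"

lemma two_term_model:
  assumes "two_term c E" "madd E X"
  shows "two_term c (two_term_model c E X)" "meq X (two_term_model c E X)" "\<exists>r. mretract (two_term_model c E X) (pow_cx r E)"
proof -
  have "\<exists>Y. two_term c Y \<and> meq X Y \<and> (\<exists>r. mretract Y (pow_cx r E))" using madd_two_term[OF assms] by metis
  from someI_ex[OF this] show "two_term c (two_term_model c E X)" "meq X (two_term_model c E X)"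
    "\<exists>r. mretract (two_term_model c E X) (pow_cx r E)" unfolding two_term_model_def by auto
qed

lemma add_classes_family:
  assumes E: "two_term c E" and ext: "ext_zero c E E"
  shows "fun_vs.independent (add_classes E)"
    "mindec X ==> mindec Y ==> madd E X ==> madd E Y ==> chi X = chi Y ==> meq X Y"
proof -
  let ?S = "{X. mindec X \<and> madd E X}"
  note t = two_term_model[OF E]
  have e: "ext_zero c (two_term_model c E X) (two_term_model c E Y)" if XY: "madd E X" "madd E Y" for X Y
  proof -
    obtain r s where "mretract (two_term_model c E X) (pow_cx r E)" "mretract (two_term_model c E Y) (pow_cx s E)"
      using t(3)[OF XY(1)] t(3)[OF XY(2)] by blast
    thus ?thesis using ext_zero_retract[OF t(1)[OF XY(1)] t(1)[OF XY(2)] two_term_pow[OF E] two_term_pow[OF E]]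
      ext_zero_pow_left[OF E two_term_pow[OF E] ext_zero_pow_right[OF E E ext]] by blast
  qed
  show "fun_vs.independent (add_classes E)" unfolding add_classes_def
    using chi_independent_family(1)[of ?S c "two_term_model c E"] t e by blast
  show "mindec X ==> mindec Y ==> madd E X ==> madd E Y ==> chi X = chi Y ==> meq X Y"
    using chi_independent_family(2)[of ?S c "two_term_model c E" X Y] t e by blast
qed

definition mgen :: "'r mcx => bool" where
  "mgen E \<longleftrightarrow> (\<forall>T. mtri T --> {X. madd E X} \<subseteq> T --> {X. cx X} \<subseteq> T)"

text \<open>Classes change sign under odd shifts and subtract on cones, so a span of classes cuts
  out a triangulated subcategory. This turns generation into spanning.\<close>

lemma mtri_chi_span: "mtri {X. cx X \<and> chi X \<in> fun_vs.span B}"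
  unfolding mtri_def using cx_mshift cx_mcone chi_meq
  by (auto simp: chi_mshift chi_mcone fun_vs.span_scale fun_vs.span_diff)

lemma mgen_span:
  assumes "mgen E"
  shows "fun_vs.span (add_classes E) = idem_classes"
proof
  show "fun_vs.span (add_classes E) \<subseteq> idem_classes"
    unfolding idem_classes_def
    by (rule fun_vs.span_minimal[OF add_classes_subset[unfolded idem_classes_def] fun_vs.subspace_span])
  let ?T = "{X. cx X \<and> chi X \<in> fun_vs.span (add_classes E)}"
  have "{X. madd E X} \<subseteq> ?T" using add_classes_span by (auto simp: madd_def)
  hence "{X. cx X} \<subseteq> ?T" using assms mtri_chi_span unfolding mgen_def by blast
  hence "rk e \<in> fun_vs.span (add_classes E)" if "e * e = e" for e
    using cx_stalk[OF that, of 0] chi_stalk_0[of e] by fastforce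
  thus "idem_classes \<subseteq> fun_vs.span (add_classes E)" unfolding idem_classes_def by (intro fun_vs.span_minimal) auto
qed

text \<open>It suffices to reach the stalks in degree \<open>c\<close>, since shifts and extensions
  then give every complex. Such a stalk is the kernel of a degreewise split epimorphism from its
  Bongartz complement onto a power of \<open>E\<close>, so the task is to place the complement in
  \<open>T\<close>.\<close>

lemma span_mgen:
  assumes E: "two_term c E" and ext: "ext_zero c E E" and sp: "fun_vs.span (add_classes E) = idem_classes"
  shows "mgen E"
  unfolding mgen_def
proof (intro allI impI)
  fix T assume T: "mtri T" and sub: "{X. madd E X} \<subseteq> T"
  have iso: "Y \<in> T" if "X \<in> T" "cx Y" "meq X Y" for X Y using T that unfolding mtri_def by blast
  have st: "stalk c q \<in> T" if q: "q * q = q" for q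
  proof -
    obtain Q r i p \<rho> s where Q: "two_term c Q" "split_exact (stalk c q) Q (pow_cx r E) i p \<rho> s"
      "!!Y. two_term c Y ==> ext_zero c E Y ==> ext_zero c Q Y" "ext_zero c E E ==> ext_zero c E Q"
      using bongartz_completion[OF E q] by blast
    have EQ: "ext_zero c E Q" and QE: "ext_zero c Q E" and QQ: "ext_zero c Q Q" using Q ext E by blast+
    have "Q \<in> T"
      using two_term_cx[OF Q(1)]
    proof (induction rule: decompose_induct)
      case (zero F)
      have "madd E zero_cx" using madd_pow[OF two_term_cx[OF E], of 0] by simp
      thus ?case using iso sub zero meq_sym[OF mzero_meq_zero] by blast
    next
      case (mindec Z)
      have Z: "two_term c Z" using mindec Q(1) mindecD(1) unfolding two_term_def by blast
      show ?case
      proof (rule ccontr)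
        assume ZT: "Z \<notin> T"
        have nX: "\<not> meq X Z" if "madd E X" for X using iso[of X Z] sub that ZT two_term_cx[OF Z] by blast
        have nZ: "\<not> madd E Z" using sub ZT by blast
        \<comment> \<open>The summand \<open>Z\<close> is adjoined to the indecomposables of the
          additive closure. It is its own two-term model, while the others use the models inside
          powers of \<open>E\<close>; all extensions between these models vanish.\<close>
        let ?S = "insert Z {X. mindec X \<and> madd E X}"
        define M where "M X = (if X = Z then Z else two_term_model c E X)" for X
        have M: "two_term c (M X)" "meq X (M X)" "mretract (M X) Q \<or> (\<exists>r. mretract (M X) (pow_cx r E))" if "X \<in> ?S" for X
          using that two_term_model[OF E] Z mindec(2) meq_refl[OF two_term_cx[OF Z]] unfolding M_def by auto
        have tp: "two_term c (pow_cx r E)" for r using E by (rule two_term_pow)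
        have ex: "ext_zero c (pow_cx r E) (pow_cx s E)" "ext_zero c (pow_cx r E) Q" "ext_zero c Q (pow_cx s E)" for r s
          using ext_zero_pow_left[OF E tp ext_zero_pow_right[OF E E ext]] ext_zero_pow_left[OF E Q(1) EQ] ext_zero_pow_right[OF E Q(1) QE] by blast+
        have "ext_zero c (M X) (M Y)" if XY: "X \<in> ?S" "Y \<in> ?S" for X Y
        proof -
          note r = ext_zero_retract[OF M(1)[OF XY(1)] M(1)[OF XY(2)]]
          show ?thesis using M(3)[OF XY(1)] M(3)[OF XY(2)] r[OF Q(1) Q(1) _ _ QQ] r[OF Q(1) tp _ _ ex(3)]
            r[OF tp Q(1) _ _ ex(2)] r[OF tp tp _ _ ex(1)] by blast
        qed
        hence fam: "fun_vs.independent (chi ` ?S)" "!!X Y. X \<in> ?S ==> Y \<in> ?S ==> chi X = chi Y ==> meq X Y"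
          using chi_independent_family[of ?S c M] M(1,2) mindec(1) by blast+
        have "chi Z \<notin> add_classes E"
        proof
          assume "chi Z \<in> add_classes E"
          then obtain X where X: "mindec X" "madd E X" "chi X = chi Z" unfolding add_classes_def by auto
          hence "meq X Z" using fam(2)[of X Z] by blast
          thus False using nX X by blast
        qed
        moreover have "chi ` ?S = insert (chi Z) (add_classes E)" unfolding add_classes_def by auto
        ultimately have "chi Z \<notin> fun_vs.span (add_classes E)" using fam(1) by (simp add: fun_vs.independent_insert)
        thus False using sp chi_in_idem_classes[OF two_term_cx[OF Z]] by simp
      qed
    next
      case (bsum F G H)
      thus ?case using mtri_bsum[OF T] iso meq_sym by blast
    qed
    moreover have "pow_cx r E \<in> T" using madd_pow[OF two_term_cx[OF E]] sub by blast
    ultimately show ?thesis using mtri_kernel[OF T _ _ cx_stalk[OF q] Q(2)] by blast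
  qed
  have "stalk n q \<in> T" if "q * q = q" for n q
    using st[OF that] T mshift_stalk[of c n q] unfolding mtri_def by metis
  thus "{X. cx X} \<subseteq> T" using mtri_stalks[OF T] by blast
qed

theorem mgen_iff_card:
  assumes E: "two_term c E" and ext: "ext_zero c E E"
  shows "mgen E \<longleftrightarrow> card (add_classes E) = card prim_classes"
proof -
  note ind = add_classes_family(1)[OF E ext]
  have sub: "add_classes E \<subseteq> fun_vs.span prim_classes" using add_classes_subset prim_classes_span by simp
  have fd: "fun_vs.fin_dim (fun_vs.span prim_classes)" unfolding fun_vs.fin_dim_def using prim_classes_finite by blast
  have dims: "fun_vs.dim (fun_vs.span (add_classes E)) = card (add_classes E)"
    "fun_vs.dim (fun_vs.span prim_classes) = card prim_classes"
    using fun_vs.dim_span_eq_card_independent ind prim_classes_independent by blast+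
  have "mgen E \<longleftrightarrow> fun_vs.span (add_classes E) = fun_vs.span prim_classes"
    using mgen_span span_mgen[OF E ext] prim_classes_span by metis
  also have "\<dots> \<longleftrightarrow> card (add_classes E) = card prim_classes"
  proof
    assume "card (add_classes E) = card prim_classes"
    thus "fun_vs.span (add_classes E) = fun_vs.span prim_classes"
      using fun_vs.dim_eq_imp_eq[OF fun_vs.subspace_span fun_vs.span_minimal[OF sub fun_vs.subspace_span] fd] dims by simp
  qed (use dims in metis)
  finally show ?thesis .
qed

end

section \<open>Complexes with cohomology in two degrees\<close>

text \<open>The contraction is built upwards, starting where the objects vanish. The remainder
  \<open>q = ob E n - df E (n - 1) * h n\<close> kills all cocycles, since these are coboundaries,
  and the hypothesis \<open>inj\<close>, injectivity of the ring, factors it through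
  \<open>df E n\<close>; the factor is the next component. The last equation says that the next
  differential splits, which makes the later truncation an idempotent.\<close>

lemma contraction_below:
  fixes E :: "'r::ring mcx"
  assumes E: "cx E"
    and ex: "!!n y. n \<le> c ==> ob E n * y = y ==> df E n * y = 0 ==> \<exists>z. y = df E (n - 1) * z"
    and inj: "!!d q :: 'r. (!!y. d * y = 0 ==> q * y = 0) ==> \<exists>h. q = h * d"
    and a: "!!m. m \<le> a ==> ob E m = 0" "a \<le> c + 1"
  shows "\<exists>h. (\<forall>m. h m \<in> arr (ob E m) (ob E (m - 1))) \<and> (\<forall>m\<le>c. ob E m = df E (m - 1) * h m + h (m + 1) * df E m) \<and>
     df E c * h (c + 1) * df E c = df E c"
proof -
  have "\<exists>h. (\<forall>m. h m \<in> arr (ob E m) (ob E (m - 1))) \<and> (\<forall>m<n. ob E m = df E (m - 1) * h m + h (m + 1) * df E m) \<and>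
     df E (n - 1) * h n * df E (n - 1) = df E (n - 1)" if "a \<le> n" "n \<le> c + 1" for n
    using that
  proof (induction n rule: int_ge_induct)
    case base
    have "df E (a - 1) = 0" using cxD(6)[OF E, of a] a(1)[of a] by (auto dest: hom_to_zero)
    thus ?case using a(1) by (intro exI[of _ "%_. 0"]) auto
  next
    case (step n)
    then obtain h where h: "!!m. h m \<in> arr (ob E m) (ob E (m - 1))" "!!m. m < n ==> ob E m = df E (m - 1) * h m + h (m + 1) * df E m"
      "df E (n - 1) * h n * df E (n - 1) = df E (n - 1)" by auto
    define q where "q = ob E n - df E (n - 1) * h n"
    have qd: "q * df E (n - 1) = 0" unfolding q_def using h(3) cxD(9)[OF E, of n] by (simp add: left_diff_distrib)
    have qh: "q \<in> arr (ob E n) (ob E n)" unfolding q_def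
      using hom_id[OF cxD(1)[OF E, of n]] hom_mult[OF h(1) cxD(6)[OF E]] by (rule hom_diff)
    have "q * y = 0" if y: "df E n * y = 0" for y
    proof -
      have "df E n * (ob E n * y) = 0" using y cxD(8)[OF E, of n] by (simp add: mult.assoc[symmetric])
      moreover have "ob E n * (ob E n * y) = ob E n * y" using cxD(1)[OF E] by (simp add: mult.assoc[symmetric])
      ultimately obtain z where "ob E n * y = df E (n - 1) * z" using ex[of n "ob E n * y"] step.prems by auto
      hence "q * (ob E n * y) = 0" using qd by (simp add: mult.assoc[symmetric])
      thus ?thesis using arrD(2)[OF qh] by (simp add: mult.assoc[symmetric])
    qed
    then obtain g0 where g0: "q = g0 * df E n" using inj by blast
    define g where "g = ob E n * g0 * ob E (n + 1)"
    have gh: "g \<in> arr (ob E (n + 1)) (ob E n)" unfolding g_def using cxD(1)[OF E] by (intro hom_corner)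
    have "g * df E n = ob E n * (g0 * (ob E (n + 1) * df E n))" unfolding g_def by (simp add: mult.assoc)
    hence gq: "g * df E n = q" unfolding cxD(7)[OF E] g0[symmetric] using arrD(1)[OF qh] by simp
    define h' where "h' = h(n + 1 := g)"
    have "df E n * g * df E n = df E n * q" using gq by (simp add: mult.assoc)
    also have "\<dots> = df E n" unfolding q_def using cxD(5,8)[OF E, of n] by (simp add: right_diff_distrib mult.assoc[symmetric])
    finally have 1: "df E (n + 1 - 1) * h' (n + 1) * df E (n + 1 - 1) = df E (n + 1 - 1)" unfolding h'_def by simp
    have "ob E m = df E (m - 1) * h' m + h' (m + 1) * df E m" if "m < n + 1" for m
    proof (cases "m = n")
      case True
      thus ?thesis unfolding h'_def using gq by (simp add: q_def)
    next
      case False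
      thus ?thesis using h(2)[of m] that unfolding h'_def by simp
    qed
    moreover have "h' m \<in> arr (ob E m) (ob E (m - 1))" for m unfolding h'_def using h(1)[of m] gh by auto
    ultimately show ?case using 1 by blast
  qed
  from this[of "c + 1"] show ?thesis using a(2) by auto
qed

text \<open>Dually, the contraction is built downwards. The remainder \<open>q\<close> consists of
  cocycles, and exactness writes it as \<open>df E (n - 1) * z\<close>; projectivity is implicit in
  the fact that exactness speaks of whole matrices.\<close>

lemma contraction_above:
  fixes E :: "'r::ring mcx"
  assumes E: "cx E"
    and ex: "!!n y. n \<ge> c ==> ob E n * y = y ==> df E n * y = 0 ==> \<exists>z. y = df E (n - 1) * z"
    and b: "!!m. m \<ge> b ==> ob E m = 0" "c - 1 \<le> b"
  shows "\<exists>h. (\<forall>m. h m \<in> arr (ob E m) (ob E (m - 1))) \<and> (\<forall>m\<ge>c. ob E m = df E (m - 1) * h m + h (m + 1) * df E m) \<and>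
     df E (c - 1) * h c * df E (c - 1) = df E (c - 1)"
proof -
  have "\<exists>h. (\<forall>m. h m \<in> arr (ob E m) (ob E (m - 1))) \<and> (\<forall>m>n. ob E m = df E (m - 1) * h m + h (m + 1) * df E m) \<and>
     df E n * h (n + 1) * df E n = df E n" if "n \<le> b" "c - 1 \<le> n" for n
    using that
  proof (induction n rule: int_le_induct)
    case base
    have "df E b = 0" using cxD(2)[OF E, of b] b(1)[of b] by (auto dest: hom_from_zero)
    thus ?case using b(1) by (intro exI[of _ "%_. 0"]) auto
  next
    case (step n)
    then obtain h where h: "!!m. h m \<in> arr (ob E m) (ob E (m - 1))" "!!m. m > n ==> ob E m = df E (m - 1) * h m + h (m + 1) * df E m"
      "df E n * h (n + 1) * df E n = df E n" by auto
    define q where "q = ob E n - h (n + 1) * df E n"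
    have h1: "h (n + 1) \<in> arr (ob E (n + 1)) (ob E n)" using h(1)[of "n + 1"] by simp
    have qh: "q \<in> arr (ob E n) (ob E n)" unfolding q_def
      using hom_id[OF cxD(1)[OF E, of n]] hom_mult[OF cxD(2)[OF E] h1] by (rule hom_diff)
    have "df E n * q = 0" unfolding q_def using h(3) cxD(8)[OF E, of n] by (simp add: right_diff_distrib mult.assoc)
    moreover have "ob E n * q = q" using qh by (rule arrD)
    ultimately obtain z where z: "q = df E (n - 1) * z" using ex[of n q] step by auto
    define g where "g = ob E (n - 1) * z * ob E n"
    have gh: "g \<in> arr (ob E n) (ob E (n - 1))" unfolding g_def using cxD(1)[OF E] by (intro hom_corner)
    have "df E (n - 1) * ob E (n - 1) = df E (n - 1)" using cxD(6)[OF E] by (rule arrD)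
    hence "df E (n - 1) * g = df E (n - 1) * z * ob E n" unfolding g_def by (simp add: mult.assoc[symmetric])
    hence gq: "df E (n - 1) * g = q" unfolding z[symmetric] using arrD(2)[OF qh] by simp
    define h' where "h' = h(n := g)"
    have "df E (n - 1) * g * df E (n - 1) = q * df E (n - 1)" using gq by simp
    also have "\<dots> = df E (n - 1)" unfolding q_def using cxD(5,9)[OF E, of n] by (simp add: left_diff_distrib mult.assoc)
    finally have 1: "df E (n - 1) * h' (n - 1 + 1) * df E (n - 1) = df E (n - 1)" unfolding h'_def by simp
    have "ob E m = df E (m - 1) * h' m + h' (m + 1) * df E m" if "m > n - 1" for m
    proof (cases "m = n")
      case True
      thus ?thesis unfolding h'_def using gq by (simp add: q_def)
    next
      case False
      thus ?thesis using h(2)[of m] that unfolding h'_def by simp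
    qed
    moreover have "h' m \<in> arr (ob E m) (ob E (m - 1))" for m unfolding h'_def using h(1)[of m] gh by auto
    ultimately show ?case using 1 by blast
  qed
  from this[of "c - 1"] show ?thesis using b(2) by auto
qed

text \<open>The contracting homotopies above and below the two cohomology degrees combine to an idempotent
  chain map that is homotopic to the identity and lives in degrees \<open>c - 1\<close> and \<open>c\<close>.\<close>

lemma two_term_reduction:
  fixes E :: "'r::ring mcx"
  assumes E: "cx E"
    and ex: "!!n y. n ~= c ==> n ~= c - 1 ==> ob E n * y = y ==> df E n * y = 0 ==> \<exists>z. y = df E (n - 1) * z"
    and inj: "!!d q :: 'r. (!!y. d * y = 0 ==> q * y = 0) ==> \<exists>h. q = h * d"
  obtains F where "two_term c F" "meq E F"
proof -
  \<comment> \<open>Adding \<open>c\<close> makes the set nonempty and places \<open>c\<close>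
    between its minimum and its maximum, as the two inductions require.\<close>
  define S where "S = insert c {n. ob E n ~= 0}"
  have S: "finite S" unfolding S_def using cxD(4)[OF E] by simp
  have "\<exists>h. (\<forall>m. h m \<in> arr (ob E m) (ob E (m - 1))) \<and> (\<forall>m\<le>c - 2. ob E m = df E (m - 1) * h m + h (m + 1) * df E m) \<and>
     df E (c - 2) * h (c - 2 + 1) * df E (c - 2) = df E (c - 2)"
  proof (rule contraction_below[OF E _ inj, of _ "Min S - 2"])
    show "ob E m = 0" if "m \<le> Min S - 2" for m
    proof (rule ccontr)
      assume "ob E m ~= 0"
      hence "Min S \<le> m" using S by (intro Min_le) (auto simp: S_def)
      thus False using that by simp
    qed
    have "Min S \<le> c" using S by (intro Min_le) (auto simp: S_def)
    thus "Min S - 2 \<le> c - 2 + 1" by simp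
  qed (use ex in auto)
  then obtain h where h: "!!m. h m \<in> arr (ob E m) (ob E (m - 1))" "!!m. m \<le> c - 2 ==> ob E m = df E (m - 1) * h m + h (m + 1) * df E m"
    "df E (c - 2) * h (c - 1) * df E (c - 2) = df E (c - 2)" by auto
  have "\<exists>h. (\<forall>m. h m \<in> arr (ob E m) (ob E (m - 1))) \<and> (\<forall>m\<ge>c + 1. ob E m = df E (m - 1) * h m + h (m + 1) * df E m) \<and>
     df E (c + 1 - 1) * h (c + 1) * df E (c + 1 - 1) = df E (c + 1 - 1)"
  proof (rule contraction_above[OF E, of _ "Max S + 1"])
    show "ob E m = 0" if "m \<ge> Max S + 1" for m
    proof (rule ccontr)
      assume "ob E m ~= 0"
      hence "m \<le> Max S" using S by (intro Max_ge) (auto simp: S_def)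
      thus False using that by simp
    qed
    have "c \<le> Max S" using S by (intro Max_ge) (auto simp: S_def)
    thus "c + 1 - 1 \<le> Max S + 1" by simp
  qed (use ex in auto)
  then obtain k where k: "!!m. k m \<in> arr (ob E m) (ob E (m - 1))" "!!m. m \<ge> c + 1 ==> ob E m = df E (m - 1) * k m + k (m + 1) * df E m"
    "df E c * k (c + 1) * df E c = df E c" by auto
  \<comment> \<open>The component from degree \<open>c\<close> to degree \<open>c - 1\<close> is the
    only one left out. Outside these degrees the homotopy cancels the identity completely, and
    inside it subtracts the parts that split off.\<close>
  define H where "H n = (if n \<le> c - 1 then h n else if n \<ge> c + 1 then k n else 0)" for n
  have H: "H n \<in> arr (ob E n) (ob E (n - 1))" for n unfolding H_def using h(1) k(1) by auto
  define g where "g n = df E (n - 1) * H n + H (n + 1) * df E n" for n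
  have gn: "g \<in> nulls E E" by (rule nullsI[OF H]) (simp add: g_def)
  define f where "f = ob E - g"
  have f: "f \<in> mhoms E E" unfolding f_def using mhoms_id[OF E] nulls_mhoms[OF E E gn] by (rule mhoms_diff)
  have f0: "f n = 0" if "n ~= c" "n ~= c - 1" for n
  proof (cases "n \<le> c - 2")
    case True
    thus ?thesis using h(2)[of n] unfolding f_def g_def H_def by simp
  next
    case False
    hence "n \<ge> c + 1" using that by linarith
    thus ?thesis using k(2)[of n] unfolding f_def g_def H_def by simp
  qed
  have fc: "f c = ob E c - k (c + 1) * df E c" unfolding f_def g_def H_def by simp
  have fc1: "f (c - 1) = ob E (c - 1) - df E (c - 2) * h (c - 1)" unfolding f_def g_def H_def by simp
  have ff: "f * f = f"
  proof
    fix n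
    consider "n = c" | "n = c - 1" | "n ~= c" "n ~= c - 1" by blast
    thus "(f * f) n = f n"
    proof cases
      case 1
      have kd: "k (c + 1) * df E c \<in> arr (ob E c) (ob E c)"
        using hom_mult[OF cxD(2)[OF E, of c] k(1)[of "c + 1", simplified]] .
      have "k (c + 1) * df E c * (k (c + 1) * df E c) = k (c + 1) * df E c"
        using k(3) by (metis mult.assoc)
      thus ?thesis unfolding 1 times_fun_apply fc using arrD[OF kd] cxD(1)[OF E, of c] by (simp add: algebra_simps)
    next
      case 2
      have "c - 1 - 1 = c - 2" by simp
      hence hd: "df E (c - 2) * h (c - 1) \<in> arr (ob E (c - 1)) (ob E (c - 1))"
        using hom_mult[OF h(1)[of "c - 1"] cxD(6)[OF E, of "c - 1"]] by metis
      have "df E (c - 2) * h (c - 1) * (df E (c - 2) * h (c - 1)) = df E (c - 2) * h (c - 1)"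
        using h(3) by (metis mult.assoc)
      thus ?thesis unfolding 2 times_fun_apply fc1 using arrD[OF hd] cxD(1)[OF E, of "c - 1"] by (simp add: algebra_simps)
    qed (simp add: f0)
  qed
  note s = sub_cx[OF E f ff]
  have "heq E E f (ob E)" unfolding heq_def f_def using nulls_uminus[OF gn] by simp
  hence "heq E E (f * f) (ob E)" by (simp only: ff)
  hence "meq E (sub_cx E f)" unfolding meq_def mequiv_def using s(2,3) ff heq_refl by (metis sub_cx_sel(1))
  moreover have "two_term c (sub_cx E f)" unfolding two_term_def using s(1) f0 by simp
  ultimately show ?thesis using that by blast
qed

section \<open>Finite matrices\<close>

text \<open>Matrices of all finite sizes in a single type, so that all finitely generated
  projectives are idempotents of one ring. In return the ring has no unit.\<close>

typedef (overloaded) 'a fmat = "{m :: nat => nat => 'a::zero. finite {(i, j). m i j ~= 0}}"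
  morphisms entry Abs_fmat
  by (rule exI[of _ "%_ _. 0"]) simp

setup_lifting type_definition_fmat

lemma fmat_eqI: "(!!i j. entry x i j = entry y i j) ==> x = y"
  by (metis entry_inject ext)

lemma finite_entries: "finite {(i, j). entry x i j ~= 0}"
  using entry[of x] by simp

definition row_support :: "'a::zero fmat => nat => nat set" where
  "row_support x i = {k. entry x i k ~= 0}"

lemma finite_row_support: "finite (row_support x i)"
proof -
  have "row_support x i \<subseteq> snd ` {(i, j). entry x i j ~= 0}" unfolding row_support_def by force
  thus ?thesis using finite_entries[of x] finite_surj by blast
qed

lemma fmat_bound: "\<exists>N. \<forall>i j. N \<le> i \<or> N \<le> j --> entry x i j = 0"
proof -
  let ?S = "{(i, j). entry x i j ~= 0}"
  have f: "finite (fst ` ?S \<union> snd ` ?S)" using finite_entries[of x] by simp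
  have "entry x i j = 0" if "Suc (Max (fst ` ?S \<union> snd ` ?S)) \<le> i \<or> Suc (Max (fst ` ?S \<union> snd ` ?S)) \<le> j" for i j
  proof (rule ccontr)
    assume "entry x i j ~= 0"
    hence "i \<in> fst ` ?S \<union> snd ` ?S" "j \<in> fst ` ?S \<union> snd ` ?S" by force+
    hence "i \<le> Max (fst ` ?S \<union> snd ` ?S)" "j \<le> Max (fst ` ?S \<union> snd ` ?S)" using Max_ge[OF f] by blast+
    thus False using that by linarith
  qed
  thus ?thesis by blast
qed

instantiation fmat :: (ring_1) ring
begin

lift_definition zero_fmat :: "'a fmat" is "%_ _. 0" by simp

lift_definition plus_fmat :: "'a fmat => 'a fmat => 'a fmat" is "%x y i j. x i j + y i j"
proof -
  fix x y :: "nat => nat => 'a"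
  assume "finite {(i, j). x i j ~= 0}" "finite {(i, j). y i j ~= 0}"
  hence "finite ({(i, j). x i j ~= 0} \<union> {(i, j). y i j ~= 0})" by simp
  thus "finite {(i, j). x i j + y i j ~= 0}" by (rule finite_subset[rotated]) auto
qed

lift_definition uminus_fmat :: "'a fmat => 'a fmat" is "%x i j. - x i j" by simp

definition minus_fmat :: "'a fmat => 'a fmat => 'a fmat" where "minus_fmat x y = x + - y"

lift_definition times_fmat :: "'a fmat => 'a fmat => 'a fmat" is
  "%x y i j. \<Sum>k | x i k ~= 0. x i k * y k j"
proof -
  fix x y :: "nat => nat => 'a"
  assume f: "finite {(i, j). x i j ~= 0}" "finite {(i, j). y i j ~= 0}"
  have "{(i, j). (\<Sum>k | x i k ~= 0. x i k * y k j) ~= 0} \<subseteq> fst ` {(i, j). x i j ~= 0} \<times> snd ` {(i, j). y i j ~= 0}"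
  proof
    fix p assume "p \<in> {(i, j). (\<Sum>k | x i k ~= 0. x i k * y k j) ~= 0}"
    then obtain i j where p: "p = (i, j)" "(\<Sum>k | x i k ~= 0. x i k * y k j) ~= 0" by blast
    then obtain k where "x i k * y k j ~= 0" by (meson sum.not_neutral_contains_not_neutral)
    hence "x i k ~= 0" "y k j ~= 0" by auto
    thus "p \<in> fst ` {(i, j). x i j ~= 0} \<times> snd ` {(i, j). y i j ~= 0}" unfolding p by force
  qed
  thus "finite {(i, j). (\<Sum>k | x i k ~= 0. x i k * y k j) ~= 0}" using f by (auto intro: finite_subset)
qed

lemma entry_times_superset:
  fixes x y :: "'a fmat"
  assumes "finite S" "row_support x i \<subseteq> S"
  shows "entry (x * y) i j = (\<Sum>k\<in>S. entry x i k * entry y k j)"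
  unfolding times_fmat.rep_eq using assms unfolding row_support_def by (intro sum.mono_neutral_left) auto

instance
proof
  fix x y z :: "'a fmat"
  show "x + y + z = x + (y + z)" "x + y = y + x" "0 + x = x" "- x + x = 0" by (transfer; simp add: algebra_simps)+
  show "x - y = x + - y" by (rule minus_fmat_def)
  show "x * y * z = x * (y * z)"
  proof (rule fmat_eqI)
    fix i j
    obtain N where N: "!!i j. N \<le> i \<or> N \<le> j ==> entry x i j = 0" using fmat_bound[of x] by blast
    obtain N' where N': "!!i j. N' \<le> i \<or> N' \<le> j ==> entry y i j = 0" using fmat_bound[of y] by blast
    have x: "row_support x i \<subseteq> {..<N}" for i unfolding row_support_def using N leI by blast
    have y: "row_support y i \<subseteq> {..<N'}" for i unfolding row_support_def using N' leI by blast
    have "entry (x * y) i j = 0" if "N' \<le> j" for i j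
      using entry_times_superset[OF _ x, of y i j] N' that by simp
    hence xy: "row_support (x * y) i \<subseteq> {..<N'}" unfolding row_support_def using leI by blast
    have "entry (x * y * z) i j = (\<Sum>k<N'. (\<Sum>l<N. entry x i l * entry y l k) * entry z k j)"
      using entry_times_superset[OF _ xy, of z j] entry_times_superset[OF _ x, of y i] by simp
    also have "\<dots> = (\<Sum>l<N. entry x i l * (\<Sum>k<N'. entry y l k * entry z k j))"
      unfolding sum_distrib_left sum_distrib_right mult.assoc by (rule sum.swap)
    also have "\<dots> = entry (x * (y * z)) i j"
      using entry_times_superset[OF _ x, of "y * z" i j] entry_times_superset[OF _ y, of z _ j] by simp
    finally show "entry (x * y * z) i j = entry (x * (y * z)) i j" .
  qed
  show "(x + y) * z = x * z + y * z"
  proof (rule fmat_eqI)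
    fix i j
    let ?S = "row_support x i \<union> row_support y i"
    have s: "finite ?S" "row_support (x + y) i \<subseteq> ?S" using finite_row_support[of x i] finite_row_support[of y i]
      by (auto simp: row_support_def plus_fmat.rep_eq)
    show "entry ((x + y) * z) i j = entry (x * z + y * z) i j"
      using entry_times_superset[OF s, of z j] entry_times_superset[OF s(1), of x i z j] entry_times_superset[OF s(1), of y i z j]
      by (simp add: plus_fmat.rep_eq distrib_right sum.distrib)
  qed
  show "x * (y + z) = x * y + x * z"
    by (rule fmat_eqI) (simp add: times_fmat.rep_eq plus_fmat.rep_eq distrib_left sum.distrib)
qed

end

lemma entry_simps [simp]: "entry 0 i j = 0" "entry (x + y) i j = entry x i j + entry y i j"
  "entry (- x) i j = - entry x i j" "entry (x - y) i j = entry x i j - entry y i j"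
  by (simp_all add: zero_fmat.rep_eq plus_fmat.rep_eq uminus_fmat.rep_eq diff_conv_add_uminus del: add_uminus_conv_diff)

lemma entry_sum: "entry (sum f I) i j = (\<Sum>k\<in>I. entry (f k) i j)"
  by (induction I rule: infinite_finite_induct) auto

text \<open>The case distinction keeps the support finite for an arbitrary function
  \<open>sc\<close>, of which no laws are known at this point.\<close>

lift_definition fscal :: "('k => 'a::zero => 'a) => 'k => 'a fmat => 'a fmat" is
  "%sc c x i j. if x i j = 0 then 0 else sc c (x i j)"
  by (auto elim: finite_subset[rotated])

lift_definition munitx :: "nat => nat => 'a::zero => 'a fmat" is "%k l a i j. if i = k \<and> j = l then a else 0"
  by (rule finite_subset[of _ "{(_, _)}"]) auto

text \<open>\<open>reindex s t x\<close> places \<open>x\<close> in the rows \<open>range s\<close> and the columns \<open>range t\<close>.\<close>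

lift_definition reindex :: "(nat => nat) => (nat => nat) => 'a::zero fmat => 'a fmat" is
  "%s t x i j. if i \<in> range s \<and> j \<in> range t then x (inv_into UNIV s i) (inv_into UNIV t j) else 0"
proof -
  fix s t :: "nat => nat" and x :: "nat => nat => 'a"
  assume "finite {(i, j). x i j ~= 0}"
  hence "finite (map_prod s t ` {(i, j). x i j ~= 0})" by simp
  thus "finite {(i, j). (if i \<in> range s \<and> j \<in> range t then x (inv_into UNIV s i) (inv_into UNIV t j) else 0) ~= 0}"
  proof (rule finite_subset[rotated], intro subsetI)
    fix p assume "p \<in> {(i, j). (if i \<in> range s \<and> j \<in> range t then x (inv_into UNIV s i) (inv_into UNIV t j) else 0) ~= 0}"
    then obtain i j where p: "p = (i, j)" "i \<in> range s" "j \<in> range t" "x (inv_into UNIV s i) (inv_into UNIV t j) ~= 0" by (auto split: if_splits)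
    hence "p = map_prod s t (inv_into UNIV s i, inv_into UNIV t j)" by (simp add: f_inv_into_f)
    thus "p \<in> map_prod s t ` {(i, j). x i j ~= 0}" using p(4) by blast
  qed
qed

lemma reindex_mult:
  fixes x y :: "'a::ring_1 fmat"
  assumes t: "inj t"
  shows "reindex s t x * reindex t u y = reindex s u (x * y)"
proof (rule fmat_eqI)
  fix i j
  show "entry (reindex s t x * reindex t u y) i j = entry (reindex s u (x * y)) i j"
  proof (cases "i \<in> range s")
    case True
    have r: "row_support (reindex s t x) i \<subseteq> t ` row_support x (inv_into UNIV s i)"
    proof
      fix k assume "k \<in> row_support (reindex s t x) i"
      hence k: "k \<in> range t" "inv_into UNIV t k \<in> row_support x (inv_into UNIV s i)"
        unfolding row_support_def by (auto simp: reindex.rep_eq split: if_splits)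
      have "k = t (inv_into UNIV t k)" using k(1) by (simp add: f_inv_into_f)
      thus "k \<in> t ` row_support x (inv_into UNIV s i)" using k(2) by blast
    qed
    have "entry (reindex s t x * reindex t u y) i j =
        (\<Sum>k\<in>t ` row_support x (inv_into UNIV s i). entry (reindex s t x) i k * entry (reindex t u y) k j)"
      by (rule entry_times_superset[OF _ r]) (simp add: finite_row_support)
    also have "\<dots> = (\<Sum>k\<in>row_support x (inv_into UNIV s i). entry (reindex s t x) i (t k) * entry (reindex t u y) (t k) j)"
      using t by (subst sum.reindex) (auto simp: inj_on_def)
    also have "\<dots> = entry (reindex s u (x * y)) i j"
      using True t by (auto simp: reindex.rep_eq inv_f_f entry_times_superset[OF finite_row_support order_refl])
    finally show ?thesis .
  qed (auto simp: reindex.rep_eq times_fmat.rep_eq)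
qed

lemma reindex_mult_zero:
  fixes x y :: "'a::ring_1 fmat"
  assumes "range t \<inter> range t' = {}"
  shows "reindex s t x * reindex t' u y = 0"
proof (rule fmat_eqI)
  fix i j
  have "entry (reindex s t x) i k * entry (reindex t' u y) k j = 0" for k
    using assms by (cases "k \<in> range t") (auto simp: reindex.rep_eq)
  thus "entry (reindex s t x * reindex t' u y) i j = entry 0 i j" by (simp add: times_fmat.rep_eq zero_fmat.rep_eq)
qed

lemma reindex_id: "reindex id id x = x"
  by (rule fmat_eqI) (simp add: reindex.rep_eq)

text \<open>Even and odd positions make room for the two blocks of a direct sum, since the matrices
  have no fixed size behind which a second block could start.\<close>

definition ev :: "nat => nat" where "ev n = 2 * n"
definition od :: "nat => nat" where "od n = 2 * n + 1"

lemma ev_od: "inj ev" "inj od" "range ev \<inter> range od = {}" "range od \<inter> range ev = {}"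
  unfolding ev_def od_def inj_on_def by (auto, presburger+)

lemma munitx_mult: "munitx i k a * munitx k' j b = (if k = k' then munitx i j (a * b) else (0 :: 'a::ring_1 fmat))"
proof (rule fmat_eqI)
  fix r s
  have "row_support (munitx i k a) r \<subseteq> {k}" unfolding row_support_def by (auto simp: munitx.rep_eq split: if_splits)
  from entry_times_superset[OF _ this, of "munitx k' j b" s]
  show "entry (munitx i k a * munitx k' j b) r s = entry (if k = k' then munitx i j (a * b) else 0) r s"
    by (auto simp: munitx.rep_eq)
qed

lemma fmat_expand:
  assumes "!!i j. N \<le> i \<or> M \<le> j ==> entry x i j = 0"
  shows "x = (\<Sum>i<N. \<Sum>j<M. munitx i j (entry x i j))"
proof (rule fmat_eqI)
  fix r s
  have "(\<Sum>i<N. \<Sum>j<M. entry (munitx i j (entry x i j)) r s) = (\<Sum>i<N. \<Sum>j<M. if j = s then (if i = r then entry x r s else 0) else 0)"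
    by (intro sum.cong) (auto simp: munitx.rep_eq)
  also have "\<dots> = (if r < N \<and> s < M then entry x r s else 0)" by (cases "s < M") simp_all
  also have "\<dots> = entry x r s" using assms[of r s] by auto
  finally show "entry x r s = entry (\<Sum>i<N. \<Sum>j<M. munitx i j (entry x i j)) r s" by (simp add: entry_sum)
qed

lemma linear_space_fscal:
  assumes "unital_algebra scale" shows "linear_space (fscal scale)"
proof -
  interpret unital_algebra scale by fact
  have e: "entry (fscal scale c x) i j = scale c (entry x i j)" for c x i j by (simp add: fscal.rep_eq)
  show ?thesis by unfold_locales (auto intro!: fmat_eqI simp: e algebra_simps)
qed

text \<open>A morphism \<open>x = g * x * f\<close> is supported in the rectangle given by the
  bounds of \<open>g\<close> and \<open>f\<close>, so a basis of the algebra in each position spans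
  the morphism space. The generator is the matrix unit at \<open>(0, 0)\<close>: a matrix is the sum
  over \<open>i\<close> of the unit at \<open>(i, 0)\<close> times the matrix with its row
  \<open>i\<close> moved to row 0.\<close>

theorem hom_finite_ring_fmat:
  fixes scale :: "'k::field => 'a::ring_1 => 'a"
  assumes "fin_dim_algebra scale"
  shows "hom_finite_ring (fscal scale) (%e f. reindex ev ev e + reindex od od f) (%e f. reindex ev id e)
    (%e f. reindex od id f) (%e f. reindex id ev e) (%e f. reindex id od f) (munitx 0 0 1)"
proof -
  interpret A: unital_algebra scale using assms unfolding fin_dim_algebra_def by blast
  obtain B where B: "finite_dimensional_vector_space scale B" using assms unfolding fin_dim_algebra_def by blast
  interpret B: finite_dimensional_vector_space scale B by fact
  have lin: "linear_space (fscal scale)" by (rule linear_space_fscal) unfold_locales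
  interpret L: linear_space "fscal scale" by (rule lin)
  have e: "entry (fscal scale c x) i j = scale c (entry x i j)" for c x i j by (simp add: fscal.rep_eq)
  have sl: "fscal scale c x * y = fscal scale c (x * y)" for c x y
  proof (rule fmat_eqI)
    fix i j
    have "row_support (fscal scale c x) i \<subseteq> row_support x i" unfolding row_support_def by (auto simp: e)
    from entry_times_superset[OF finite_row_support this, of y j] entry_times_superset[OF finite_row_support order_refl, of x y i j]
    show "entry (fscal scale c x * y) i j = entry (fscal scale c (x * y)) i j"
      by (simp add: e A.scale_mult_left A.scale_sum_right)
  qed
  have sr: "x * fscal scale c y = fscal scale c (x * y)" for c x y
    by (rule fmat_eqI) (simp add: times_fmat.rep_eq e A.scale_mult_right A.scale_sum_right)
  have fd: "L.fin_dim (arr f g)" for f g :: "'a fmat"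
  proof -
    obtain N where N: "!!i j. N \<le> i \<or> N \<le> j ==> entry g i j = 0" using fmat_bound[of g] by blast
    obtain M where M: "!!i j. M \<le> i \<or> M \<le> j ==> entry f i j = 0" using fmat_bound[of f] by blast
    let ?S = "\<Union>i<N. \<Union>j<M. munitx i j ` B"
    have "munitx i j a \<in> L.span ?S" if ij: "i < N" "j < M" for i j a
    proof -
      let ?T = "{a. munitx i j a \<in> L.span ?S}"
      have ma: "munitx i j (a + b) = munitx i j a + munitx i j b" "munitx i j (scale c a) = fscal scale c (munitx i j a)"
        "munitx i j 0 = (0 :: 'a fmat)" for a b c
        by (auto intro!: fmat_eqI simp: munitx.rep_eq e)
      have "A.span B \<subseteq> ?T"
      proof (rule A.span_minimal)
        show "B \<subseteq> ?T" using ij by (auto intro!: L.span_base)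
        show "A.subspace ?T" unfolding A.subspace_def by (auto simp: ma intro: L.span_add L.span_scale L.span_zero)
      qed
      thus ?thesis using B.span_Basis by auto
    qed
    moreover have "x = (\<Sum>i<N. \<Sum>j<M. munitx i j (entry x i j))" if x: "x \<in> arr f g" for x
    proof (rule fmat_expand)
      fix i j assume ij: "N \<le> i \<or> M \<le> j"
      have "entry x i j = entry (g * x) i j" "entry x i j = entry (x * f) i j" using arrD[OF x] by simp_all
      thus "entry x i j = 0" using ij N M unfolding times_fmat.rep_eq by (metis (no_types, lifting) mult_zero_left mult_zero_right sum.neutral)
    qed
    ultimately have "arr f g \<subseteq> L.span ?S" by (metis (no_types, lifting) L.span_sum lessThan_iff subsetI)
    moreover have "finite ?S" using B.finite_Basis by simp
    ultimately show ?thesis unfolding L.fin_dim_def by blast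
  qed
  show ?thesis
  proof (intro hom_finite_ring.intro hom_finite_ring_axioms.intro lin)
    fix f g :: "'a fmat" assume f: "f * f = f" and g: "g * g = g"
    note r = reindex_mult[OF ev_od(1)] reindex_mult[OF ev_od(2)] reindex_mult[OF inj_on_id] reindex_mult_zero[OF ev_od(3)] reindex_mult_zero[OF ev_od(4)]
    show "(reindex ev ev f + reindex od od g) * (reindex ev ev f + reindex od od g) = reindex ev ev f + reindex od od g \<and>
       reindex ev id f \<in> arr f (reindex ev ev f + reindex od od g) \<and> reindex od id g \<in> arr g (reindex ev ev f + reindex od od g) \<and>
       reindex id ev f \<in> arr (reindex ev ev f + reindex od od g) f \<and> reindex id od g \<in> arr (reindex ev ev f + reindex od od g) g \<and>
       reindex id ev f * reindex ev id f = f \<and> reindex id od g * reindex od id g = g \<and>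
       reindex id ev f * reindex od id g = 0 \<and> reindex id od g * reindex ev id f = 0 \<and>
       reindex ev id f * reindex id ev f + reindex od id g * reindex id od g = reindex ev ev f + reindex od od g"
      unfolding arr_def using r(3)[of ev f id f] r(3)[of od g id g] r(3)[of id f ev f] r(3)[of id g od g]
      by (simp add: distrib_left distrib_right r f g reindex_id)
  next
    show "munitx 0 0 1 * munitx 0 0 1 = (munitx 0 0 1 :: 'a fmat)" by (simp add: munitx_mult)
  next
    fix f :: "'a fmat" assume "f * f = f"
    obtain N where N: "!!i j. N \<le> i \<or> N \<le> j ==> entry f i j = 0" using fmat_bound[of f] by blast
    have "f = (\<Sum>i<N. munitx i 0 1 * munitx 0 0 1 * (\<Sum>j<N. munitx 0 j (entry f i j)))"
      using fmat_expand[of N N f] N by (simp add: sum_distrib_left munitx_mult)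
    thus "\<exists>n::nat. \<exists>u v. f = (\<Sum>i<n. u i * munitx 0 0 1 * v i)" by (intro exI)
  qed (auto simp: sl sr fd)
qed

section \<open>Column modules\<close>

text \<open>Columns may have infinitely many nonzero entries; the rows of the matrix are finite, and
  this suffices for the product.\<close>

definition act :: "'a::ring_1 fmat => 'a univ => 'a univ" where
  "act x v = (%i. \<Sum>k\<in>row_support x i. entry x i k * v k)"

lemma act_superset:
  assumes "finite S" "row_support x i \<subseteq> S"
  shows "act x v i = (\<Sum>k\<in>S. entry x i k * v k)"
  unfolding act_def using assms by (intro sum.mono_neutral_left) (auto simp: row_support_def)

lemma act_plus: "act x (v + w) = act x v + act x w"
  by (rule ext) (simp add: act_def distrib_left sum.distrib)

lemma act_add_left: "act (x + y) v = act x v + act y v"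
proof
  fix i
  let ?S = "row_support x i \<union> row_support y i"
  have s: "finite ?S" "row_support (x + y) i \<subseteq> ?S" using finite_row_support[of x i] finite_row_support[of y i]
    by (auto simp: row_support_def)
  show "act (x + y) v i = (act x v + act y v) i"
    using act_superset[OF s, of v] act_superset[OF s(1), of x i v] act_superset[OF s(1), of y i v]
    by (simp add: distrib_right sum.distrib)
qed

lemma act_zero [simp]: "act 0 v = 0" "act x 0 = 0"
  by (simp_all add: act_def fun_eq_iff row_support_def)

lemma act_uminus: "act (- x) v = - act x v" "act x (- v) = - act x v"
  by (simp_all add: act_def fun_eq_iff row_support_def sum_negf)

lemma act_diff: "act (x - y) v = act x v - act y v"
  using act_add_left[of x "- y" v] act_uminus(1)[of y v] by simp

lemma act_smult: "act x (%i. v i * a) = (%i. act x v i * a)"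
  by (simp add: act_def fun_eq_iff sum_distrib_right mult.assoc)

lemma act_times: "act (x * y) v = act x (act y v)"
proof
  fix i
  obtain N where N: "!!i j. N \<le> i \<or> N \<le> j ==> entry x i j = 0" using fmat_bound[of x] by blast
  obtain N' where N': "!!i j. N' \<le> i \<or> N' \<le> j ==> entry y i j = 0" using fmat_bound[of y] by blast
  have x: "row_support x i \<subseteq> {..<N}" for i unfolding row_support_def using N leI by blast
  have y: "row_support y i \<subseteq> {..<N'}" for i unfolding row_support_def using N' leI by blast
  have "entry (x * y) i j = 0" if "N' \<le> j" for i j
    using entry_times_superset[OF _ x, of y i j] N' that by simp
  hence xy: "row_support (x * y) i \<subseteq> {..<N'}" unfolding row_support_def using leI by blast
  have "act (x * y) v i = (\<Sum>k<N'. (\<Sum>l<N. entry x i l * entry y l k) * v k)"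
    using act_superset[OF _ xy, of v] entry_times_superset[OF _ x, of y i] by simp
  also have "\<dots> = (\<Sum>l<N. entry x i l * (\<Sum>k<N'. entry y l k * v k))"
    unfolding sum_distrib_left sum_distrib_right mult.assoc by (rule sum.swap)
  also have "\<dots> = act x (act y v) i"
    using act_superset[OF _ x, of "act y v" i] act_superset[OF _ y, of v] by simp
  finally show "act (x * y) v i = act x (act y v) i" .
qed

definition unitv :: "nat => 'a::ring_1 univ" where "unitv j = (%i. if i = j then 1 else 0)"

lemma act_unitv: "act x (unitv j) i = entry x i j"
proof -
  have "act x (unitv j) i = (\<Sum>k\<in>insert j (row_support x i). entry x i k * unitv j k)"
    by (rule act_superset) (auto simp: finite_row_support)
  also have "\<dots> = (\<Sum>k\<in>insert j (row_support x i). if k = j then entry x i j else 0)"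
    by (rule sum.cong) (auto simp: unitv_def)
  also have "\<dots> = entry x i j" using finite_row_support[of x i] by simp
  finally show ?thesis .
qed

lemma act_inject: "(!!v. act x v = act y v) ==> x = y"
  using act_unitv by (metis fmat_eqI)

text \<open>For an idempotent \<open>e\<close> this is the image of \<open>e\<close>, a finitely
  generated projective right module. Matrices act from the left and scalars from the right.\<close>

definition col :: "'a::ring_1 fmat => ('a, 'a univ) module" where
  "col e = \<lparr>carrier = {v. act e v = v}, mult = undefined, one = undefined,
     zero = 0, add = (+), smult = (%a v i. v i * a)\<rparr>"

lemma col_simps [simp]: "v \<in> carrier (col e) \<longleftrightarrow> act e v = v" "\<zero>\<^bsub>col e\<^esub> = 0" "v \<oplus>\<^bsub>col e\<^esub> w = v + w"
  "a \<odot>\<^bsub>col e\<^esub> v = (%i. v i * a)"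
  unfolding col_def by auto

lemma right_module_col: "right_module (col e)"
proof -
  have "abelian_group (col e)"
  proof (rule abelian_groupI)
    fix v assume "v \<in> carrier (col e)"
    thus "\<exists>w\<in>carrier (col e). w \<oplus>\<^bsub>col e\<^esub> v = \<zero>\<^bsub>col e\<^esub>" by (intro bexI[of _ "- v"]) (auto simp: act_uminus)
  qed (auto simp: act_plus add.assoc add.commute)
  thus ?thesis
    by (intro right_module.intro right_module_axioms.intro) (auto simp: act_smult fun_eq_iff distrib_left distrib_right mult.assoc)
qed

lemma col_a_inv: "v \<in> carrier (col e) ==> \<ominus>\<^bsub>col e\<^esub> v = - v"
  using abelian_group.minus_equality[OF right_module.axioms(1)[OF right_module_col[of e]], of "- v" v] by (simp add: act_uminus)

lemma col_bounded: "\<exists>N. \<forall>v\<in>carrier (col e). \<forall>i\<ge>N. v i = 0"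
proof -
  obtain N where N: "!!i j. N \<le> i \<or> N \<le> j ==> entry e i j = 0" using fmat_bound[of e] by blast
  have "v i = 0" if "act e v = v" "i \<ge> N" for v i
  proof -
    have "act e v i = 0" unfolding act_def using N that(2) by simp
    thus ?thesis using that(1) by simp
  qed
  thus ?thesis by (intro exI[of _ N]) simp
qed

lemma module_homsD:
  assumes "f \<in> module_homs M N"
  shows "x \<in> carrier M ==> f x \<in> carrier N" "x \<in> carrier M ==> y \<in> carrier M ==> f (x \<oplus>\<^bsub>M\<^esub> y) = f x \<oplus>\<^bsub>N\<^esub> f y"
    "x \<in> carrier M ==> f (a \<odot>\<^bsub>M\<^esub> x) = a \<odot>\<^bsub>N\<^esub> f x"
  using assms unfolding module_homs_def by auto

lemma module_homsI:
  assumes "!!x. x \<in> carrier M ==> f x \<in> carrier N"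
    and "!!x y. x \<in> carrier M ==> y \<in> carrier M ==> f (x \<oplus>\<^bsub>M\<^esub> y) = f x \<oplus>\<^bsub>N\<^esub> f y"
    and "!!a x. x \<in> carrier M ==> f (a \<odot>\<^bsub>M\<^esub> x) = a \<odot>\<^bsub>N\<^esub> f x"
  shows "f \<in> module_homs M N"
  using assms unfolding module_homs_def by auto

lemma module_homs_comp: "f \<in> module_homs L M ==> g \<in> module_homs M N ==> (%x. g (f x)) \<in> module_homs L N"
  by (rule module_homsI) (auto simp: module_homsD)

lemma module_homs_cong:
  assumes "f \<in> module_homs M N" "right_module M" "!!x. x \<in> carrier M ==> g x = f x"
  shows "g \<in> module_homs M N"
proof -
  interpret M: right_module M by fact
  show ?thesis using assms M.act_closed by (intro module_homsI) (auto simp: module_homsD)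
qed

lemma module_homs_zero:
  assumes "f \<in> module_homs M N" "right_module M" "right_module N"
  shows "f \<zero>\<^bsub>M\<^esub> = \<zero>\<^bsub>N\<^esub>"
proof -
  interpret M: right_module M by fact
  interpret N: right_module N by fact
  have c: "f \<zero>\<^bsub>M\<^esub> \<in> carrier N" by (rule module_homsD(1)[OF assms(1)]) simp
  have "f \<zero>\<^bsub>M\<^esub> \<oplus>\<^bsub>N\<^esub> f \<zero>\<^bsub>M\<^esub> = f \<zero>\<^bsub>M\<^esub>" using module_homsD(2)[OF assms(1), of "\<zero>\<^bsub>M\<^esub>" "\<zero>\<^bsub>M\<^esub>"] by simp
  thus ?thesis using N.add.r_cancel_one[OF c c] by simp
qed

lemma module_homs_a_inv:
  assumes "f \<in> module_homs M N" "right_module M" "right_module N" "x \<in> carrier M"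
  shows "f (\<ominus>\<^bsub>M\<^esub> x) = \<ominus>\<^bsub>N\<^esub> f x"
proof -
  interpret M: right_module M by fact
  interpret N: right_module N by fact
  have "f (\<ominus>\<^bsub>M\<^esub> x) \<oplus>\<^bsub>N\<^esub> f x = \<zero>\<^bsub>N\<^esub>"
    using module_homsD(2)[OF assms(1), of "\<ominus>\<^bsub>M\<^esub> x" x] assms module_homs_zero[OF assms(1-3)] by (simp add: M.l_neg)
  thus ?thesis using assms module_homsD(1)[OF assms(1)] by (intro N.minus_equality[symmetric]) auto
qed

lemma act_module_homs: "f \<in> arr e e' ==> act f \<in> module_homs (col e) (col e')"
  by (rule module_homsI) (auto simp: act_plus act_smult act_times[symmetric] arrD)

lemma module_homs_column_sum:
  assumes f: "f \<in> module_homs (col e) (col e')" and w: "!!j. w j \<in> carrier (col e)"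
  shows "f (%i. \<Sum>j\<in>S. w j i * b j) = (%i. \<Sum>j\<in>S. f (w j) i * b j) \<and> (%i. \<Sum>j\<in>S. w j i * b j) \<in> carrier (col e)"
proof (induction S rule: infinite_finite_induct)
  case (infinite A)
  thus ?case using module_homs_zero[OF f right_module_col right_module_col] by (simp add: zero_fun_def[symmetric])
next
  case empty
  thus ?case using module_homs_zero[OF f right_module_col right_module_col] by (simp add: zero_fun_def[symmetric])
next
  case (insert x S)
  have e: "(%i. \<Sum>j\<in>insert x S. w' j i * b j) = (%i. w' x i * b x) + (%i. \<Sum>j\<in>S. w' j i * b j)" for w' :: "'b => 'a univ"
    using insert.hyps by (simp add: fun_eq_iff)
  have c: "(%i. w x i * b x) \<in> carrier (col e)" using w[of x] by (simp add: act_smult)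
  have "f ((%i. w x i * b x) + (%i. \<Sum>j\<in>S. w j i * b j)) = (%i. f (w x) i * b x) + (%i. \<Sum>j\<in>S. f (w j) i * b j)"
    using module_homsD(2)[OF f c, of "%i. \<Sum>j\<in>S. w j i * b j"] insert.IH module_homsD(3)[OF f w, of "b x" x] by simp
  moreover have "(%i. w x i * b x) + (%i. \<Sum>j\<in>S. w j i * b j) \<in> carrier (col e)"
    using c insert.IH by (simp add: act_plus)
  ultimately show ?case unfolding e by blast
qed

lemma act_columns:
  assumes "!!i j. N \<le> j ==> entry e i j = 0"
  shows "act e v = (%i. \<Sum>j<N. act e (unitv j) i * v j)"
proof
  fix i
  have "row_support e i \<subseteq> {..<N}" using assms unfolding row_support_def by (auto intro: ccontr)
  from act_superset[OF _ this, of v] show "act e v i = (\<Sum>j<N. act e (unitv j) i * v j)" by (simp add: act_unitv)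
qed

text \<open>The columns of the matrix are the images of the generators
  \<open>act e (unitv j)\<close>. Both modules have bounded entries, so finitely many entries
  determine the homomorphism; the corner by \<open>e'\<close> and \<open>e\<close> turns the matrix
  into a morphism.\<close>

lemma module_homs_matrix:
  assumes f: "f \<in> module_homs (col e) (col e')" and e: "e * e = e" "e' * e' = e'"
  shows "\<exists>x\<in>arr e e'. \<forall>v\<in>carrier (col e). f v = act x v"
proof -
  obtain N where N: "!!i j. N \<le> i \<or> N \<le> j ==> entry e i j = 0" using fmat_bound[of e] by blast
  obtain M where M: "!!v i. v \<in> carrier (col e') ==> M \<le> i ==> v i = 0" using col_bounded[of e'] by metis
  define w where "w j = act e (unitv j)" for j
  have w: "w j \<in> carrier (col e)" for j unfolding w_def by (simp add: act_times[symmetric] e)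
  define x where "x = (\<Sum>i<M. \<Sum>j<N. munitx i j (f (w j) i))"
  have x: "entry x i j = (if i < M \<and> j < N then f (w j) i else 0)" for i j
  proof -
    have "entry x i j = (\<Sum>k<M. \<Sum>l<N. if l = j then (if k = i then f (w j) i else 0) else 0)"
      unfolding x_def entry_sum by (intro sum.cong) (auto simp: munitx.rep_eq)
    thus ?thesis by (cases "j < N") simp_all
  qed
  have fx: "f v = act x v" if v: "v \<in> carrier (col e)" for v
  proof
    fix i
    have "v = (%i. \<Sum>j<N. w j i * v j)" using act_columns[of N e v] N v unfolding w_def by simp
    hence "f v = (%i. \<Sum>j<N. f (w j) i * v j)" using module_homs_column_sum[where w = w and b = v and S = "{..<N}", OF f w] by metis
    hence fv: "f v i = (\<Sum>j<N. f (w j) i * v j)" by metis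
    have fz: "f (w j) i = 0" if "\<not> i < M" for j using M[OF module_homsD(1)[OF f w]] that by simp
    have "row_support x i \<subseteq> {..<N}" unfolding row_support_def x by auto
    from act_superset[OF _ this, of v] show "f v i = act x v i" unfolding fv x using fz by (auto intro!: sum.cong)
  qed
  have "f v = act (e' * x * e) v" if v: "v \<in> carrier (col e)" for v
  proof -
    have "act e' (f v) = f v" using module_homsD(1)[OF f v] by simp
    thus ?thesis using v fx[OF v] by (simp add: act_times)
  qed
  thus ?thesis using hom_corner[OF e, of x] by blast
qed

lemma act_faithful:
  assumes "x \<in> arr e e'" "y \<in> arr e e'" "e * e = e" "!!v. v \<in> carrier (col e) ==> act x v = act y v"
  shows "x = y"
proof (rule act_inject)
  fix v
  have "act x (act e v) = act y (act e v)" by (rule assms(4)) (simp add: act_times[symmetric] assms(3))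
  thus "act x v = act y v" using arrD(2)[OF assms(1)] arrD(2)[OF assms(2)] by (simp add: act_times[symmetric])
qed

lemma zero_module_col: "e * e = e ==> zero_module (col e) \<longleftrightarrow> e = 0"
proof
  assume e: "e * e = e" and z: "zero_module (col e)"
  have "act e v = 0" for v
  proof -
    have "act e v \<in> carrier (col e)" by (simp add: act_times[symmetric] e)
    thus ?thesis using z unfolding zero_module_def by simp
  qed
  thus "e = 0" by (intro act_inject) simp
qed (auto simp: zero_module_def)

lemma finsum_col:
  assumes "finite S" "!!g. g \<in> S ==> f g \<in> carrier (col e)"
  shows "finsum (col e) f S = sum f S"
proof -
  interpret right_module "col e" by (rule right_module_col)
  show ?thesis using assms
    by (induction S rule: finite_induct) (auto simp: finsum_insert Pi_def)
qed

lemma finitely_generated_col: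
  fixes e :: "'a::ring_1 fmat"
  assumes e: "e * e = e"
  shows "finitely_generated (col e)"
proof -
  obtain N where N: "!!i j. N \<le> i \<or> N \<le> j ==> entry e i j = 0" using fmat_bound[of e] by blast
  define w where "w j = act e (unitv j)" for j
  have w: "act e (w j) = w j" for j unfolding w_def by (simp add: act_times[symmetric] e)
  have "\<exists>c. v = (\<Oplus>\<^bsub>col e\<^esub>g\<in>w ` {..<N}. c g \<odot>\<^bsub>col e\<^esub> g)" if v: "v \<in> carrier (col e)" for v
  proof
    let ?c = "%g. \<Sum>j | j < N \<and> w j = g. v j"
    have "(\<Oplus>\<^bsub>col e\<^esub>g\<in>w ` {..<N}. ?c g \<odot>\<^bsub>col e\<^esub> g) = (\<Sum>g\<in>w ` {..<N}. (%i. g i * ?c g))"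
      using w by (subst finsum_col) (auto simp: act_smult)
    also have "\<dots> = (%i. \<Sum>g\<in>w ` {..<N}. g i * ?c g)"
    proof
      fix i show "(\<Sum>g\<in>S. (%i. g i * ?c g)) i = (\<Sum>g\<in>S. g i * ?c g)" for S
        by (induction S rule: infinite_finite_induct) auto
    qed
    also have "\<dots> = (%i. \<Sum>g\<in>w ` {..<N}. \<Sum>j | j < N \<and> w j = g. w j i * v j)"
      by (intro ext sum.cong refl) (auto simp: sum_distrib_left)
    also have "\<dots> = (%i. \<Sum>j<N. w j i * v j)"
    proof
      fix i
      have "(\<Sum>j<N. w j i * v j) = (\<Sum>g\<in>w ` {..<N}. \<Sum>j | j \<in> {..<N} \<and> w j = g. w j i * v j)"
        by (rule sum.image_gen) simp
      thus "(\<Sum>g\<in>w ` {..<N}. \<Sum>j | j < N \<and> w j = g. w j i * v j) = (\<Sum>j<N. w j i * v j)" by simp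
    qed
    also have "\<dots> = act e v" using act_columns[of N e v] N unfolding w_def by simp
    finally show "v = (\<Oplus>\<^bsub>col e\<^esub>g\<in>w ` {..<N}. ?c g \<odot>\<^bsub>col e\<^esub> g)" using v by simp
  qed
  thus ?thesis unfolding finitely_generated_def using w by (intro exI[of _ "w ` {..<N}"]) auto
qed

lemma right_module_linear_combination:
  fixes g :: "nat => 'm" and M :: "('a::ring_1, 'm) module"
  assumes M: "right_module M" and g: "!!i. i < r ==> g i \<in> carrier M"
  shows "(%v. \<Oplus>\<^bsub>M\<^esub>i\<in>{..<r}. v i \<odot>\<^bsub>M\<^esub> g i) \<in> module_homs (col e) M"
proof -
  interpret right_module M by fact
  have c: "(%i. v i \<odot>\<^bsub>M\<^esub> g i) \<in> {..<r} \<rightarrow> carrier M" for v using g act_closed by auto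
  show ?thesis
  proof (rule module_homsI)
    show "(\<Oplus>\<^bsub>M\<^esub>i\<in>{..<r}. v i \<odot>\<^bsub>M\<^esub> g i) \<in> carrier M" for v :: "'a univ" using c by (rule finsum_closed)
    show "(\<Oplus>\<^bsub>M\<^esub>i\<in>{..<r}. (v \<oplus>\<^bsub>col e\<^esub> w) i \<odot>\<^bsub>M\<^esub> g i) =
        (\<Oplus>\<^bsub>M\<^esub>i\<in>{..<r}. v i \<odot>\<^bsub>M\<^esub> g i) \<oplus>\<^bsub>M\<^esub> (\<Oplus>\<^bsub>M\<^esub>i\<in>{..<r}. w i \<odot>\<^bsub>M\<^esub> g i)" for v w
      unfolding finsum_addf[OF c c, symmetric] using g act_closed by (intro finsum_cong') (auto simp: act_add_scalar)
    fix a v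
    have "(\<Oplus>\<^bsub>M\<^esub>i\<in>S. a \<odot>\<^bsub>M\<^esub> (v i \<odot>\<^bsub>M\<^esub> g i)) = a \<odot>\<^bsub>M\<^esub> (\<Oplus>\<^bsub>M\<^esub>i\<in>S. v i \<odot>\<^bsub>M\<^esub> g i)" if "finite S" "S \<subseteq> {..<r}" for S
      using that
    proof (induction S rule: finite_induct)
      case empty
      have "a \<odot>\<^bsub>M\<^esub> \<zero>\<^bsub>M\<^esub> \<oplus>\<^bsub>M\<^esub> a \<odot>\<^bsub>M\<^esub> \<zero>\<^bsub>M\<^esub> = a \<odot>\<^bsub>M\<^esub> \<zero>\<^bsub>M\<^esub>" using act_add[of "\<zero>\<^bsub>M\<^esub>" "\<zero>\<^bsub>M\<^esub>" a] by simp
      hence "a \<odot>\<^bsub>M\<^esub> \<zero>\<^bsub>M\<^esub> = \<zero>\<^bsub>M\<^esub>" using add.r_cancel_one[OF act_closed[OF zero_closed, of a] act_closed[OF zero_closed, of a]] by simp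
      thus ?case by simp
    next
      case (insert x S)
      have i: "i \<in> {..<r}" if "i \<in> S \<or> i = x" for i using insert.prems that by auto
      have "(%i. v i \<odot>\<^bsub>M\<^esub> g i) \<in> S \<rightarrow> carrier M" using c i by blast
      thus ?case using insert i g act_closed by (simp add: finsum_insert Pi_def act_add finsum_closed)
    qed
    hence "(\<Oplus>\<^bsub>M\<^esub>i\<in>{..<r}. a \<odot>\<^bsub>M\<^esub> (v i \<odot>\<^bsub>M\<^esub> g i)) = a \<odot>\<^bsub>M\<^esub> (\<Oplus>\<^bsub>M\<^esub>i\<in>{..<r}. v i \<odot>\<^bsub>M\<^esub> g i)" by simp
    moreover have "(\<Oplus>\<^bsub>M\<^esub>i\<in>{..<r}. (a \<odot>\<^bsub>col e\<^esub> v) i \<odot>\<^bsub>M\<^esub> g i) = (\<Oplus>\<^bsub>M\<^esub>i\<in>{..<r}. a \<odot>\<^bsub>M\<^esub> (v i \<odot>\<^bsub>M\<^esub> g i))"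
      using g act_closed by (intro finsum_cong') (auto simp: act_mult)
    ultimately show "(\<Oplus>\<^bsub>M\<^esub>i\<in>{..<r}. (a \<odot>\<^bsub>col e\<^esub> v) i \<odot>\<^bsub>M\<^esub> g i) = a \<odot>\<^bsub>M\<^esub> (\<Oplus>\<^bsub>M\<^esub>i\<in>{..<r}. v i \<odot>\<^bsub>M\<^esub> g i)" by simp
  qed
qed

text \<open>A homomorphism out of a column module is determined by the images of finitely many columns, and
  can be lifted along any additive relation that the columns satisfy; this is the form in which
  projectivity is used.\<close>

lemma col_extend:
  fixes M :: "('a::ring_1, 'm) module"
  assumes M: "right_module M" and e: "e * e = e" and m: "!!j. m j \<in> carrier M"
  obtains g where "g \<in> module_homs (col e) M"
    "!!(N :: ('a, 'n) module) p f. right_module N ==> p \<in> module_homs M N ==> f \<in> module_homs (col e) N ==>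
      (!!j. p (m j) = f (act e (unitv j))) ==> (!!v. v \<in> carrier (col e) ==> p (g v) = f v)"
proof -
  obtain r where r: "!!i j. r \<le> i \<or> r \<le> j ==> entry e i j = 0" using fmat_bound[of e] by blast
  let ?g = "%v. \<Oplus>\<^bsub>M\<^esub>i\<in>{..<r}. v i \<odot>\<^bsub>M\<^esub> m i"
  have gh: "?g \<in> module_homs (col e) M" using M m by (rule right_module_linear_combination)
  have "p (?g v) = f v" if N: "right_module N" and p: "p \<in> module_homs M N" and f: "f \<in> module_homs (col e) N"
    and pm: "!!j. p (m j) = f (act e (unitv j))" and v: "v \<in> carrier (col e)" for N :: "('a, 'n) module" and p f v
  proof -
    interpret M: right_module M by fact
    interpret N: right_module N by fact
    interpret C: right_module "col e" by (rule right_module_col)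
    have w: "act e (unitv j) \<in> carrier (col e)" for j by (simp add: act_times[symmetric] e)
    have "p (\<Oplus>\<^bsub>M\<^esub>i\<in>S. v i \<odot>\<^bsub>M\<^esub> m i) = f (\<Oplus>\<^bsub>col e\<^esub>i\<in>S. v i \<odot>\<^bsub>col e\<^esub> act e (unitv i))" if "finite S" for S
      using that
    proof (induction S rule: finite_induct)
      case empty
      show ?case using module_homs_zero[OF p M N] module_homs_zero[OF f right_module_col N] by (simp add: zero_fun_def)
    next
      case (insert x S)
      have 1: "v i \<odot>\<^bsub>M\<^esub> m i \<in> carrier M" for i using m by (rule M.act_closed)
      have 2: "v i \<odot>\<^bsub>col e\<^esub> act e (unitv i) \<in> carrier (col e)" for i using w by (rule C.act_closed)
      have "p (\<Oplus>\<^bsub>M\<^esub>i\<in>insert x S. v i \<odot>\<^bsub>M\<^esub> m i) = p (v x \<odot>\<^bsub>M\<^esub> m x) \<oplus>\<^bsub>N\<^esub> p (\<Oplus>\<^bsub>M\<^esub>i\<in>S. v i \<odot>\<^bsub>M\<^esub> m i)"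
        using insert.hyps 1 by (subst M.finsum_insert) (auto intro!: module_homsD(2)[OF p] M.finsum_closed)
      also have "p (v x \<odot>\<^bsub>M\<^esub> m x) = f (v x \<odot>\<^bsub>col e\<^esub> act e (unitv x))"
        using module_homsD(3)[OF p m] module_homsD(3)[OF f w] pm by metis
      also have "f (v x \<odot>\<^bsub>col e\<^esub> act e (unitv x)) \<oplus>\<^bsub>N\<^esub> p (\<Oplus>\<^bsub>M\<^esub>i\<in>S. v i \<odot>\<^bsub>M\<^esub> m i) =
          f (\<Oplus>\<^bsub>col e\<^esub>i\<in>insert x S. v i \<odot>\<^bsub>col e\<^esub> act e (unitv i))"
        unfolding insert.IH using insert.hyps 2
        by (subst C.finsum_insert) (auto intro!: module_homsD(2)[OF f, symmetric] C.finsum_closed simp del: col_simps)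
      finally show ?case .
    qed
    hence "p (?g v) = f (\<Oplus>\<^bsub>col e\<^esub>i\<in>{..<r}. v i \<odot>\<^bsub>col e\<^esub> act e (unitv i))" by simp
    also have "(\<Oplus>\<^bsub>col e\<^esub>i\<in>{..<r}. v i \<odot>\<^bsub>col e\<^esub> act e (unitv i)) = (\<Sum>j<r. (%i. act e (unitv j) i * v j))"
      using w by (subst finsum_col) (auto simp: act_smult)
    also have "\<dots> = (%i. \<Sum>j<r. act e (unitv j) i * v j)"
    proof
      fix i show "(\<Sum>j\<in>S. (%i. act e (unitv j) i * v j)) i = (\<Sum>j\<in>S. act e (unitv j) i * v j)" for S
        by (induction S rule: infinite_finite_induct) auto
    qed
    also have "\<dots> = v" using act_columns[of r e v] r v by simp
    finally show ?thesis .
  qed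
  thus ?thesis using that gh by blast
qed

lemma fg_projective_col:
  fixes e :: "'a::ring_1 fmat"
  assumes e: "e * e = e"
  shows "fg_projective (col e)"
proof -
  have "projective_module (col e)"
    unfolding projective_module_def
  proof (intro allI impI)
    fix N L :: "('a, 'a univ) module" and p f
    assume N: "right_module N" and L: "right_module L" and p: "p \<in> module_homs N L" "p ` carrier N = carrier L"
      and f: "f \<in> module_homs (col e) L"
    have "\<exists>n. n \<in> carrier N \<and> p n = f (act e (unitv j))" for j
    proof -
      have "f (act e (unitv j)) \<in> carrier L" by (rule module_homsD(1)[OF f]) (simp add: act_times[symmetric] e)
      thus ?thesis using p(2) by (metis imageE)
    qed
    then obtain m where m: "!!j. m j \<in> carrier N" "!!j. p (m j) = f (act e (unitv j))" by metis
    show "\<exists>g\<in>module_homs (col e) N. \<forall>x\<in>carrier (col e). p (g x) = f x"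
    proof (rule col_extend[OF N e m(1)])
      fix g assume g: "g \<in> module_homs (col e) N"
        and H: "!!(L :: ('a, 'a univ) module) p f. right_module L ==> p \<in> module_homs N L ==> f \<in> module_homs (col e) L ==>
          (!!j. p (m j) = f (act e (unitv j))) ==> (!!v. v \<in> carrier (col e) ==> p (g v) = f v)"
      show ?thesis using g H[OF L p(1) f m(2)] by blast
    qed
  qed
  thus ?thesis unfolding fg_projective_def using right_module_col finitely_generated_col[OF e] by blast
qed

text \<open>\<open>projective_module\<close> lifts only along maps between modules on
  \<open>nat => 'a\<close>. A module on another type is first copied there along an
  injection.\<close>

definition copy_module :: "('m => 'n) => ('a, 'm) module => ('a, 'n) module" where
  "copy_module s M = \<lparr>carrier = s ` carrier M, mult = undefined, one = undefined, zero = s \<zero>\<^bsub>M\<^esub>,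
     add = (%x y. s (inv_into (carrier M) s x \<oplus>\<^bsub>M\<^esub> inv_into (carrier M) s y)),
     smult = (%a x. s (a \<odot>\<^bsub>M\<^esub> inv_into (carrier M) s x))\<rparr>"

lemma copy_module:
  assumes M: "right_module M" and s: "inj_on s (carrier M)"
  shows "right_module (copy_module s M)" "s \<in> module_homs M (copy_module s M)" "carrier (copy_module s M) = s ` carrier M"
proof -
  interpret right_module M by fact
  let ?L = "copy_module s M"
  have i: "inv_into (carrier M) s (s x) = x" if "x \<in> carrier M" for x using s that by (rule inv_into_f_f)
  have sel: "carrier ?L = s ` carrier M" "\<zero>\<^bsub>?L\<^esub> = s \<zero>\<^bsub>M\<^esub>"
    "x \<oplus>\<^bsub>?L\<^esub> y = s (inv_into (carrier M) s x \<oplus>\<^bsub>M\<^esub> inv_into (carrier M) s y)"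
    "a \<odot>\<^bsub>?L\<^esub> x = s (a \<odot>\<^bsub>M\<^esub> inv_into (carrier M) s x)" for x y a
    unfolding copy_module_def by auto
  have "abelian_group ?L"
  proof (rule abelian_groupI)
    fix x assume "x \<in> carrier ?L"
    then obtain x' where "x' \<in> carrier M" "x = s x'" unfolding sel by blast
    thus "\<exists>y\<in>carrier ?L. y \<oplus>\<^bsub>?L\<^esub> x = \<zero>\<^bsub>?L\<^esub>" by (intro bexI[of _ "s (\<ominus>\<^bsub>M\<^esub> x')"]) (auto simp: sel i l_neg)
  qed (auto simp: sel i a_assoc a_comm a_lcomm)
  thus "right_module ?L"
    by (intro right_module.intro right_module_axioms.intro)
      (auto simp: sel i act_closed act_add_scalar act_add act_mult act_one)
  show "s \<in> module_homs M ?L" by (rule module_homsI) (auto simp: sel i act_closed)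
  show "carrier ?L = s ` carrier M" by (rule sel)
qed

definition idm :: "nat => 'a::ring_1 fmat" where "idm r = (\<Sum>i<r. munitx i i 1)"

lemma act_idm: "act (idm r) v = (%i. if i < r then v i else 0)"
proof
  fix i
  have e: "entry (idm r) i j = (if i = j \<and> i < r then 1 else 0 :: 'a)" for j
  proof -
    have "entry (idm r) i j = (\<Sum>k<r. if k = i then (if i = j then 1 else 0 :: 'a) else 0)"
      unfolding idm_def entry_sum by (intro sum.cong) (auto simp: munitx.rep_eq)
    thus ?thesis by auto
  qed
  have "row_support (idm r :: 'a fmat) i \<subseteq> {i}" unfolding row_support_def e by auto
  from act_superset[OF _ this, of v] show "act (idm r) v i = (if i < r then v i else 0)" by (simp add: e)
qed

lemma idm_idem: "idm r * idm r = idm r"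
  by (rule act_inject) (auto simp: act_times act_idm)

text \<open>The composite of \<open>\<pi>\<close> and \<open>h\<close> is an idempotent endomorphism
  of \<open>col d\<close>. Its matrix \<open>e\<close> has an image onto which \<open>h\<close> is
  an isomorphism.\<close>

lemma col_retract:
  fixes M :: "('a::ring_1, 'm) module"
  assumes d: "d * d = d" and h: "h \<in> module_homs M (col d)" and \<pi>: "\<pi> \<in> module_homs (col d) M"
    and \<pi>h: "!!x. x \<in> carrier M ==> \<pi> (h x) = x"
  obtains e where "e \<in> arr d d" "e * e = e" "h \<in> module_homs M (col e)" "\<pi> \<in> module_homs (col e) M"
    "!!v. v \<in> carrier (col e) ==> h (\<pi> v) = v"
proof -
  obtain e where e: "e \<in> arr d d" "!!v. v \<in> carrier (col d) ==> h (\<pi> v) = act e v"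
    using module_homs_matrix[OF module_homs_comp[OF \<pi> h] d d] by blast
  have ee: "e * e = e"
  proof (rule act_faithful[OF hom_mult[OF e(1,1)] e(1) d])
    fix v assume v: "v \<in> carrier (col d)"
    hence "act e v \<in> carrier (col d)" using module_homsD(1)[OF act_module_homs[OF e(1)]] by blast
    hence "act e (act e v) = h (\<pi> (h (\<pi> v)))" using e(2)[OF v] e(2)[of "act e v"] by simp
    also have "\<dots> = act e v" using \<pi>h[OF module_homsD(1)[OF \<pi> v]] e(2)[OF v] by simp
    finally show "act (e * e) v = act e v" unfolding act_times .
  qed
  have sub: "v \<in> carrier (col d)" if "v \<in> carrier (col e)" for v
  proof -
    have "act d (act e v) = act e v" using arrD(1)[OF e(1)] by (simp add: act_times[symmetric])
    thus ?thesis using that by simp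
  qed
  have "act e (h x) = h x" if "x \<in> carrier M" for x
    using e(2)[OF module_homsD(1)[OF h that]] \<pi>h[OF that] by simp
  hence "h \<in> module_homs M (col e)" using module_homsD(2,3)[OF h] by (intro module_homsI) auto
  moreover have "\<pi> \<in> module_homs (col e) M" using sub module_homsD[OF \<pi>] by (intro module_homsI) auto
  moreover have "h (\<pi> v) = v" if "v \<in> carrier (col e)" for v using e(2)[OF sub[OF that]] that by simp
  ultimately show ?thesis using that e(1) ee by blast
qed

text \<open>A choice of preimages under a surjection \<open>\<pi>\<close> from a free module copies
  \<open>M\<close> into the type of columns. Projectivity then lifts the copying map to a section of
  \<open>\<pi>\<close>, and \<open>M\<close> is a retract of the free module.\<close>

lemma fg_projective_rep:
  fixes M :: "('a::ring_1, 'm) module"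
  assumes "fg_projective M"
  shows "\<exists>e u v. e * e = e \<and> u \<in> module_homs M (col e) \<and> v \<in> module_homs (col e) M \<and>
    (\<forall>x\<in>carrier M. v (u x) = x) \<and> (\<forall>y\<in>carrier (col e). u (v y) = y)"
proof -
  have M: "right_module M" and fg: "finitely_generated M" and pr: "projective_module M"
    using assms unfolding fg_projective_def by auto
  interpret right_module M by fact
  obtain G where G: "finite G" "G \<subseteq> carrier M" "!!x. x \<in> carrier M ==> \<exists>c. x = (\<Oplus>\<^bsub>M\<^esub>g\<in>G. c g \<odot>\<^bsub>M\<^esub> g)"
    using fg unfolding finitely_generated_def by blast
  obtain g where g: "bij_betw g {0..<card G} G" using ex_bij_betw_nat_finite[OF G(1)] by blast
  define r where "r = card G"
  have g': "inj_on g {..<r}" "g ` {..<r} = G" using g unfolding r_def bij_betw_def by (simp_all add: atLeast0LessThan)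
  have gM: "g i \<in> carrier M" if "i < r" for i using g'(2) G(2) that by blast
  let ?F = "col (idm r :: 'a fmat)"
  define \<pi> where "\<pi> v = (\<Oplus>\<^bsub>M\<^esub>i\<in>{..<r}. v i \<odot>\<^bsub>M\<^esub> g i)" for v :: "'a univ"
  have \<pi>: "\<pi> \<in> module_homs ?F M" unfolding \<pi>_def using M gM by (rule right_module_linear_combination)
  have "\<exists>v\<in>carrier ?F. \<pi> v = x" if x: "x \<in> carrier M" for x
  proof -
    obtain c where c: "x = (\<Oplus>\<^bsub>M\<^esub>h\<in>G. c h \<odot>\<^bsub>M\<^esub> h)" using G(3)[OF x] by blast
    have "x = (\<Oplus>\<^bsub>M\<^esub>i\<in>{..<r}. c (g i) \<odot>\<^bsub>M\<^esub> g i)"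
      unfolding c g'(2)[symmetric] using g'(1) gM act_closed by (intro finsum_reindex) auto
    also have "\<dots> = \<pi> (%i. if i < r then c (g i) else 0)" unfolding \<pi>_def
      using gM act_closed by (intro finsum_cong') auto
    finally show ?thesis by (intro bexI[of _ "%i. if i < r then c (g i) else 0"]) (auto simp: act_idm)
  qed
  then obtain s where s: "!!x. x \<in> carrier M ==> s x \<in> carrier ?F" "!!x. x \<in> carrier M ==> \<pi> (s x) = x" by metis
  have inj: "inj_on s (carrier M)" using s(2) by (metis inj_onI)
  note L = copy_module[OF M inj]
  let ?L = "copy_module s M"
  have "(%v. s (\<pi> v)) \<in> module_homs ?F ?L" using \<pi> L(2) by (rule module_homs_comp)
  moreover have "(%v. s (\<pi> v)) ` carrier ?F = carrier ?L"
    unfolding L(3)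
  proof (intro equalityI subsetI)
    fix y assume "y \<in> s ` carrier M"
    then obtain x where "x \<in> carrier M" "y = s x" by blast
    thus "y \<in> (%v. s (\<pi> v)) ` carrier ?F" using s by (intro image_eqI[of _ _ "s x"]) simp_all
  qed (use module_homsD(1)[OF \<pi>] in blast)
  ultimately obtain h where h: "h \<in> module_homs M ?F" "!!x. x \<in> carrier M ==> s (\<pi> (h x)) = s x"
    using pr right_module_col L(1,2) unfolding projective_module_def by metis
  have \<pi>h: "\<pi> (h x) = x" if "x \<in> carrier M" for x
    using h(2)[OF that] inj module_homsD(1)[OF \<pi>] module_homsD(1)[OF h(1)] that by (metis inj_onD)
  obtain e where "e * e = e" "h \<in> module_homs M (col e)" "\<pi> \<in> module_homs (col e) M"
    "!!v. v \<in> carrier (col e) ==> h (\<pi> v) = v"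
    using col_retract[OF idm_idem h(1) \<pi> \<pi>h] by blast
  thus ?thesis using \<pi>h by (intro exI[of _ e] exI[of _ h] exI[of _ \<pi>]) blast
qed

section \<open>Counting indecomposable projective modules\<close>

lemma num_iso_types_card:
  assumes "!!X Y. X \<in> S ==> Y \<in> S ==> R X Y \<longleftrightarrow> f X = f Y"
  shows "num_iso_types S R = card (f ` S)"
proof -
  let ?r = "{(X, Y). X \<in> S \<and> Y \<in> S \<and> R X Y}"
  have "S // ?r = (%X. ?r `` {X}) ` S" unfolding quotient_def by blast
  also have "\<dots> = (%X. {Y \<in> S. f Y = f X}) ` S"
    using assms by (intro image_cong refl) (auto simp: Image_def)
  also have "\<dots> = (%b. {Y \<in> S. f Y = b}) ` (f ` S)" by (simp add: image_image)
  finally have "S // ?r = (%b. {Y \<in> S. f Y = b}) ` (f ` S)" .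
  moreover have "inj_on (%b. {Y \<in> S. f Y = b}) (f ` S)" by (rule inj_onI) blast
  ultimately show ?thesis unfolding num_iso_types_def by (simp add: card_image)
qed

lemma module_isoI:
  assumes "u \<in> module_homs M N" "!!y. y \<in> carrier N ==> v y \<in> carrier M"
    "!!x. x \<in> carrier M ==> v (u x) = x" "!!y. y \<in> carrier N ==> u (v y) = y"
  shows "module_iso M N"
  unfolding module_iso_def using assms module_homsD(1)[OF assms(1)]
  by (intro bexI[of _ u] bij_betw_byWitness[where f' = v]) auto

lemma module_isoE:
  assumes "module_iso M N" "right_module M"
  obtains u v where "u \<in> module_homs M N" "v \<in> module_homs N M"
    "!!x. x \<in> carrier M ==> v (u x) = x" "!!y. y \<in> carrier N ==> u (v y) = y"
proof -
  interpret right_module M by fact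
  obtain u where u: "u \<in> module_homs M N" "bij_betw u (carrier M) (carrier N)"
    using assms(1) unfolding module_iso_def by blast
  let ?v = "inv_into (carrier M) u"
  have vu: "?v (u x) = x" if "x \<in> carrier M" for x using u(2) that by (simp add: bij_betw_inv_into_left)
  have uv: "u (?v y) = y" if "y \<in> carrier N" for y using u(2) that by (simp add: bij_betw_inv_into_right)
  have v: "?v y \<in> carrier M" if "y \<in> carrier N" for y using bij_betwE[OF bij_betw_inv_into[OF u(2)]] that by blast
  have "?v \<in> module_homs N M"
  proof (rule module_homsI[OF v])
    fix x y a assume xy: "x \<in> carrier N" "y \<in> carrier N"
    have "u (?v x \<oplus>\<^bsub>M\<^esub> ?v y) = x \<oplus>\<^bsub>N\<^esub> y" using module_homsD(2)[OF u(1) v v] xy uv by simp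
    thus "?v (x \<oplus>\<^bsub>N\<^esub> y) = ?v x \<oplus>\<^bsub>M\<^esub> ?v y" using vu[of "?v x \<oplus>\<^bsub>M\<^esub> ?v y"] v xy by simp
  next
    fix x a assume x: "x \<in> carrier N"
    have "u (a \<odot>\<^bsub>M\<^esub> ?v x) = a \<odot>\<^bsub>N\<^esub> x" using module_homsD(3)[OF u(1) v] x uv by simp
    thus "?v (a \<odot>\<^bsub>N\<^esub> x) = a \<odot>\<^bsub>M\<^esub> ?v x" using vu[OF act_closed[OF v[OF x]], of a] by simp
  qed
  thus ?thesis using that u(1) vu uv by blast
qed

lemma module_sum_sel [simp]:
  "carrier (module_sum M N) = carrier M \<times> carrier N" "\<zero>\<^bsub>module_sum M N\<^esub> = (\<zero>\<^bsub>M\<^esub>, \<zero>\<^bsub>N\<^esub>)"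
  "x \<oplus>\<^bsub>module_sum M N\<^esub> y = (fst x \<oplus>\<^bsub>M\<^esub> fst y, snd x \<oplus>\<^bsub>N\<^esub> snd y)"
  "a \<odot>\<^bsub>module_sum M N\<^esub> x = (a \<odot>\<^bsub>M\<^esub> fst x, a \<odot>\<^bsub>N\<^esub> snd x)"
  unfolding module_sum_def by auto

lemma smult_zero:
  assumes "right_module M" shows "a \<odot>\<^bsub>M\<^esub> \<zero>\<^bsub>M\<^esub> = \<zero>\<^bsub>M\<^esub>"
proof -
  interpret right_module M by fact
  have c: "a \<odot>\<^bsub>M\<^esub> \<zero>\<^bsub>M\<^esub> \<in> carrier M" by (rule act_closed) simp
  have "a \<odot>\<^bsub>M\<^esub> \<zero>\<^bsub>M\<^esub> \<oplus>\<^bsub>M\<^esub> a \<odot>\<^bsub>M\<^esub> \<zero>\<^bsub>M\<^esub> = a \<odot>\<^bsub>M\<^esub> \<zero>\<^bsub>M\<^esub>"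
    using act_add[of "\<zero>\<^bsub>M\<^esub>" "\<zero>\<^bsub>M\<^esub>" a] by simp
  thus ?thesis using add.r_cancel_one[OF c c] by simp
qed

lemma module_sum_homs:
  assumes M: "right_module M" and N: "right_module N"
  shows "(%x. (x, \<zero>\<^bsub>N\<^esub>)) \<in> module_homs M (module_sum M N)" "(%y. (\<zero>\<^bsub>M\<^esub>, y)) \<in> module_homs N (module_sum M N)"
    "fst \<in> module_homs (module_sum M N) M" "snd \<in> module_homs (module_sum M N) N"
proof -
  interpret M: right_module M by fact
  interpret N: right_module N by fact
  show "(%x. (x, \<zero>\<^bsub>N\<^esub>)) \<in> module_homs M (module_sum M N)" "(%y. (\<zero>\<^bsub>M\<^esub>, y)) \<in> module_homs N (module_sum M N)"
    "fst \<in> module_homs (module_sum M N) M" "snd \<in> module_homs (module_sum M N) N"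
    by (auto intro!: module_homsI simp: smult_zero[OF M] smult_zero[OF N])
qed

lemma right_module_sum:
  assumes "right_module M" "right_module N"
  shows "right_module (module_sum M N)"
proof -
  interpret M: right_module M by fact
  interpret N: right_module N by fact
  have "abelian_group (module_sum M N)"
  proof (rule abelian_groupI)
    fix x assume "x \<in> carrier (module_sum M N)"
    thus "\<exists>y\<in>carrier (module_sum M N). y \<oplus>\<^bsub>module_sum M N\<^esub> x = \<zero>\<^bsub>module_sum M N\<^esub>"
      by (intro bexI[of _ "(\<ominus>\<^bsub>M\<^esub> fst x, \<ominus>\<^bsub>N\<^esub> snd x)"]) (auto simp: M.l_neg N.l_neg)
  qed (auto simp: M.a_assoc M.a_comm M.a_lcomm N.a_assoc N.a_comm N.a_lcomm)
  thus ?thesis by (intro right_module.intro right_module_axioms.intro)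
    (auto simp: M.act_closed N.act_closed M.act_add_scalar N.act_add_scalar M.act_add N.act_add M.act_mult N.act_mult M.act_one N.act_one)
qed

lemma module_power_sel [simp]:
  "carrier (module_power r M) = (\<Pi>\<^sub>E i\<in>{..<r}. carrier M)"
  "x \<oplus>\<^bsub>module_power r M\<^esub> y = (\<lambda>i\<in>{..<r}. x i \<oplus>\<^bsub>M\<^esub> y i)"
  "a \<odot>\<^bsub>module_power r M\<^esub> x = (\<lambda>i\<in>{..<r}. a \<odot>\<^bsub>M\<^esub> x i)"
  unfolding module_power_def by auto

lemma regular_module_sel [simp]: "carrier regular_module = UNIV" "x \<oplus>\<^bsub>regular_module\<^esub> y = x + y" "a \<odot>\<^bsub>regular_module\<^esub> x = x * a"
  unfolding regular_module_def by auto

lemma restrict_module_homs: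
  "(%v. restrict v {..<r}) \<in> module_homs (col e) (module_power r regular_module)"
  by (rule module_homsI) (auto simp: fun_eq_iff)

lemma extend_module_homs:
  "(%x i. if i < r then x i else 0) \<in> module_homs (module_power r regular_module) (col (idm r))"
  by (rule module_homsI) (auto simp: fun_eq_iff act_idm)

lemma nulls_stalk: "f \<in> nulls (stalk c e) (stalk c e') ==> f = 0"
  unfolding nulls_def by (auto simp: fun_eq_iff)

context hom_finite_ring
begin

text \<open>Null homotopic endomorphisms of a stalk are zero, so a decomposition up to homotopy is
  the same as an idempotent of the corner ring of \<open>e\<close>.\<close>

lemma mindec_stalk_iff:
  assumes e: "e * e = e"
  shows "mindec (stalk c e) \<longleftrightarrow> e ~= 0 \<and> (\<forall>p\<in>arr e e. p * p = p --> p = 0 \<or> p = e)"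
proof -
  let ?E = "stalk c e"
  have E: "cx ?E" using e by (rule cx_stalk)
  have z: "mzero ?E \<longleftrightarrow> e = 0"
  proof
    assume "mzero ?E"
    hence "ob ?E = 0" unfolding mzero_def by (rule nulls_stalk)
    hence "ob ?E c = 0" by simp
    thus "e = 0" by simp
  next
    assume "e = 0"
    hence "ob ?E = 0" by (simp add: fun_eq_iff)
    thus "mzero ?E" unfolding mzero_def using nulls_zero by simp
  qed
  have map: "(%n. if n = c then x else 0) \<in> mhoms ?E ?E" if "x \<in> arr e e" for x using that by (auto intro!: mhomsI)
  show ?thesis
  proof (intro iffI conjI ballI impI)
    assume m: "mindec ?E"
    show "e ~= 0" using mindecD(2)[OF m] z by blast
    fix p assume p: "p \<in> arr e e" "p * p = p"
    define q where "q = (%n. if n = c then p else 0)"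
    have q: "q \<in> mhoms ?E ?E" "q * q = q" using map[OF p(1)] p(2) unfolding q_def by auto
    note s = mbiprod_sub_cx[OF E q]
    have "meq ?E (bsum (sub_cx ?E q) (sub_cx ?E (ob ?E - q)))" by (intro mbiprod_meq s sub_cx E q)
    hence "mzero (sub_cx ?E q) \<or> mzero (sub_cx ?E (ob ?E - q))"
      using m sub_cx(1)[OF E q] sub_cx(1)[OF E s(1,2)] unfolding mindec_def by blast
    hence "q = 0 \<or> ob ?E - q = 0" using mzero_sub_cx[OF E q] mzero_sub_cx[OF E s(1,2)] nulls_stalk by blast
    hence "q c = 0 \<or> (ob ?E - q) c = 0" by auto
    thus "p = 0 \<or> p = e" unfolding q_def by auto
  next
    assume h: "e ~= 0 \<and> (\<forall>p\<in>arr e e. p * p = p --> p = 0 \<or> p = e)"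
    show "mindec ?E"
      unfolding mindec_def
    proof (intro conjI allI impI)
      show "cx ?E" by (rule E)
      show "\<not> mzero ?E" using h z by blast
      fix F G assume FG: "cx F" "cx G" "meq ?E (bsum F G)"
      obtain u v u' v' where k: "u \<in> mhoms F ?E" "v \<in> mhoms ?E F" "u' \<in> mhoms G ?E" "v' \<in> mhoms ?E G"
         "heq F F (v * u) (ob F)" "heq G G (v' * u') (ob G)" "heq G F (v * u') 0" "heq F G (v' * u) 0"
         "heq ?E ?E (u * v + u' * v') (ob ?E)" using meq_bsum_mbiprod[OF FG] unfolding mbiprod_def by blast
      have uv: "u * v \<in> mhoms ?E ?E" using k by (auto intro: mhoms_mult)
      have "heq ?E ?E (u * (v * u) * v) (u * ob F * v)" by (intro heq_right[where F = F] heq_left[where F = F] k)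
      hence "heq ?E ?E (u * v * (u * v)) (u * v)" unfolding mhoms_id_right[OF k(1)] by (simp add: mult.assoc)
      hence "u * v * (u * v) - u * v = 0" unfolding heq_def by (rule nulls_stalk)
      hence uvuv: "u * v * (u * v) = u * v" by simp
      have "(u * v) c * (u * v) c = (u * v) c" using fun_cong[OF uvuv, of c] by simp
      moreover have "(u * v) c \<in> arr e e" using mhomsD(1)[OF uv, of c] by simp
      ultimately have "(u * v) c = 0 \<or> (u * v) c = e" using h by blast
      moreover have out: "(u * v) n = 0" if "n ~= c" for n using mhomsD(3)[OF uv, of n] that by simp
      moreover have eqI: "f = g" if "f c = g c" "!!n. n ~= c ==> f n = g n" for f g :: "int => 'r"
      proof
        fix n show "f n = g n" using that by (cases "n = c") auto
      qed
      ultimately have "u * v = 0 \<or> u * v = ob ?E"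
        using eqI[of "u * v" 0] eqI[of "u * v" "ob ?E"] out by (auto simp del: times_fun_apply)
      moreover have sum: "u * v + u' * v' - ob ?E = 0" using k(9) unfolding heq_def by (rule nulls_stalk)
      ultimately have "u * v = 0 \<or> u' * v' = 0" by auto
      moreover have zero: "mzero K" if "x \<in> mhoms K ?E" "y \<in> mhoms ?E K" "heq K K (y * x) (ob K)" "x * y = 0" for K x y
      proof -
        have "heq K K (y * x * (y * x)) (ob K)"
          using heq_trans[OF heq_right[OF that(3) mhoms_mult[OF that(1,2)]]] that(3) mhoms_id_left[OF mhoms_mult[OF that(1,2)]] by simp
        moreover have "y * x * (y * x) = y * (x * y) * x" by (simp only: mult.assoc)
        ultimately have "heq K K 0 (ob K)" using that(4) by simp
        thus ?thesis unfolding mzero_def using heq_sym heq_zero by blast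
      qed
      ultimately show "mzero F \<or> mzero G" using k by blast
    qed
  qed
qed

lemma prim_iff: "prim e \<longleftrightarrow> e * e = e \<and> e ~= 0 \<and> (\<forall>p\<in>arr e e. p * p = p --> p = 0 \<or> p = e)"
  unfolding prim_def using mindec_stalk_iff by blast

text \<open>Linear independence makes the rank function a complete invariant of primitive
  idempotents.\<close>

lemma rk_eq_iff:
  assumes "prim e" "prim f"
  shows "rk e = rk f \<longleftrightarrow> (\<exists>u\<in>arr e f. \<exists>v\<in>arr f e. v * u = e \<and> u * v = f)"
proof
  assume "rk e = rk f"
  from prim_classes_inj[OF assms this] show "\<exists>u\<in>arr e f. \<exists>v\<in>arr f e. v * u = e \<and> u * v = f"
    using hom_imp_iso_stalk by metis
next
  assume "\<exists>u\<in>arr e f. \<exists>v\<in>arr f e. v * u = e \<and> u * v = f"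
  thus "rk e = rk f" using rk_iso assms unfolding prim_def by blast
qed

end

locale fmat_category = hom_finite_ring scale bs i1 i2 p1 p2 gen
  for scale :: "'k::field => 'a::ring_1 fmat => 'a fmat"
    and bs i1 i2 p1 p2 :: "'a fmat => 'a fmat => 'a fmat" and gen :: "'a fmat"
begin

definition cmod :: "('a, 'm) module => 'a fmat => bool" where
  "cmod M e \<longleftrightarrow> e * e = e \<and> (\<exists>u v. u \<in> module_homs M (col e) \<and> v \<in> module_homs (col e) M \<and>
    (\<forall>x\<in>carrier M. v (u x) = x) \<and> (\<forall>y\<in>carrier (col e). u (v y) = y))"

lemma cmod_iso:
  fixes M :: "('a, 'm) module" and N :: "('a, 'n) module"
  assumes M: "right_module M" and e: "cmod M e" and f: "cmod N f"
  shows "module_iso M N \<longleftrightarrow> (\<exists>x\<in>arr e f. \<exists>y\<in>arr f e. y * x = e \<and> x * y = f)"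
proof -
  obtain u v where u: "e * e = e" "u \<in> module_homs M (col e)" "v \<in> module_homs (col e) M"
    "!!x. x \<in> carrier M ==> v (u x) = x" "!!y. y \<in> carrier (col e) ==> u (v y) = y" using e unfolding cmod_def by blast
  obtain u' v' where u': "f * f = f" "u' \<in> module_homs N (col f)" "v' \<in> module_homs (col f) N"
    "!!x. x \<in> carrier N ==> v' (u' x) = x" "!!y. y \<in> carrier (col f) ==> u' (v' y) = y" using f unfolding cmod_def by blast
  show ?thesis
  proof
    assume "module_iso M N"
    then obtain p q where p: "p \<in> module_homs M N" "q \<in> module_homs N M"
      "!!x. x \<in> carrier M ==> q (p x) = x" "!!y. y \<in> carrier N ==> p (q y) = y" using module_isoE[OF _ M] by metis
    obtain x where x: "x \<in> arr e f" "!!w. w \<in> carrier (col e) ==> u' (p (v w)) = act x w"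
      using module_homs_matrix[OF module_homs_comp[OF module_homs_comp[OF u(3) p(1)] u'(2)] u(1) u'(1)] by blast
    obtain y where y: "y \<in> arr f e" "!!w. w \<in> carrier (col f) ==> u (q (v' w)) = act y w"
      using module_homs_matrix[OF module_homs_comp[OF module_homs_comp[OF u'(3) p(2)] u(2)] u'(1) u(1)] by blast
    have "y * x = e"
    proof (rule act_faithful[OF hom_mult[OF x(1) y(1)] hom_id[OF u(1)] u(1)])
      fix w assume w: "w \<in> carrier (col e)"
      have "act y (act x w) = u (q (v' (u' (p (v w)))))"
        using x(2)[OF w] y(2)[of "act x w"] module_homsD(1)[OF act_module_homs[OF x(1)] w] by simp
      also have "\<dots> = w" using u'(4) p(3) u(5) module_homsD(1)[OF p(1)] module_homsD(1)[OF u(3) w] w by simp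
      finally show "act (y * x) w = act e w" using w by (simp add: act_times)
    qed
    moreover have "x * y = f"
    proof (rule act_faithful[OF hom_mult[OF y(1) x(1)] hom_id[OF u'(1)] u'(1)])
      fix w assume w: "w \<in> carrier (col f)"
      have "act x (act y w) = u' (p (v (u (q (v' w)))))"
        using y(2)[OF w] x(2)[of "act y w"] module_homsD(1)[OF act_module_homs[OF y(1)] w] by simp
      also have "\<dots> = w" using u(4) p(4) u'(5) module_homsD(1)[OF p(2)] module_homsD(1)[OF u'(3) w] w by simp
      finally show "act (x * y) w = act f w" using w by (simp add: act_times)
    qed
    ultimately show "\<exists>x\<in>arr e f. \<exists>y\<in>arr f e. y * x = e \<and> x * y = f" using x(1) y(1) by blast
  next
    assume "\<exists>x\<in>arr e f. \<exists>y\<in>arr f e. y * x = e \<and> x * y = f"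
    then obtain x y where xy: "x \<in> arr e f" "y \<in> arr f e" "y * x = e" "x * y = f" by blast
    note ax = act_module_homs[OF xy(1)] and ay = act_module_homs[OF xy(2)]
    show "module_iso M N"
    proof (rule module_isoI[of "%m. v' (act x (u m))" _ _ "%n. v (act y (u' n))"])
      show "(%m. v' (act x (u m))) \<in> module_homs M N"
        by (rule module_homs_comp[OF module_homs_comp[OF u(2) ax] u'(3)])
      show "v (act y (u' n)) \<in> carrier M" if "n \<in> carrier N" for n
        using module_homsD(1)[OF module_homs_comp[OF module_homs_comp[OF u'(2) ay] u(3)] that] .
      show "v (act y (u' (v' (act x (u m))))) = m" if m: "m \<in> carrier M" for m
      proof -
        have um: "u m \<in> carrier (col e)" using module_homsD(1)[OF u(2) m] .
        have "act y (act x (u m)) = u m" using um by (simp add: act_times[symmetric] xy(3))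
        thus ?thesis using u'(5)[OF module_homsD(1)[OF ax um]] u(4)[OF m] by simp
      qed
      show "v' (act x (u (v (act y (u' n))))) = n" if n: "n \<in> carrier N" for n
      proof -
        have un: "u' n \<in> carrier (col f)" using module_homsD(1)[OF u'(2) n] .
        have "act x (act y (u' n)) = u' n" using un by (simp add: act_times[symmetric] xy(4))
        thus ?thesis using u(5)[OF module_homsD(1)[OF ay un]] u'(4)[OF n] by simp
      qed
    qed
  qed
qed

lemma cmod_col: "e * e = e ==> cmod (col e) e"
  unfolding cmod_def using act_module_homs[OF hom_id, of e] by (intro conjI exI[of _ "act e"]) auto

text \<open>An idempotent \<open>p\<close> below \<open>e\<close> would decompose the module into
  the images of \<open>p\<close> and \<open>e - p\<close>.\<close>

lemma cmod_prim:
  fixes M :: "('a, 'm) module"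
  assumes M: "indecomposable_module M" and e: "cmod M e"
  shows "prim e"
proof -
  have rM: "right_module M" using M unfolding indecomposable_module_def by blast
  interpret right_module M by fact
  obtain u v where u: "e * e = e" "u \<in> module_homs M (col e)" "v \<in> module_homs (col e) M"
    "!!x. x \<in> carrier M ==> v (u x) = x" "!!y. y \<in> carrier (col e) ==> u (v y) = y" using e unfolding cmod_def by blast
  have "e ~= 0"
  proof
    assume "e = 0"
    hence "u x = 0" if "x \<in> carrier M" for x using module_homsD(1)[OF u(2) that] by simp
    hence v0: "x = v 0" if "x \<in> carrier M" for x using u(4)[OF that] that by simp
    have "x = \<zero>\<^bsub>M\<^esub>" if "x \<in> carrier M" for x
      by (rule trans[OF v0[OF that] v0[OF zero_closed, symmetric]])
    hence "carrier M = {\<zero>\<^bsub>M\<^esub>}" using zero_closed by blast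
    thus False using M unfolding indecomposable_module_def zero_module_def by blast
  qed
  moreover have "p = 0 \<or> p = e" if p: "p \<in> arr e e" "p * p = p" for p
  proof -
    let ?q = "e - p"
    have q: "?q \<in> arr e e" "?q * ?q = ?q" "p * ?q = 0" "?q * p = 0"
      using hom_diff[OF hom_id[OF u(1)] p(1)] p(2) u(1) arrD[OF p(1)] by (simp_all add: algebra_simps)
    have pp: "act p (act p w) = act p w" "act ?q (act ?q w) = act ?q w" "act p (act ?q w) = 0" "act ?q (act p w) = 0" for w
      using p(2) q by (simp_all add: act_times[symmetric])
    have pq: "act p w + act ?q w = act e w" for w by (simp add: act_add_left[symmetric])
    have "module_iso M (module_sum (col p) (col ?q))"
    proof (rule module_isoI[of "%x. (act p (u x), act ?q (u x))" _ _ "%(y, z). v (y + z)"])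
      show "(%x. (act p (u x), act ?q (u x))) \<in> module_homs M (module_sum (col p) (col ?q))"
        using pp by (intro module_homsI) (auto simp: module_homsD(2,3)[OF u(2)] act_plus act_smult)
      have e1: "act e (y + z) = y + z" if "act p y = y" "act ?q z = z" for y z
        using that arrD(1)[OF p(1)] arrD(1)[OF q(1)] by (metis act_plus act_times)
      show "(case yz of (y, z) => v (y + z)) \<in> carrier M" if "yz \<in> carrier (module_sum (col p) (col ?q))" for yz
        using that e1 module_homsD(1)[OF u(3)] by auto
      show "(case (act p (u x), act ?q (u x)) of (y, z) => v (y + z)) = x" if "x \<in> carrier M" for x
        using u(4)[OF that] module_homsD(1)[OF u(2) that] by (simp add: pq)
      show "(act p (u (case yz of (y, z) => v (y + z))), act ?q (u (case yz of (y, z) => v (y + z)))) = yz"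
        if yz: "yz \<in> carrier (module_sum (col p) (col ?q))" for yz
      proof -
        obtain y z where yz': "yz = (y, z)" "act p y = y" "act ?q z = z" using yz by auto
        have "u (v (y + z)) = y + z" using u(5)[of "y + z"] e1[OF yz'(2,3)] by simp
        moreover have "act p z = 0" "act ?q y = 0" using pp(3)[of z] pp(4)[of y] yz' by simp_all
        ultimately show ?thesis using yz' by (simp add: act_plus)
      qed
    qed
    hence "zero_module (col p) \<or> zero_module (col ?q)"
      using M right_module_col unfolding indecomposable_module_def by blast
    thus ?thesis using zero_module_col[OF p(2)] zero_module_col[OF q(2)] by auto
  qed
  ultimately show ?thesis unfolding prim_iff using u(1) by blast
qed

text \<open>The embedding into a power of the regular module, padded with zeros beyond
  \<open>r\<close>, makes the module a retract of the free column module of rank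
  \<open>r\<close>.\<close>

lemma in_add_cmod:
  fixes M :: "('a, 'm) module"
  assumes "in_add_module (regular_module :: ('a, 'a) module) M"
  shows "\<exists>e. cmod M e"
proof -
  obtain r and Y :: "('a, 'a univ) module" where M: "right_module M" and Y: "right_module Y"
    and iso: "module_iso (module_sum M Y) (module_power r (regular_module :: ('a, 'a) module))"
    using assms unfolding in_add_module_def by blast
  obtain \<phi> where \<phi>: "\<phi> \<in> module_homs (module_sum M Y) (module_power r (regular_module :: ('a, 'a) module))"
    "bij_betw \<phi> (carrier (module_sum M Y)) (carrier (module_power r (regular_module :: ('a, 'a) module)))"
    using iso unfolding module_iso_def by blast
  interpret M: right_module M by fact
  interpret Y: right_module Y by fact
  have rS: "right_module (module_sum M Y)" using M Y by (rule right_module_sum)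
  obtain f g where f: "f \<in> module_homs (module_sum M Y) (module_power r (regular_module :: ('a, 'a) module))"
    "g \<in> module_homs (module_power r (regular_module :: ('a, 'a) module)) (module_sum M Y)"
    "!!x. x \<in> carrier (module_sum M Y) ==> g (f x) = x" using module_isoE[OF iso rS] by metis
  let ?h = "%x i. if i < r then f (x, \<zero>\<^bsub>Y\<^esub>) i else 0" and ?k = "%v. fst (g (restrict v {..<r}))"
  have h: "?h \<in> module_homs M (col (idm r))"
    using module_homs_comp[OF module_homs_comp[OF module_sum_homs(1)[OF M Y] f(1)] extend_module_homs] by simp
  have k: "?k \<in> module_homs (col (idm r)) M"
    using module_homs_comp[OF module_homs_comp[OF restrict_module_homs f(2)] module_sum_homs(3)[OF M Y]] by simp
  have kh: "?k (?h x) = x" if x: "x \<in> carrier M" for x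
  proof -
    have "f (x, \<zero>\<^bsub>Y\<^esub>) \<in> carrier (module_power r (regular_module :: ('a, 'a) module))"
      using x by (intro module_homsD(1)[OF f(1)]) simp
    hence "restrict (?h x) {..<r} = f (x, \<zero>\<^bsub>Y\<^esub>)" by (auto simp: fun_eq_iff PiE_def extensional_def)
    thus ?thesis using f(3)[of "(x, \<zero>\<^bsub>Y\<^esub>)"] x by simp
  qed
  obtain e where e: "e * e = e" "?h \<in> module_homs M (col e)" "?k \<in> module_homs (col e) M"
    "!!v. v \<in> carrier (col e) ==> ?h (?k v) = v" using col_retract[OF idm_idem h k kh] by blast
  show ?thesis unfolding cmod_def using e kh by (intro exI[of _ e] conjI exI[of _ ?h] exI[of _ ?k]) blast+
qed

text \<open>If \<open>r\<close> bounds the entries of \<open>e\<close>, the complement of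
  \<open>col e\<close> in the free module of rank \<open>r\<close> is the image of
  \<open>idm r - e\<close>.\<close>

lemma col_in_add:
  fixes e :: "'a fmat"
  assumes e: "e * e = e"
  shows "in_add_module (regular_module :: ('a, 'a) module) (col e)"
proof -
  obtain r where r: "!!i j. r \<le> i \<or> r \<le> j ==> entry e i j = 0" using fmat_bound[of e] by blast
  have ae: "act e v i = 0" if "i \<ge> r" for v i unfolding act_def using r that by simp
  have ie: "idm r * e = e"
    by (rule act_inject) (auto simp: act_times act_idm fun_eq_iff ae)
  have ei: "e * idm r = e"
  proof (rule fmat_eqI)
    fix i j
    have "entry (e * idm r) i j = act e (act (idm r) (unitv j)) i" by (simp add: act_unitv[symmetric] act_times)
    also have "act (idm r) (unitv j) = (if j < r then unitv j else 0)" by (auto simp: act_idm unitv_def fun_eq_iff)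
    also have "act e \<dots> i = entry e i j" using r by (auto simp: act_unitv)
    finally show "entry (e * idm r) i j = entry e i j" .
  qed
  let ?q = "idm r - e"
  have q: "?q * ?q = ?q" "e * ?q = 0" "?q * e = 0" using ie ei e by (simp_all add: algebra_simps idm_idem)
  have qq: "act e (act e v) = act e v" "act ?q (act ?q v) = act ?q v" "act e (act ?q v) = 0" "act ?q (act e v) = 0" for v
    using e q by (simp_all add: act_times[symmetric])
  have sm: "act e v + act ?q v = act (idm r) v" for v by (simp add: act_add_left[symmetric])
  have "module_iso (module_sum (col e) (col ?q)) (module_power r (regular_module :: ('a, 'a) module))"
  proof (rule module_isoI[of "%yz. restrict (fst yz + snd yz) {..<r}" _ _
        "%x. (act e (%i. if i < r then x i else 0), act ?q (%i. if i < r then x i else 0))"])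
    show "(%yz. restrict (fst yz + snd yz) {..<r}) \<in> module_homs (module_sum (col e) (col ?q)) (module_power r regular_module)"
      by (rule module_homsI) (auto simp: fun_eq_iff algebra_simps)
    show "(act e (%i. if i < r then x i else 0), act ?q (%i. if i < r then x i else 0)) \<in> carrier (module_sum (col e) (col ?q))" for x
      by (simp add: qq)
    show "restrict (fst (act e (%i. if i < r then x i else 0), act ?q (%i. if i < r then x i else 0)) +
        snd (act e (%i. if i < r then x i else 0), act ?q (%i. if i < r then x i else 0))) {..<r} = x"
      if "x \<in> carrier (module_power r (regular_module :: ('a, 'a) module))" for x
      using that by (auto simp: sm act_idm fun_eq_iff PiE_def extensional_def)
    fix yz assume "yz \<in> carrier (module_sum (col e) (col ?q))"
    then obtain y z where yz: "yz = (y, z)" "act e y = y" "act ?q z = z" by auto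
    have i: "act (idm r) (y + z) = y + z"
      using yz ie arrD(1) q by (metis act_plus act_times right_diff_distrib idm_idem)
    have s: "(%i. if i < r then restrict (y + z) {..<r} i else 0) = act (idm r) (y + z)" by (auto simp: act_idm fun_eq_iff)
    have "act e z = 0" "act ?q y = 0" using qq(3)[of z] qq(4)[of y] yz by simp_all
    thus "(act e (%i. if i < r then restrict (fst yz + snd yz) {..<r} i else 0),
        act ?q (%i. if i < r then restrict (fst yz + snd yz) {..<r} i else 0)) = yz"
      unfolding yz(1) fst_conv snd_conv s i using yz(2,3) by (simp add: act_plus)
  qed
  thus ?thesis unfolding in_add_module_def using right_module_col by blast
qed

text \<open>In a decomposition, the projection onto the first summand is given by an idempotent in
  the corner of \<open>e\<close>, hence by 0 or by \<open>e\<close>.\<close>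

lemma col_indecomposable:
  assumes e: "prim e"
  shows "indecomposable_module (col e)"
  unfolding indecomposable_module_def
proof (intro conjI allI impI)
  have ee: "e * e = e" and e0: "e ~= 0" and ep: "!!p. p \<in> arr e e ==> p * p = p ==> p = 0 \<or> p = e"
    using e unfolding prim_iff by blast+
  show "right_module (col e)" by (rule right_module_col)
  show "\<not> zero_module (col e)" using zero_module_col[OF ee] e0 by blast
  fix Y Z :: "('a, 'a univ) module"
  assume Y: "right_module Y" and Z: "right_module Z" and iso: "module_iso (col e) (module_sum Y Z)"
  interpret Y: right_module Y by fact
  interpret Z: right_module Z by fact
  obtain f g where f: "f \<in> module_homs (col e) (module_sum Y Z)" "g \<in> module_homs (module_sum Y Z) (col e)"
    "!!x. x \<in> carrier (col e) ==> g (f x) = x" "!!y. y \<in> carrier (module_sum Y Z) ==> f (g y) = y"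
    using module_isoE[OF iso right_module_col] by metis
  have "(%v. g (fst (f v), \<zero>\<^bsub>Z\<^esub>)) \<in> module_homs (col e) (col e)"
    using module_homs_comp[OF module_homs_comp[OF module_homs_comp[OF f(1) module_sum_homs(3)[OF Y Z]] module_sum_homs(1)[OF Y Z]] f(2)] by simp
  from module_homs_matrix[OF this ee ee] obtain p where p: "p \<in> arr e e" "!!v. v \<in> carrier (col e) ==> g (fst (f v), \<zero>\<^bsub>Z\<^esub>) = act p v"
    by blast
  have fc: "fst (f v) \<in> carrier Y" if "v \<in> carrier (col e)" for v using module_homsD(1)[OF f(1) that] by auto
  have "p * p = p"
  proof (rule act_faithful[OF hom_mult[OF p(1,1)] p(1) ee])
    fix v assume v: "v \<in> carrier (col e)"
    have c: "act p v \<in> carrier (col e)" using module_homsD(1)[OF act_module_homs[OF p(1)] v] .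
    have "f (g (fst (f v), \<zero>\<^bsub>Z\<^esub>)) = (fst (f v), \<zero>\<^bsub>Z\<^esub>)" using fc[OF v] by (intro f(4)) simp
    hence "act p (act p v) = act p v" using p(2)[OF c] p(2)[OF v] by simp
    thus "act (p * p) v = act p v" by (simp add: act_times)
  qed
  hence "p = 0 \<or> p = e" using ep p(1) by blast
  moreover have fz: "f (g (\<zero>\<^bsub>Y\<^esub>, \<zero>\<^bsub>Z\<^esub>)) = (\<zero>\<^bsub>Y\<^esub>, \<zero>\<^bsub>Z\<^esub>)" by (rule f(4)) simp
  moreover have g0: "g (\<zero>\<^bsub>Y\<^esub>, \<zero>\<^bsub>Z\<^esub>) = 0"
  proof -
    have "g (\<zero>\<^bsub>Y\<^esub>, \<zero>\<^bsub>Z\<^esub>) \<oplus>\<^bsub>col e\<^esub> g (\<zero>\<^bsub>Y\<^esub>, \<zero>\<^bsub>Z\<^esub>) = g (\<zero>\<^bsub>Y\<^esub>, \<zero>\<^bsub>Z\<^esub>)"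
      using module_homsD(2)[OF f(2), of "(\<zero>\<^bsub>Y\<^esub>, \<zero>\<^bsub>Z\<^esub>)" "(\<zero>\<^bsub>Y\<^esub>, \<zero>\<^bsub>Z\<^esub>)"] by simp
    thus ?thesis by simp
  qed
  moreover have "zero_module Y" if "p = 0"
  proof -
    have "y = \<zero>\<^bsub>Y\<^esub>" if y: "y \<in> carrier Y" for y
    proof -
      have v: "g (y, \<zero>\<^bsub>Z\<^esub>) \<in> carrier (col e)" using y by (intro module_homsD(1)[OF f(2)]) simp
      have fv: "f (g (y, \<zero>\<^bsub>Z\<^esub>)) = (y, \<zero>\<^bsub>Z\<^esub>)" using y by (intro f(4)) simp
      have "g (y, \<zero>\<^bsub>Z\<^esub>) = 0" using p(2)[OF v] \<open>p = 0\<close> unfolding fv by simp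
      hence "g (y, \<zero>\<^bsub>Z\<^esub>) = g (\<zero>\<^bsub>Y\<^esub>, \<zero>\<^bsub>Z\<^esub>)" using g0 by simp
      hence "f (g (y, \<zero>\<^bsub>Z\<^esub>)) = f (g (\<zero>\<^bsub>Y\<^esub>, \<zero>\<^bsub>Z\<^esub>))" by (rule arg_cong)
      thus ?thesis unfolding fv fz by simp
    qed
    thus ?thesis unfolding zero_module_def using Y.zero_closed by blast
  qed
  moreover have "zero_module Z" if "p = e"
  proof -
    have "z = \<zero>\<^bsub>Z\<^esub>" if z: "z \<in> carrier Z" for z
    proof -
      have v: "g (\<zero>\<^bsub>Y\<^esub>, z) \<in> carrier (col e)" using z by (intro module_homsD(1)[OF f(2)]) simp
      have fv: "f (g (\<zero>\<^bsub>Y\<^esub>, z)) = (\<zero>\<^bsub>Y\<^esub>, z)" using z by (intro f(4)) simp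
      have "g (\<zero>\<^bsub>Y\<^esub>, z) = g (\<zero>\<^bsub>Y\<^esub>, \<zero>\<^bsub>Z\<^esub>)" using p(2)[OF v] v \<open>p = e\<close> unfolding fv by simp
      hence "f (g (\<zero>\<^bsub>Y\<^esub>, z)) = f (g (\<zero>\<^bsub>Y\<^esub>, \<zero>\<^bsub>Z\<^esub>))" by (rule arg_cong)
      thus ?thesis unfolding fv fz by simp
    qed
    thus ?thesis unfolding zero_module_def using Z.zero_closed by blast
  qed
  ultimately show "zero_module Y \<or> zero_module Z" by blast
qed

theorem num_indec_regular: "num_indec_module (regular_module :: ('a, 'a) module) = card prim_classes"
proof -
  let ?S = "{X :: ('a, 'a univ) module. in_add_module (regular_module :: ('a, 'a) module) X \<and> indecomposable_module X}"
  define \<epsilon> where "\<epsilon> X = (SOME e. cmod X e)" for X :: "('a, 'a univ) module"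
  have \<epsilon>: "cmod X (\<epsilon> X)" "prim (\<epsilon> X)" "right_module X" if "X \<in> ?S" for X
  proof -
    have "\<exists>e. cmod X e" using in_add_cmod[of X] that by simp
    thus "cmod X (\<epsilon> X)" unfolding \<epsilon>_def by (rule someI_ex)
    thus "prim (\<epsilon> X)" using cmod_prim that by blast
    show "right_module X" using that unfolding indecomposable_module_def by blast
  qed
  have "num_iso_types ?S module_iso = card ((%X. rk (\<epsilon> X)) ` ?S)"
  proof (rule num_iso_types_card)
    fix X Y assume X: "X \<in> ?S" and Y: "Y \<in> ?S"
    show "module_iso X Y \<longleftrightarrow> rk (\<epsilon> X) = rk (\<epsilon> Y)"
      using cmod_iso[OF \<epsilon>(3)[OF X] \<epsilon>(1)[OF X] \<epsilon>(1)[OF Y]] rk_eq_iff[OF \<epsilon>(2)[OF X] \<epsilon>(2)[OF Y]] by simp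
  qed
  moreover have "(%X. rk (\<epsilon> X)) ` ?S = prim_classes"
  proof (intro equalityI subsetI)
    fix b assume "b \<in> (%X. rk (\<epsilon> X)) ` ?S"
    thus "b \<in> prim_classes" unfolding prim_classes_def using \<epsilon>(2) by blast
  next
    fix b assume "b \<in> prim_classes"
    then obtain e where e: "prim e" "b = rk e" unfolding prim_classes_def by blast
    hence ee: "e * e = e" unfolding prim_def by blast
    have C: "col e \<in> ?S" using col_in_add[OF ee] col_indecomposable[OF e(1)] by simp
    have "module_iso (col e) (col e)" unfolding module_iso_def
      using act_module_homs[OF hom_id[OF ee]] module_homs_cong[OF _ right_module_col, of "act e" e "col e" "%x. x"]
      by (intro bexI[of _ "%x. x"]) (auto simp: bij_betw_def inj_on_def)
    hence "rk (\<epsilon> (col e)) = rk e"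
      using cmod_iso[OF right_module_col \<epsilon>(1)[OF C] cmod_col[OF ee]] rk_eq_iff[OF \<epsilon>(2)[OF C] e(1)] by simp
    thus "b \<in> (%X. rk (\<epsilon> X)) ` ?S" using C e(2) by (metis (no_types, lifting) image_eqI)
  qed
  ultimately show ?thesis unfolding num_indec_module_def by simp
qed

end

lemma mbiprod_sym: "mbiprod E X Y ==> mbiprod E Y X"
  unfolding mbiprod_def by (metis add.commute)

section \<open>Complexes of modules as complexes of idempotents\<close>

definition phi :: "'a::ring_1 fmat mcx => ('a, 'a univ) cpx" where
  "phi E = \<lparr>obj = (%n. col (ob E n)), diff = (%n. act (df E n))\<rparr>"

lemma phi_sel [simp]: "obj (phi E) n = col (ob E n)" "diff (phi E) n = act (df E n)"
  unfolding phi_def by auto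

text \<open>A strict isomorphism \<open>u\<close> with inverse \<open>v\<close> between
  \<open>X\<close> and the complex of column modules of \<open>E\<close>. The complex
  \<open>X\<close> may be carried by any type, which admits sums, powers and cones; that its
  differential squares to zero is inherited from \<open>E\<close>.\<close>

definition crep :: "('a::ring_1, 'm) cpx => 'a fmat mcx => (int => 'm => 'a univ) => (int => 'a univ => 'm) => bool" where
  "crep X E u v \<longleftrightarrow> cx E \<and> (\<forall>n. diff X n \<in> module_homs (obj X n) (obj X (n + 1))) \<and>
     (\<forall>n. u n \<in> module_homs (obj X n) (col (ob E n))) \<and> (\<forall>n. v n \<in> module_homs (col (ob E n)) (obj X n)) \<and>
     (\<forall>n. \<forall>x\<in>carrier (obj X n). v n (u n x) = x) \<and> (\<forall>n. \<forall>y\<in>carrier (col (ob E n)). u n (v n y) = y) \<and>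
     (\<forall>n. \<forall>x\<in>carrier (obj X n). u (n + 1) (diff X n x) = act (df E n) (u n x))"

lemma crepD:
  assumes "crep X E u v"
  shows "cx E" "diff X n \<in> module_homs (obj X n) (obj X (n + 1))" "u n \<in> module_homs (obj X n) (col (ob E n))"
    "v n \<in> module_homs (col (ob E n)) (obj X n)" "x \<in> carrier (obj X n) ==> v n (u n x) = x"
    "y \<in> carrier (col (ob E n)) ==> u n (v n y) = y"
    "x \<in> carrier (obj X n) ==> u (n + 1) (diff X n x) = act (df E n) (u n x)"
  using assms unfolding crep_def by auto

lemma crep_v_diff:
  assumes r: "crep X E u v" and y: "y \<in> carrier (col (ob E n))"
  shows "diff X n (v n y) = v (n + 1) (act (df E n) y)"
proof -
  have x: "v n y \<in> carrier (obj X n)" by (rule module_homsD(1)[OF crepD(4)[OF r] y])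
  have "diff X n (v n y) = v (n + 1) (u (n + 1) (diff X n (v n y)))"
    by (rule crepD(5)[OF r, symmetric]) (rule module_homsD(1)[OF crepD(2)[OF r] x])
  thus ?thesis unfolding crepD(7)[OF r x] crepD(6)[OF r y] .
qed

lemma module_homs_id: "(%x. x) \<in> module_homs M M"
  by (rule module_homsI) auto

lemma crep_phi: "cx E ==> crep (phi E) E (%_ x. x) (%_ x. x)"
  unfolding crep_def using act_module_homs[OF cxD(2)] by (auto simp: module_homs_id)

lemma Kb_proj_crep:
  fixes X :: "('a::ring_1, 'm) cpx"
  assumes "Kb_proj X"
  shows "\<exists>E u v. crep X E u v"
proof -
  have X: "is_complex X" "!!n. fg_projective (obj X n)" "finite {n. \<not> zero_module (obj X n)}"
    using assms unfolding Kb_proj_def by auto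
  have M: "right_module (obj X n)" and d: "diff X n \<in> module_homs (obj X n) (obj X (n + 1))"
    and dd: "x \<in> carrier (obj X n) ==> diff X (n + 1) (diff X n x) = \<zero>\<^bsub>obj X (n + 2)\<^esub>" for n x
    using X(1) unfolding is_complex_def by auto
  have "\<forall>n. \<exists>e u v. e * e = e \<and> u \<in> module_homs (obj X n) (col e) \<and> v \<in> module_homs (col e) (obj X n) \<and>
    (\<forall>x\<in>carrier (obj X n). v (u x) = x) \<and> (\<forall>y\<in>carrier (col e). u (v y) = y)" using fg_projective_rep[OF X(2)] by blast
  then obtain e u v where e: "!!n. e n * e n = e n" and u: "!!n. u n \<in> module_homs (obj X n) (col (e n))"
    and v: "!!n. v n \<in> module_homs (col (e n)) (obj X n)" and vu: "!!n x. x \<in> carrier (obj X n) ==> v n (u n x) = x"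
    and uv: "!!n y. y \<in> carrier (col (e n)) ==> u n (v n y) = y" by metis
  have "\<forall>n. \<exists>x\<in>arr (e n) (e (n + 1)). \<forall>w\<in>carrier (col (e n)). u (n + 1) (diff X n (v n w)) = act x w"
    using module_homs_matrix[OF module_homs_comp[OF module_homs_comp[OF v d] u] e e] by blast
  then obtain D where D: "!!n. D n \<in> arr (e n) (e (n + 1))"
    "!!n w. w \<in> carrier (col (e n)) ==> u (n + 1) (diff X n (v n w)) = act (D n) w" by metis
  define E where "E = \<lparr>ob = e, df = D\<rparr>"
  have n2: "n + 1 + 1 = n + 2" for n :: int by simp
  have DD: "D (n + 1) * D n = 0" for n
  proof (rule act_faithful[of _ "e n" "e (n + 2)"])
    show "D (n + 1) * D n \<in> arr (e n) (e (n + 2))" using hom_mult[OF D(1) D(1)[of "n + 1"]] unfolding n2 .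
    fix w assume w: "w \<in> carrier (col (e n))"
    have vw: "v n w \<in> carrier (obj X n)" by (rule module_homsD(1)[OF v w])
    have dv: "diff X n (v n w) \<in> carrier (obj X (n + 1))" by (rule module_homsD(1)[OF d vw])
    have "act (D n) w \<in> carrier (col (e (n + 1)))" by (rule module_homsD(1)[OF act_module_homs[OF D(1)] w])
    hence "act (D (n + 1)) (act (D n) w) = u (n + 2) (diff X (n + 1) (v (n + 1) (act (D n) w)))" using D(2)[of "act (D n) w" "n + 1"] n2 by simp
    also have "v (n + 1) (act (D n) w) = diff X n (v n w)" unfolding D(2)[OF w, symmetric] by (rule vu[OF dv])
    also have "u (n + 2) (diff X (n + 1) (diff X n (v n w))) = 0"
      unfolding dd[OF vw] using module_homs_zero[OF u M right_module_col] by simp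
    finally show "act (D (n + 1) * D n) w = act 0 w" by (simp add: act_times)
  qed (simp_all add: e)
  have z: "e n = 0" if "zero_module (obj X n)" for n
  proof -
    have "y = 0" if y: "y \<in> carrier (col (e n))" for y
    proof -
      have "v n y = \<zero>\<^bsub>obj X n\<^esub>" using module_homsD(1)[OF v y] \<open>zero_module (obj X n)\<close> unfolding zero_module_def by blast
      hence "y = u n \<zero>\<^bsub>obj X n\<^esub>" using uv[OF y] by simp
      thus ?thesis using module_homs_zero[OF u M right_module_col] by simp
    qed
    hence "zero_module (col (e n))" unfolding zero_module_def by auto
    thus ?thesis using zero_module_col[OF e] by blast
  qed
  have "finite {n. e n ~= 0}" using X(3) by (rule finite_subset[rotated]) (use z in blast)
  hence cE: "cx E" unfolding cx_def E_def using e D(1) DD by simp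
  have "u (n + 1) (diff X n x) = act (D n) (u n x)" if x: "x \<in> carrier (obj X n)" for n x
    using D(2)[OF module_homsD(1)[OF u x]] vu[OF x] by simp
  hence "crep X E u v" unfolding crep_def using cE d u v vu uv by (simp add: E_def)
  thus ?thesis by blast
qed

lemma Kb_proj_from_crep:
  fixes X :: "('a::ring_1, 'm) cpx"
  assumes r: "crep X E u v" and fg: "!!n. fg_projective (obj X n)"
  shows "Kb_proj X"
proof -
  have M: "right_module (obj X n)" for n using fg[of n] unfolding fg_projective_def by blast
  have v0: "v n 0 = \<zero>\<^bsub>obj X n\<^esub>" for n using module_homs_zero[OF crepD(4)[OF r] right_module_col M] by simp
  have dd: "diff X (n + 1) (diff X n x) = \<zero>\<^bsub>obj X (n + 2)\<^esub>" if x: "x \<in> carrier (obj X n)" for n x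
  proof -
    have dx: "diff X n x \<in> carrier (obj X (n + 1))" by (rule module_homsD(1)[OF crepD(2)[OF r] x])
    have ddx: "diff X (n + 1) (diff X n x) \<in> carrier (obj X (n + 2))"
      using module_homsD(1)[OF crepD(2)[OF r] dx] by (simp add: add.assoc)
    have "u (n + 2) (diff X (n + 1) (diff X n x)) = act (df E (n + 1)) (u (n + 1) (diff X n x))"
      using crepD(7)[OF r dx] by (simp add: add.assoc)
    also have "\<dots> = act (df E (n + 1) * df E n) (u n x)" unfolding crepD(7)[OF r x] by (simp add: act_times)
    also have "\<dots> = 0" using cxD(3)[OF crepD(1)[OF r]] by simp
    finally show ?thesis using crepD(5)[OF r ddx] v0 by simp
  qed
  have "zero_module (obj X n)" if e: "ob E n = 0" for n
  proof -
    have "x = \<zero>\<^bsub>obj X n\<^esub>" if x: "x \<in> carrier (obj X n)" for x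
    proof -
      have "u n x = 0" using module_homsD(1)[OF crepD(3)[OF r] x] e by simp
      thus ?thesis using crepD(5)[OF r x] v0 by simp
    qed
    moreover have "\<zero>\<^bsub>obj X n\<^esub> \<in> carrier (obj X n)" using module_homsD(1)[OF crepD(4)[OF r], of 0 n] v0 by simp
    ultimately show ?thesis unfolding zero_module_def by blast
  qed
  hence "finite {n. \<not> zero_module (obj X n)}"
    by (intro finite_subset[OF _ cxD(4)[OF crepD(1)[OF r]]]) blast
  thus ?thesis unfolding Kb_proj_def is_complex_def using M crepD(2)[OF r] dd fg by blast
qed

lemma Kb_proj_phi: "cx E ==> Kb_proj (phi E)"
  using Kb_proj_from_crep[OF crep_phi] fg_projective_col cxD(1) by fastforce

definition matrix_of :: "('a::ring_1, 'm) cpx => (int => 'm => 'a univ) => (int => 'n => 'a univ) => (int => 'm => 'n) => (int => 'a fmat) => bool" where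
  "matrix_of X u u' f F \<longleftrightarrow> (\<forall>n. \<forall>x\<in>carrier (obj X n). u' n (f n x) = act (F n) (u n x))"

lemma chain_mapsD:
  assumes "f \<in> chain_maps X Y"
  shows "f n \<in> module_homs (obj X n) (obj Y n)" "x \<in> carrier (obj X n) ==> f (n + 1) (diff X n x) = diff Y n (f n x)"
  using assms unfolding chain_maps_def by auto

lemma chain_map_matrix:
  assumes X: "crep X E u v" and Y: "crep Y F u' v'" and f: "f \<in> chain_maps X Y"
  shows "\<exists>M\<in>mhoms E F. matrix_of X u u' f M"
proof -
  note e = cxD(1)[OF crepD(1)[OF X]] and e' = cxD(1)[OF crepD(1)[OF Y]]
  have "\<forall>n. \<exists>x\<in>arr (ob E n) (ob F n). \<forall>w\<in>carrier (col (ob E n)). u' n (f n (v n w)) = act x w"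
    using module_homs_matrix[OF module_homs_comp[OF module_homs_comp[OF crepD(4)[OF X] chain_mapsD(1)[OF f]] crepD(3)[OF Y]] e e'] by blast
  then obtain M where M: "!!n. M n \<in> arr (ob E n) (ob F n)"
    "!!n w. w \<in> carrier (col (ob E n)) ==> u' n (f n (v n w)) = act (M n) w" by metis
  have m: "u' n (f n x) = act (M n) (u n x)" if x: "x \<in> carrier (obj X n)" for n x
    using M(2)[OF module_homsD(1)[OF crepD(3)[OF X] x]] crepD(5)[OF X x] by simp
  have "M \<in> mhoms E F"
  proof (rule mhomsI[OF M(1)])
    fix n
    show "df F n * M n = M (n + 1) * df E n"
    proof (rule act_faithful[OF hom_mult[OF M(1) cxD(2)[OF crepD(1)[OF Y]]] hom_mult[OF cxD(2)[OF crepD(1)[OF X]] M(1)] e])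
      fix w assume w: "w \<in> carrier (col (ob E n))"
      have x: "v n w \<in> carrier (obj X n)" by (rule module_homsD(1)[OF crepD(4)[OF X] w])
      have fx: "f n (v n w) \<in> carrier (obj Y n)" by (rule module_homsD(1)[OF chain_mapsD(1)[OF f] x])
      have dx: "diff X n (v n w) \<in> carrier (obj X (n + 1))" by (rule module_homsD(1)[OF crepD(2)[OF X] x])
      have "act (df F n * M n) w = act (df F n) (u' n (f n (v n w)))" using M(2)[OF w] by (simp add: act_times)
      also have "\<dots> = u' (n + 1) (diff Y n (f n (v n w)))" using crepD(7)[OF Y fx] by simp
      also have "\<dots> = u' (n + 1) (f (n + 1) (diff X n (v n w)))" using chain_mapsD(2)[OF f x] by simp
      also have "\<dots> = act (M (n + 1)) (u (n + 1) (diff X n (v n w)))" by (rule m[OF dx])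
      also have "\<dots> = act (M (n + 1)) (act (df E n) w)" unfolding crepD(7)[OF X x] crepD(6)[OF X w] ..
      finally show "act (df F n * M n) w = act (M (n + 1) * df E n) w" by (simp add: act_times)
    qed
  qed
  thus ?thesis unfolding matrix_of_def using m by blast
qed

lemma matrix_chain_map:
  assumes X: "crep X E u v" and Y: "crep Y F u' v'" and M: "M \<in> mhoms E F"
  defines "f \<equiv> %n x. v' n (act (M n) (u n x))"
  shows "f \<in> chain_maps X Y" "matrix_of X u u' f M"
proof -
  note Mh = act_module_homs[OF mhomsD(1)[OF M]]
  have c: "act (M n) (u n x) \<in> carrier (col (ob F n))" if "x \<in> carrier (obj X n)" for n x
    by (rule module_homsD(1)[OF Mh module_homsD(1)[OF crepD(3)[OF X] that]])
  have "f n \<in> module_homs (obj X n) (obj Y n)" for n unfolding f_def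
    by (rule module_homs_comp[OF module_homs_comp[OF crepD(3)[OF X] Mh] crepD(4)[OF Y]])
  moreover have "f (n + 1) (diff X n x) = diff Y n (f n x)" if x: "x \<in> carrier (obj X n)" for n x
  proof -
    have "f (n + 1) (diff X n x) = v' (n + 1) (act (M (n + 1) * df E n) (u n x))"
      unfolding f_def crepD(7)[OF X x] by (simp add: act_times)
    also have "\<dots> = v' (n + 1) (act (df F n) (act (M n) (u n x)))"
      unfolding mhomsD(2)[OF M, symmetric] by (simp add: act_times)
    also have "\<dots> = diff Y n (f n x)" unfolding f_def by (rule crep_v_diff[OF Y c[OF x], symmetric])
    finally show ?thesis .
  qed
  ultimately show "f \<in> chain_maps X Y" unfolding chain_maps_def by blast
  show "matrix_of X u u' f M" unfolding matrix_of_def f_def using crepD(6)[OF Y c] by blast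
qed

lemma matrix_of_comp:
  assumes "f \<in> chain_maps X Y" "matrix_of X u u' f M" "matrix_of Y u' u'' g N"
  shows "matrix_of X u u'' (comp_maps g f) (N * M)"
  using assms module_homsD(1)[OF chain_mapsD(1)[OF assms(1)]] unfolding matrix_of_def by (simp add: act_times)

lemma matrix_of_id: "crep X E u v ==> matrix_of X u u (%n x. x) (ob E)"
  unfolding matrix_of_def using module_homsD(1)[OF crepD(3)] by fastforce

lemma chain_maps_comp: "f \<in> chain_maps X Y ==> g \<in> chain_maps Y Z ==> comp_maps g f \<in> chain_maps X Z"
proof -
  assume f: "f \<in> chain_maps X Y" and g: "g \<in> chain_maps Y Z"
  have "(%x. g n (f n x)) \<in> module_homs (obj X n) (obj Z n)" for n
    by (rule module_homs_comp[OF chain_mapsD(1)[OF f] chain_mapsD(1)[OF g]])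
  thus ?thesis unfolding chain_maps_def using chain_mapsD(2)[OF f] chain_mapsD(2)[OF g] module_homsD(1)[OF chain_mapsD(1)[OF f]]
    by (auto simp: comp_def)
qed

text \<open>The maps are only asked to preserve the carriers and to have matrices that are morphisms
  in each degree, because \<open>homotopy_zero\<close> compares the identity with a family of
  constant maps. A homotopy is turned into matrices, and back, degree by degree.\<close>

lemma homotopic_maps_iff:
  assumes X: "crep X E u v" and Y: "crep Y F u' v'" and f: "!!n x. x \<in> carrier (obj X n) ==> f n x \<in> carrier (obj Y n)"
    and g: "!!n x. x \<in> carrier (obj X n) ==> g n x \<in> carrier (obj Y n)"
    and M: "!!n. M n \<in> arr (ob E n) (ob F n)" and N: "!!n. N n \<in> arr (ob E n) (ob F n)"
    and fM: "matrix_of X u u' f M" and gN: "matrix_of X u u' g N"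
  shows "homotopic_maps X Y f g \<longleftrightarrow> heq E F M N"
proof
  note e = cxD(1)[OF crepD(1)[OF X]] and e' = cxD(1)[OF crepD(1)[OF Y]]
  note dE = cxD(2)[OF crepD(1)[OF X]] and dF = cxD(6)[OF crepD(1)[OF Y]]
  have dY: "diff Y (n - 1) \<in> module_homs (obj Y (n - 1)) (obj Y n)" for n using crepD(2)[OF Y, of "n - 1"] by simp
  have uY: "u' n (diff Y (n - 1) y) = act (df F (n - 1)) (u' (n - 1) y)" if "y \<in> carrier (obj Y (n - 1))" for n y
    using crepD(7)[OF Y that] by simp
  {
    assume "homotopic_maps X Y f g"
    then obtain h where h: "!!n. h n \<in> module_homs (obj X n) (obj Y (n - 1))"
      "!!n x. x \<in> carrier (obj X n) ==> f n x = g n x \<oplus>\<^bsub>obj Y n\<^esub> (diff Y (n - 1) (h n x) \<oplus>\<^bsub>obj Y n\<^esub> h (n + 1) (diff X n x))"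
      unfolding homotopic_maps_def by blast
    have h1: "h (n + 1) \<in> module_homs (obj X (n + 1)) (obj Y n)" for n using h(1)[of "n + 1"] by simp
    have "\<forall>n. \<exists>x\<in>arr (ob E n) (ob F (n - 1)). \<forall>w\<in>carrier (col (ob E n)). u' (n - 1) (h n (v n w)) = act x w"
      using module_homs_matrix[OF module_homs_comp[OF module_homs_comp[OF crepD(4)[OF X] h(1)] crepD(3)[OF Y]] e e'] by blast
    then obtain H where H: "!!n. H n \<in> arr (ob E n) (ob F (n - 1))"
      "!!n w. w \<in> carrier (col (ob E n)) ==> u' (n - 1) (h n (v n w)) = act (H n) w" by metis
    have hH: "u' (n - 1) (h n x) = act (H n) (u n x)" if x: "x \<in> carrier (obj X n)" for n x
      using H(2)[OF module_homsD(1)[OF crepD(3)[OF X] x]] crepD(5)[OF X x] by simp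
    have H1: "H (n + 1) \<in> arr (ob E (n + 1)) (ob F n)" for n using H(1)[of "n + 1"] by simp
    have "M - N \<in> nulls E F"
    proof (rule nullsI[OF H(1)])
      fix n
      have "M n - N n = df F (n - 1) * H n + H (n + 1) * df E n"
      proof (rule act_faithful[OF hom_diff[OF M N] hom_add[OF hom_mult[OF H(1) dF] hom_mult[OF dE H1]] e])
        fix w assume w: "w \<in> carrier (col (ob E n))"
        have x: "v n w \<in> carrier (obj X n)" by (rule module_homsD(1)[OF crepD(4)[OF X] w])
        let ?x = "v n w"
        have c: "h n ?x \<in> carrier (obj Y (n - 1))" "diff X n ?x \<in> carrier (obj X (n + 1))"
          by (rule module_homsD(1)[OF h(1) x], rule module_homsD(1)[OF crepD(2)[OF X] x])
        have c2: "diff Y (n - 1) (h n ?x) \<in> carrier (obj Y n)" "h (n + 1) (diff X n ?x) \<in> carrier (obj Y n)"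
          by (rule module_homsD(1)[OF dY c(1)], rule module_homsD(1)[OF h1 c(2)])
        have c3: "diff Y (n - 1) (h n ?x) \<oplus>\<^bsub>obj Y n\<^esub> h (n + 1) (diff X n ?x) \<in> carrier (obj Y n)"
        proof -
          have "v' n (u' n (diff Y (n - 1) (h n ?x)) + u' n (h (n + 1) (diff X n ?x))) =
              diff Y (n - 1) (h n ?x) \<oplus>\<^bsub>obj Y n\<^esub> h (n + 1) (diff X n ?x)"
            using module_homsD(2)[OF crepD(4)[OF Y] module_homsD(1)[OF crepD(3)[OF Y] c2(1)] module_homsD(1)[OF crepD(3)[OF Y] c2(2)]]
              crepD(5)[OF Y c2(1)] crepD(5)[OF Y c2(2)] by simp
          moreover have "u' n (diff Y (n - 1) (h n ?x)) + u' n (h (n + 1) (diff X n ?x)) \<in> carrier (col (ob F n))"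
            using module_homsD(1)[OF crepD(3)[OF Y] c2(1)] module_homsD(1)[OF crepD(3)[OF Y] c2(2)] by (simp add: act_plus)
          ultimately show ?thesis using module_homsD(1)[OF crepD(4)[OF Y]] by metis
        qed
        have "act (M n) w = u' n (f n ?x)" using fM x crepD(6)[OF X w] unfolding matrix_of_def by simp
        also have "\<dots> = u' n (g n ?x) + (u' n (diff Y (n - 1) (h n ?x)) + u' n (h (n + 1) (diff X n ?x)))"
          unfolding h(2)[OF x] using module_homsD(2)[OF crepD(3)[OF Y] g[OF x] c3] module_homsD(2)[OF crepD(3)[OF Y] c2] by simp
        also have "u' n (g n ?x) = act (N n) w" using gN x crepD(6)[OF X w] unfolding matrix_of_def by simp
        also have "u' n (diff Y (n - 1) (h n ?x)) = act (df F (n - 1)) (act (H n) w)" unfolding uY[OF c(1)] H(2)[OF w] ..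
        also have "u' n (h (n + 1) (diff X n ?x)) = act (H (n + 1)) (act (df E n) w)"
          using hH[OF c(2)] crepD(7)[OF X x] crepD(6)[OF X w] by simp
        finally have "act (M n) w = act (N n) w + (act (df F (n - 1)) (act (H n) w) + act (H (n + 1)) (act (df E n) w))" .
        thus "act (M n - N n) w = act (df F (n - 1) * H n + H (n + 1) * df E n) w"
          by (simp only: act_diff act_add_left act_times add_diff_cancel_left')
      qed
      thus "(M - N) n = df F (n - 1) * H n + H (n + 1) * df E n" by simp
    qed
    thus "heq E F M N" unfolding heq_def .
  }
  assume "heq E F M N"
  then obtain H where H: "!!n. H n \<in> arr (ob E n) (ob F (n - 1))" "!!n. (M - N) n = df F (n - 1) * H n + H (n + 1) * df E n"
    unfolding heq_def nulls_def by blast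
  define h where "h n x = v' (n - 1) (act (H n) (u n x))" for n x
  have Hc: "act (H n) (u n x) \<in> carrier (col (ob F (n - 1)))" if "x \<in> carrier (obj X n)" for n x
    by (rule module_homsD(1)[OF act_module_homs[OF H(1)] module_homsD(1)[OF crepD(3)[OF X] that]])
  have hh: "h n \<in> module_homs (obj X n) (obj Y (n - 1))" for n
    using module_homs_comp[OF module_homs_comp[OF crepD(3)[OF X] act_module_homs[OF H(1)]] crepD(4)[OF Y]] unfolding h_def by blast
  have h1: "h (n + 1) \<in> module_homs (obj X (n + 1)) (obj Y n)" for n using hh[of "n + 1"] by simp
  have "f n x = g n x \<oplus>\<^bsub>obj Y n\<^esub> (diff Y (n - 1) (h n x) \<oplus>\<^bsub>obj Y n\<^esub> h (n + 1) (diff X n x))" if x: "x \<in> carrier (obj X n)" for n x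
  proof -
    have dx: "diff X n x \<in> carrier (obj X (n + 1))" by (rule module_homsD(1)[OF crepD(2)[OF X] x])
    have a: "u' n (diff Y (n - 1) (h n x)) = act (df F (n - 1)) (act (H n) (u n x))"
      using uY[OF module_homsD(1)[OF hh x]] crepD(6)[OF Y Hc[OF x]] unfolding h_def by simp
    have b: "u' n (h (n + 1) (diff X n x)) = act (H (n + 1)) (act (df E n) (u n x))"
      using crepD(6)[OF Y Hc[OF dx]] crepD(7)[OF X x] unfolding h_def by simp
    have c2: "diff Y (n - 1) (h n x) \<in> carrier (obj Y n)" "h (n + 1) (diff X n x) \<in> carrier (obj Y n)"
      by (rule module_homsD(1)[OF dY module_homsD(1)[OF hh x]], rule module_homsD(1)[OF h1 dx])
    let ?y1 = "u' n (g n x)" and ?y2 = "u' n (diff Y (n - 1) (h n x))" and ?y3 = "u' n (h (n + 1) (diff X n x))"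
    have y: "?y1 \<in> carrier (col (ob F n))" "?y2 \<in> carrier (col (ob F n))" "?y3 \<in> carrier (col (ob F n))"
      using module_homsD(1)[OF crepD(3)[OF Y]] g[OF x] c2 by blast+
    have y23: "?y2 + ?y3 \<in> carrier (col (ob F n))" using y by (simp add: act_plus)
    have "act (M n) (u n x) = act (N n) (u n x) + act ((M - N) n) (u n x)" by (simp add: act_diff)
    also have "\<dots> = ?y1 + (?y2 + ?y3)" unfolding H(2) a b using gN x unfolding matrix_of_def by (simp add: act_add_left act_times)
    finally have "u' n (f n x) = ?y1 + (?y2 + ?y3)" using fM x unfolding matrix_of_def by simp
    hence "v' n (u' n (f n x)) = v' n ?y1 \<oplus>\<^bsub>obj Y n\<^esub> (v' n ?y2 \<oplus>\<^bsub>obj Y n\<^esub> v' n ?y3)"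
      using module_homsD(2)[OF crepD(4)[OF Y] y(1) y23] module_homsD(2)[OF crepD(4)[OF Y] y(2,3)] by simp
    thus ?thesis using crepD(5)[OF Y f[OF x]] crepD(5)[OF Y g[OF x]] crepD(5)[OF Y c2(1)] crepD(5)[OF Y c2(2)] by simp
  qed
  thus "homotopic_maps X Y f g" unfolding homotopic_maps_def using hh by blast
qed

lemma homotopic_maps_chain_iff:
  assumes "crep X E u v" "crep Y F u' v'" "f \<in> chain_maps X Y" "g \<in> chain_maps X Y" "M \<in> mhoms E F" "N \<in> mhoms E F"
    "matrix_of X u u' f M" "matrix_of X u u' g N"
  shows "homotopic_maps X Y f g \<longleftrightarrow> heq E F M N"
  by (rule homotopic_maps_iff[OF assms(1,2) _ _ mhomsD(1)[OF assms(5)] mhomsD(1)[OF assms(6)] assms(7,8)])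
    (erule module_homsD(1)[OF chain_mapsD(1)[OF assms(3)]], erule module_homsD(1)[OF chain_mapsD(1)[OF assms(4)]])

lemma chain_maps_id: "crep X E u v ==> (%n x. x) \<in> chain_maps X X"
  unfolding chain_maps_def by (simp add: module_homs_id)

theorem homotopy_iso_iff:
  assumes X: "crep X E u v" and Y: "crep Y F u' v'"
  shows "homotopy_iso X Y \<longleftrightarrow> meq E F"
proof
  assume "homotopy_iso X Y"
  then obtain f g where f: "f \<in> chain_maps X Y" "g \<in> chain_maps Y X" "homotopic_maps X X (comp_maps g f) (%n x. x)"
    "homotopic_maps Y Y (comp_maps f g) (%n y. y)" unfolding homotopy_iso_def by blast
  obtain M where M: "M \<in> mhoms E F" "matrix_of X u u' f M" using chain_map_matrix[OF X Y f(1)] by blast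
  obtain N where N: "N \<in> mhoms F E" "matrix_of Y u' u g N" using chain_map_matrix[OF Y X f(2)] by blast
  have "heq E E (N * M) (ob E)"
    using f(3) homotopic_maps_chain_iff[OF X X chain_maps_comp[OF f(1,2)] chain_maps_id[OF X] mhoms_mult[OF M(1) N(1)]
      mhoms_id[OF crepD(1)[OF X]] matrix_of_comp[OF f(1) M(2) N(2)] matrix_of_id[OF X]] by blast
  moreover have "heq F F (M * N) (ob F)"
    using f(4) homotopic_maps_chain_iff[OF Y Y chain_maps_comp[OF f(2,1)] chain_maps_id[OF Y] mhoms_mult[OF N(1) M(1)]
      mhoms_id[OF crepD(1)[OF Y]] matrix_of_comp[OF f(2) N(2) M(2)] matrix_of_id[OF Y]] by blast
  ultimately show "meq E F" unfolding meq_def mequiv_def using M N by blast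
next
  assume "meq E F"
  then obtain M N where M: "M \<in> mhoms E F" "N \<in> mhoms F E" "heq E E (N * M) (ob E)" "heq F F (M * N) (ob F)"
    unfolding meq_def mequiv_def by blast
  note f = matrix_chain_map[OF X Y M(1)] and g = matrix_chain_map[OF Y X M(2)]
  show "homotopy_iso X Y" unfolding homotopy_iso_def
    by (intro bexI[OF _ f(1)] bexI[OF _ g(1)] conjI
      homotopic_maps_chain_iff[OF X X chain_maps_comp[OF f(1) g(1)] chain_maps_id[OF X] mhoms_mult[OF M(1,2)]
        mhoms_id[OF crepD(1)[OF X]] matrix_of_comp[OF f g(2)] matrix_of_id[OF X], THEN iffD2] M(3)
      homotopic_maps_chain_iff[OF Y Y chain_maps_comp[OF g(1) f(1)] chain_maps_id[OF Y] mhoms_mult[OF M(2,1)]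
        mhoms_id[OF crepD(1)[OF Y]] matrix_of_comp[OF g f(2)] matrix_of_id[OF Y], THEN iffD2] M(4))
qed

lemma homotopy_zero_iff:
  assumes X: "crep X E u v" and C: "is_complex X"
  shows "homotopy_zero X \<longleftrightarrow> mzero E"
proof -
  have M: "right_module (obj X n)" for n using C unfolding is_complex_def by blast
  have z: "\<zero>\<^bsub>obj X n\<^esub> \<in> carrier (obj X n)" for n
  proof -
    interpret right_module "obj X n" by (rule M)
    show ?thesis by simp
  qed
  have "matrix_of X u u (%n x. \<zero>\<^bsub>obj X n\<^esub>) 0" unfolding matrix_of_def
    using module_homs_zero[OF crepD(3)[OF X] M right_module_col] by simp
  hence "homotopy_zero X \<longleftrightarrow> heq E E (ob E) 0" unfolding homotopy_zero_def
    using z cxD(1)[OF crepD(1)[OF X]] by (intro homotopic_maps_iff[OF X X]) (auto simp: matrix_of_id[OF X] intro: hom_id)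
  thus ?thesis unfolding mzero_def heq_zero .
qed

section \<open>Matrix models of shifts, sums, cones and powers\<close>

lemma module_homs_pair: "f \<in> module_homs L M ==> g \<in> module_homs L N ==> (%x. (f x, g x)) \<in> module_homs L (module_sum M N)"
  by (rule module_homsI) (auto simp: module_homsD)

lemma module_homs_fst: "fst \<in> module_homs (module_sum M N) M"
  and module_homs_snd: "snd \<in> module_homs (module_sum M N) N"
  by (auto intro!: module_homsI)

lemma module_homs_plus:
  assumes f: "f \<in> module_homs L M" and g: "g \<in> module_homs L M" and M: "right_module M"
  shows "(%x. f x \<oplus>\<^bsub>M\<^esub> g x) \<in> module_homs L M"
proof -
  interpret right_module M by fact
  show ?thesis
  proof (rule module_homsI)
    fix x y assume xy: "x \<in> carrier L" "y \<in> carrier L"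
    have c: "f x \<in> carrier M" "f y \<in> carrier M" "g x \<in> carrier M" "g y \<in> carrier M"
      using xy module_homsD(1)[OF f] module_homsD(1)[OF g] by auto
    show "f (x \<oplus>\<^bsub>L\<^esub> y) \<oplus>\<^bsub>M\<^esub> g (x \<oplus>\<^bsub>L\<^esub> y) = f x \<oplus>\<^bsub>M\<^esub> g x \<oplus>\<^bsub>M\<^esub> (f y \<oplus>\<^bsub>M\<^esub> g y)"
      using c by (simp add: module_homsD(2)[OF f xy] module_homsD(2)[OF g xy] a_ac)
  qed (use module_homsD[OF f] module_homsD[OF g] act_add in auto)
qed

lemma smult_a_inv:
  assumes "right_module M" "x \<in> carrier M"
  shows "a \<odot>\<^bsub>M\<^esub> (\<ominus>\<^bsub>M\<^esub> x) = \<ominus>\<^bsub>M\<^esub> (a \<odot>\<^bsub>M\<^esub> x)"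
proof -
  interpret right_module M by fact
  have "a \<odot>\<^bsub>M\<^esub> (\<ominus>\<^bsub>M\<^esub> x) \<oplus>\<^bsub>M\<^esub> a \<odot>\<^bsub>M\<^esub> x = a \<odot>\<^bsub>M\<^esub> \<zero>\<^bsub>M\<^esub>"
    using act_add[of "\<ominus>\<^bsub>M\<^esub> x" x a] assms(2) by (simp add: l_neg)
  thus ?thesis using assms(2) act_closed by (intro minus_equality[symmetric]) (simp_all add: smult_zero[OF assms(1)])
qed

lemma module_homs_neg:
  assumes f: "f \<in> module_homs L M" and M: "right_module M"
  shows "(%x. \<ominus>\<^bsub>M\<^esub> f x) \<in> module_homs L M"
proof -
  interpret right_module M by fact
  show ?thesis
    by (rule module_homsI) (simp_all add: module_homsD[OF f] smult_a_inv[OF M] minus_add)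
qed

lemma crep_transfer:
  assumes r: "crep X E u v" and d: "!!n. diff X' n \<in> module_homs (obj X' n) (obj X' (n + 1))"
    and p: "!!n. p n \<in> module_homs (obj X' n) (obj X n)" and q: "!!n. q n \<in> module_homs (obj X n) (obj X' n)"
    and qp: "!!n x. x \<in> carrier (obj X' n) ==> q n (p n x) = x" and pq: "!!n y. y \<in> carrier (obj X n) ==> p n (q n y) = y"
    and pd: "!!n x. x \<in> carrier (obj X' n) ==> p (n + 1) (diff X' n x) = diff X n (p n x)"
  shows "crep X' E (%n x. u n (p n x)) (%n y. q n (v n y))"
  unfolding crep_def
  using crepD[OF r] d module_homs_comp[OF p crepD(3)[OF r]] module_homs_comp[OF crepD(4)[OF r] q] qp pq pd
    module_homsD(1)[OF p] module_homsD(1)[OF crepD(4)[OF r]] by simp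

lemma crep_shift:
  assumes r: "crep X E u v" and M: "!!n. right_module (obj X n)"
  shows "crep (shift m X) (mshift m E) (%n. u (n + m)) (%n. v (n + m))"
proof -
  have s: "obj (shift m X) n = obj X (n + m)"
    "diff (shift m X) n = (%x. if even m then diff X (n + m) x else \<ominus>\<^bsub>obj X (n + m + 1)\<^esub> diff X (n + m) x)" for n
    unfolding shift_def by simp_all
  have i: "n + 1 + m = n + m + 1" for n by simp
  have d: "diff (shift m X) n \<in> module_homs (obj (shift m X) n) (obj (shift m X) (n + 1))" for n
    unfolding s i using crepD(2)[OF r, of "n + m"] module_homs_neg[OF crepD(2)[OF r, of "n + m"] M] by (cases "even m") simp_all
  have e: "u (n + m + 1) (diff (shift m X) n x) = act (df (mshift m E) n) (u (n + m) x)"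
    if x: "x \<in> carrier (obj X (n + m))" for n x
  proof -
    have dx: "diff X (n + m) x \<in> carrier (obj X (n + m + 1))" by (rule module_homsD(1)[OF crepD(2)[OF r] x])
    show ?thesis unfolding s
      using crepD(7)[OF r x] module_homs_a_inv[OF crepD(3)[OF r] M right_module_col dx]
        col_a_inv[OF module_homsD(1)[OF crepD(3)[OF r] dx]] by (simp add: act_uminus)
  qed
  show ?thesis unfolding crep_def
    using cx_mshift[OF crepD(1)[OF r]] d crepD(3-6)[OF r] e by (simp add: s i)
qed

context fmat_category
begin

lemma act_biprod:
  assumes "e * e = e" "f * f = f"
  shows "act (p1 e f) (act (i1 e f) w) = act e w" "act (p2 e f) (act (i2 e f) w) = act f w"
    "act (p1 e f) (act (i2 e f) w) = 0" "act (p2 e f) (act (i1 e f) w) = 0"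
    "act (i1 e f) (act (p1 e f) w) + act (i2 e f) (act (p2 e f) w) = act (bs e f) w"
  using biprodD[OF assms] by (simp_all add: act_times[symmetric] act_add_left[symmetric])

lemma module_sum_rep:
  assumes e: "e * e = e" and f: "f * f = f"
    and u: "u \<in> module_homs M (col e)" and v: "v \<in> module_homs (col e) M"
    and u': "u' \<in> module_homs N (col f)" and v': "v' \<in> module_homs (col f) N"
  defines "U \<equiv> %z. act (i1 e f) (u (fst z)) + act (i2 e f) (u' (snd z))"
    and "V \<equiv> %y. (v (act (p1 e f) y), v' (act (p2 e f) y))"
  shows "U \<in> module_homs (module_sum M N) (col (bs e f))" "V \<in> module_homs (col (bs e f)) (module_sum M N)"
    "(!!x. x \<in> carrier M ==> v (u x) = x) ==> (!!x. x \<in> carrier N ==> v' (u' x) = x) ==>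
      z \<in> carrier (module_sum M N) ==> V (U z) = z"
    "(!!y. y \<in> carrier (col e) ==> u (v y) = y) ==> (!!y. y \<in> carrier (col f) ==> u' (v' y) = y) ==>
      y \<in> carrier (col (bs e f)) ==> U (V y) = y"
proof -
  note b = biprodD[OF e f] and ab = act_biprod[OF e f]
  have "(%z. act (i1 e f) (u (fst z)) \<oplus>\<^bsub>col (bs e f)\<^esub> act (i2 e f) (u' (snd z))) \<in> module_homs (module_sum M N) (col (bs e f))"
    by (intro module_homs_plus right_module_col module_homs_comp[OF module_homs_comp[OF module_homs_fst u] act_module_homs[OF b(2)]]
      module_homs_comp[OF module_homs_comp[OF module_homs_snd u'] act_module_homs[OF b(3)]])
  thus "U \<in> module_homs (module_sum M N) (col (bs e f))" unfolding U_def by simp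
  show "V \<in> module_homs (col (bs e f)) (module_sum M N)" unfolding V_def
    by (intro module_homs_pair module_homs_comp[OF act_module_homs[OF b(4)] v] module_homs_comp[OF act_module_homs[OF b(5)] v'])
  show "V (U z) = z" if "!!x. x \<in> carrier M ==> v (u x) = x" "!!x. x \<in> carrier N ==> v' (u' x) = x" "z \<in> carrier (module_sum M N)"
  proof -
    obtain x y where z: "z = (x, y)" "x \<in> carrier M" "y \<in> carrier N" using \<open>z \<in> _\<close> by auto
    have "act e (u x) = u x" "act f (u' y) = u' y" using module_homsD(1)[OF u z(2)] module_homsD(1)[OF u' z(3)] by simp_all
    thus ?thesis unfolding U_def V_def using that z by (simp add: act_plus ab)
  qed
  show "U (V y) = y" if "!!y. y \<in> carrier (col e) ==> u (v y) = y" "!!y. y \<in> carrier (col f) ==> u' (v' y) = y"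
    "y \<in> carrier (col (bs e f))"
  proof -
    have "u (v (act (p1 e f) y)) = act (p1 e f) y" "u' (v' (act (p2 e f) y)) = act (p2 e f) y"
      using that(3) by (intro that module_homsD(1)[OF act_module_homs[OF b(4)]] module_homsD(1)[OF act_module_homs[OF b(5)]]; assumption)+
    thus ?thesis unfolding U_def V_def using that(3) ab(5)[of y] by simp
  qed
qed

lemma crep_sum:
  assumes X: "crep X E u v" and Y: "crep Y F u' v'"
  shows "\<exists>u v. crep (cpx_sum X Y) (bsum E F) u v"
proof -
  note e = cxD(1)[OF crepD(1)[OF X]] and f = cxD(1)[OF crepD(1)[OF Y]]
  define U where "U n z = act (i1 (ob E n) (ob F n)) (u n (fst z)) + act (i2 (ob E n) (ob F n)) (u' n (snd z))" for n z
  define V where "V n y = (v n (act (p1 (ob E n) (ob F n)) y), v' n (act (p2 (ob E n) (ob F n)) y))" for n y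
  have r: "U n \<in> module_homs (module_sum (obj X n) (obj Y n)) (col (bs (ob E n) (ob F n)))"
      "V n \<in> module_homs (col (bs (ob E n) (ob F n))) (module_sum (obj X n) (obj Y n))"
      "z \<in> carrier (module_sum (obj X n) (obj Y n)) ==> V n (U n z) = z"
      "y \<in> carrier (col (bs (ob E n) (ob F n))) ==> U n (V n y) = y" for n y z
    using module_sum_rep[OF e f crepD(3,4)[OF X] crepD(3,4)[OF Y]] crepD(5,6)[OF X] crepD(5,6)[OF Y]
    unfolding U_def V_def by blast+
  have s: "obj (cpx_sum X Y) n = module_sum (obj X n) (obj Y n)" "diff (cpx_sum X Y) n = (%x. (diff X n (fst x), diff Y n (snd x)))"
    "ob (bsum E F) n = bs (ob E n) (ob F n)" for n unfolding cpx_sum_def bsum_def by simp_all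
  have "diff (cpx_sum X Y) n \<in> module_homs (obj (cpx_sum X Y) n) (obj (cpx_sum X Y) (n + 1))" for n unfolding s
    by (intro module_homs_pair module_homs_comp[OF module_homs_fst crepD(2)[OF X]] module_homs_comp[OF module_homs_snd crepD(2)[OF Y]])
  moreover have "U (n + 1) (diff (cpx_sum X Y) n z) = act (df (bsum E F) n) (U n z)" if zc: "z \<in> carrier (module_sum (obj X n) (obj Y n))" for n z
  proof -
    obtain x y where z: "z = (x, y)" "x \<in> carrier (obj X n)" "y \<in> carrier (obj Y n)" using zc by auto
    have c: "act (ob E n) (u n x) = u n x" "act (ob F n) (u' n y) = u' n y"
      using module_homsD(1)[OF crepD(3)[OF X] z(2)] module_homsD(1)[OF crepD(3)[OF Y] z(3)] by simp_all
    show ?thesis unfolding U_def z s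
      by (simp add: crepD(7)[OF X z(2)] crepD(7)[OF Y z(3)] bsum_def act_add_left act_plus act_times act_biprod[OF e f] c)
  qed
  ultimately have "crep (cpx_sum X Y) (bsum E F) U V" unfolding crep_def
    using bsum_cx(1)[OF crepD(1)[OF X] crepD(1)[OF Y]] r by (simp only: s) blast
  thus ?thesis by blast
qed

lemma crep_cone:
  assumes X: "crep X E u v" and Y: "crep Y F u' v'" and MX: "!!n. right_module (obj X n)" and MY: "!!n. right_module (obj Y n)"
    and f: "f \<in> chain_maps X Y" and M: "M \<in> mhoms E F" "matrix_of X u u' f M"
  shows "\<exists>u v. crep (mapping_cone X Y f) (mcone E F M) u v"
proof -
  note e = cxD(1)[OF crepD(1)[OF X]] and ef = cxD(1)[OF crepD(1)[OF Y]]
  define U where "U n z = act (i1 (ob E (n + 1)) (ob F n)) (u (n + 1) (fst z)) + act (i2 (ob E (n + 1)) (ob F n)) (u' n (snd z))" for n z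
  define V where "V n y = (v (n + 1) (act (p1 (ob E (n + 1)) (ob F n)) y), v' n (act (p2 (ob E (n + 1)) (ob F n)) y))" for n y
  have r: "U n \<in> module_homs (module_sum (obj X (n + 1)) (obj Y n)) (col (bs (ob E (n + 1)) (ob F n)))"
      "V n \<in> module_homs (col (bs (ob E (n + 1)) (ob F n))) (module_sum (obj X (n + 1)) (obj Y n))"
      "z \<in> carrier (module_sum (obj X (n + 1)) (obj Y n)) ==> V n (U n z) = z"
      "y \<in> carrier (col (bs (ob E (n + 1)) (ob F n))) ==> U n (V n y) = y" for n y z
    using module_sum_rep[OF e ef crepD(3,4)[OF X] crepD(3,4)[OF Y]] crepD(5,6)[OF X] crepD(5,6)[OF Y]
    unfolding U_def V_def by blast+
  have i: "n + 1 + 1 = n + 2" for n :: int by simp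
  have s: "obj (mapping_cone X Y f) n = module_sum (obj X (n + 1)) (obj Y n)"
    "diff (mapping_cone X Y f) n = (%z. (\<ominus>\<^bsub>obj X (n + 2)\<^esub> diff X (n + 1) (fst z), f (n + 1) (fst z) \<oplus>\<^bsub>obj Y (n + 1)\<^esub> diff Y n (snd z)))" for n
    unfolding mapping_cone_def by simp_all
  have dX: "diff X (n + 1) \<in> module_homs (obj X (n + 1)) (obj X (n + 2))" for n using crepD(2)[OF X, of "n + 1"] unfolding i .
  have "diff (mapping_cone X Y f) n \<in> module_homs (obj (mapping_cone X Y f) n) (obj (mapping_cone X Y f) (n + 1))" for n unfolding s i
    by (intro module_homs_pair module_homs_plus MX MY module_homs_neg module_homs_comp[OF module_homs_fst dX]
      module_homs_comp[OF module_homs_snd crepD(2)[OF Y]] module_homs_comp[OF module_homs_fst chain_mapsD(1)[OF f]])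
  moreover have "U (n + 1) (diff (mapping_cone X Y f) n z) = act (df (mcone E F M) n) (U n z)"
    if zc: "z \<in> carrier (module_sum (obj X (n + 1)) (obj Y n))" for n z
  proof -
    obtain x y where z: "z = (x, y)" "x \<in> carrier (obj X (n + 1))" "y \<in> carrier (obj Y n)" using zc by auto
    have dx: "diff X (n + 1) x \<in> carrier (obj X (n + 2))" by (rule module_homsD(1)[OF dX z(2)])
    have c: "act (ob E (n + 1)) (u (n + 1) x) = u (n + 1) x" "act (ob F n) (u' n y) = u' n y"
      using module_homsD(1)[OF crepD(3)[OF X] z(2)] module_homsD(1)[OF crepD(3)[OF Y] z(3)] by simp_all
    have 1: "u (n + 2) (\<ominus>\<^bsub>obj X (n + 2)\<^esub> diff X (n + 1) x) = - act (df E (n + 1)) (u (n + 1) x)"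
      using module_homs_a_inv[OF crepD(3)[OF X] MX right_module_col dx] col_a_inv[OF module_homsD(1)[OF crepD(3)[OF X] dx]]
        crepD(7)[OF X z(2)] unfolding i by simp
    have 2: "u' (n + 1) (f (n + 1) x \<oplus>\<^bsub>obj Y (n + 1)\<^esub> diff Y n y) = act (M (n + 1)) (u (n + 1) x) + act (df F n) (u' n y)"
      using module_homsD(2)[OF crepD(3)[OF Y] module_homsD(1)[OF chain_mapsD(1)[OF f] z(2)] module_homsD(1)[OF crepD(2)[OF Y] z(3)]]
        M(2) z(2) crepD(7)[OF Y z(3)] unfolding matrix_of_def by simp
    show ?thesis unfolding U_def z s i fst_conv snd_conv 1 2 mcone_sel
      by (simp only: act_add_left act_diff act_plus act_times act_biprod[OF e ef] c act_zero act_uminus add_0_right add_0_left) (simp only: uminus_add_conv_diff diff_zero diff_add_eq)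
  qed
  ultimately have "crep (mapping_cone X Y f) (mcone E F M) U V" unfolding crep_def
    using cx_mcone[OF crepD(1)[OF X] crepD(1)[OF Y] M(1)] r unfolding s mcone_sel by blast
  thus ?thesis by blast
qed

text \<open>Splitting off the last coordinate identifies a power with a sum of a smaller power and
  \<open>X\<close>. The power with exponent 0 is carried by the single function that is undefined
  everywhere, and it is represented by the zero complex.\<close>

lemma crep_power:
  assumes X: "crep X E u v"
  shows "\<exists>u v. crep (cpx_power r X) (pow_cx r E) u v"
proof (induction r)
  case 0
  have s: "carrier (obj (cpx_power 0 X) n) = {%_. undefined}" "diff (cpx_power 0 X) n x = (%_. undefined)"
    "a \<oplus>\<^bsub>obj (cpx_power 0 X) n\<^esub> b = (%_. undefined)" "c \<odot>\<^bsub>obj (cpx_power 0 X) n\<^esub> b = (%_. undefined)" for n a b c x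
    unfolding cpx_power_def by (simp_all add: restrict_def)
  have z: "ob zero_cx n = 0" "df zero_cx n = 0" for n unfolding zero_cx_def by simp_all
  have "crep (cpx_power 0 X) zero_cx (%_ _. 0) (%_ _ _. undefined)" unfolding crep_def
    by (auto intro!: module_homsI simp: s z cx_zero fun_eq_iff)
  thus ?case by auto
next
  case (Suc r)
  then obtain U V where "crep (cpx_power r X) (pow_cx r E) U V" by blast
  then obtain U' V' where r: "crep (cpx_sum (cpx_power r X) X) (bsum (pow_cx r E) E) U' V'" using crep_sum[OF _ X] by blast
  let ?P = "cpx_power (Suc r) X" and ?S = "cpx_sum (cpx_power r X) X"
  have s: "obj ?P n = module_power (Suc r) (obj X n)" "obj ?S n = module_sum (module_power r (obj X n)) (obj X n)"
    "diff ?P n x = (\<lambda>i\<in>{..<Suc r}. diff X n (x i))" "diff ?S n z = ((\<lambda>i\<in>{..<r}. diff X n (fst z i)), diff X n (snd z))" for n x z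
    unfolding cpx_power_def cpx_sum_def by simp_all
  note dX = module_homsD[OF crepD(2)[OF X]]
  have "crep ?P (bsum (pow_cx r E) E) (%n x. U' n (restrict x {..<r}, x r)) (%n y. (%z. \<lambda>i\<in>{..<Suc r}. if i < r then fst z i else snd z) (V' n y))"
  proof (rule crep_transfer[OF r])
    show "diff ?P n \<in> module_homs (obj ?P n) (obj ?P (n + 1))" for n unfolding s
      by (rule module_homsI) (auto simp: s fun_eq_iff PiE_iff dX)
    show "(%x. (restrict x {..<r}, x r)) \<in> module_homs (obj ?P n) (obj ?S n)" for n unfolding s
      by (rule module_homsI) (auto simp: fun_eq_iff PiE_iff)
    show "(%z. \<lambda>i\<in>{..<Suc r}. if i < r then fst z i else snd z) \<in> module_homs (obj ?S n) (obj ?P n)" for n unfolding s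
    proof (rule module_homsI)
      fix z assume "z \<in> carrier (module_sum (module_power r (obj X n)) (obj X n))"
      thus "(\<lambda>i\<in>{..<Suc r}. if i < r then fst z i else snd z) \<in> carrier (module_power (Suc r) (obj X n))"
        unfolding module_sum_sel module_power_sel by (intro restrict_PiE_iff[THEN iffD2] ballI) (auto simp: mem_Times_iff PiE_iff)
    qed (simp_all only: module_sum_sel module_power_sel fst_conv snd_conv, (rule restrict_ext, simp)+)
    show "(\<lambda>i\<in>{..<Suc r}. if i < r then fst (restrict x {..<r}, x r) i else snd (restrict x {..<r}, x r)) = x"
      if "x \<in> carrier (obj ?P n)" for n x
      using that unfolding s by (auto simp: fun_eq_iff PiE_iff extensional_def less_Suc_eq)
    show "(restrict (\<lambda>i\<in>{..<Suc r}. if i < r then fst z i else snd z) {..<r}, (\<lambda>i\<in>{..<Suc r}. if i < r then fst z i else snd z) r) = z"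
      if "z \<in> carrier (obj ?S n)" for n z
      using that unfolding s by (cases z) (auto simp: fun_eq_iff PiE_iff extensional_def)
  qed (auto simp: s fun_eq_iff)
  thus ?case by (simp only: pow_cx.simps) blast
qed

end

section \<open>Transfer of summands and of generation to complexes of idempotents\<close>

context fmat_category
begin

lemma meq_bsum_cong:
  assumes "cx X" "cx Y" "cx X'" "cx Y'" "meq X X'" "meq Y Y'"
  shows "meq (bsum X Y) (bsum X' Y')"
  using mbiprod_meq[OF assms(3,4)] mbiprod_meq_left[OF mbiprod_sym[OF mbiprod_meq_left[OF mbiprod_bsum[OF assms(1,2)] assms(5)]] assms(6)]
    mbiprod_sym by blast

lemma meq_pow_cong:
  assumes "cx E" "cx F" "meq E F"
  shows "meq (pow_cx r E) (pow_cx r F)"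
  by (induction r) (use assms in \<open>auto intro: meq_refl cx_zero meq_bsum_cong cx_pow\<close>)

lemma madd_cong:
  assumes "cx E" "cx F" "meq E F"
  shows "madd E X \<longleftrightarrow> madd F X"
  unfolding madd_def using meq_pow_cong[OF assms] meq_mretract meq_sym mretract_trans by meson

lemma add_classes_cong:
  assumes "cx E" "cx F" "meq E F"
  shows "add_classes E = add_classes F" "mgen E \<longleftrightarrow> mgen F"
  unfolding add_classes_def mgen_def using madd_cong[OF assms] by auto

text \<open>A complement in the homotopy category is found among complexes of idempotents and
  carried back by \<open>phi\<close>, which lands in the type over which \<open>in_add_Kb\<close>
  quantifies.\<close>

lemma in_add_Kb_iff:
  assumes P: "crep P E u v" and X: "crep X F u' v'" and KX: "Kb_proj X"
  shows "in_add_Kb P X \<longleftrightarrow> madd E F"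
proof
  note cE = crepD(1)[OF P] and cF = crepD(1)[OF X]
  {
    assume "in_add_Kb P X"
    then obtain r and Y :: "('a, 'a univ) cpx" where Y: "Kb_proj Y" "homotopy_iso (cpx_sum X Y) (cpx_power r P)"
      unfolding in_add_Kb_def by blast
    obtain G a b where G: "crep Y G a b" using Kb_proj_crep[OF Y(1)] by blast
    obtain a b where S: "crep (cpx_sum X Y) (bsum F G) a b" using crep_sum[OF X G] by blast
    obtain a b where Q: "crep (cpx_power r P) (pow_cx r E) a b" using crep_power[OF P] by blast
    have "meq (bsum F G) (pow_cx r E)" using Y(2) homotopy_iso_iff[OF S Q] by blast
    moreover have "mretract F (bsum F G)" using mbiprod_retracts[OF mbiprod_bsum[OF cF crepD(1)[OF G]]] by blast
    ultimately show "madd E F" unfolding madd_def using cF meq_mretract mretract_trans by blast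
  }
  assume "madd E F"
  then obtain r where r: "mretract F (pow_cx r E)" unfolding madd_def by blast
  obtain G where G: "cx G" "meq (pow_cx r E) (bsum F G)" using retract_complement[OF cF cx_pow[OF cE] r] by metis
  obtain a b where S: "crep (cpx_sum X (phi G)) (bsum F G) a b" using crep_sum[OF X crep_phi[OF G(1)]] by blast
  obtain a b where Q: "crep (cpx_power r P) (pow_cx r E) a b" using crep_power[OF P] by blast
  have "homotopy_iso (cpx_sum X (phi G)) (cpx_power r P)" using homotopy_iso_iff[OF S Q] meq_sym[OF G(2)] by blast
  thus "in_add_Kb P X" unfolding in_add_Kb_def using KX Kb_proj_phi[OF G(1)] by blast
qed

lemma indecomposable_Kb_iff:
  assumes X: "crep X F u' v'" and KX: "Kb_proj X"
  shows "indecomposable_Kb X \<longleftrightarrow> mindec F"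
proof
  have c: "is_complex Y" if "Kb_proj Y" for Y :: "('a, 'n) cpx" using that unfolding Kb_proj_def by blast
  have c': "is_complex Y" if "Kb_proj Y" for Y :: "('a, 'a univ) cpx" using that unfolding Kb_proj_def by blast
  have hz: "homotopy_zero X \<longleftrightarrow> mzero F" using homotopy_zero_iff[OF X] KX unfolding Kb_proj_def by blast
  {
    assume i: "indecomposable_Kb X"
    show "mindec F" unfolding mindec_def
    proof (intro conjI allI impI)
      show "cx F" by (rule crepD(1)[OF X])
      show "\<not> mzero F" using i hz unfolding indecomposable_Kb_def by blast
      fix G H assume GH: "cx G" "cx H" "meq F (bsum G H)"
      obtain a b where S: "crep (cpx_sum (phi G) (phi H)) (bsum G H) a b" using crep_sum[OF crep_phi[OF GH(1)] crep_phi[OF GH(2)]] by blast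
      have "homotopy_iso X (cpx_sum (phi G) (phi H))" using homotopy_iso_iff[OF X S] GH(3) by blast
      hence "homotopy_zero (phi G) \<or> homotopy_zero (phi H)"
        using i Kb_proj_phi[OF GH(1)] Kb_proj_phi[OF GH(2)] unfolding indecomposable_Kb_def by blast
      thus "mzero G \<or> mzero H"
        using homotopy_zero_iff[OF crep_phi[OF GH(1)] c'[OF Kb_proj_phi[OF GH(1)]]]
          homotopy_zero_iff[OF crep_phi[OF GH(2)] c'[OF Kb_proj_phi[OF GH(2)]]] by blast
    qed
  }
  assume i: "mindec F"
  show "indecomposable_Kb X" unfolding indecomposable_Kb_def
  proof (intro conjI allI impI)
    show "Kb_proj X" by (rule KX)
    show "\<not> homotopy_zero X" using i hz unfolding mindec_def by blast
    fix Y Z :: "('a, 'a univ) cpx"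
    assume Y: "Kb_proj Y" and Z: "Kb_proj Z" and h: "homotopy_iso X (cpx_sum Y Z)"
    obtain G a b where G: "crep Y G a b" using Kb_proj_crep[OF Y] by blast
    obtain H a' b' where H: "crep Z H a' b'" using Kb_proj_crep[OF Z] by blast
    obtain a'' b'' where S: "crep (cpx_sum Y Z) (bsum G H) a'' b''" using crep_sum[OF G H] by blast
    have "meq F (bsum G H)" using homotopy_iso_iff[OF X S] h by blast
    hence "mzero G \<or> mzero H" using i crepD(1)[OF G] crepD(1)[OF H] unfolding mindec_def by blast
    thus "homotopy_zero Y \<or> homotopy_zero Z"
      using homotopy_zero_iff[OF G c'[OF Y]] homotopy_zero_iff[OF H c'[OF Z]] by blast
  qed
qed

lemma crep_meq: "crep X E u v ==> crep X F u' v' ==> meq E F"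
proof -
  assume X: "crep X E u v" and Y: "crep X F u' v'"
  have "homotopy_iso X X" using homotopy_iso_iff[OF X X] meq_refl[OF crepD(1)[OF X]] by blast
  thus ?thesis using homotopy_iso_iff[OF X Y] by blast
qed

lemma Kb_proj_right_module: "Kb_proj X ==> right_module (obj X n)"
  unfolding Kb_proj_def is_complex_def by blast

lemma Kb_proj_shift:
  assumes X: "Kb_proj X" shows "Kb_proj (shift m X)"
proof -
  obtain F u v where F: "crep X F u v" using Kb_proj_crep[OF X] by blast
  have "fg_projective (obj (shift m X) n)" for n using X unfolding Kb_proj_def shift_def by simp
  thus ?thesis using Kb_proj_from_crep[OF crep_shift[OF F Kb_proj_right_module[OF X]]] by blast
qed

text \<open>Membership asks for some model in \<open>T\<close>. Models of the same complex are
  isomorphic and \<open>T\<close> is closed under isomorphism, so the choice of the model has no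
  influence.\<close>

lemma mtri_triangulated:
  fixes T :: "'a fmat mcx set"
  assumes T: "mtri T" "T ~= {}"
  shows "triangulated_subcategory {X :: ('a, 'a univ) cpx. Kb_proj X \<and> (\<exists>F u v. crep X F u v \<and> F \<in> T)}" (is "triangulated_subcategory ?T")
  unfolding triangulated_subcategory_def
proof (intro conjI ballI allI impI)
  have mt: "cx F" "meq F G ==> cx G ==> G \<in> T" "mshift m F \<in> T" if "F \<in> T" for F G m
    using T(1) that unfolding mtri_def by blast+
  have mc: "mcone F G M \<in> T" if "F \<in> T" "G \<in> T" "M \<in> mhoms F G" for F G M
    using T(1) that unfolding mtri_def by blast
  obtain F where F: "F \<in> T" using T(2) by blast
  have "phi F \<in> ?T" using F Kb_proj_phi[OF mt(1)[OF F]] crep_phi[OF mt(1)[OF F]] by blast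
  thus "?T ~= {}" by blast
  show "Kb_proj X" if "X \<in> ?T" for X using that by blast
  show "Y \<in> ?T" if "X \<in> ?T" "Kb_proj Y" "homotopy_iso X Y" for X Y
  proof -
    obtain F u v where F: "crep X F u v" "F \<in> T" using \<open>X \<in> ?T\<close> by blast
    obtain G u' v' where G: "crep Y G u' v'" using Kb_proj_crep[OF \<open>Kb_proj Y\<close>] by blast
    have "meq F G" using homotopy_iso_iff[OF F(1) G] \<open>homotopy_iso X Y\<close> by blast
    thus ?thesis using mt(2)[OF F(2) _ crepD(1)[OF G]] G \<open>Kb_proj Y\<close> by blast
  qed
  show "shift m X \<in> ?T" if "X \<in> ?T" for X m
  proof -
    obtain F u v where F: "crep X F u v" "F \<in> T" and X: "Kb_proj X" using \<open>X \<in> ?T\<close> by blast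
    show ?thesis using crep_shift[OF F(1) Kb_proj_right_module[OF X]] mt(3)[OF F(2)] Kb_proj_shift[OF X] by blast
  qed
  show "Z \<in> ?T" if "X \<in> ?T" "Y \<in> ?T" and f: "f \<in> chain_maps X Y" and Z: "Kb_proj Z" "homotopy_iso Z (mapping_cone X Y f)" for X Y f Z
  proof -
    obtain F u v where F: "crep X F u v" "F \<in> T" and X: "Kb_proj X" using \<open>X \<in> ?T\<close> by blast
    obtain G u' v' where G: "crep Y G u' v'" "G \<in> T" and Y: "Kb_proj Y" using \<open>Y \<in> ?T\<close> by blast
    obtain M where M: "M \<in> mhoms F G" "matrix_of X u u' f M" using chain_map_matrix[OF F(1) G(1) f] by blast
    obtain a b where C: "crep (mapping_cone X Y f) (mcone F G M) a b"
      using crep_cone[OF F(1) G(1) Kb_proj_right_module[OF X] Kb_proj_right_module[OF Y] f M] by blast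
    obtain H a' b' where H: "crep Z H a' b'" using Kb_proj_crep[OF Z(1)] by blast
    have "meq (mcone F G M) H" using homotopy_iso_iff[OF H C] Z(2) meq_sym by blast
    thus ?thesis using mt(2)[OF mc[OF F(2) G(2) M(1)] _ crepD(1)[OF H]] H Z(1) by blast
  qed
qed

lemma triangulated_mtri:
  fixes T :: "('a, 'a univ) cpx set"
  assumes T: "triangulated_subcategory T"
  shows "mtri {F. cx F \<and> phi F \<in> T}"
proof -
  have t: "Kb_proj X" "Kb_proj Y ==> homotopy_iso X Y ==> Y \<in> T" "shift m X \<in> T" if "X \<in> T" for X Y m
    using T that unfolding triangulated_subcategory_def by blast+
  have tc: "Z \<in> T" if "X \<in> T" "Y \<in> T" "f \<in> chain_maps X Y" "Kb_proj Z" "homotopy_iso Z (mapping_cone X Y f)" for X Y f Z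
    using T that unfolding triangulated_subcategory_def by blast
  show ?thesis unfolding mtri_def
  proof (intro conjI ballI allI impI)
    fix F assume "F \<in> {F. cx F \<and> phi F \<in> T}"
    hence F: "cx F" "phi F \<in> T" by auto
    show "cx F" by (rule F)
    show "G \<in> {F. cx F \<and> phi F \<in> T}" if "cx G" "meq F G" for G
      using t(2)[OF F(2) Kb_proj_phi[OF that(1)]] homotopy_iso_iff[OF crep_phi[OF F(1)] crep_phi[OF that(1)]] that by blast
    show "mshift m F \<in> {F. cx F \<and> phi F \<in> T}" for m
    proof -
      have "homotopy_iso (shift m (phi F)) (phi (mshift m F))"
        using homotopy_iso_iff[OF crep_shift[OF crep_phi[OF F(1)] Kb_proj_right_module[OF Kb_proj_phi[OF F(1)]]] crep_phi[OF cx_mshift[OF F(1)]]]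
          meq_refl[OF cx_mshift[OF F(1)]] by blast
      thus ?thesis using t(2)[OF t(3)[OF F(2)] Kb_proj_phi[OF cx_mshift[OF F(1)]]] cx_mshift[OF F(1)] by blast
    qed
    fix G M assume "G \<in> {F. cx F \<and> phi F \<in> T}" and M: "M \<in> mhoms F G"
    hence G: "cx G" "phi G \<in> T" by auto
    note f = matrix_chain_map[OF crep_phi[OF F(1)] crep_phi[OF G(1)] M]
    note c = cx_mcone[OF F(1) G(1) M]
    obtain a b where C: "crep (mapping_cone (phi F) (phi G) (%n x. act (M n) x)) (mcone F G M) a b"
      using crep_cone[OF crep_phi[OF F(1)] crep_phi[OF G(1)] Kb_proj_right_module[OF t(1)[OF F(2)]] Kb_proj_right_module[OF t(1)[OF G(2)]] f(1) M f(2)] by blast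
    have "homotopy_iso (phi (mcone F G M)) (mapping_cone (phi F) (phi G) (%n x. act (M n) x))"
      using homotopy_iso_iff[OF crep_phi[OF c] C] meq_refl[OF c] by blast
    thus "mcone F G M \<in> {F. cx F \<and> phi F \<in> T}" using tc[OF F(2) G(2) f(1) Kb_proj_phi[OF c]] c by blast
  qed
qed

text \<open>Triangulated subcategories are moved in both directions, by taking models and by pulling
  back along \<open>phi\<close>, and the additive closures of \<open>P\<close> and \<open>E\<close>
  correspond.\<close>

lemma generates_Kb_iff:
  assumes P: "crep P E u v"
  shows "generates_Kb {X. in_add_Kb P X} \<longleftrightarrow> mgen E"
proof
  note cE = crepD(1)[OF P]
  assume g: "generates_Kb {X. in_add_Kb P X}"
  show "mgen E" unfolding mgen_def
  proof (intro allI impI subsetI)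
    fix T and G :: "'a fmat mcx" assume T: "mtri T" "{X. madd E X} \<subseteq> T" and "G \<in> {X. cx X}"
    hence G: "cx G" by blast
    let ?T = "{X :: ('a, 'a univ) cpx. Kb_proj X \<and> (\<exists>F u v. crep X F u v \<and> F \<in> T)}"
    have "T ~= {}" using T(2) madd_pow[OF cE] by blast
    hence "triangulated_subcategory ?T" by (rule mtri_triangulated[OF T(1)])
    moreover have "X \<in> ?T" if X: "in_add_Kb P X" for X
    proof -
      have KX: "Kb_proj X" using X unfolding in_add_Kb_def by blast
      obtain F a b where F: "crep X F a b" using Kb_proj_crep[OF KX] by blast
      show ?thesis using in_add_Kb_iff[OF P F KX] X T(2) F KX by blast
    qed
    ultimately have "phi G \<in> ?T" using g Kb_proj_phi[OF G] unfolding generates_Kb_def by blast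
    then obtain F a b where F: "crep (phi G) F a b" "F \<in> T" by blast
    show "G \<in> T" using T(1) F(2) G crep_meq[OF F(1) crep_phi[OF G]] unfolding mtri_def by blast
  qed
next
  assume g: "mgen E"
  show "generates_Kb {X. in_add_Kb P X}" unfolding generates_Kb_def
  proof (intro allI impI subsetI)
    fix T :: "('a, 'a univ) cpx set" and X :: "('a, 'a univ) cpx"
    assume T: "triangulated_subcategory T" "{X. in_add_Kb P X} \<subseteq> T" and "X \<in> {X. Kb_proj X}"
    hence KX: "Kb_proj X" by blast
    obtain F a b where F: "crep X F a b" using Kb_proj_crep[OF KX] by blast
    have "phi G \<in> T" if "madd E G" for G :: "'a fmat mcx"
    proof -
      have c: "cx G" using that unfolding madd_def by blast
      show ?thesis using in_add_Kb_iff[OF P crep_phi[OF c] Kb_proj_phi[OF c]] that T(2) by blast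
    qed
    moreover have "cx G" if "madd E G" for G :: "'a fmat mcx" using that unfolding madd_def by blast
    ultimately have "{X. madd E X} \<subseteq> {F. cx F \<and> phi F \<in> T}" by blast
    hence "phi F \<in> T" using g triangulated_mtri[OF T(1)] crepD(1)[OF F] unfolding mgen_def by blast
    moreover have "homotopy_iso (phi F) X" using homotopy_iso_iff[OF crep_phi[OF crepD(1)[OF F]] F] meq_refl[OF crepD(1)[OF F]] by blast
    ultimately show "X \<in> T" using T(1) KX unfolding triangulated_subcategory_def by blast
  qed
qed

text \<open>For indecomposable summands the class of a model is a complete invariant, by the
  independence theorem for the two-term complex \<open>F\<close>.\<close>

lemma num_indec_Kb_eq:
  fixes P :: "('a, 'm) cpx"
  assumes P: "crep P E u v" and F: "two_term c F" "ext_zero c F F" "meq E F"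
  shows "num_indec_Kb P = card (add_classes F)"
proof -
  let ?S = "{X :: ('a, 'a univ) cpx. in_add_Kb P X \<and> indecomposable_Kb X}"
  define rep where "rep X = (SOME G. \<exists>u v. crep X G u v)" for X :: "('a, 'a univ) cpx"
  have r: "\<exists>u v. crep X (rep X) u v" if "Kb_proj X" for X
    unfolding rep_def using someI_ex[OF Kb_proj_crep[OF that]] .
  note mF = madd_cong[OF crepD(1)[OF P] two_term_cx[OF F(1)] F(3)]
  have S: "madd F (rep X)" "mindec (rep X)" "Kb_proj X" if X: "X \<in> ?S" for X
  proof -
    show K: "Kb_proj X" using X unfolding in_add_Kb_def by blast
    obtain a b where a: "crep X (rep X) a b" using r[OF K] by blast
    show "madd F (rep X)" "mindec (rep X)" using X in_add_Kb_iff[OF P a K] indecomposable_Kb_iff[OF a K] mF by blast+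
  qed
  have "homotopy_iso X Y \<longleftrightarrow> chi (rep X) = chi (rep Y)" if XY: "X \<in> ?S" "Y \<in> ?S" for X Y
  proof -
    obtain a b a' b' where a: "crep X (rep X) a b" "crep Y (rep Y) a' b'" using r[OF S(3)[OF XY(1)]] r[OF S(3)[OF XY(2)]] by blast
    show ?thesis using homotopy_iso_iff[OF a] chi_meq[OF crepD(1)[OF a(1)] crepD(1)[OF a(2)]]
      add_classes_family(2)[OF F(1,2) S(2)[OF XY(1)] S(2)[OF XY(2)] S(1)[OF XY(1)] S(1)[OF XY(2)]] by blast
  qed
  hence "num_indec_Kb P = card ((%X. chi (rep X)) ` ?S)" unfolding num_indec_Kb_def by (rule num_iso_types_card)
  moreover have "(%X. chi (rep X)) ` ?S = add_classes F"
  proof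
    show "(%X. chi (rep X)) ` ?S \<subseteq> add_classes F" unfolding add_classes_def using S(1,2) by blast
    show "add_classes F \<subseteq> (%X. chi (rep X)) ` ?S"
    proof
      fix q assume "q \<in> add_classes F"
      then obtain G where G: "q = chi G" "mindec G" "madd F G" unfolding add_classes_def by blast
      have c: "cx G" by (rule mindecD(1)[OF G(2)])
      note p = crep_phi[OF c] and k = Kb_proj_phi[OF c]
      have s: "phi G \<in> ?S" using in_add_Kb_iff[OF P p k] indecomposable_Kb_iff[OF p k] G mF by blast
      obtain a b where a: "crep (phi G) (rep (phi G)) a b" using r[OF k] by blast
      have "q = chi (rep (phi G))" unfolding G(1) by (rule chi_meq[OF c crepD(1)[OF a] crep_meq[OF p a]])
      thus "q \<in> (%X. chi (rep X)) ` ?S" using s by blast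
    qed
  qed
  ultimately show ?thesis by simp
qed

end

section \<open>Cohomology and quasi-isomorphisms\<close>

lemma is_complexD:
  assumes "is_complex X"
  shows "right_module (obj X n)" "diff X n \<in> module_homs (obj X n) (obj X (n + 1))"
    "diff X (n - 1) \<in> module_homs (obj X (n - 1)) (obj X n)"
    "x \<in> carrier (obj X (n - 1)) ==> diff X n (diff X (n - 1) x) = \<zero>\<^bsub>obj X (n + 1)\<^esub>"
proof -
  show "right_module (obj X n)" and d: "diff X n \<in> module_homs (obj X n) (obj X (n + 1))" for n
    using assms unfolding is_complex_def by auto
  show "diff X (n - 1) \<in> module_homs (obj X (n - 1)) (obj X n)" using d[of "n - 1"] by simp
  have "\<forall>x\<in>carrier (obj X (n - 1)). diff X (n - 1 + 1) (diff X (n - 1) x) = \<zero>\<^bsub>obj X (n - 1 + 2)\<^esub>"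
    using assms unfolding is_complex_def by blast
  moreover have "n - 1 + 1 = n" "n - 1 + 2 = n + 1" by simp_all
  ultimately show "x \<in> carrier (obj X (n - 1)) ==> diff X n (diff X (n - 1) x) = \<zero>\<^bsub>obj X (n + 1)\<^esub>" by (simp only:)
qed

lemma subgroup_coboundaries:
  assumes X: "is_complex X"
  shows "subgroup (coboundaries X n) (add_monoid (obj X n))"
proof -
  interpret M: right_module "obj X n" by (rule is_complexD(1)[OF X])
  interpret N: right_module "obj X (n - 1)" by (rule is_complexD(1)[OF X])
  note d = is_complexD(3)[OF X, of n]
  have "coboundaries X n \<subseteq> carrier (add_monoid (obj X n))"
    unfolding coboundaries_def using module_homsD(1)[OF d] by auto
  moreover have "coboundaries X n ~= {}" unfolding coboundaries_def using N.zero_closed by blast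
  moreover have "inv\<^bsub>add_monoid (obj X n)\<^esub> x \<in> coboundaries X n" if "x \<in> coboundaries X n" for x
  proof -
    obtain y where y: "y \<in> carrier (obj X (n - 1))" "x = diff X (n - 1) y" using \<open>x \<in> _\<close> unfolding coboundaries_def by blast
    have "inv\<^bsub>add_monoid (obj X n)\<^esub> x = diff X (n - 1) (\<ominus>\<^bsub>obj X (n - 1)\<^esub> y)"
      using module_homs_a_inv[OF d is_complexD(1)[OF X] is_complexD(1)[OF X] y(1)] y(2) by (simp add: a_inv_def)
    thus ?thesis unfolding coboundaries_def using y(1) by blast
  qed
  moreover have "x \<otimes>\<^bsub>add_monoid (obj X n)\<^esub> x' \<in> coboundaries X n" if "x \<in> coboundaries X n" "x' \<in> coboundaries X n" for x x'
  proof -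
    obtain y y' where y: "y \<in> carrier (obj X (n - 1))" "x = diff X (n - 1) y" "y' \<in> carrier (obj X (n - 1))" "x' = diff X (n - 1) y'"
      using \<open>x \<in> _\<close> \<open>x' \<in> _\<close> unfolding coboundaries_def by blast
    show ?thesis unfolding coboundaries_def using y module_homsD(2)[OF d y(1,3)] by (intro image_eqI[of _ _ "y \<oplus>\<^bsub>obj X (n - 1)\<^esub> y'"]) auto
  qed
  ultimately show ?thesis by (rule group.subgroupI[OF M.a_group])
qed

lemma carrier_cohomology: "carrier (cohomology n X) = (%x. coboundaries X n +>\<^bsub>obj X n\<^esub> x) ` cocycles X n"
  and one_cohomology: "\<one>\<^bsub>cohomology n X\<^esub> = coboundaries X n"
  unfolding cohomology_def A_FactGroup_def FactGroup_def RCOSETS_def a_r_coset_def r_coset_def by auto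

lemma coset_coboundaries:
  assumes X: "is_complex X" and x: "x \<in> carrier (obj X n)"
  shows "coboundaries X n +>\<^bsub>obj X n\<^esub> x = coboundaries X n \<longleftrightarrow> x \<in> coboundaries X n"
    "x \<in> coboundaries X n +>\<^bsub>obj X n\<^esub> x"
proof -
  interpret M: right_module "obj X n" by (rule is_complexD(1)[OF X])
  note s = subgroup_coboundaries[OF X, of n]
  show "coboundaries X n +>\<^bsub>obj X n\<^esub> x = coboundaries X n \<longleftrightarrow> x \<in> coboundaries X n"
    using M.a_coset_join1[OF _ x s] M.a_coset_join2[OF x s] by blast
  have "\<zero>\<^bsub>obj X n\<^esub> \<in> coboundaries X n" "coboundaries X n \<subseteq> carrier (obj X n)"
    using subgroup.one_closed[OF s] subgroup.subset[OF s] by simp_all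
  from M.a_rcosI[OF this x] show "x \<in> coboundaries X n +>\<^bsub>obj X n\<^esub> x" using x by simp
qed

lemma cohomology_support_iff:
  assumes X: "is_complex X"
  shows "n \<notin> cohomology_support X \<longleftrightarrow> cocycles X n \<subseteq> coboundaries X n"
proof -
  interpret M: right_module "obj X n" by (rule is_complexD(1)[OF X])
  have z: "\<zero>\<^bsub>obj X n\<^esub> \<in> cocycles X n"
    unfolding cocycles_def using module_homs_zero[OF is_complexD(2)[OF X] is_complexD(1)[OF X] is_complexD(1)[OF X]] by simp
  have "n \<notin> cohomology_support X \<longleftrightarrow> (\<forall>x\<in>cocycles X n. coboundaries X n +>\<^bsub>obj X n\<^esub> x = coboundaries X n)"
    unfolding cohomology_support_def carrier_cohomology one_cohomology using z by auto
  also have "\<dots> \<longleftrightarrow> cocycles X n \<subseteq> coboundaries X n"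
    using coset_coboundaries(1)[OF X] unfolding cocycles_def by auto
  finally show ?thesis .
qed

lemma cohomology_map_coset:
  assumes X: "is_complex X" and Y: "is_complex Y" and f: "f \<in> chain_maps X Y" and x: "x \<in> cocycles X n"
  shows "f n x \<in> cocycles Y n"
    "cohomology_map n Y f (coboundaries X n +>\<^bsub>obj X n\<^esub> x) = coboundaries Y n +>\<^bsub>obj Y n\<^esub> f n x"
proof -
  interpret M: right_module "obj X n" by (rule is_complexD(1)[OF X])
  interpret N: right_module "obj Y n" by (rule is_complexD(1)[OF Y])
  note s = subgroup_coboundaries[OF Y, of n]
  have xc: "x \<in> carrier (obj X n)" "diff X n x = \<zero>\<^bsub>obj X (n + 1)\<^esub>" using x unfolding cocycles_def by auto
  have fx: "f n x \<in> carrier (obj Y n)" by (rule module_homsD(1)[OF chain_mapsD(1)[OF f] xc(1)])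
  have "diff Y n (f n x) = \<zero>\<^bsub>obj Y (n + 1)\<^esub>"
    using chain_mapsD(2)[OF f xc(1)] module_homs_zero[OF chain_mapsD(1)[OF f] is_complexD(1)[OF X] is_complexD(1)[OF Y], of "n + 1"] xc(2) by simp
  thus "f n x \<in> cocycles Y n" unfolding cocycles_def using fx by simp
  have "coboundaries Y n +>\<^bsub>obj Y n\<^esub> f n x' = coboundaries Y n +>\<^bsub>obj Y n\<^esub> f n x" if "x' \<in> coboundaries X n +>\<^bsub>obj X n\<^esub> x" for x'
  proof -
    obtain b where b: "b \<in> carrier (obj X (n - 1))" "x' = diff X (n - 1) b \<oplus>\<^bsub>obj X n\<^esub> x"
      using \<open>x' \<in> _\<close> unfolding a_r_coset_def r_coset_def coboundaries_def by auto
    have fb: "f (n - 1) b \<in> carrier (obj Y (n - 1))" by (rule module_homsD(1)[OF chain_mapsD(1)[OF f] b(1)])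
    have "f n (diff X (n - 1) b) = diff Y (n - 1) (f (n - 1) b)" using chain_mapsD(2)[OF f b(1)] by simp
    hence c: "f n (diff X (n - 1) b) \<in> coboundaries Y n" using fb unfolding coboundaries_def by simp
    have "f n x' = f n (diff X (n - 1) b) \<oplus>\<^bsub>obj Y n\<^esub> f n x"
      unfolding b(2) by (rule module_homsD(2)[OF chain_mapsD(1)[OF f] module_homsD(1)[OF is_complexD(3)[OF X] b(1)] xc(1)])
    hence "f n x' \<in> coboundaries Y n +>\<^bsub>obj Y n\<^esub> f n x"
      using N.a_rcosI[OF c _ fx] subgroup.subset[OF s] by simp
    from N.a_repr_independence[OF this fx s] show ?thesis by simp
  qed
  thus "cohomology_map n Y f (coboundaries X n +>\<^bsub>obj X n\<^esub> x) = coboundaries Y n +>\<^bsub>obj Y n\<^esub> f n x"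
    unfolding cohomology_map_def using coset_coboundaries(2)[OF X xc(1)] by blast
qed

text \<open>Surjectivity and injectivity on cohomology, unfolded from cosets to elements.\<close>

lemma quasi_isoD:
  assumes X: "is_complex X" and Y: "is_complex Y" and q: "quasi_iso X Y f"
  shows "y \<in> cocycles Y n ==> \<exists>x\<in>cocycles X n. \<exists>b\<in>carrier (obj Y (n - 1)). y = diff Y (n - 1) b \<oplus>\<^bsub>obj Y n\<^esub> f n x"
    "x \<in> cocycles X n ==> f n x \<in> coboundaries Y n ==> x \<in> coboundaries X n"
proof -
  interpret M: right_module "obj X n" by (rule is_complexD(1)[OF X])
  interpret N: right_module "obj Y n" by (rule is_complexD(1)[OF Y])
  have f: "f \<in> chain_maps X Y" and b: "bij_betw (cohomology_map n Y f) (carrier (cohomology n X)) (carrier (cohomology n Y))"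
    using q unfolding quasi_iso_def by auto
  note m = cohomology_map_coset(2)[OF X Y f, of _ n]
  show "\<exists>x\<in>cocycles X n. \<exists>b\<in>carrier (obj Y (n - 1)). y = diff Y (n - 1) b \<oplus>\<^bsub>obj Y n\<^esub> f n x" if y: "y \<in> cocycles Y n"
  proof -
    have "coboundaries Y n +>\<^bsub>obj Y n\<^esub> y \<in> cohomology_map n Y f ` carrier (cohomology n X)"
      using b y unfolding bij_betw_def by (simp add: carrier_cohomology)
    then obtain x where x: "x \<in> cocycles X n" "coboundaries Y n +>\<^bsub>obj Y n\<^esub> y = coboundaries Y n +>\<^bsub>obj Y n\<^esub> f n x"
      unfolding carrier_cohomology using m by auto
    have "y \<in> carrier (obj Y n)" using y unfolding cocycles_def by blast
    from coset_coboundaries(2)[OF Y this] have "y \<in> coboundaries Y n +>\<^bsub>obj Y n\<^esub> f n x" using x(2) by simp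
    thus ?thesis using x(1) unfolding a_r_coset_def r_coset_def coboundaries_def by auto
  qed
  show "x \<in> coboundaries X n" if x: "x \<in> cocycles X n" and fx: "f n x \<in> coboundaries Y n"
  proof -
    have z: "\<zero>\<^bsub>obj X n\<^esub> \<in> cocycles X n"
      unfolding cocycles_def using module_homs_zero[OF is_complexD(2)[OF X] is_complexD(1)[OF X] is_complexD(1)[OF X]] by simp
    have zb: "\<zero>\<^bsub>obj X n\<^esub> \<in> coboundaries X n" "\<zero>\<^bsub>obj Y n\<^esub> \<in> coboundaries Y n"
      using subgroup.one_closed[OF subgroup_coboundaries[OF X]] subgroup.one_closed[OF subgroup_coboundaries[OF Y]] by simp_all
    have fz: "f n \<zero>\<^bsub>obj X n\<^esub> = \<zero>\<^bsub>obj Y n\<^esub>" by (rule module_homs_zero[OF chain_mapsD(1)[OF f] is_complexD(1)[OF X] is_complexD(1)[OF Y]])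
    have xc: "x \<in> carrier (obj X n)" "f n x \<in> carrier (obj Y n)" using x cohomology_map_coset(1)[OF X Y f x] unfolding cocycles_def by auto
    have "coboundaries Y n +>\<^bsub>obj Y n\<^esub> f n x = coboundaries Y n +>\<^bsub>obj Y n\<^esub> f n \<zero>\<^bsub>obj X n\<^esub>"
      using coset_coboundaries(1)[OF Y xc(2)] coset_coboundaries(1)[OF Y N.zero_closed] fx zb(2) fz by simp
    hence "cohomology_map n Y f (coboundaries X n +>\<^bsub>obj X n\<^esub> x) = cohomology_map n Y f (coboundaries X n +>\<^bsub>obj X n\<^esub> \<zero>\<^bsub>obj X n\<^esub>)"
      unfolding m[OF x] m[OF z] .
    hence "coboundaries X n +>\<^bsub>obj X n\<^esub> x = coboundaries X n +>\<^bsub>obj X n\<^esub> \<zero>\<^bsub>obj X n\<^esub>"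
      using b x z unfolding bij_betw_def inj_on_def carrier_cohomology by blast
    thus ?thesis using coset_coboundaries(1)[OF X xc(1)] coset_coboundaries(1)[OF X M.zero_closed] zb(1) by simp
  qed
qed

lemma quasi_iso_strict:
  assumes X: "is_complex X" and Y: "is_complex Y" and f: "f \<in> chain_maps X Y" and g: "g \<in> chain_maps Y X"
    and gf: "!!n x. x \<in> carrier (obj X n) ==> g n (f n x) = x" and fg: "!!n y. y \<in> carrier (obj Y n) ==> f n (g n y) = y"
  shows "quasi_iso X Y f"
  unfolding quasi_iso_def
proof (intro conjI allI f)
  fix n
  note m = cohomology_map_coset[OF X Y f, of _ n] and m' = cohomology_map_coset[OF Y X g, of _ n]
  have c: "x \<in> cocycles X n ==> x \<in> carrier (obj X n)" "y \<in> cocycles Y n ==> y \<in> carrier (obj Y n)" for x y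
    unfolding cocycles_def by auto
  show "bij_betw (cohomology_map n Y f) (carrier (cohomology n X)) (carrier (cohomology n Y))"
    by (rule bij_betw_byWitness[where f' = "cohomology_map n X g"])
      (auto simp: carrier_cohomology m m' gf[OF c(1)] fg[OF c(2)])
qed

lemma homotopic_maps_refl:
  assumes X: "is_complex X" and Y: "is_complex Y" and f: "f \<in> chain_maps X Y"
  shows "homotopic_maps X Y f f"
proof -
  have M: "right_module (obj Y n)" for n by (rule is_complexD(1)[OF Y])
  have z: "\<zero>\<^bsub>obj Y n\<^esub> \<in> carrier (obj Y n)" "x \<in> carrier (obj Y n) ==> x \<oplus>\<^bsub>obj Y n\<^esub> (\<zero>\<^bsub>obj Y n\<^esub> \<oplus>\<^bsub>obj Y n\<^esub> \<zero>\<^bsub>obj Y n\<^esub>) = x"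
    "\<zero>\<^bsub>obj Y n\<^esub> \<oplus>\<^bsub>obj Y n\<^esub> \<zero>\<^bsub>obj Y n\<^esub> = \<zero>\<^bsub>obj Y n\<^esub>" for n x
  proof -
    interpret right_module "obj Y n" by (rule M)
    show "\<zero>\<^bsub>obj Y n\<^esub> \<in> carrier (obj Y n)" "x \<in> carrier (obj Y n) ==> x \<oplus>\<^bsub>obj Y n\<^esub> (\<zero>\<^bsub>obj Y n\<^esub> \<oplus>\<^bsub>obj Y n\<^esub> \<zero>\<^bsub>obj Y n\<^esub>) = x"
      "\<zero>\<^bsub>obj Y n\<^esub> \<oplus>\<^bsub>obj Y n\<^esub> \<zero>\<^bsub>obj Y n\<^esub> = \<zero>\<^bsub>obj Y n\<^esub>" by simp_all
  qed
  have "(%_. \<zero>\<^bsub>obj Y (n - 1)\<^esub>) \<in> module_homs (obj X n) (obj Y (n - 1))" for n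
    using z(3)[of "n - 1"] by (intro module_homsI z(1)) (simp_all add: smult_zero[OF M])
  moreover have "diff Y (n - 1) \<zero>\<^bsub>obj Y (n - 1)\<^esub> = \<zero>\<^bsub>obj Y n\<^esub>" for n by (rule module_homs_zero[OF is_complexD(3)[OF Y] M M])
  ultimately show ?thesis unfolding homotopic_maps_def
    using z(2)[OF module_homsD(1)[OF chain_mapsD(1)[OF f]]] by (intro exI[of _ "%n _. \<zero>\<^bsub>obj Y (n - 1)\<^esub>"]) simp
qed

lemma roof_rel_refl:
  fixes X :: "('a::ring_1, 'm) cpx"
  assumes X: "is_complex X" and Y: "is_complex Y" and r: "(W, s, f) \<in> roofs X Y"
  shows "((W, s, f), (W, s, f)) \<in> roof_rel X Y"
proof -
  have W: "is_complex W" "quasi_iso W X s" "s \<in> chain_maps W X" "f \<in> chain_maps W Y" using r unfolding roofs_def quasi_iso_def by auto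
  have i: "(%n x. x) \<in> chain_maps W W" unfolding chain_maps_def by (simp add: module_homs_id)
  have e: "comp_maps s (%n x. x) = s" "comp_maps f (%n x. x) = f" by (simp_all add: comp_def)
  have 1: "quasi_iso W X (comp_maps s (%n x. x))" unfolding e by (rule W(2))
  have 2: "homotopic_maps W X (comp_maps s (%n x. x)) (comp_maps s (%n x. x))" unfolding e by (rule homotopic_maps_refl[OF W(1) X W(3)])
  have 3: "homotopic_maps W Y (comp_maps f (%n x. x)) (comp_maps f (%n x. x))" unfolding e by (rule homotopic_maps_refl[OF W(1) Y W(4)])
  show ?thesis unfolding roof_rel_def mem_Collect_eq prod.case
    by (rule conjI[OF r], rule conjI[OF r], rule exI[of _ W], rule conjI[OF W(1)], rule bexI[where x = "%n x. x"],
      rule bexI[where x = "%n x. x"], rule conjI[OF 1 conjI[OF 2 3]]) (rule i)+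
qed

text \<open>If the quotient has a single element, both roofs have the same image under
  \<open>roof_rel\<close>. Reflexivity puts \<open>r'\<close> into its own image, hence into that of
  \<open>r\<close>; transitivity of the relation does not enter.\<close>

lemma derived_hom_singleton:
  fixes X :: "('a::ring_1, 'm) cpx"
  assumes X: "is_complex X" and Y: "is_complex Y" and d: "is_singleton (derived_hom X Y)"
    and r: "r \<in> roofs X Y" "r' \<in> roofs X Y"
  shows "(r, r') \<in> roof_rel X Y"
proof -
  have "(r', r') \<in> roof_rel X Y" using roof_rel_refl[OF X Y, of "fst r'" "fst (snd r')" "snd (snd r')"] r(2) by (simp only: prod.collapse)
  moreover have "roof_rel X Y `` {r} = roof_rel X Y `` {r'}"
  proof -
    obtain C where C: "derived_hom X Y = {C}" using d unfolding is_singleton_def by (elim exE)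
    have "roof_rel X Y `` {r} \<in> {C}" "roof_rel X Y `` {r'} \<in> {C}"
      unfolding C[symmetric] derived_hom_def by (rule quotientI[OF r(1)], rule quotientI[OF r(2)])
    thus ?thesis by (simp only: singleton_iff)
  qed
  ultimately have "r' \<in> roof_rel X Y `` {r}" by (simp only: Image_singleton_iff)
  thus ?thesis by (simp only: Image_singleton_iff)
qed

lemma Kb_proj_cohomology_support:
  assumes X: "Kb_proj X"
  shows "finite (cohomology_support X)"
proof (rule finite_subset)
  have c: "is_complex X" using X unfolding Kb_proj_def by blast
  show "cohomology_support X \<subseteq> {n. \<not> zero_module (obj X n)}"
  proof
    fix n assume n: "n \<in> cohomology_support X"
    have "cocycles X n \<subseteq> coboundaries X n" if "zero_module (obj X n)"
      using subgroup.one_closed[OF subgroup_coboundaries[OF c, of n]] that unfolding cocycles_def zero_module_def by auto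
    thus "n \<in> {n. \<not> zero_module (obj X n)}" using n cohomology_support_iff[OF c] by blast
  qed
  show "finite {n. \<not> zero_module (obj X n)}" using X unfolding Kb_proj_def by blast
qed

lemma length_two_support:
  assumes X: "Kb_proj X" "cpx_length X = 2"
  obtains c where "!!n. n ~= c ==> n ~= c - 1 ==> cocycles X n \<subseteq> coboundaries X n"
proof -
  let ?S = "cohomology_support X"
  have c: "is_complex X" using X unfolding Kb_proj_def by blast
  \<comment> \<open>The length 2 excludes the empty support, for which the length is set to 0. The
    degree \<open>c\<close> obtained below is the maximum of the support.\<close>
  have S: "Max ?S - Min ?S = 1" using X(2) unfolding cpx_length_def by (auto split: if_splits)
  have "n \<notin> ?S" if "n ~= Max ?S" "n ~= Max ?S - 1" for n
    using Max_ge[OF Kb_proj_cohomology_support[OF X(1)], of n] Min_le[OF Kb_proj_cohomology_support[OF X(1)], of n] S that by fastforce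
  thus ?thesis using that cohomology_support_iff[OF c] by blast
qed

section \<open>Injectivity of symmetric algebras\<close>

lemma act_truncate:
  assumes "!!i j. N \<le> j ==> entry e i j = 0" "!!j. j < N ==> v j = w j"
  shows "act e v = act e w"
proof -
  have "act e v = (%i. \<Sum>j<N. act e (unitv j) i * v j)" by (rule act_columns[OF assms(1)])
  also have "\<dots> = (%i. \<Sum>j<N. act e (unitv j) i * w j)" using assms(2) by simp
  also have "\<dots> = act e w" by (rule act_columns[OF assms(1), symmetric])
  finally show ?thesis .
qed

lemma act_munitx: "act (munitx i j a) v = (%k. if k = i then a * v j else 0)"
proof
  fix k
  have "row_support (munitx i j a) k \<subseteq> {j}" unfolding row_support_def by (auto simp: munitx.rep_eq split: if_splits)
  from act_superset[OF _ this, of v] show "act (munitx i j a) v k = (if k = i then a * v j else 0)" by (simp add: munitx.rep_eq)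
qed

lemma act_sum: "act (sum f S) v = (\<Sum>s\<in>S. act (f s) v)"
  by (induction S rule: infinite_finite_induct) (simp_all add: act_add_left)

lemma sum_fun_apply: "sum f S x = (\<Sum>s\<in>S. f s x)"
  by (induction S rule: infinite_finite_induct) simp_all

text \<open>The hypothesis speaks of matrices \<open>y\<close> and the conclusion of columns: the
  first entries of \<open>w\<close>, as many as \<open>d\<close> and \<open>q\<close> can see, form
  the column 0 of a matrix \<open>y\<close>.\<close>

lemma act_kernel:
  fixes d q :: "'a::ring_1 fmat"
  assumes "!!y. d * y = 0 ==> q * y = 0" "act d w = 0"
  shows "act q w = 0"
proof -
  obtain N1 where N1: "!!i j. N1 \<le> i \<or> N1 \<le> j ==> entry d i j = 0" using fmat_bound[of d] by blast
  obtain N2 where N2: "!!i j. N2 \<le> i \<or> N2 \<le> j ==> entry q i j = 0" using fmat_bound[of q] by blast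
  define N where "N = max N1 N2"
  define y where "y = (\<Sum>i<N. munitx i 0 (w i))"
  have y: "act y v i = (if i < N then w i * v 0 else 0)" for v i
    unfolding y_def act_sum act_munitx sum_fun_apply by simp
  have t: "act d (act y v) = (%i. act d w i * v 0)" "act q (act y v) = (%i. act q w i * v 0)" for v
    unfolding act_smult[symmetric] using N1 N2 by (auto intro!: act_truncate[of N] simp: y N_def)
  have "d * y = 0" by (rule act_inject) (simp add: act_times t assms(2) fun_eq_iff)
  hence "act (q * y) (unitv 0) = 0" using assms(1) by simp
  thus ?thesis by (simp add: act_times t unitv_def fun_eq_iff)
qed

text \<open>\<open>\<tau>\<close> below is the symmetrizing form. Each row of \<open>q\<close> yields a functional on column vectors that vanishes on
  the kernel of \<open>d\<close>, hence factors through \<open>d\<close>.\<close>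

lemma symmetric_algebra_injective:
  fixes scale :: "'k::field => 'a::ring_1 => 'a" and d q :: "'a fmat"
  assumes "fin_dim_algebra scale" "symmetric_algebra scale"
    and dq: "!!y. d * y = 0 ==> q * y = 0"
  shows "\<exists>h. q = h * d"
proof -
  interpret A: unital_algebra scale using assms(1) unfolding fin_dim_algebra_def by blast
  obtain \<phi> where \<phi>: "bij_betw \<phi> UNIV {f. Vector_Spaces.linear scale ((*) :: 'k => 'k => 'k) f}"
    "!!x y. \<phi> (x + y) = (%z. \<phi> x z + \<phi> y z)" "!!a x b. \<phi> (a * x * b) = (%z. \<phi> x (b * z * a))"
    using assms(2) unfolding symmetric_algebra_def by blast
  define \<tau> where "\<tau> = \<phi> 1"
  have \<phi>\<tau>: "\<phi> b z = \<tau> (b * z)" for b z using \<phi>(3)[of 1 1 b] unfolding \<tau>_def by simp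
  have lin: "Vector_Spaces.linear scale ((*) :: 'k => 'k => 'k) \<tau>"
    unfolding \<tau>_def using bij_betwE[OF \<phi>(1)] by blast
  interpret \<tau>: Vector_Spaces.linear scale "(*) :: 'k => 'k => 'k" \<tau> by (rule lin)
  have nondeg: "x = 0" if "!!a. \<tau> (x * a) = 0" for x
  proof -
    have "\<phi> x = \<phi> 0" using that by (simp add: fun_eq_iff \<phi>\<tau> \<tau>.zero)
    thus ?thesis using \<phi>(1) unfolding bij_betw_def inj_on_def by blast
  qed
  have repr: "\<exists>b. \<forall>z. f z = \<tau> (b * z)" if "Vector_Spaces.linear scale ((*) :: 'k => 'k => 'k) f" for f
  proof -
    have "f \<in> \<phi> ` UNIV" using that \<phi>(1) unfolding bij_betw_def by blast
    then obtain b where "f = \<phi> b" by blast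
    thus ?thesis using \<phi>\<tau> by blast
  qed
  define sc where "sc c v = (%i. scale c (v i))" for c and v :: "nat => 'a"
  have vs: "vector_space sc"
    by unfold_locales (auto simp: sc_def fun_eq_iff A.scale_right_distrib A.scale_left_distrib)
  interpret V: vector_space sc by (rule vs)
  have act_sc: "act e (sc c v) = sc c (act e v)" for e c v
    by (simp add: act_def sc_def fun_eq_iff A.scale_mult_right A.scale_sum_right)
  interpret VV: vector_space_pair sc sc by unfold_locales
  have "Vector_Spaces.linear sc sc (act d)"
    by unfold_locales (auto simp: act_plus act_sc)
  from VV.linear_exists_right_inverse_on[OF this V.subspace_UNIV]
  \<comment> \<open>A section of \<open>act d\<close> over its image that is linear over the field
    only. It need not be linear over the algebra; the symmetrizing form repairs this.\<close>
  obtain g where g: "Vector_Spaces.linear sc sc g" "!!v. act d (g (act d v)) = act d v" by blast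
  interpret g: Vector_Spaces.linear sc sc g by (rule g(1))
  have qg: "act q (g (act d w)) = act q w" for w
  proof -
    have "act d (g (act d w) - w) = 0" using g(2)[of w] act_plus[of d "g (act d w) - w" w] by simp
    hence "act q (g (act d w) - w) = 0" using dq by (rule act_kernel[rotated])
    thus ?thesis using act_plus[of q "g (act d w) - w" w] by simp
  qed
  \<comment> \<open>The entry \<open>b i j\<close> of the factor \<open>h\<close> represents the
    functional that feeds \<open>z\<close> in position \<open>j\<close> through the section and
    \<open>q\<close> and then applies the form to the entry \<open>i\<close>.\<close>
  have ex: "\<exists>b. \<forall>z. \<tau> (act q (g (%k. if k = j then z else 0)) i) = \<tau> (b * z)" for i j
  proof (rule repr)
    have 1: "(%k. if k = j then x + y else 0) = (%k. if k = j then x else 0) + (%k. if k = j then y else 0)" for x y :: 'a by auto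
    have 2: "(%k. if k = j then scale c x else 0) = sc c (%k. if k = j then x else 0)" for c x by (auto simp: sc_def)
    show "Vector_Spaces.linear scale ((*) :: 'k => 'k => 'k) (%z. \<tau> (act q (g (%k. if k = j then z else 0)) i))"
    proof
      fix x y :: 'a and c :: 'k
      let ?u = "%z. (%k. if k = j then z else 0) :: nat => 'a"
      have "act q (g (?u (x + y))) = act q (g (?u x)) + act q (g (?u y))" by (simp only: 1 g.add act_plus)
      thus "\<tau> (act q (g (?u (x + y))) i) = \<tau> (act q (g (?u x)) i) + \<tau> (act q (g (?u y)) i)" by (simp add: \<tau>.add)
      have "act q (g (?u (scale c x))) = sc c (act q (g (?u x)))" by (simp only: 2 g.scale act_sc)
      thus "\<tau> (act q (g (?u (scale c x))) i) = c * \<tau> (act q (g (?u x)) i)" by (simp add: sc_def \<tau>.scale)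
    qed
  qed
  define b where "b i j = (SOME b. \<forall>z. \<tau> (act q (g (%k. if k = j then z else 0)) i) = \<tau> (b * z))" for i j
  have b: "\<tau> (act q (g (%k. if k = j then z else 0)) i) = \<tau> (b i j * z)" for i j z
    using someI_ex[OF ex] unfolding b_def by (rule spec)
  obtain N1 where N1: "!!i j. N1 \<le> i \<or> N1 \<le> j ==> entry d i j = 0" using fmat_bound[of d] by blast
  obtain N2 where N2: "!!i j. N2 \<le> i \<or> N2 \<le> j ==> entry q i j = 0" using fmat_bound[of q] by blast
  define N where "N = max N1 N2"
  have dN: "act d w i = 0" if "N \<le> i" for w i using N1 that by (simp add: act_def N_def)
  have qN: "act q w i = 0" if "N \<le> i" for w i using N2 that by (simp add: act_def N_def)
  define h where "h = (\<Sum>i<N. \<Sum>j<N. munitx i j (b i j))"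
  have h: "act h v i = (if i < N then \<Sum>j<N. b i j * v j else 0)" for v i
  proof -
    have "act h v i = (\<Sum>i'<N. if i = i' then \<Sum>j<N. b i j * v j else 0)"
      unfolding h_def act_sum act_munitx sum_fun_apply by (intro sum.cong) auto
    thus ?thesis by simp
  qed
  have ev: "\<tau> (act q w i) = \<tau> (\<Sum>j<N. b i j * act d w j)" for w i
  proof -
    have e: "act d w = (\<Sum>j<N. (%k. if k = j then act d w j else 0))"
      using dN by (auto simp: fun_eq_iff sum_fun_apply)
    have "\<tau> (act q w i) = \<tau> (act q (g (act d w)) i)" by (simp only: qg)
    also have "\<dots> = \<tau> (act q (g (\<Sum>j<N. (%k. if k = j then act d w j else 0))) i)" using e by (simp only:)
    also have "\<dots> = (\<Sum>j<N. \<tau> (act q (g (%k. if k = j then act d w j else 0)) i))"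
    proof -
      have "\<tau> (act q (g (sum f S)) i) = (\<Sum>j\<in>S. \<tau> (act q (g (f j)) i))" if "finite S" for f and S :: "nat set"
        using that
      proof (induction S)
        case empty
        have "act q (g (sum f {})) = 0" by (simp only: sum.empty g.zero act_zero)
        hence "act q (g (sum f {})) i = 0" by (simp only: zero_fun_apply)
        thus ?case by (simp only: \<tau>.zero sum.empty)
      next
        case (insert j S)
        have "act q (g (sum f (insert j S))) = act q (g (f j)) + act q (g (sum f S))"
          by (simp only: sum.insert[OF insert.hyps] g.add act_plus)
        hence "act q (g (sum f (insert j S))) i = act q (g (f j)) i + act q (g (sum f S)) i" by (simp only: plus_fun_apply)
        hence "\<tau> (act q (g (sum f (insert j S))) i) = \<tau> (act q (g (f j)) i) + \<tau> (act q (g (sum f S)) i)" by (simp only: \<tau>.add)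
        thus ?case unfolding insert.IH sum.insert[OF insert.hyps] .
      qed
      thus ?thesis by simp
    qed
    finally show ?thesis unfolding b \<tau>.sum .
  qed
  \<comment> \<open>The two sides agree under the form. Replacing \<open>w\<close> by its multiples
    \<open>w a\<close> shows that they agree after multiplication by every \<open>a\<close>, so they
    are equal by nondegeneracy.\<close>
  have "act q w i = (\<Sum>j<N. b i j * act d w j)" for w i
  proof -
    have "\<tau> ((act q w i - (\<Sum>j<N. b i j * act d w j)) * a) = 0" for a
      using ev[of "%k. w k * a" i] unfolding act_smult
      by (simp add: left_diff_distrib \<tau>.diff sum_distrib_right mult.assoc)
    hence "act q w i - (\<Sum>j<N. b i j * act d w j) = 0" by (rule nondeg)
    thus ?thesis by simp
  qed
  hence "q = h * d" using qN by (intro act_inject) (auto simp: act_times h fun_eq_iff)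
  thus ?thesis by blast
qed

section \<open>Vanishing of extensions\<close>

text \<open>Two conditions are lifted simultaneously: a lift along a quasi-isomorphism has to have
  the right image and, at the same time, a prescribed differential.\<close>

lemma col_lift:
  fixes M :: "('a::ring_1, 'm) module" and N N' :: "('a, 'a univ) module"
  assumes M: "right_module M" and N: "right_module N" and N': "right_module N'" and e: "e * e = e"
    and p: "p \<in> module_homs M N" and p': "p' \<in> module_homs M N'" and f: "f \<in> module_homs (col e) N" and f': "f' \<in> module_homs (col e) N'"
    and ex: "!!y. y \<in> carrier (col e) ==> \<exists>m\<in>carrier M. p m = f y \<and> p' m = f' y"
  shows "\<exists>G\<in>module_homs (col e) M. \<forall>y\<in>carrier (col e). p (G y) = f y \<and> p' (G y) = f' y"
proof -
  define m where "m j = (SOME m. m \<in> carrier M \<and> p m = f (act e (unitv j)) \<and> p' m = f' (act e (unitv j)))" for j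
  have "act e (unitv j) \<in> carrier (col e)" for j using e by (simp add: act_times[symmetric])
  hence "\<exists>m. m \<in> carrier M \<and> p m = f (act e (unitv j)) \<and> p' m = f' (act e (unitv j))" for j using ex by blast
  from someI_ex[OF this] have m: "m j \<in> carrier M" "p (m j) = f (act e (unitv j))" "p' (m j) = f' (act e (unitv j))" for j
    unfolding m_def by blast+
  show ?thesis
  proof (rule col_extend[OF M e m(1)])
    fix G assume G: "G \<in> module_homs (col e) M"
      and H: "!!(N :: ('a, 'a univ) module) p f. right_module N ==> p \<in> module_homs M N ==> f \<in> module_homs (col e) N ==>
        (!!j. p (m j) = f (act e (unitv j))) ==> (!!v. v \<in> carrier (col e) ==> p (G v) = f v)"
    show ?thesis using G H[OF N p f m(2)] H[OF N' p' f' m(3)] by blast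
  qed
qed

lemma act_minus: "act x (v - w) = act x v - act x w"
  using act_plus[of x v "- w"] act_uminus(2)[of x w] by simp

lemma module_homs_diff:
  assumes f: "f \<in> module_homs L (col e)" and g: "g \<in> module_homs L (col e)"
  shows "(%x. f x - g x) \<in> module_homs L (col e)"
proof (rule module_homsI)
  show "f x - g x \<in> carrier (col e)" if "x \<in> carrier L" for x
    using module_homsD(1)[OF f that] module_homsD(1)[OF g that] by (simp add: act_minus)
  show "f (x \<oplus>\<^bsub>L\<^esub> y) - g (x \<oplus>\<^bsub>L\<^esub> y) = f x - g x \<oplus>\<^bsub>col e\<^esub> (f y - g y)" if "x \<in> carrier L" "y \<in> carrier L" for x y
    using module_homsD(2)[OF f that] module_homsD(2)[OF g that] by (simp only: col_simps add_diff_add)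
  show "f (a \<odot>\<^bsub>L\<^esub> x) - g (a \<odot>\<^bsub>L\<^esub> x) = a \<odot>\<^bsub>col e\<^esub> (f x - g x)" if "x \<in> carrier L" for a x
    using module_homsD(3)[OF f that] module_homsD(3)[OF g that] by (simp add: fun_eq_iff left_diff_distrib)
qed

text \<open>The two halves of a quasi-isomorphism, with its target described by columns: a cocycle
  is hit up to a coboundary, and a cocycle with trivial image is a coboundary.\<close>

lemma column_quasi_iso:
  assumes P: "crep P E u v" and KP: "is_complex P" and V: "is_complex V" and t: "quasi_iso V P t"
  shows "y \<in> carrier (col (ob E n)) ==> act (df E n) y = 0 ==> \<exists>w\<in>carrier (obj V n). \<exists>z\<in>carrier (col (ob E (n - 1))).
      diff V n w = \<zero>\<^bsub>obj V (n + 1)\<^esub> \<and> u n (t n w) + act (df E (n - 1)) z = y"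
    "w \<in> carrier (obj V n) ==> diff V n w = \<zero>\<^bsub>obj V (n + 1)\<^esub> ==> z \<in> carrier (col (ob E (n - 1))) ==>
      u n (t n w) = act (df E (n - 1)) z ==> \<exists>w'\<in>carrier (obj V (n - 1)). w = diff V (n - 1) w'"
proof -
  have tc: "t \<in> chain_maps V P" using t unfolding quasi_iso_def by blast
  note q = quasi_isoD[OF V KP t]
  have v0: "v m 0 = \<zero>\<^bsub>obj P m\<^esub>" for m using module_homs_zero[OF crepD(4)[OF P] right_module_col is_complexD(1)[OF KP]] by simp
  have ud: "u n (diff P (n - 1) b) = act (df E (n - 1)) (u (n - 1) b)" if "b \<in> carrier (obj P (n - 1))" for b
    using crepD(7)[OF P that] by simp
  show "\<exists>w\<in>carrier (obj V n). \<exists>z\<in>carrier (col (ob E (n - 1))). diff V n w = \<zero>\<^bsub>obj V (n + 1)\<^esub> \<and> u n (t n w) + act (df E (n - 1)) z = y"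
    if y: "y \<in> carrier (col (ob E n))" "act (df E n) y = 0"
  proof -
    have "v n y \<in> cocycles P n" unfolding cocycles_def
      using crep_v_diff[OF P y(1)] y(2) v0 module_homsD(1)[OF crepD(4)[OF P] y(1)] by simp
    then obtain w b where w: "w \<in> cocycles V n" "b \<in> carrier (obj P (n - 1))" "v n y = diff P (n - 1) b \<oplus>\<^bsub>obj P n\<^esub> t n w" using q(1) by blast
    have wc: "w \<in> carrier (obj V n)" "diff V n w = \<zero>\<^bsub>obj V (n + 1)\<^esub>" using w(1) unfolding cocycles_def by auto
    have "y = u n (v n y)" using crepD(6)[OF P y(1)] by simp
    also have "\<dots> = act (df E (n - 1)) (u (n - 1) b) + u n (t n w)"
      unfolding w(3) using module_homsD(2)[OF crepD(3)[OF P] module_homsD(1)[OF is_complexD(3)[OF KP] w(2)] module_homsD(1)[OF chain_mapsD(1)[OF tc] wc(1)]]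
        ud[OF w(2)] by simp
    finally have "u n (t n w) + act (df E (n - 1)) (u (n - 1) b) = y" by (simp only: add.commute)
    thus ?thesis using wc module_homsD(1)[OF crepD(3)[OF P] w(2)] by blast
  qed
  show "\<exists>w'\<in>carrier (obj V (n - 1)). w = diff V (n - 1) w'"
    if w: "w \<in> carrier (obj V n)" "diff V n w = \<zero>\<^bsub>obj V (n + 1)\<^esub>" "z \<in> carrier (col (ob E (n - 1)))" "u n (t n w) = act (df E (n - 1)) z"
  proof -
    have "t n w = v n (u n (t n w))" using crepD(5)[OF P module_homsD(1)[OF chain_mapsD(1)[OF tc] w(1)]] by simp
    also have "\<dots> = diff P (n - 1) (v (n - 1) z)" unfolding w(4) using crep_v_diff[OF P w(3)] by simp
    finally have "t n w \<in> coboundaries P n" unfolding coboundaries_def using module_homsD(1)[OF crepD(4)[OF P] w(3)] by blast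
    hence "w \<in> coboundaries V n" using q(2) w(1,2) unfolding cocycles_def by blast
    thus ?thesis unfolding coboundaries_def by blast
  qed
qed

text \<open>The columns of \<open>a\<close> lift along \<open>t\<close> up to homotopy, first in degree \<open>c\<close> and then in degree \<open>c - 1\<close>. Since the composite of
  \<open>g\<close> with \<open>t\<close> is null homotopic, so is the composite of \<open>g\<close> with \<open>a\<close>.\<close>

lemma lift_null_homotopy:
  fixes V :: "('a::ring_1, 'a univ) cpx" and P :: "('a, 'm) cpx"
  assumes P: "crep P E u v" and KP: "is_complex P" and V: "is_complex V" and t: "quasi_iso V P t"
    and a: "a \<in> mhoms F E" and F: "two_term c F"
    and g: "!!n. g n \<in> arr (ob E n) (ob E (n + 1))" "!!n. g (n + 1) * df E n = - (df E (n + 1) * g n)"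
    and k: "!!n. k n \<in> module_homs (obj V n) (col (ob E n))"
      "!!n w. w \<in> carrier (obj V n) ==> act (g n) (u n (t n w)) = k (n + 1) (diff V n w) - act (df E n) (k n w)"
  shows "\<exists>h\<in>arr (ob F (c - 1)) (ob E (c - 1)). \<exists>h'\<in>arr (ob F c) (ob E c). g (c - 1) * a (c - 1) = h' * df F (c - 1) - df E (c - 1) * h"
proof -
  have tc: "t \<in> chain_maps V P" using t unfolding quasi_iso_def by blast
  note cE = crepD(1)[OF P] and cF = two_term_cx[OF F]
  note q = column_quasi_iso[OF P KP V t]
  have a_hom: "act (a n) \<in> module_homs (col (ob F n)) (col (ob E n))" for n by (rule act_module_homs[OF mhomsD(1)[OF a]])
  have dE: "act (df E (n - 1)) \<in> module_homs (col (ob E (n - 1))) (col (ob E n))" for n by (rule act_module_homs[OF cxD(6)[OF cE]])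
  have dF: "act (df F (n - 1)) \<in> module_homs (col (ob F (n - 1))) (col (ob F n))" for n by (rule act_module_homs[OF cxD(6)[OF cF]])
  define T where "T n w = u n (t n w)" for n w
  have T: "T n \<in> module_homs (obj V n) (col (ob E n))" for n
    unfolding T_def by (rule module_homs_comp[OF chain_mapsD(1)[OF tc] crepD(3)[OF P]])
  have Td: "T n (diff V (n - 1) w) = act (df E (n - 1)) (T (n - 1) w)" if "w \<in> carrier (obj V (n - 1))" for n w
    unfolding T_def using chain_mapsD(2)[OF tc that] crepD(7)[OF P module_homsD(1)[OF chain_mapsD(1)[OF tc] that]] by simp
  have kd: "act (g (n - 1)) (T (n - 1) w) = k n (diff V (n - 1) w) - act (df E (n - 1)) (k (n - 1) w)" if "w \<in> carrier (obj V (n - 1))" for n w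
    using k(2)[OF that] unfolding T_def by simp
  have gd: "act (g (n - 1)) (act (df E (n - 2)) z) = - act (df E (n - 1)) (act (g (n - 2)) z)" for n z
    using g(2)[of "n - 2"] by (simp add: act_times[symmetric] act_uminus)
  have aF: "act (a n) (act (df F (n - 1)) y) = act (df E (n - 1)) (act (a (n - 1)) y)" for n y
    using mhomsD(2)[OF a, of "n - 1"] by (simp add: act_times[symmetric])
  \<comment> \<open>A pair consists of an element of \<open>V\<close> and a column one degree lower
    that corrects its image by a coboundary. Such pairs are the lifts up to homotopy.\<close>
  let ?M = "%n. module_sum (obj V n) (col (ob E (n - 1)))"
  have M: "right_module (?M n)" for n by (rule right_module_sum[OF is_complexD(1)[OF V] right_module_col])
  have p: "(%x. T n (fst x) + act (df E (n - 1)) (snd x)) \<in> module_homs (?M n) (col (ob E n))" for n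
    using module_homs_plus[OF module_homs_comp[OF module_homs_fst T] module_homs_comp[OF module_homs_snd dE] right_module_col, of n] by simp
  have p': "(%x. diff V n (fst x)) \<in> module_homs (?M n) (obj V (n + 1))" for n
    by (rule module_homs_comp[OF module_homs_fst is_complexD(2)[OF V]])
  have z: "\<zero>\<^bsub>obj V n\<^esub> \<in> carrier (obj V n)" "\<zero>\<^bsub>obj V n\<^esub> \<oplus>\<^bsub>obj V n\<^esub> \<zero>\<^bsub>obj V n\<^esub> = \<zero>\<^bsub>obj V n\<^esub>"
    "x \<in> carrier (obj V n) ==> x \<oplus>\<^bsub>obj V n\<^esub> \<zero>\<^bsub>obj V n\<^esub> = x" for n x
  proof -
    interpret right_module "obj V n" by (rule is_complexD(1)[OF V])
    show "\<zero>\<^bsub>obj V n\<^esub> \<in> carrier (obj V n)" "\<zero>\<^bsub>obj V n\<^esub> \<oplus>\<^bsub>obj V n\<^esub> \<zero>\<^bsub>obj V n\<^esub> = \<zero>\<^bsub>obj V n\<^esub>"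
      "x \<in> carrier (obj V n) ==> x \<oplus>\<^bsub>obj V n\<^esub> \<zero>\<^bsub>obj V n\<^esub> = x" by simp_all
  qed
  have f0: "(%_. \<zero>\<^bsub>obj V (c + 1)\<^esub>) \<in> module_homs (col (ob F c)) (obj V (c + 1))"
    by (rule module_homsI) (simp_all add: z smult_zero[OF is_complexD(1)[OF V]])
  have ex: "\<exists>m\<in>carrier (?M c). T c (fst m) + act (df E (c - 1)) (snd m) = act (a c) y \<and> diff V c (fst m) = \<zero>\<^bsub>obj V (c + 1)\<^esub>"
    if y: "y \<in> carrier (col (ob F c))" for y
  proof -
    \<comment> \<open>In the upper degree the columns of \<open>a\<close> are cocycles because
      \<open>F\<close> ends there, so they lift to cocycles of \<open>V\<close>.\<close>
    have "ob F (c + 1) = 0" using F unfolding two_term_def by auto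
    hence "a (c + 1) = 0" using mhomsD(1)[OF a, of "c + 1"] by (auto dest: hom_from_zero)
    hence "act (df E c) (act (a c) y) = 0" using mhomsD(2)[OF a, of c] by (simp add: act_times[symmetric])
    from q(1)[OF module_homsD(1)[OF a_hom y] this] obtain w z where "w \<in> carrier (obj V c)" "z \<in> carrier (col (ob E (c - 1)))"
      "diff V c w = \<zero>\<^bsub>obj V (c + 1)\<^esub>" "u c (t c w) + act (df E (c - 1)) z = act (a c) y" by blast
    thus ?thesis by (intro bexI[of _ "(w, z)"]) (simp_all add: T_def)
  qed
  obtain G where G0: "G \<in> module_homs (col (ob F c)) (?M c)"
    "\<forall>y\<in>carrier (col (ob F c)). T c (fst (G y)) + act (df E (c - 1)) (snd (G y)) = act (a c) y \<and> diff V c (fst (G y)) = \<zero>\<^bsub>obj V (c + 1)\<^esub>"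
  proof -
    have "\<exists>G\<in>module_homs (col (ob F c)) (?M c). \<forall>y\<in>carrier (col (ob F c)).
        T c (fst (G y)) + act (df E (c - 1)) (snd (G y)) = act (a c) y \<and> diff V c (fst (G y)) = \<zero>\<^bsub>obj V (c + 1)\<^esub>"
      by (rule col_lift[OF M right_module_col is_complexD(1)[OF V] cxD(1)[OF cF] p p' a_hom f0]) (rule ex)
    thus ?thesis using that by (elim bexE)
  qed
  have G: "G \<in> module_homs (col (ob F c)) (?M c)"
    "!!y. y \<in> carrier (col (ob F c)) ==> T c (fst (G y)) + act (df E (c - 1)) (snd (G y)) = act (a c) y"
    "!!y. y \<in> carrier (col (ob F c)) ==> diff V c (fst (G y)) = \<zero>\<^bsub>obj V (c + 1)\<^esub>"
    using G0 by simp_all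
  note G1 = module_homs_comp[OF G(1) module_homs_fst] and G2 = module_homs_comp[OF G(1) module_homs_snd]
  have i: "c - 1 + 1 = c" "c - 1 - 1 = c - 2" by simp_all
  \<comment> \<open>In the lower degree the correction chosen in degree \<open>c\<close> has to be
    subtracted, so that the new lift has the old one as its differential.\<close>
  let ?f = "%y. act (a (c - 1)) y - snd (G (act (df F (c - 1)) y))"
  have f: "?f \<in> module_homs (col (ob F (c - 1))) (col (ob E (c - 1)))"
  proof -
    have s: "(%y. snd (G (act (df F (c - 1)) y))) \<in> module_homs (col (ob F (c - 1))) (col (ob E (c - 1)))" by (rule module_homs_comp[OF dF G2])
    show ?thesis by (rule module_homs_diff[OF a_hom s])
  qed
  have ex': "\<exists>m\<in>carrier (?M (c - 1)). T (c - 1) (fst m) + act (df E (c - 1 - 1)) (snd m) = ?f y \<and> diff V (c - 1) (fst m) = fst (G (act (df F (c - 1)) y))"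
    if y: "y \<in> carrier (col (ob F (c - 1)))" for y
  proof -
    let ?x = "act (df F (c - 1)) y"
    have x: "?x \<in> carrier (col (ob F c))" by (rule module_homsD(1)[OF dF y])
    have fy: "?f y \<in> carrier (col (ob E (c - 1)))" by (rule module_homsD(1)[OF f y])
    have Tw: "T c (fst (G ?x)) = act (df E (c - 1)) (?f y)"
      using G(2)[OF x] unfolding aF act_minus by (simp only: eq_diff_eq)
    obtain w where w: "w \<in> carrier (obj V (c - 1))" "fst (G ?x) = diff V (c - 1) w"
      using q(2)[OF module_homsD(1)[OF G1 x] G(3)[OF x] fy] Tw unfolding T_def by blast
    have Tc: "T (c - 1) w \<in> carrier (col (ob E (c - 1)))" by (rule module_homsD(1)[OF T w(1)])
    have "act (df E (c - 1)) (?f y - T (c - 1) w) = 0" using Td[OF w(1)] Tw w(2) by (simp only: act_minus diff_self)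
    moreover have "?f y - T (c - 1) w \<in> carrier (col (ob E (c - 1)))" using fy Tc by (simp add: act_minus)
    ultimately obtain w' z where w': "w' \<in> carrier (obj V (c - 1))" "z \<in> carrier (col (ob E (c - 1 - 1)))"
      "diff V (c - 1) w' = \<zero>\<^bsub>obj V (c - 1 + 1)\<^esub>" "u (c - 1) (t (c - 1) w') + act (df E (c - 1 - 1)) z = ?f y - T (c - 1) w"
      using q(1)[of "?f y - T (c - 1) w" "c - 1"] by blast
    let ?w = "w \<oplus>\<^bsub>obj V (c - 1)\<^esub> w'"
    have wc: "?w \<in> carrier (obj V (c - 1))"
    proof -
      interpret right_module "obj V (c - 1)" by (rule is_complexD(1)[OF V])
      show ?thesis using w(1) w'(1) by simp
    qed
    have "T (c - 1) ?w + act (df E (c - 1 - 1)) z = ?f y"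
      using module_homsD(2)[OF T w(1) w'(1)] w'(4) unfolding T_def[symmetric] by (simp only: col_simps add.assoc eq_diff_eq add.commute add.left_commute)
    moreover have "diff V (c - 1) ?w = fst (G ?x)"
      using module_homsD(2)[OF is_complexD(3)[OF V] w(1) w'(1)] w'(3) w(2) z(3)[OF module_homsD(1)[OF is_complexD(3)[OF V] w(1)]] unfolding i by simp
    ultimately show ?thesis using wc w'(2) by (intro bexI[of _ "(?w, z)"]) simp_all
  qed
  have f': "(%y. fst (G (act (df F (c - 1)) y))) \<in> module_homs (col (ob F (c - 1))) (obj V (c - 1 + 1))"
    using module_homs_comp[OF dF G1] by simp
  obtain G' where G0': "G' \<in> module_homs (col (ob F (c - 1))) (?M (c - 1))"
    "\<forall>y\<in>carrier (col (ob F (c - 1))). T (c - 1) (fst (G' y)) + act (df E (c - 1 - 1)) (snd (G' y)) = ?f y \<and>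
      diff V (c - 1) (fst (G' y)) = fst (G (act (df F (c - 1)) y))"
  proof -
    have "\<exists>H\<in>module_homs (col (ob F (c - 1))) (?M (c - 1)). \<forall>y\<in>carrier (col (ob F (c - 1))).
        T (c - 1) (fst (H y)) + act (df E (c - 1 - 1)) (snd (H y)) = ?f y \<and> diff V (c - 1) (fst (H y)) = fst (G (act (df F (c - 1)) y))"
      by (rule col_lift[OF M right_module_col is_complexD(1)[OF V] cxD(1)[OF cF] p p' f f']) (rule ex')
    thus ?thesis using that by (elim bexE)
  qed
  note G' = G0'(1) bspec[OF G0'(2), THEN conjunct1] bspec[OF G0'(2), THEN conjunct2]
  note G1' = module_homs_comp[OF G'(1) module_homs_fst] and G2' = module_homs_comp[OF G'(1) module_homs_snd]
  have gE: "act (g (n - 1)) \<in> module_homs (col (ob E (n - 1))) (col (ob E n))" for n using act_module_homs[OF g(1)[of "n - 1"]] by simp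
  \<comment> \<open>Both components combine the given homotopy \<open>k\<close> on the part in
    \<open>V\<close> with \<open>g\<close> applied to the correcting columns.\<close>
  let ?h = "%y. k (c - 1) (fst (G' y)) + act (g (c - 1 - 1)) (snd (G' y))"
  let ?h' = "%y. k c (fst (G y)) + act (g (c - 1)) (snd (G y))"
  have h0h: "?h \<in> module_homs (col (ob F (c - 1))) (col (ob E (c - 1)))"
    using module_homs_plus[OF module_homs_comp[OF G1' k(1)] module_homs_comp[OF G2' gE] right_module_col] by simp
  obtain h where h0: "h \<in> arr (ob F (c - 1)) (ob E (c - 1))" "\<forall>y\<in>carrier (col (ob F (c - 1))). ?h y = act h y"
    using module_homs_matrix[OF h0h cxD(1)[OF cF] cxD(1)[OF cE]] by (elim bexE)
  note h = h0(1) bspec[OF h0(2)]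
  have h1h: "?h' \<in> module_homs (col (ob F c)) (col (ob E c))"
    using module_homs_plus[OF module_homs_comp[OF G1 k(1)] module_homs_comp[OF G2 gE] right_module_col] by simp
  obtain h' where h10: "h' \<in> arr (ob F c) (ob E c)" "\<forall>y\<in>carrier (col (ob F c)). ?h' y = act h' y"
    using module_homs_matrix[OF h1h cxD(1)[OF cF] cxD(1)[OF cE]] by (elim bexE)
  note h' = h10(1) bspec[OF h10(2)]
  have "g (c - 1) * a (c - 1) = h' * df F (c - 1) - df E (c - 1) * h"
  proof (rule act_faithful[OF hom_mult[OF mhomsD(1)[OF a] _] hom_diff[OF hom_mult[OF cxD(6)[OF cF] h'(1)] hom_mult[OF h(1) cxD(6)[OF cE]]] cxD(1)[OF cF]])
    show "g (c - 1) \<in> arr (ob E (c - 1)) (ob E c)" using g(1)[of "c - 1"] by simp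
    fix y assume y: "y \<in> carrier (col (ob F (c - 1)))"
    let ?x = "act (df F (c - 1)) y"
    have x: "?x \<in> carrier (col (ob F c))" by (rule module_homsD(1)[OF dF y])
    have "act (a (c - 1)) y = T (c - 1) (fst (G' y)) + act (df E (c - 2)) (snd (G' y)) + snd (G ?x)"
      using G'(2)[OF y] unfolding i by (simp only: eq_diff_eq)
    hence "act (g (c - 1)) (act (a (c - 1)) y) = k c (fst (G ?x)) - act (df E (c - 1)) (k (c - 1) (fst (G' y)))
        + - act (df E (c - 1)) (act (g (c - 2)) (snd (G' y))) + act (g (c - 1)) (snd (G ?x))"
      by (simp only: act_plus kd[OF module_homsD(1)[OF G1' y]] gd G'(3)[OF y])
    also have "\<dots> = ?h' ?x - act (df E (c - 1)) (?h y)" unfolding i by (simp only: act_plus diff_conv_add_uminus minus_add_distrib add_ac)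
    also have "\<dots> = act (h' * df F (c - 1) - df E (c - 1) * h) y" unfolding h(2)[OF y] h'(2)[OF x] by (simp add: act_diff act_times)
    finally show "act (g (c - 1) * a (c - 1)) y = act (h' * df F (c - 1) - df E (c - 1) * h) y" by (simp add: act_times)
  qed
  thus ?thesis using h(1) h'(1) by blast
qed

text \<open>The matrix \<open>y\<close> has finitely many columns, so it is a morphism from a free
  module whose values are cocycles; these are coboundaries and lift along the differential.\<close>

lemma column_exactness:
  assumes P: "crep P E u v" and KP: "is_complex P" and n: "cocycles P n \<subseteq> coboundaries P n"
    and y: "ob E n * y = y" "df E n * y = 0"
  shows "\<exists>z. y = df E (n - 1) * z"
proof -
  note cE = crepD(1)[OF P]
  obtain N where N: "!!i j. N \<le> i \<or> N \<le> j ==> entry y i j = 0" using fmat_bound[of y] by blast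
  have yN: "y * idm N = y"
    by (rule act_inject) (use N in \<open>auto simp: act_times act_idm intro!: act_truncate[of N]\<close>)
  have y_arr: "y \<in> arr (idm N) (ob E n)" by (rule arrI[OF y(1) yN])
  have v0: "v m 0 = \<zero>\<^bsub>obj P m\<^esub>" for m using module_homs_zero[OF crepD(4)[OF P] right_module_col is_complexD(1)[OF KP]] by simp
  have ex: "\<exists>m\<in>carrier (col (ob E (n - 1))). act (df E (n - 1)) m = act y w \<and> act (df E (n - 1)) m = act y w"
    if "w \<in> carrier (col (idm N))" for w
  proof -
    have c: "act y w \<in> carrier (col (ob E n))" using y(1) by (simp add: act_times[symmetric])
    have "diff P n (v n (act y w)) = v (n + 1) 0" using crep_v_diff[OF P c] y(2) by (simp add: act_times[symmetric])
    hence "v n (act y w) \<in> cocycles P n" unfolding cocycles_def using v0 module_homsD(1)[OF crepD(4)[OF P] c] by simp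
    then obtain b where b: "b \<in> carrier (obj P (n - 1))" "v n (act y w) = diff P (n - 1) b" using n unfolding coboundaries_def by blast
    have "act y w = act (df E (n - 1)) (u (n - 1) b)" using crepD(6)[OF P c] crepD(7)[OF P b(1)] b(2) by simp
    thus ?thesis using module_homsD(1)[OF crepD(3)[OF P] b(1)] by (intro bexI[of _ "u (n - 1) b"]) simp_all
  qed
  note d = act_module_homs[OF cxD(6)[OF cE, of n]] and y_hom = act_module_homs[OF y_arr]
  have "\<exists>G\<in>module_homs (col (idm N)) (col (ob E (n - 1))). \<forall>w\<in>carrier (col (idm N)).
      act (df E (n - 1)) (G w) = act y w \<and> act (df E (n - 1)) (G w) = act y w"
    by (rule col_lift[OF right_module_col right_module_col right_module_col idm_idem d d y_hom y_hom]) (rule ex)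
  then obtain G where G: "G \<in> module_homs (col (idm N)) (col (ob E (n - 1)))"
    "!!w. w \<in> carrier (col (idm N)) ==> act (df E (n - 1)) (G w) = act y w" by blast
  obtain z where z: "z \<in> arr (idm N) (ob E (n - 1))" "\<forall>w\<in>carrier (col (idm N)). G w = act z w"
    using module_homs_matrix[OF G(1) idm_idem cxD(1)[OF cE]] by (elim bexE)
  have "y = df E (n - 1) * z"
    by (rule act_faithful[OF y_arr hom_mult[OF z(1) cxD(6)[OF cE]] idm_idem]) (use G(2) z(2) in \<open>simp add: act_times\<close>)
  thus ?thesis by blast
qed

context fmat_category
begin

text \<open>A morphism \<open>x\<close> between the two objects of \<open>F\<close> induces a chain
  map from \<open>E\<close> to its shift. The roof with this right leg equals the zero roof, so the
  map becomes null homotopic after a quasi-isomorphism from some \<open>V\<close>, which may consist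
  of arbitrary modules. Lifting the columns of the bounded projective complex \<open>F\<close> to
  \<open>V\<close> removes the quasi-isomorphism.\<close>

lemma partial_tilting_ext_zero:
  fixes P :: "('a, 'm) cpx"
  assumes PT: "partial_tilting P" and P: "crep P E u v" and F: "two_term c F" and FE: "meq F E"
  shows "ext_zero c F F"
  unfolding ext_zero_def
proof
  fix x assume x: "x \<in> arr (ob F (c - 1)) (ob F c)"
  have K: "Kb_proj P" and dh: "is_singleton (derived_hom P (shift 1 P))" using PT unfolding partial_tilting_def by auto
  have KP: "is_complex P" and KS: "is_complex (shift 1 P)" using K Kb_proj_shift[OF K] unfolding Kb_proj_def by blast+
  note cE = crepD(1)[OF P] and cF = two_term_cx[OF F]
  obtain a b where ab: "a \<in> mhoms F E" "b \<in> mhoms E F" "heq F F (b * a) (ob F)"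
    using FE unfolding meq_def mequiv_def by blast
  obtain k where k: "!!n. k n \<in> arr (ob F n) (ob F (n - 1))" "!!n. (b * a - ob F) n = df F (n - 1) * k n + k (n + 1) * df F n"
    using ab(3) unfolding heq_def nulls_def by blast
  have dF: "df F c = 0" "df F (c - 2) = 0"
  proof -
    have "ob F (c + 1) = 0" "ob F (c - 2) = 0" using F unfolding two_term_def by auto
    thus "df F c = 0" "df F (c - 2) = 0" using cxD(2)[OF cF, of c] cxD(2)[OF cF, of "c - 2"] by (auto dest: hom_to_zero hom_from_zero)
  qed
  \<comment> \<open>The element \<open>x\<close>, carried over to \<open>E\<close> by the mutually
    inverse homotopy equivalences \<open>a\<close> and \<open>b\<close>. It anticommutes with the
    differentials because \<open>F\<close> vanishes outside its two degrees.\<close>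
  define g where "g n = (if n = c - 1 then a c * x * b (c - 1) else 0)" for n
  have g: "g n \<in> arr (ob E n) (ob E (n + 1))" for n
    unfolding g_def using hom_mult[OF mhomsD(1)[OF ab(2)] hom_mult[OF x mhomsD(1)[OF ab(1)]]] by (simp add: mult.assoc)
  have gd: "g (n + 1) * df E n = - (df E (n + 1) * g n)" for n
  proof -
    have "df E c * (a c * x * b (c - 1)) = a (c + 1) * df F c * (x * b (c - 1))" using mhomsD(2)[OF ab(1), of c] by (simp add: mult.assoc[symmetric])
    hence 1: "df E c * (a c * x * b (c - 1)) = 0" using dF by simp
    have "a c * x * b (c - 1) * df E (c - 2) = a c * x * (df F (c - 2) * b (c - 2))" using mhomsD(2)[OF ab(2), of "c - 2"] by (simp add: mult.assoc)
    hence 2: "a c * x * b (c - 1) * df E (c - 2) = 0" using dF by simp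
    have "n = c - 1 \<or> n = c - 2 \<or> n ~= c - 1 \<and> n + 1 ~= c - 1" by auto
    thus ?thesis unfolding g_def using 1 2 by auto
  qed
  have gS: "g \<in> mhoms E (mshift 1 E)" by (rule mhomsI) (use g gd in simp_all)
  note S = crep_shift[OF P is_complexD(1)[OF KP], of 1]
  note f = matrix_chain_map[OF crep_phi[OF cE] S gS] and z = matrix_chain_map[OF crep_phi[OF cE] S mhoms_zero]
  define f where "f n y = v (n + 1) (act (g n) y)" for n y
  define z where "z n y = v (n + 1) (act ((0 :: int => 'a fmat) n) y)" for n y
  have fz: "f \<in> chain_maps (phi E) (shift 1 P)" "z \<in> chain_maps (phi E) (shift 1 P)"
    unfolding f_def z_def using f(1) z(1) by simp_all
  have vc: "v \<in> chain_maps (phi E) P" and uc: "u \<in> chain_maps P (phi E)"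
    unfolding chain_maps_def using crepD(3,4,7)[OF P] crep_v_diff[OF P] by auto
  have cphi: "is_complex (phi E)" using Kb_proj_phi[OF cE] unfolding Kb_proj_def by blast
  have "quasi_iso (phi E) P v"
    by (rule quasi_iso_strict[OF cphi KP vc uc]) (use crepD(5,6)[OF P] in auto)
  \<comment> \<open>Both roofs have the isomorphism \<open>v\<close> from the column model as left
    leg; the right legs are the map given by \<open>g\<close> and zero.\<close>
  hence "(phi E, v, f) \<in> roofs P (shift 1 P)" "(phi E, v, z) \<in> roofs P (shift 1 P)"
    unfolding roofs_def using fz cphi by auto
  from derived_hom_singleton[OF KP KS dh this]
  obtain V :: "('a, 'a univ) cpx" and s s' where V: "is_complex V" "s \<in> chain_maps V (phi E)" "s' \<in> chain_maps V (phi E)"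
    "quasi_iso V P (comp_maps v s)" "homotopic_maps V (shift 1 P) (comp_maps f s) (comp_maps z s')"
    unfolding roof_rel_def by auto
  obtain m where m: "!!n. m n \<in> module_homs (obj V n) (obj (shift 1 P) (n - 1))"
    "!!n w. w \<in> carrier (obj V n) ==> f n (s n w) = z n (s' n w) \<oplus>\<^bsub>obj (shift 1 P) n\<^esub>
      (diff (shift 1 P) (n - 1) (m n w) \<oplus>\<^bsub>obj (shift 1 P) n\<^esub> m (n + 1) (diff V n w))"
    using V(5) unfolding homotopic_maps_def comp_def by blast
  have oS: "obj (shift 1 P) n = obj P (n + 1)" "obj (shift 1 P) (n - 1) = obj P n" for n unfolding shift_def by simp_all
  have m': "m n \<in> module_homs (obj V n) (obj P n)" for n using m(1)[of n] unfolding oS(2) .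
  have us: "u n (v n (s n w)) = s n w" "s n w \<in> carrier (col (ob E n))" if "w \<in> carrier (obj V n)" for n w
    using crepD(6)[OF P] module_homsD(1)[OF chain_mapsD(1)[OF V(2)] that] by auto
  have mk: "act (g n) (u n (comp_maps v s n w)) = u (n + 1) (m (n + 1) (diff V n w)) - act (df E n) (u n (m n w))"
    if w: "w \<in> carrier (obj V n)" for n w
  proof -
    have dw: "diff V n w \<in> carrier (obj V (n + 1))" by (rule module_homsD(1)[OF is_complexD(2)[OF V(1)] w])
    have mw: "m n w \<in> carrier (obj P n)" "m (n + 1) (diff V n w) \<in> carrier (obj P (n + 1))"
      by (rule module_homsD(1)[OF m' w], rule module_homsD(1)[OF m' dw])
    have gs: "act (g n) (s n w) \<in> carrier (col (ob E (n + 1)))" by (rule module_homsD(1)[OF act_module_homs[OF g] us(2)[OF w]])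
    have dm: "diff (shift 1 P) (n - 1) (m n w) \<in> carrier (obj P (n + 1))"
      using module_homsD(1)[OF is_complexD(3)[OF KS], of "m n w" n] mw(1) unfolding oS(2) unfolding oS(1) by blast
    have udm: "u (n + 1) (diff (shift 1 P) (n - 1) (m n w)) = - act (df E n) (u n (m n w))"
      using crepD(7)[OF S, of "m n w" "n - 1"] mw(1) unfolding oS(2) by (simp add: act_uminus)
    have zz: "z n (s' n w) = \<zero>\<^bsub>obj P (n + 1)\<^esub>"
      unfolding z_def using module_homs_zero[OF crepD(4)[OF P] right_module_col is_complexD(1)[OF KP]] by simp
    have sum: "f n (s n w) = diff (shift 1 P) (n - 1) (m n w) \<oplus>\<^bsub>obj P (n + 1)\<^esub> m (n + 1) (diff V n w)"
    proof -
      interpret right_module "obj P (n + 1)" by (rule is_complexD(1)[OF KP])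
      show ?thesis using m(2)[OF w] zz dm mw(2) unfolding oS(1) by simp
    qed
    have "act (g n) (s n w) = u (n + 1) (f n (s n w))" unfolding f_def using crepD(6)[OF P gs] by simp
    also have "\<dots> = - act (df E n) (u n (m n w)) + u (n + 1) (m (n + 1) (diff V n w))"
      unfolding sum using module_homsD(2)[OF crepD(3)[OF P] dm mw(2)] udm by simp
    finally show ?thesis unfolding comp_def us(1)[OF w] by (simp only: uminus_add_conv_diff)
  qed
  obtain h h' where h: "h \<in> arr (ob F (c - 1)) (ob E (c - 1))" "h' \<in> arr (ob F c) (ob E c)"
    "g (c - 1) * a (c - 1) = h' * df F (c - 1) - df E (c - 1) * h"
    using lift_null_homotopy[OF P KP V(1,4) ab(1) F g gd module_homs_comp[OF m' crepD(3)[OF P]] mk] by blast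
  \<comment> \<open>Returning to \<open>F\<close>, the round trip \<open>b * a\<close> differs from
    the identity by the homotopy \<open>k\<close>, whose terms are absorbed into \<open>?s\<close>
    and \<open>?t\<close>.\<close>
  have ba: "b c * a c = ob F c + df F (c - 1) * k c" "b (c - 1) * a (c - 1) = ob F (c - 1) + k c * df F (c - 1)"
    using k(2)[of c] k(2)[of "c - 1"] dF by (simp_all add: diff_eq_eq add.commute)
  have bd: "b c * df E (c - 1) = df F (c - 1) * b (c - 1)" using mhomsD(2)[OF ab(2), of "c - 1"] by simp
  let ?s = "b c * h' - b c * a c * x * k c" and ?t = "- (b (c - 1) * h) - k c * x"
  have "b c * (g (c - 1) * a (c - 1)) = b c * a c * x * (b (c - 1) * a (c - 1))" unfolding g_def by (simp add: mult.assoc)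
  also have "\<dots> = b c * a c * x + b c * a c * x * k c * df F (c - 1)"
    unfolding ba(2) using arrD(2)[OF x] by (simp add: distrib_left mult.assoc)
  finally have "b c * a c * x + b c * a c * x * k c * df F (c - 1) = b c * h' * df F (c - 1) - df F (c - 1) * b (c - 1) * h"
    unfolding h(3) right_diff_distrib mult.assoc[symmetric] bd by simp
  hence e: "b c * a c * x = b c * h' * df F (c - 1) - df F (c - 1) * b (c - 1) * h - b c * a c * x * k c * df F (c - 1)"
    by (simp only: eq_diff_eq)
  have "b c * a c * x = x + df F (c - 1) * k c * x" unfolding ba(1) using arrD(1)[OF x] by (simp add: distrib_right)
  hence "x = b c * a c * x - df F (c - 1) * k c * x" by (simp only: add_diff_cancel_right')
  also have "\<dots> = b c * h' * df F (c - 1) - df F (c - 1) * b (c - 1) * h - b c * a c * x * k c * df F (c - 1) - df F (c - 1) * k c * x"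
    by (simp only: e[symmetric])
  also have "\<dots> = ?s * df F (c - 1) + df F (c - 1) * ?t" by (simp add: algebra_simps)
  finally have "x = ?s * df F (c - 1) + df F (c - 1) * ?t" .
  moreover have "?s \<in> arr (ob F c) (ob F c)"
  proof (rule hom_diff)
    show "b c * h' \<in> arr (ob F c) (ob F c)" by (rule hom_mult[OF h(2) mhomsD(1)[OF ab(2)]])
    have "b c * (a c * (x * k c)) \<in> arr (ob F c) (ob F c)"
      by (intro hom_mult[OF _ mhomsD(1)[OF ab(2)]] hom_mult[OF _ mhomsD(1)[OF ab(1)]] hom_mult[OF k(1) x])
    thus "b c * a c * x * k c \<in> arr (ob F c) (ob F c)" by (simp only: mult.assoc)
  qed
  moreover have "?t \<in> arr (ob F (c - 1)) (ob F (c - 1))"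
    by (intro hom_diff hom_uminus hom_mult[OF h(1) mhomsD(1)[OF ab(2)]] hom_mult[OF x k(1)])
  ultimately show "\<exists>s\<in>arr (ob F c) (ob F c). \<exists>h\<in>arr (ob F (c - 1)) (ob F (c - 1)). x = s * df F (c - 1) + df F (c - 1) * h" by blast
qed

end

theorem corollary4p9:
  fixes scale :: "'k::field \<Rightarrow> 'a::ring_1 \<Rightarrow> 'a"
    and P :: "('a, 'm) cpx"
  assumes "fin_dim_algebra scale"
    and "symmetric_algebra scale"
    and "Kb_proj P"
    and "partial_tilting P"
    and "cpx_length P = 2"
  shows "tilting P \<longleftrightarrow> num_indec_Kb P = num_indec_module (regular_module :: ('a, 'a) module)"
proof -
  interpret fmat_category "fscal scale" "%e f. reindex ev ev e + reindex od od f" "%e f. reindex ev id e"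
    "%e f. reindex od id f" "%e f. reindex id ev e" "%e f. reindex id od f" "munitx 0 0 (1 :: 'a)"
    by (rule fmat_category.intro[OF hom_finite_ring_fmat[OF assms(1)]])
  have KP: "is_complex P" using assms(3) unfolding Kb_proj_def by blast
  obtain E u v where P: "crep P E u v" using Kb_proj_crep[OF assms(3)] by blast
  note cE = crepD(1)[OF P]
  obtain c where c: "!!n. n ~= c ==> n ~= c - 1 ==> cocycles P n \<subseteq> coboundaries P n"
    using length_two_support[OF assms(3,5)] by blast
  obtain F where F: "two_term c F" "meq E F"
    using two_term_reduction[OF cE column_exactness[OF P KP c] symmetric_algebra_injective[OF assms(1,2)]] .
  have ext: "ext_zero c F F" by (rule partial_tilting_ext_zero[OF assms(4) P F(1) meq_sym[OF F(2)]])
  have "tilting P \<longleftrightarrow> mgen F"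
    unfolding tilting_def generates_Kb_iff[OF P] add_classes_cong(2)[OF cE two_term_cx[OF F(1)] F(2)] using assms(4) by blast
  also have "\<dots> \<longleftrightarrow> card (add_classes F) = card prim_classes" by (rule mgen_iff_card[OF F(1) ext])
  finally show ?thesis unfolding num_indec_Kb_eq[OF P F(1) ext F(2)] num_indec_regular .
qed

end
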